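(* Let $T:X\to X$ be the restriction of an Axiom A map to one of its basic sets, and assume that $T$ is topologically mixing. Let $m$ be a Gibbs measure with respect to some H\"older continuous potential. Let $f:X\to\mathbb{R}$ be H\"older continuous with $\int f\,dm=0$, and let $\sigma^2\ge0$ be such that $S_nf/\sqrt n$ converges in distribution (with respect to $m$) to $\mathcal{W}=\mathcal{N}(0,\sigma^2)$ (such a $\sigma^2$ exists by the classical central limit theorem). Then the sequence $S_nf/\sqrt n$ satisfies an almost sure limit theorem towards $\mathcal{W}$.
   Context: $S_nf=\sum_{k=0}^{n-1}f\circ T^k$. The sequence $S_nf/\sqrt n$ satisfies an almost sure limit theorem towards $\mathcal{W}$ if, for $m$-almost all $x\in X$, the measures $\frac{1}{\log N}\sum_{k=1}^N\frac1k\delta_{S_kf(x)/\sqrt k}$ converge weakly as $N\to\infty$ to the law of $\mathcal{W}$ ($\delta_x$ is the Dirac mass at $x$). $\mathcal{N}(0,0)$ is the Dirac mass at $0$. *)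

theory Defs
  imports "HOL-Probability.Probability"
begin

section \<open>Closed Riemannian manifolds\<close>

text \<open>
  A chart is a domain together with a coordinate map into the model space \<open>'e\<close>.  Atlases are only
  required to be of class C1 and Riemannian metrics to be continuous, so that smooth manifolds
  with smooth metrics are included.  Second countability follows from compactness.
\<close>

type_synonym ('a, 'e) chart = "'a set \<times> ('a \<Rightarrow> 'e)"

definition chart_inv :: "('a, 'e) chart \<Rightarrow> 'e \<Rightarrow> 'a" where
  "chart_inv c = the_inv_into (fst c) (snd c)"

definition C1_on :: "('e::euclidean_space \<Rightarrow> 'e) \<Rightarrow> 'e set \<Rightarrow> bool" where
  "C1_on h S \<longleftrightarrow>
     (\<exists>h' :: 'e \<Rightarrow> 'e \<Rightarrow>\<^sub>L 'e. (\<forall>x\<in>S. (h has_derivative blinfun_apply (h' x)) (at x)) \<and>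
        continuous_on S h')"

definition closed_manifold ::
  "'a::t2_space set \<Rightarrow> ('a, 'e::euclidean_space) chart set \<Rightarrow> bool" where
  "closed_manifold M A \<longleftrightarrow>
     compact M \<and>
     (\<Union>c\<in>A. fst c) = M \<and>
     (\<forall>c\<in>A. openin (top_of_set M) (fst c) \<and> open (snd c ` fst c) \<and>
            homeomorphism (fst c) (snd c ` fst c) (snd c) (chart_inv c)) \<and>
     (\<forall>c\<in>A. \<forall>d\<in>A. C1_on (snd d \<circ> chart_inv c) (snd c ` (fst c \<inter> fst d)))"

text \<open>
  The tangent space at \<open>p\<close> is the model space \<open>'e\<close>: a vector of \<open>'e\<close> stands for the tangent vector
  at \<open>p\<close> with these coordinates in the chart \<open>chart_at A p\<close>, chosen once and for all for each
  point.  Since \<open>chart_at A p\<close> need not vary continuously with \<open>p\<close>, continuity statements about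
  objects on the tangent bundle have to be made in the coordinates of a fixed chart \<open>c\<close>, and
  \<open>to_tangent A c p\<close> takes \<open>c\<close>-coordinates of a tangent vector at \<open>p\<close> to its representation.
\<close>

definition chart_at :: "('a, 'e) chart set \<Rightarrow> 'a \<Rightarrow> ('a, 'e) chart" where
  "chart_at A p = (SOME c. c \<in> A \<and> p \<in> fst c)"

definition to_tangent ::
  "('a, 'e::euclidean_space) chart set \<Rightarrow> ('a, 'e) chart \<Rightarrow> 'a \<Rightarrow> 'e \<Rightarrow> 'e" where
  "to_tangent A c p = frechet_derivative (snd (chart_at A p) \<circ> chart_inv c) (at (snd c p))"

definition riemannian_metric ::
  "'a::t2_space set \<Rightarrow> ('a, 'e::euclidean_space) chart set \<Rightarrow> ('a \<Rightarrow> 'e \<Rightarrow> 'e \<Rightarrow> real) \<Rightarrow> bool" where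
  "riemannian_metric M A g \<longleftrightarrow>
     (\<forall>p\<in>M. bilinear (g p) \<and> (\<forall>v w. g p v w = g p w v) \<and> (\<forall>v. v \<noteq> 0 \<longrightarrow> g p v v > 0)) \<and>
     (\<forall>c\<in>A. \<forall>v w. continuous_on (fst c) (\<lambda>p. g p (to_tangent A c p v) (to_tangent A c p w)))"

definition tangent_norm :: "('a \<Rightarrow> 'e \<Rightarrow> 'e \<Rightarrow> real) \<Rightarrow> 'a \<Rightarrow> 'e \<Rightarrow> real" where
  "tangent_norm g p v = sqrt (g p v v)"

definition velocity ::
  "('a, 'e::euclidean_space) chart set \<Rightarrow> (real \<Rightarrow> 'a) \<Rightarrow> real \<Rightarrow> 'e" where
  "velocity A \<gamma> t = vector_derivative (snd (chart_at A (\<gamma> t)) \<circ> \<gamma>) (at t)"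

definition piecewise_C1_path ::
  "'a::t2_space set \<Rightarrow> ('a, 'e::euclidean_space) chart set \<Rightarrow> (real \<Rightarrow> 'a) \<Rightarrow> bool" where
  "piecewise_C1_path M A \<gamma> \<longleftrightarrow>
     path \<gamma> \<and> path_image \<gamma> \<subseteq> M \<and>
     (\<exists>S. finite S \<and> {0, 1} \<subseteq> S \<and>
        (\<forall>c\<in>A. (snd c \<circ> \<gamma>) C1_differentiable_on {t \<in> {0..1} - S. \<gamma> t \<in> fst c}))"

definition path_length ::
  "('a, 'e::euclidean_space) chart set \<Rightarrow> ('a \<Rightarrow> 'e \<Rightarrow> 'e \<Rightarrow> real) \<Rightarrow> (real \<Rightarrow> 'a) \<Rightarrow> ennreal" where
  "path_length A g \<gamma> = (\<integral>\<^sup>+t\<in>{0..1}. ennreal (tangent_norm g (\<gamma> t) (velocity A \<gamma> t)) \<partial>lborel)"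

text \<open>The distance is infinite between points of different components of \<open>M\<close>.\<close>

definition riemannian_dist ::
  "'a::t2_space set \<Rightarrow> ('a, 'e::euclidean_space) chart set \<Rightarrow> ('a \<Rightarrow> 'e \<Rightarrow> 'e \<Rightarrow> real) \<Rightarrow>
     'a \<Rightarrow> 'a \<Rightarrow> ennreal" where
  "riemannian_dist M A g x y =
     (INF \<gamma>\<in>{\<gamma>. piecewise_C1_path M A \<gamma> \<and> pathstart \<gamma> = x \<and> pathfinish \<gamma> = y}. path_length A g \<gamma>)"


section \<open>Axiom A diffeomorphisms and their basic sets\<close>

definition C1_map ::
  "'a::t2_space set \<Rightarrow> ('a, 'e::euclidean_space) chart set \<Rightarrow> ('a \<Rightarrow> 'a) \<Rightarrow> bool" where
  "C1_map M A F \<longleftrightarrow>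
     F ` M \<subseteq> M \<and> continuous_on M F \<and>
     (\<forall>c\<in>A. \<forall>d\<in>A. C1_on (snd d \<circ> F \<circ> chart_inv c) (snd c ` {p \<in> fst c. F p \<in> fst d}))"

definition diffeo ::
  "'a::t2_space set \<Rightarrow> ('a, 'e::euclidean_space) chart set \<Rightarrow> ('a \<Rightarrow> 'a) \<Rightarrow> bool" where
  "diffeo M A F \<longleftrightarrow> bij_betw F M M \<and> C1_map M A F \<and> C1_map M A (the_inv_into M F)"

definition tangent_map ::
  "('a, 'e::euclidean_space) chart set \<Rightarrow> ('a \<Rightarrow> 'a) \<Rightarrow> 'a \<Rightarrow> 'e \<Rightarrow> 'e" where
  "tangent_map A F p =
     frechet_derivative (snd (chart_at A (F p)) \<circ> F \<circ> chart_inv (chart_at A p))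
       (at (snd (chart_at A p) p))"

definition hyperbolic_set ::
  "'a::t2_space set \<Rightarrow> ('a, 'e::euclidean_space) chart set \<Rightarrow> ('a \<Rightarrow> 'e \<Rightarrow> 'e \<Rightarrow> real) \<Rightarrow>
     ('a \<Rightarrow> 'a) \<Rightarrow> 'a set \<Rightarrow> bool" where
  "hyperbolic_set M A g F \<Lambda> \<longleftrightarrow>
     closedin (top_of_set M) \<Lambda> \<and> F ` \<Lambda> = \<Lambda> \<and>
     (\<exists>Es Eu c r. c > 0 \<and> 0 < r \<and> r < 1 \<and>
        (\<forall>p\<in>\<Lambda>.
           subspace (Es p) \<and> subspace (Eu p) \<and>
           Es p \<inter> Eu p = {0} \<and> {v + w | v w. v \<in> Es p \<and> w \<in> Eu p} = UNIV \<and>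
           tangent_map A F p ` Es p = Es (F p) \<and> tangent_map A F p ` Eu p = Eu (F p) \<and>
           (\<forall>n. \<forall>v\<in>Es p.
              tangent_norm g ((F ^^ n) p) (tangent_map A (F ^^ n) p v)
                \<le> c * r ^ n * tangent_norm g p v) \<and>
           (\<forall>n. \<forall>v\<in>Eu p.
              tangent_norm g ((the_inv_into M F ^^ n) p) (tangent_map A (the_inv_into M F ^^ n) p v)
                \<le> c * r ^ n * tangent_norm g p v)))"

definition nonwandering_set :: "'a::topological_space set \<Rightarrow> ('a \<Rightarrow> 'a) \<Rightarrow> 'a set" where
  "nonwandering_set M F =
     {x \<in> M. \<forall>U. openin (top_of_set M) U \<and> x \<in> U \<longrightarrow> (\<exists>n>0. (F ^^ n) ` U \<inter> U \<noteq> {})}"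

definition periodic_points :: "'a set \<Rightarrow> ('a \<Rightarrow> 'a) \<Rightarrow> 'a set" where
  "periodic_points M F = {x \<in> M. \<exists>n>0. (F ^^ n) x = x}"

definition axiom_A ::
  "'a::t2_space set \<Rightarrow> ('a, 'e::euclidean_space) chart set \<Rightarrow> ('a \<Rightarrow> 'e \<Rightarrow> 'e \<Rightarrow> real) \<Rightarrow>
     ('a \<Rightarrow> 'a) \<Rightarrow> bool" where
  "axiom_A M A g F \<longleftrightarrow>
     diffeo M A F \<and>
     hyperbolic_set M A g F (nonwandering_set M F) \<and>
     nonwandering_set M F = M \<inter> closure (periodic_points M F)"

definition topologically_transitive_on :: "('a::topological_space \<Rightarrow> 'a) \<Rightarrow> 'a set \<Rightarrow> bool" where
  "topologically_transitive_on T X \<longleftrightarrow>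
     (\<forall>U V. openin (top_of_set X) U \<and> openin (top_of_set X) V \<and> U \<noteq> {} \<and> V \<noteq> {} \<longrightarrow>
        (\<exists>n>0. (T ^^ n) ` U \<inter> V \<noteq> {}))"

definition topologically_mixing_on :: "('a::topological_space \<Rightarrow> 'a) \<Rightarrow> 'a set \<Rightarrow> bool" where
  "topologically_mixing_on T X \<longleftrightarrow>
     (\<forall>U V. openin (top_of_set X) U \<and> openin (top_of_set X) V \<and> U \<noteq> {} \<and> V \<noteq> {} \<longrightarrow>
        (\<exists>N. \<forall>n\<ge>N. (T ^^ n) ` U \<inter> V \<noteq> {}))"

text \<open>
  The basic sets are the pieces of the spectral decomposition of the nonwandering set, which for
  an Axiom A diffeomorphism exists and is unique (Smale).
\<close>

definition spectral_decomposition ::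
  "'a::topological_space set \<Rightarrow> ('a \<Rightarrow> 'a) \<Rightarrow> 'a set set \<Rightarrow> bool" where
  "spectral_decomposition M F \<B> \<longleftrightarrow>
     finite \<B> \<and> disjoint \<B> \<and> \<Union>\<B> = nonwandering_set M F \<and>
     (\<forall>\<Lambda>\<in>\<B>. \<Lambda> \<noteq> {} \<and> closedin (top_of_set M) \<Lambda> \<and> F ` \<Lambda> = \<Lambda> \<and> topologically_transitive_on F \<Lambda>)"

definition basic_set :: "'a::topological_space set \<Rightarrow> ('a \<Rightarrow> 'a) \<Rightarrow> 'a set \<Rightarrow> bool" where
  "basic_set M F X \<longleftrightarrow> (\<exists>\<B>. spectral_decomposition M F \<B> \<and> X \<in> \<B>)"


section \<open>Hoelder functions, Birkhoff sums and Gibbs measures\<close>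

definition hoelder_on :: "('a \<Rightarrow> 'a \<Rightarrow> ennreal) \<Rightarrow> 'a set \<Rightarrow> ('a \<Rightarrow> real) \<Rightarrow> bool" where
  "hoelder_on d X f \<longleftrightarrow>
     (\<exists>C \<alpha>. C \<ge> 0 \<and> 0 < \<alpha> \<and> \<alpha> \<le> 1 \<and>
        (\<forall>x\<in>X. \<forall>y\<in>X. d x y < \<infinity> \<longrightarrow> \<bar>f x - f y\<bar> \<le> C * enn2real (d x y) powr \<alpha>))"

definition birkhoff_sum :: "('a \<Rightarrow> 'a) \<Rightarrow> ('a \<Rightarrow> real) \<Rightarrow> nat \<Rightarrow> 'a \<Rightarrow> real" where
  "birkhoff_sum T f n x = (\<Sum>k<n. f ((T ^^ k) x))"

definition bowen_ball ::
  "('a \<Rightarrow> 'a \<Rightarrow> ennreal) \<Rightarrow> 'a set \<Rightarrow> ('a \<Rightarrow> 'a) \<Rightarrow> nat \<Rightarrow> real \<Rightarrow> 'a \<Rightarrow> 'a set" where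
  "bowen_ball d X T n \<epsilon> x = {y \<in> X. \<forall>k<n. d ((T ^^ k) x) ((T ^^ k) y) < ennreal \<epsilon>}"

text \<open>
  Gibbs measures are defined by Bowen's two-sided estimate on dynamical balls.  The estimate forces
  \<open>P\<close> to be the topological pressure of \<open>\<phi>\<close>.  It can only be asked for small \<open>\<epsilon>\<close>: for large \<open>\<epsilon>\<close> all
  the balls are equal to \<open>X\<close>.
\<close>

definition gibbs_measure ::
  "('a::topological_space \<Rightarrow> 'a \<Rightarrow> ennreal) \<Rightarrow> 'a set \<Rightarrow> ('a \<Rightarrow> 'a) \<Rightarrow> ('a \<Rightarrow> real) \<Rightarrow>
     'a measure \<Rightarrow> bool" where
  "gibbs_measure d X T \<phi> m \<longleftrightarrow>
     prob_space m \<and> sets m = sets (restrict_space borel X) \<and>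
     T \<in> measurable m m \<and> distr m m T = m \<and>
     (\<exists>P. \<exists>\<epsilon>\<^sub>0>0. \<forall>\<epsilon>. 0 < \<epsilon> \<and> \<epsilon> < \<epsilon>\<^sub>0 \<longrightarrow>
        (\<exists>c C. 0 < c \<and> 0 < C \<and>
           (\<forall>x\<in>X. \<forall>n.
              c * exp (birkhoff_sum T \<phi> n x - real n * P) \<le> measure m (bowen_ball d X T n \<epsilon> x) \<and>
              measure m (bowen_ball d X T n \<epsilon> x) \<le> C * exp (birkhoff_sum T \<phi> n x - real n * P))))"


section \<open>Limit laws\<close>

definition normal_law :: "real \<Rightarrow> real \<Rightarrow> real measure" where
  "normal_law \<mu> v =
     (if v = 0 then return borel \<mu> else density lborel (\<lambda>x. ennreal (normal_density \<mu> (sqrt v) x)))"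

text \<open>
  Weak convergence of measures that need not have total mass one; for probability measures it
  amounts to \<^const>\<open>weak_conv_m\<close>.
\<close>

definition converges_weakly :: "(nat \<Rightarrow> real measure) \<Rightarrow> real measure \<Rightarrow> bool" where
  "converges_weakly \<mu> \<nu> \<longleftrightarrow>
     (\<forall>h :: real \<Rightarrow> real. continuous_on UNIV h \<and> bounded (range h) \<longrightarrow>
        (\<lambda>N. \<integral>x. h x \<partial>\<mu> N) \<longlonglongrightarrow> (\<integral>x. h x \<partial>\<nu>))"

text \<open>
  The logarithmic average of the Dirac masses at \<open>a 1, \<dots>, a N\<close>, as the image under \<open>a\<close> of a weighted
  counting measure.
\<close>

definition log_average :: "(nat \<Rightarrow> real) \<Rightarrow> nat \<Rightarrow> real measure" where
  "log_average a N =
     distr (density (count_space {1..N}) (\<lambda>k. ennreal (1 / ln (real N) * (1 / real k)))) borel a"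

lemma emeasure_log_average:
  assumes "B \<in> sets borel"
  shows "emeasure (log_average a N) B =
    ennreal (1 / ln (real N)) * (\<Sum>k=1..N. ennreal (1 / real k) * emeasure (return borel (a k)) B)"
proof -
  have "emeasure (log_average a N) B =
      (\<Sum>k=1..N. ennreal (1 / ln (real N) * (1 / real k)) * indicator (a -` B \<inter> {1..N}) k)"
    using assms unfolding log_average_def
    by (subst emeasure_distr)
       (auto simp: emeasure_density nn_integral_count_space_finite intro!: sum.cong)
  also have "\<dots> = (\<Sum>k=1..N. ennreal (1 / ln (real N)) *
      (ennreal (1 / real k) * emeasure (return borel (a k)) B))"
  proof (intro sum.cong refl)
    fix k assume k: "k \<in> {1..N}"
    have "ln (real N) \<ge> 0" using k by auto
    hence "ennreal (1 / ln (real N) * (1 / real k)) =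
        ennreal (1 / ln (real N)) * ennreal (1 / real k)"
      by (intro ennreal_mult) auto
    thus "ennreal (1 / ln (real N) * (1 / real k)) * indicator (a -` B \<inter> {1..N}) k =
        ennreal (1 / ln (real N)) * (ennreal (1 / real k) * emeasure (return borel (a k)) B)"
      using assms k by (auto simp: indicator_def mult.assoc)
  qed
  finally show ?thesis by (simp add: sum_distrib_left)
qed

definition almost_sure_limit_theorem ::
  "'a measure \<Rightarrow> (nat \<Rightarrow> 'a \<Rightarrow> real) \<Rightarrow> real measure \<Rightarrow> bool" where
  "almost_sure_limit_theorem m Y \<nu> \<longleftrightarrow>
     (AE x in m. converges_weakly (log_average (\<lambda>k. Y k x)) \<nu>)"

end

theory Submission
 imports Defs "HOL-Real_Asymp.Real_Asymp"
begin

text \<open>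
Bowen's estimate makes the measures of dynamical balls multiplicative up to constants.  Hence, for
each length \<open>l\<close>, the space has a countable partition into cells comparable to Bowen balls of length
\<open>l\<close>, and orbits that visit prescribed cells in consecutive windows have measure at most the product
of the measures of the cells, up to a constant factor per window.  By hyperbolicity (linearization
in charts and the cone argument) two points of the same cell are exponentially close in the interior
of the window, so a Hoelder function is there almost determined by the cell.

This upper bound alone gives only finitely many ergodic components, but functions of distant
windows still decouple once their ergodic averages vanish.  Comparing \<open>S\<^sub>l\<^sub>n f\<close> with \<open>l\<close> independent copies
of \<open>S\<^sub>n f\<close> on each component shows that the values on the components of the characteristic function
of \<open>S\<^sub>n f / sqrt n\<close>, weighted by the masses of the components, have asymptotically the moments of a
point mass; hence the central limit theorem passes from the whole space to each
component.  So bounded Lipschitz functions of \<open>S\<^sub>k f / sqrt k\<close>, centred by the normal law, become weakly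
null and decorrelate.  On a block \<open>[n, 2\<^sup>q n)\<close> the sum \<open>S\<^sub>k f\<close> is replaced by its increment since
time \<open>n\<close>; exponential Chebyshev bounds for products over windows show that blocks with a large
logarithmic sum, and blocks with a large starting value, are rare almost surely.
\<close>

text \<open>The product bound is one-sided and concerns nonnegative functions, so a single signed
  correlation cannot be estimated from it. What can be estimated is a sum of r correlations at once,
  through the absolute value of one kernel in two variables: if the first factors are nearly
  orthogonal, Cauchy-Schwarz bounds the sum by a multiple of \<open>sqrt r\<close>, so that r terms
  cannot all be large with the same sign. This decouples windows, but without any rate. Without a
  rate the variances of the logarithmic averages need not be summable, and almost sure convergence
  must come from elsewhere: a block that depends on its own window only can be fed into the product
  bound, whose exponential gain beats the factor K per window as soon as bad blocks have small
  enough probability. The central limit theorem controls no moments either; second moments are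
  recovered from a self-improving estimate of fourth moments along powers of 2, in which tightness
  makes the tail term small.\<close>

abbreviation tends :: "(nat => 'a::topological_space) => 'a => bool" (infix "\<leadsto>" 60) where
 "X \<leadsto> L \<equiv> X \<longlonglongrightarrow> L"

abbreviation eventually_seq :: "(nat => bool) => bool" (binder "EV " 10) where
 "eventually_seq P \<equiv> eventually P sequentially"

section \<open>Systems with a quasi-Bernoulli bound\<close>

fun cylinder :: "'a set => ('a => 'a) => (nat => 'a => nat) => (nat \<times> nat) list => 'a set" where
 "cylinder X T \<kappa> [] = X"
| "cylinder X T \<kappa> ((l, a) # w) = {x \<in> X. \<kappa> l x = a \<and> (T^^l) x \<in> cylinder X T \<kappa> w}"

text \<open>Values in \<open>ennreal\<close> allow weights to be expanded over the countably many
  cells of a window without summability conditions. Indicator weights give back the indicator of a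
  cylinder.\<close>

fun window_prod :: "('a => 'a) => (nat => 'a => nat) => (nat \<times> (nat => ennreal)) list => 'a => ennreal" where
 "window_prod T \<kappa> [] x = 1"
| "window_prod T \<kappa> ((l, \<phi>) # w) x = \<phi> (\<kappa> l x) * window_prod T \<kappa> w ((T^^l) x)"

text \<open>Here \<open>\<kappa> l x\<close> is the name of the cell containing \<open>x\<close> in a partition adapted to orbit segments of
 length \<open>l\<close>.\<close>

locale quasi_bernoulli = prob_space m for m :: "'a measure" +
 fixes T :: "'a => 'a" and f :: "'a => real" and \<kappa> :: "nat => 'a => nat" and B C \<rho> K :: real
 assumes T_measurable [measurable]: "T \<in> measurable m m"
  and T_distr: "distr m m T = m"
  and f_measurable [measurable]: "f \<in> borel_measurable m"
  and f_bound: "\<And>x. x \<in> space m ==> abs (f x) <= B"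
  and cell_measurable [measurable]: "\<And>l. \<kappa> l \<in> measurable m (count_space UNIV)"
  and rho: "0 < \<rho>" "\<rho> < 1" and C_nonneg: "C >= 0" and K_ge_1: "K >= 1"
  and f_oscillation: "\<And>l k x y. x \<in> space m ==> y \<in> space m ==> \<kappa> l x = \<kappa> l y ==> k < l ==>
     abs (f ((T^^k) x) - f ((T^^k) y)) <= C * (\<rho> ^ k + \<rho> ^ (l - k))"
  and cylinder_bound: "\<And>w. measure m (cylinder (space m) T \<kappa> w) <=
     (\<Prod>(l, a)\<leftarrow>w. K * measure m {x \<in> space m. \<kappa> l x = a})"
begin

abbreviation expect :: "('a => 'b) => 'b::{banach, second_countable_topology}" (binder "\<E>" 10) where
 "expect u \<equiv> integral\<^sup>L m u"

abbreviation S :: "nat => 'a => real" where "S \<equiv> birkhoff_sum T f"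

lemma iter_measurable [measurable]: "(T^^n) \<in> measurable m m"
proof (induction n)
 case (Suc n)
 then show ?case using measurable_comp[OF Suc T_measurable] by simp
qed (simp add: id_def)

lemma iter_space [simp]: "x \<in> space m ==> (T^^n) x \<in> space m"
 using measurable_space[OF iter_measurable] .

lemma iter_distr: "distr m m (T^^n) = m"
proof (induction n)
 case (Suc n)
 have "distr m m (T^^Suc n) = distr (distr m m (T^^n)) m T"
  by (subst distr_distr) (simp_all add: comp_def)
 then show ?case by (simp only: Suc T_distr)
qed (simp add: distr_id2 id_def)

lemma integral_iter:
 fixes u :: "'a => 'b::{banach, second_countable_topology}"
 assumes "u \<in> borel_measurable m"
 shows "(\<E> x. u ((T^^n) x)) = (\<E> x. u x)"
 using integral_distr[OF iter_measurable[of n] assms] by (simp add: iter_distr)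

lemma nn_integral_iter:
 assumes "u \<in> borel_measurable m"
 shows "(\<integral>\<^sup>+x. u ((T^^n) x) \<partial>m) = (\<integral>\<^sup>+x. u x \<partial>m)"
 using nn_integral_distr[OF iter_measurable[of n], of u] assms by (simp add: iter_distr)

lemma S_measurable [measurable]: "S n \<in> borel_measurable m"
proof -
 have "(\<lambda>x. f ((T^^k) x)) \<in> borel_measurable m" for k
  by (rule measurable_compose[OF iter_measurable f_measurable])
 then show ?thesis unfolding birkhoff_sum_def[abs_def] by measurable
qed

lemma S_iter_measurable [measurable]: "(\<lambda>x. S n ((T^^k) x)) \<in> borel_measurable m"
 by (rule measurable_compose[OF iter_measurable S_measurable])

lemma S_add: "S (n + k) x = S n x + S k ((T^^n) x)"
proof -
 have "S (n + k) x = S n x + (\<Sum>i=n..<n+k. f ((T^^i) x))"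
  unfolding birkhoff_sum_def lessThan_atLeast0 by (rule sum.atLeastLessThan_concat[symmetric]) auto
 also have "(\<Sum>i=n..<n+k. f ((T^^i) x)) = (\<Sum>i<k. f ((T^^(i + n)) x))"
  using sum.shift_bounds_nat_ivl[of "\<lambda>i. f ((T^^i) x)" 0 n k] by (simp add: lessThan_atLeast0 add.commute)
 also have "... = S k ((T^^n) x)"
  unfolding birkhoff_sum_def by (simp add: funpow_add)
 finally show ?thesis .
qed

lemma B_nonneg: "B >= 0"
proof -
 obtain x where "x \<in> space m" using not_empty by auto
 then show ?thesis using f_bound[of x] by linarith
qed

lemma S_bound: "x \<in> space m ==> abs (S n x) <= real n * B"
proof -
 assume x: "x \<in> space m"
 have "abs (S n x) <= (\<Sum>k<n. abs (f ((T^^k) x)))" unfolding birkhoff_sum_def by (rule sum_abs)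
 also have "... <= (\<Sum>k<n. B)" by (intro sum_mono f_bound) (simp add: x)
 finally show ?thesis by simp
qed

text \<open>Sum of the geometric series that bounds the oscillation of f along a window:
  \<open>2 * D\<close> bounds the oscillation, on one cell, of every Birkhoff sum inside the window,
  whatever its length.\<close>

definition D :: real where "D = C / (1 - \<rho>)"

lemma D_nonneg: "D >= 0" unfolding D_def using rho C_nonneg by auto

lemma geometric_bound: "(\<Sum>k<n. \<rho> ^ k) <= 1 / (1 - \<rho>)"
proof -
 have "(\<Sum>k<n. \<rho> ^ k) = (1 - \<rho> ^ n) / (1 - \<rho>)" using rho by (simp add: sum_gp_strict)
 also have "... <= 1 / (1 - \<rho>)" using rho by (intro divide_right_mono) auto
 finally show ?thesis .
qed

text \<open>The margins s and e matter when the Birkhoff sum is kept fixed and the window grows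
  around it: then the oscillation tends to 0. Where a small factor such as \<open>1 / sqrt n\<close>
  is present, the cruder \<open>S_oscillation\<close> suffices.\<close>

lemma S_oscillation_general:
 assumes x: "x \<in> space m" "y \<in> space m" and eq: "\<kappa> l x = \<kappa> l y" and l: "s + n + e = l"
 shows "abs (S n ((T^^s) x) - S n ((T^^s) y)) <= D * (\<rho> ^ s + \<rho> ^ e)"
proof -
 have "abs (S n ((T^^s) x) - S n ((T^^s) y)) <= (\<Sum>k<n. abs (f ((T^^(s + k)) x) - f ((T^^(s + k)) y)))"
  unfolding birkhoff_sum_def sum_subtractf[symmetric] by (subst (1 2) add.commute, subst (1 2) funpow_add) (simp add: sum_abs)
 also have "... <= (\<Sum>k<n. C * (\<rho> ^ (s + k) + \<rho> ^ (l - (s + k))))"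
  by (intro sum_mono f_oscillation) (use x eq l in auto)
 also have "... <= (\<Sum>k<n. C * (\<rho> ^ s * \<rho> ^ k + \<rho> ^ e * \<rho> ^ (n - Suc k)))"
 proof (intro sum_mono mult_left_mono add_mono C_nonneg)
  fix k assume k: "k \<in> {..<n}"
  \<comment> \<open>The surplus factor \<rho> is dropped, so that reversing the index turns this sum
    into the same geometric sum as the other one.\<close>
  have "l - (s + k) = e + (n - Suc k) + 1" using k l by auto
  then have "\<rho> ^ (l - (s + k)) = \<rho> * (\<rho> ^ e * \<rho> ^ (n - Suc k))" by (simp add: power_add)
  also have "... <= 1 * (\<rho> ^ e * \<rho> ^ (n - Suc k))" using rho by (intro mult_right_mono) auto
  finally show "\<rho> ^ (l - (s + k)) <= \<rho> ^ e * \<rho> ^ (n - Suc k)" by simp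
 qed (simp add: power_add)
 also have "... = C * (\<rho> ^ s * (\<Sum>k<n. \<rho> ^ k) + \<rho> ^ e * (\<Sum>k<n. \<rho> ^ (n - Suc k)))"
  by (simp add: sum_distrib_left sum.distrib algebra_simps)
 also have "(\<Sum>k<n. \<rho> ^ (n - Suc k)) = (\<Sum>k<n. \<rho> ^ k)" by (rule sum.nat_diff_reindex)
 also have "C * (\<rho> ^ s * (\<Sum>k<n. \<rho> ^ k) + \<rho> ^ e * (\<Sum>k<n. \<rho> ^ k)) = (C * (\<Sum>k<n. \<rho> ^ k)) * (\<rho> ^ s + \<rho> ^ e)"
  by (simp add: algebra_simps)
 also have "... <= (C * (1 / (1 - \<rho>))) * (\<rho> ^ s + \<rho> ^ e)"
  using rho C_nonneg geometric_bound by (intro mult_right_mono mult_left_mono) auto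
 finally show ?thesis by (simp add: D_def)
qed

lemma S_oscillation:
 assumes "x \<in> space m" "y \<in> space m" "\<kappa> l x = \<kappa> l y" "s + n <= l"
 shows "abs (S n ((T^^s) x) - S n ((T^^s) y)) <= 2 * D"
proof -
 obtain e where e: "s + n + e = l" using le_Suc_ex[OF assms(4)] by auto
 have "abs (S n ((T^^s) x) - S n ((T^^s) y)) <= D * (\<rho> ^ s + \<rho> ^ e)"
  by (rule S_oscillation_general[OF assms(1-3) e])
 also have "... <= D * (1 + 1)"
  using rho D_nonneg by (intro mult_left_mono add_mono power_le_one) auto
 finally show ?thesis by simp
qed

lemma cylinder_sets [measurable]: "cylinder (space m) T \<kappa> w \<in> sets m"
proof (induction w)
 case (Cons p w)
 obtain l a where p: "p = (l, a)" by (cases p)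
 have "cylinder (space m) T \<kappa> (p # w) =
  (\<kappa> l -` {a} \<inter> space m) \<inter> ((T^^l) -` cylinder (space m) T \<kappa> w \<inter> space m)"
  by (auto simp: p)
 then show ?case
  using measurable_sets[OF cell_measurable, of "{a}"] measurable_sets[OF iter_measurable Cons] by auto
qed simp

lemma window_prod_measurable [measurable]: "window_prod T \<kappa> w \<in> borel_measurable m"
proof (induction w)
 case (Cons p w)
 obtain l \<phi> where p: "p = (l, \<phi>)" by (cases p)
 have "(\<lambda>x. window_prod T \<kappa> w ((T^^l) x)) \<in> borel_measurable m"
  by (rule measurable_compose[OF iter_measurable Cons])
 moreover have "(\<lambda>x. \<phi> (\<kappa> l x)) \<in> borel_measurable m"
  by (rule measurable_compose[OF cell_measurable]) simp
 ultimately show ?case unfolding p window_prod.simps[abs_def] by measurable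
qed simp

lemma cylinder_indicator:
 "x \<in> space m ==>
  indicator (cylinder (space m) T \<kappa> w) x = window_prod T \<kappa> (map (\<lambda>(l, a). (l, indicator {a})) w) x"
proof (induction w arbitrary: x)
 case (Cons p w)
 obtain l a where p: "p = (l, a)" by (cases p)
 show ?case using Cons.IH[of "(T^^l) x"] Cons.prems
  by (auto simp: p split: split_indicator)
qed simp

lemma window_prod_append:
 "window_prod T \<kappa> (v @ w) x = window_prod T \<kappa> v x * window_prod T \<kappa> w ((T^^(sum_list (map fst v))) x)"
proof (induction v arbitrary: x)
 case (Cons p v)
 obtain l a where p: "p = (l, a)" by (cases p)
 show ?case using Cons.IH
  by (simp add: p mult.assoc funpow_add add.commute[of l])
qed simp

lemma nn_integral_cell:
 "(\<integral>\<^sup>+x. \<phi> (\<kappa> l x) \<partial>m) = (\<Sum>a. \<phi> a * ennreal (measure m {x \<in> space m. \<kappa> l x = a}))"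
proof -
 have *: "\<phi> (\<kappa> l x) = (\<Sum>a. \<phi> a * indicator {x \<in> space m. \<kappa> l x = a} x)" if "x \<in> space m" for x
 proof -
  have "(\<Sum>a. \<phi> a * indicator {x \<in> space m. \<kappa> l x = a} x) = (\<Sum>a\<in>{\<kappa> l x}. \<phi> a * indicator {x \<in> space m. \<kappa> l x = a} x)"
   by (rule suminf_finite) (use that in auto)
  then show ?thesis using that by simp
 qed
 have "(\<integral>\<^sup>+x. \<phi> (\<kappa> l x) \<partial>m) = (\<integral>\<^sup>+x. (\<Sum>a. \<phi> a * indicator {x \<in> space m. \<kappa> l x = a} x) \<partial>m)"
  by (rule nn_integral_cong) (rule *)
 also have "... = (\<Sum>a. \<integral>\<^sup>+x. \<phi> a * indicator {x \<in> space m. \<kappa> l x = a} x \<partial>m)"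
  by (rule nn_integral_suminf) measurable
 also have "... = (\<Sum>a. \<phi> a * ennreal (measure m {x \<in> space m. \<kappa> l x = a}))"
  by (subst nn_integral_cmult_indicator) (auto simp: emeasure_eq_measure)
 finally show ?thesis .
qed

text \<open>The windows in w are already resolved into single cells, those in v are not. The
  induction moves the head of v to the end of w by expanding its weight over the cells; when v is
  exhausted only a cylinder is left.\<close>

lemma window_prod_bound_aux:
 "(\<integral>\<^sup>+x. window_prod T \<kappa> (map (\<lambda>(l, a). (l, indicator {a})) w @ v) x \<partial>m) <=
  (\<Prod>(l, a)\<leftarrow>w. ennreal (K * measure m {x \<in> space m. \<kappa> l x = a})) *
  (\<Prod>(l, \<phi>)\<leftarrow>v. ennreal K * (\<integral>\<^sup>+x. \<phi> (\<kappa> l x) \<partial>m))"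
proof (induction v arbitrary: w)
 case Nil
 have "(\<integral>\<^sup>+x. window_prod T \<kappa> (map (\<lambda>(l, a). (l, indicator {a})) w) x \<partial>m) =
   (\<integral>\<^sup>+x. indicator (cylinder (space m) T \<kappa> w) x \<partial>m)"
  by (rule nn_integral_cong) (simp add: cylinder_indicator)
 also have "... = ennreal (measure m (cylinder (space m) T \<kappa> w))"
  by (subst nn_integral_indicator) (auto simp: emeasure_eq_measure)
 also have "... <= ennreal (\<Prod>(l, a)\<leftarrow>w. K * measure m {x \<in> space m. \<kappa> l x = a})"
  by (intro ennreal_leI cylinder_bound)
 also have "... = (\<Prod>(l, a)\<leftarrow>w. ennreal (K * measure m {x \<in> space m. \<kappa> l x = a}))"
 proof (induction w)
  case (Cons p w)
  have "0 <= (\<Prod>(l, a)\<leftarrow>w. K * measure m {x \<in> space m. \<kappa> l x = a})"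
   using K_ge_1 by (intro prod_list_nonneg) auto
  then show ?case using Cons K_ge_1 by (cases p) (simp add: ennreal_mult)
 qed simp
 finally show ?case by simp
next
 case (Cons p v)
 obtain l \<phi> where p: "p = (l, \<phi>)" by (cases p)
 let ?w = "map (\<lambda>(l, a). (l, indicator {a})) w :: (nat \<times> (nat => ennreal)) list"
 let ?n = "sum_list (map fst ?w)"
 let ?q = "\<lambda>a. measure m {x \<in> space m. \<kappa> l x = a}"
 let ?W = "\<Prod>(l, a)\<leftarrow>w. ennreal (K * measure m {x \<in> space m. \<kappa> l x = a})"
 let ?V = "\<Prod>(l, \<phi>)\<leftarrow>v. ennreal K * (\<integral>\<^sup>+x. \<phi> (\<kappa> l x) \<partial>m)"
 \<comment> \<open>Only the cell actually visited contributes, so the series has a single nonzero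
   term.\<close>
 have split: "window_prod T \<kappa> (?w @ p # v) x =
   (\<Sum>a. \<phi> a * window_prod T \<kappa> (map (\<lambda>(l, a). (l, indicator {a})) (w @ [(l, a)]) @ v) x)" for x
 proof -
  let ?y = "(T^^?n) x"
  have "(\<Sum>a. \<phi> a * window_prod T \<kappa> (map (\<lambda>(l, a). (l, indicator {a})) (w @ [(l, a)]) @ v) x) =
    (\<Sum>a\<in>{\<kappa> l ?y}. \<phi> a * window_prod T \<kappa> (map (\<lambda>(l, a). (l, indicator {a})) (w @ [(l, a)]) @ v) x)"
   by (rule suminf_finite) (auto simp: window_prod_append)
  then show ?thesis by (simp add: p window_prod_append ac_simps)
 qed
 have "(\<integral>\<^sup>+x. window_prod T \<kappa> (?w @ p # v) x \<partial>m) =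
  (\<Sum>a. \<integral>\<^sup>+x. \<phi> a * window_prod T \<kappa> (map (\<lambda>(l, a). (l, indicator {a})) (w @ [(l, a)]) @ v) x \<partial>m)"
  unfolding split by (rule nn_integral_suminf) measurable
 also have "... = (\<Sum>a. \<phi> a * (\<integral>\<^sup>+x. window_prod T \<kappa> (map (\<lambda>(l, a). (l, indicator {a})) (w @ [(l, a)]) @ v) x \<partial>m))"
  by (subst nn_integral_cmult) auto
 also have "... <= (\<Sum>a. \<phi> a * (?W * ennreal (K * ?q a) * ?V))"
 proof (intro suminf_le mult_left_mono)
  fix a
  show "(\<integral>\<^sup>+x. window_prod T \<kappa> (map (\<lambda>(l, a). (l, indicator {a})) (w @ [(l, a)]) @ v) x \<partial>m) <=
   ?W * ennreal (K * ?q a) * ?V"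
   using Cons.IH[of "w @ [(l, a)]"] by simp
 qed auto
 also have "... = (\<Sum>a. (\<phi> a * ennreal (?q a)) * (?W * ennreal K * ?V))"
  using K_ge_1 by (simp add: ennreal_mult ac_simps)
 also have "... = (\<Sum>a. \<phi> a * ennreal (?q a)) * (?W * ennreal K * ?V)"
  by (rule ennreal_suminf_multc)
 also have "... = (\<integral>\<^sup>+x. \<phi> (\<kappa> l x) \<partial>m) * (?W * ennreal K * ?V)"
  by (simp add: nn_integral_cell)
 finally show ?case by (simp add: p ac_simps)
qed

lemma window_prod_bound:
 "(\<integral>\<^sup>+x. window_prod T \<kappa> v x \<partial>m) <= (\<Prod>(l, \<phi>)\<leftarrow>v. ennreal K * (\<integral>\<^sup>+x. \<phi> (\<kappa> l x) \<partial>m))"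
 using window_prod_bound_aux[of "[]" v] by simp

text \<open>The joint law of the names of two consecutive windows is dominated by \<open>K^2\<close>
  times the product of their laws. Unlike \<open>window_prod_bound\<close> this covers weights that
  do not factor, which the kernel in \<open>correlation_bound\<close> requires.\<close>

lemma nn_integral_two_cells:
 fixes w :: "nat => nat => ennreal"
 shows "(\<integral>\<^sup>+x. w (\<kappa> l x) (\<kappa> k ((T^^l) x)) \<partial>m) <=
  ennreal (K^2) * (\<integral>\<^sup>+x. (\<integral>\<^sup>+y. w (\<kappa> l x) (\<kappa> k y) \<partial>m) \<partial>m)"
proof -
 let ?q = "\<lambda>l a. measure m {x \<in> space m. \<kappa> l x = a}"
 have split: "w (\<kappa> l x) (\<kappa> k ((T^^l) x)) = (\<Sum>a. \<Sum>b. w a b * indicator (cylinder (space m) T \<kappa> [(l, a), (k, b)]) x)"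
  if "x \<in> space m" for x
 proof -
  have "(\<Sum>b. w a b * indicator (cylinder (space m) T \<kappa> [(l, a), (k, b)]) x) =
   (\<Sum>b\<in>{\<kappa> k ((T^^l) x)}. w a b * indicator (cylinder (space m) T \<kappa> [(l, a), (k, b)]) x)" for a
   by (rule suminf_finite) (auto simp: indicator_def)
  then have "(\<Sum>a. \<Sum>b. w a b * indicator (cylinder (space m) T \<kappa> [(l, a), (k, b)]) x) =
   (\<Sum>a. w a (\<kappa> k ((T^^l) x)) * indicator {\<kappa> l x} a)"
   using that by (auto simp: indicator_def intro!: suminf_cong)
  also have "... = (\<Sum>a\<in>{\<kappa> l x}. w a (\<kappa> k ((T^^l) x)) * indicator {\<kappa> l x} a)"
   by (rule suminf_finite) auto
  finally show ?thesis by simp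
 qed
 have "(\<integral>\<^sup>+x. w (\<kappa> l x) (\<kappa> k ((T^^l) x)) \<partial>m) =
  (\<integral>\<^sup>+x. (\<Sum>a. \<Sum>b. w a b * indicator (cylinder (space m) T \<kappa> [(l, a), (k, b)]) x) \<partial>m)"
  by (rule nn_integral_cong) (rule split)
 also have "... = (\<Sum>a. \<integral>\<^sup>+x. (\<Sum>b. w a b * indicator (cylinder (space m) T \<kappa> [(l, a), (k, b)]) x) \<partial>m)"
  by (rule nn_integral_suminf) (intro borel_measurable_suminf_order borel_measurable_times_ennreal borel_measurable_const borel_measurable_indicator cylinder_sets)
 also have "... = (\<Sum>a. \<Sum>b. \<integral>\<^sup>+x. w a b * indicator (cylinder (space m) T \<kappa> [(l, a), (k, b)]) x \<partial>m)"
  by (intro suminf_cong nn_integral_suminf) (intro borel_measurable_times_ennreal borel_measurable_const borel_measurable_indicator cylinder_sets)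
 also have "... = (\<Sum>a. \<Sum>b. w a b * ennreal (measure m (cylinder (space m) T \<kappa> [(l, a), (k, b)])))"
  by (intro suminf_cong, subst nn_integral_cmult_indicator) (auto simp: emeasure_eq_measure simp del: cylinder.simps)
 also have "... <= (\<Sum>a. \<Sum>b. w a b * (ennreal (K^2) * ennreal (?q l a) * ennreal (?q k b)))"
 proof (intro suminf_le mult_left_mono)
  fix a b
  have "measure m (cylinder (space m) T \<kappa> [(l, a), (k, b)]) <= K^2 * ?q l a * ?q k b"
   using cylinder_bound[of "[(l, a), (k, b)]"] by (simp add: power2_eq_square algebra_simps)
  then show "ennreal (measure m (cylinder (space m) T \<kappa> [(l, a), (k, b)])) <= ennreal (K^2) * ennreal (?q l a) * ennreal (?q k b)"
   by (simp add: ennreal_mult[symmetric] ennreal_leI)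
 qed auto
 also have "... = (\<Sum>a. (\<Sum>b. w a b * ennreal (?q k b)) * (ennreal (K^2) * ennreal (?q l a)))"
  by (subst ennreal_suminf_multc[symmetric]) (simp add: ac_simps)
 also have "... = (\<Sum>a. (\<integral>\<^sup>+y. w a (\<kappa> k y) \<partial>m) * ennreal (?q l a) * ennreal (K^2))"
  by (simp add: nn_integral_cell[of "w _" k] ac_simps)
 also have "... = (\<Sum>a. (\<integral>\<^sup>+y. w a (\<kappa> k y) \<partial>m) * ennreal (?q l a)) * ennreal (K^2)"
  by (rule ennreal_suminf_multc)
 also have "... = ennreal (K^2) * (\<integral>\<^sup>+x. (\<integral>\<^sup>+y. w (\<kappa> l x) (\<kappa> k y) \<partial>m) \<partial>m)"
  by (simp add: nn_integral_cell[of "\<lambda>a. (\<integral>\<^sup>+y. w a (\<kappa> k y) \<partial>m)" l] ac_simps)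
 finally show ?thesis .
qed

end

section \<open>Sums of correlations between two consecutive windows\<close>

context quasi_bernoulli begin

lemma integrable_bounded:
 assumes "u \<in> borel_measurable m" "\<And>x. x \<in> space m ==> abs (u x) <= c"
 shows "integrable m (u :: 'a => real)"
 by (rule integrable_const_bound[of _ c]) (use assms in \<open>auto intro!: AE_I2\<close>)

lemma integral_le_bound:
 assumes "\<And>x. x \<in> space m ==> abs (u x) <= c"
 shows "abs (\<E> x. u x) <= (c :: real)"
proof (cases "integrable m u")
 case True
 have "abs (\<E> x. u x) <= (\<E> x. abs (u x))" by (rule integral_abs_bound)
 also have "... <= (\<E> x. c)" by (rule integral_mono) (use True assms in auto)
 finally show ?thesis by (simp add: prob_space)
next
 case False
 obtain x where "x \<in> space m" using not_empty by auto
 then have "c >= 0" using assms[of x] by linarith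
 then show ?thesis by (simp add: not_integrable_integral_eq[OF False])
qed

lemma integral_square_le:
 assumes "u \<in> borel_measurable m" "\<And>x. x \<in> space m ==> abs (u x) <= c"
 shows "(\<E> x. u x)^2 <= (\<E> x. (u x :: real)^2)"
proof -
 have i: "integrable m u" by (rule integrable_bounded[OF assms])
 have i2: "integrable m (\<lambda>x. (u x)^2)"
 proof (rule integrable_bounded)
  show "(\<lambda>x. (u x)^2) \<in> borel_measurable m" using assms(1) by measurable
  show "abs ((u x)^2) <= c^2" if "x \<in> space m" for x
   using power_mono[OF assms(2)[OF that], of 2] by simp
 qed
 let ?a = "(\<E> x. u x)"
 have "0 <= (\<E> x. (u x - ?a)^2)" by simp
 also have "(\<lambda>x. (u x - ?a)^2) = (\<lambda>x. (u x)^2 - 2 * ?a * u x + ?a^2)"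
  by (auto simp: power2_diff algebra_simps)
 also have "(\<E> x. (u x)^2 - 2 * ?a * u x + ?a^2) = (\<E> x. (u x)^2) - 2 * ?a * ?a + ?a^2"
  using i i2 by (simp add: prob_space)
 finally show ?thesis by (simp add: power2_eq_square)
qed

lemma cell_function_measurable [measurable]:
 "(\<lambda>x. (\<phi> :: nat => real) (\<kappa> l x)) \<in> borel_measurable m"
 by (rule measurable_compose[OF cell_measurable]) simp

lemma two_cells_measurable:
 assumes "g \<in> measurable m (count_space UNIV)" "h \<in> measurable m (count_space UNIV)"
 shows "(\<lambda>x. (w :: nat => nat => real) (g x) (h x)) \<in> borel_measurable m"
proof (rule measurable_compose_countable[OF _ assms(1)])
 fix i :: nat
 show "(\<lambda>x. w i (h x)) \<in> borel_measurable m"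
  by (rule measurable_compose[OF assms(2)]) simp
qed

lemma integral_two_cells:
 fixes w :: "nat => nat => real"
 assumes "\<And>a b. 0 <= w a b" "\<And>a b. w a b <= c"
 shows "(\<E> x. w (\<kappa> l x) (\<kappa> k ((T^^l) x))) <= K^2 * (\<E> x. (\<E> y. w (\<kappa> l x) (\<kappa> k y)))"
proof -
 have kT: "(\<lambda>x. \<kappa> k ((T^^l) x)) \<in> measurable m (count_space UNIV)"
  by (rule measurable_compose[OF iter_measurable cell_measurable])
 have c: "abs (w a b) <= c" for a b using assms[of a b] by auto
 let ?I = "\<lambda>a. (\<E> y. w a (\<kappa> k y))"
 have I0: "0 <= ?I a" for a by (rule Bochner_Integration.integral_nonneg) (use assms in auto)
 have Ic: "abs (?I a) <= c" for a by (rule integral_le_bound) (rule c)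
 have i2: "(\<integral>\<^sup>+y. ennreal (w a (\<kappa> k y)) \<partial>m) = ennreal (?I a)" for a
  by (rule nn_integral_eq_integral) (use assms c in \<open>auto intro!: integrable_bounded\<close>)
 have i1: "(\<integral>\<^sup>+x. ennreal (?I (\<kappa> l x)) \<partial>m) = ennreal (\<E> x. ?I (\<kappa> l x))"
 proof (rule nn_integral_eq_integral)
  show "integrable m (\<lambda>x. ?I (\<kappa> l x))"
   by (rule integrable_bounded[OF _ Ic]) (rule cell_function_measurable)
 qed (use I0 in auto)
 have "ennreal (\<E> x. w (\<kappa> l x) (\<kappa> k ((T^^l) x))) = (\<integral>\<^sup>+x. ennreal (w (\<kappa> l x) (\<kappa> k ((T^^l) x))) \<partial>m)"
  by (rule nn_integral_eq_integral[symmetric])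
   (use assms c two_cells_measurable[OF cell_measurable kT] in \<open>auto intro!: integrable_bounded\<close>)
 also have "... <= ennreal (K^2) * (\<integral>\<^sup>+x. (\<integral>\<^sup>+y. ennreal (w (\<kappa> l x) (\<kappa> k y)) \<partial>m) \<partial>m)"
  by (rule nn_integral_two_cells)
 also have "... = ennreal (K^2 * (\<E> x. ?I (\<kappa> l x)))"
  using I0 by (simp add: i2 i1 ennreal_mult)
 finally show ?thesis using I0 by (subst (asm) ennreal_le_iff) (auto intro!: mult_nonneg_nonneg)
qed

text \<open>The error is measured in L1 because ergodic limits and indicators of invariant sets are
  only L1 limits of functions nearly determined by cells.\<close>

definition adapted :: "nat => real => ('a => real) => bool" where
 "adapted p eps u \<longleftrightarrow> (\<exists>\<phi>. (\<forall>a. abs (\<phi> a) <= 1) \<and> (\<E> x. abs (u x - \<phi> (\<kappa> p x))) <= eps)"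

definition unit_bounded :: "('a => real) => bool" where
 "unit_bounded u \<longleftrightarrow> u \<in> borel_measurable m \<and> (\<forall>x\<in>space m. abs (u x) <= 1)"

lemma unit_boundedD: "unit_bounded u ==> u \<in> borel_measurable m" "unit_bounded u ==> x \<in> space m ==> abs (u x) <= 1"
 by (auto simp: unit_bounded_def)

lemma unit_bounded_iter: "unit_bounded u ==> unit_bounded (\<lambda>x. u ((T^^n) x))"
 unfolding unit_bounded_def using measurable_compose[OF iter_measurable, of u borel n] by auto

lemma unit_bounded_mult: "unit_bounded u ==> unit_bounded v ==> unit_bounded (\<lambda>x. u x * v x)"
 unfolding unit_bounded_def by (auto simp: abs_mult intro!: mult_le_one)

lemma abs_mult_diff_le:
 fixes a b c d :: real
 assumes "abs b <= 1" "abs c <= 1"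
 shows "abs (a * b - c * d) <= abs (a - c) + abs (b - d)"
proof -
 have "a * b - c * d = (a - c) * b + c * (b - d)" by (simp add: algebra_simps)
 also have "abs ... <= abs (a - c) * abs b + abs c * abs (b - d)"
  by (metis abs_mult abs_triangle_ineq)
 also have "... <= abs (a - c) * 1 + 1 * abs (b - d)"
  using assms by (intro add_mono mult_left_mono mult_right_mono) auto
 finally show ?thesis by simp
qed

text \<open>The sum over A is the integral of one kernel along the orbit. Its absolute value is a
  nonnegative weight on pairs of cells, so domination replaces the orbit by two independent points.
  There Cauchy-Schwarz applies, and the second moment of the kernel splits into the entrywise
  product of the two Gram matrices.\<close>

lemma correlation_bound:
 fixes u v :: "'i => 'a => real"
 assumes fin: "finite A"
  and u: "\<And>a. a \<in> A ==> unit_bounded (u a)" and v: "\<And>a. a \<in> A ==> unit_bounded (v a)"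
  and au: "\<And>a. a \<in> A ==> adapted p eps (u a)" and av: "\<And>a. a \<in> A ==> adapted q eps (v a)"
 shows "abs (\<Sum>a\<in>A. (\<E> x. u a x * v a ((T^^p) x))) <=
  K^2 * sqrt (\<Sum>a\<in>A. \<Sum>b\<in>A. (\<E> x. u a x * u b x) * (\<E> x. v a x * v b x)) + 4 * K^2 * card A * eps"
proof -
 note [measurable] = unit_boundedD(1)[OF u] unit_boundedD(1)[OF v]
 have K1: "1 <= K^2" using K_ge_1 by (simp add: one_le_power)
 obtain \<phi> where \<phi>: "\<And>a c. a \<in> A ==> abs (\<phi> a c) <= 1" "\<And>a. a \<in> A ==> (\<E> x. abs (u a x - \<phi> a (\<kappa> p x))) <= eps"
  using au unfolding adapted_def by metis
 obtain \<psi> where \<psi>: "\<And>a c. a \<in> A ==> abs (\<psi> a c) <= 1" "\<And>a. a \<in> A ==> (\<E> x. abs (v a x - \<psi> a (\<kappa> q x))) <= eps"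
  using av unfolding adapted_def by metis
 have ui: "integrable m (\<lambda>x. abs (u a x - \<phi> a (\<kappa> p x)))" if "a \<in> A" for a
 proof (rule integrable_bounded[of _ 2])
  show "(\<lambda>x. abs (u a x - \<phi> a (\<kappa> p x))) \<in> borel_measurable m" using that by measurable
  show "abs ( abs (u a x - \<phi> a (\<kappa> p x))) <= 2" if "x \<in> space m" for x
   using \<phi>(1)[OF \<open>a \<in> A\<close>, of "\<kappa> p x"] unit_boundedD(2)[OF u[OF \<open>a \<in> A\<close>] that] by linarith
 qed
 have vi: "integrable m (\<lambda>x. abs (v a x - \<psi> a (\<kappa> q x)))" if "a \<in> A" for a
 proof (rule integrable_bounded[of _ 2])
  show "(\<lambda>x. abs (v a x - \<psi> a (\<kappa> q x))) \<in> borel_measurable m" using that by measurable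
  show "abs ( abs (v a x - \<psi> a (\<kappa> q x))) <= 2" if "x \<in> space m" for x
   using \<psi>(1)[OF \<open>a \<in> A\<close>, of "\<kappa> q x"] unit_boundedD(2)[OF v[OF \<open>a \<in> A\<close>] that] by linarith
 qed
 \<comment> \<open>W is the kernel, and w the absolute value of its approximation by names; only w
   can be passed to \<open>integral_two_cells\<close>.\<close>
 define W where "W x y = (\<Sum>a\<in>A. u a x * v a y)" for x y
 define w where "w c d = abs (\<Sum>a\<in>A. \<phi> a c * \<psi> a d)" for c d
 have w_bd: "w c d <= card A" for c d
 proof -
  have "w c d <= (\<Sum>a\<in>A. abs (\<phi> a c * \<psi> a d))" unfolding w_def by (rule sum_abs)
  also have "... <= (\<Sum>a\<in>A. 1)" using \<phi>(1) \<psi>(1) by (intro sum_mono) (auto simp: abs_mult intro!: mult_le_one)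
  finally show ?thesis by simp
 qed
 have W_bd: "abs (W x y) <= card A" if "x \<in> space m" "y \<in> space m" for x y
 proof -
  have "abs (W x y) <= (\<Sum>a\<in>A. abs (u a x * v a y))" unfolding W_def by (rule sum_abs)
  also have "... <= (\<Sum>a\<in>A. 1)" using unit_boundedD(2)[OF u] unit_boundedD(2)[OF v] that
   by (intro sum_mono) (auto simp: abs_mult intro!: mult_le_one)
  finally show ?thesis by simp
 qed
 define du where "du x = (\<Sum>a\<in>A. abs (u a x - \<phi> a (\<kappa> p x)))" for x
 define dv where "dv x = (\<Sum>a\<in>A. abs (v a x - \<psi> a (\<kappa> q x)))" for x
 have dui: "integrable m du" and dvi: "integrable m dv"
  unfolding du_def dv_def using ui vi by (auto intro!: Bochner_Integration.integrable_sum)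
 have duE: "(\<E> x. du x) <= card A * eps"
  unfolding du_def using ui \<phi>(2) by (subst Bochner_Integration.integral_sum) (auto intro!: sum_bounded_above)
 have dvE: "(\<E> x. dv x) <= card A * eps"
  unfolding dv_def using vi \<psi>(2) by (subst Bochner_Integration.integral_sum) (auto intro!: sum_bounded_above)
 have diff: "abs (W x y - (\<Sum>a\<in>A. \<phi> a (\<kappa> p x) * \<psi> a (\<kappa> q y))) <= du x + dv y" if "x \<in> space m" "y \<in> space m" for x y
 proof -
  have "abs (W x y - (\<Sum>a\<in>A. \<phi> a (\<kappa> p x) * \<psi> a (\<kappa> q y))) <= (\<Sum>a\<in>A. abs (u a x * v a y - \<phi> a (\<kappa> p x) * \<psi> a (\<kappa> q y)))"
   unfolding W_def sum_subtractf[symmetric] by (rule sum_abs)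
  also have "... <= (\<Sum>a\<in>A. abs (u a x - \<phi> a (\<kappa> p x)) + abs (v a y - \<psi> a (\<kappa> q y)))"
   using \<phi>(1) unit_boundedD(2)[OF v] that by (intro sum_mono abs_mult_diff_le) auto
  finally show ?thesis by (simp add: du_def dv_def sum.distrib)
 qed
 have [measurable]: "(\<lambda>x. v a ((T^^p) x)) \<in> borel_measurable m" if "a \<in> A" for a
  using unit_bounded_iter[OF v[OF that]] by (rule unit_boundedD(1))
 have kT [measurable]: "(\<lambda>x. \<kappa> q ((T^^p) x)) \<in> measurable m (count_space UNIV)"
  by (rule measurable_compose[OF iter_measurable cell_measurable])
 have dvT: "integrable m (\<lambda>x. dv ((T^^p) x))" "(\<E> x. dv ((T^^p) x)) = (\<E> x. dv x)"
 proof -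
  show "(\<E> x. dv ((T^^p) x)) = (\<E> x. dv x)"
   by (rule integral_iter) (use dvi in auto)
  have "integrable (distr m m (T^^p)) dv" using dvi by (simp add: iter_distr)
  then show "integrable m (\<lambda>x. dv ((T^^p) x))"
   by (subst (asm) integrable_distr_eq) (use dvi in auto)
 qed
 have wi: "integrable m (\<lambda>x. w (\<kappa> p x) (\<kappa> q ((T^^p) x)))"
  by (rule integrable_bounded[of _ "card A"]) (use w_bd in \<open>auto simp: w_def intro!: two_cells_measurable[of _ _ w, unfolded w_def]\<close>)
 have "(\<Sum>a\<in>A. (\<E> x. u a x * v a ((T^^p) x))) = (\<E> x. W x ((T^^p) x))"
  unfolding W_def
 proof (rule Bochner_Integration.integral_sum[symmetric])
  fix a assume a: "a \<in> A"
  show "integrable m (\<lambda>x. u a x * v a ((T^^p) x))"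
   using unit_bounded_mult[OF u[OF a] unit_bounded_iter[OF v[OF a]]]
   by (auto simp: unit_bounded_def intro!: integrable_bounded[of _ 1])
 qed
 also have "abs ... <= (\<E> x. abs (W x ((T^^p) x)))" by (rule integral_abs_bound)
 also have "... <= (\<E> x. w (\<kappa> p x) (\<kappa> q ((T^^p) x)) + (du x + dv ((T^^p) x)))"
 proof (rule integral_mono)
  show "integrable m (\<lambda>x. abs (W x ((T^^p) x)))"
   by (rule integrable_bounded[of _ "card A"]) (use W_bd in \<open>auto simp: W_def\<close>)
  show "integrable m (\<lambda>x. w (\<kappa> p x) (\<kappa> q ((T^^p) x)) + (du x + dv ((T^^p) x)))"
   using wi dui dvT(1) by auto
  show "abs (W x ((T^^p) x)) <= w (\<kappa> p x) (\<kappa> q ((T^^p) x)) + (du x + dv ((T^^p) x))" if "x \<in> space m" for x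
   using diff[OF that iter_space[OF that, of p]] by (simp add: w_def)
 qed
 also have "... = (\<E> x. w (\<kappa> p x) (\<kappa> q ((T^^p) x))) + ((\<E> x. du x) + (\<E> x. dv x))"
  using wi dui dvT by simp
 also have "... <= (\<E> x. w (\<kappa> p x) (\<kappa> q ((T^^p) x))) + (card A * eps + card A * eps)"
  using duE dvE by linarith
 also have "(\<E> x. w (\<kappa> p x) (\<kappa> q ((T^^p) x))) <= K^2 * (\<E> x. (\<E> y. w (\<kappa> p x) (\<kappa> q y)))"
  by (rule integral_two_cells[OF _ w_bd]) (simp add: w_def)
 also have "(\<E> x. (\<E> y. w (\<kappa> p x) (\<kappa> q y))) <= (\<E> x. (\<E> y. abs (W x y)) + (du x + (\<E> y. dv y)))"
 proof (rule integral_mono)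
  show "integrable m (\<lambda>x. (\<E> y. w (\<kappa> p x) (\<kappa> q y)))"
  proof (rule integrable_bounded)
   show "(\<lambda>x. (\<E> y. w (\<kappa> p x) (\<kappa> q y))) \<in> borel_measurable m"
    by (rule cell_function_measurable)
   show "abs (\<E> y. w (\<kappa> p x) (\<kappa> q y)) <= card A" for x
    by (rule integral_le_bound) (use w_bd in \<open>auto simp: w_def\<close>)
  qed
  show "integrable m (\<lambda>x. (\<E> y. abs (W x y)) + (du x + (\<E> y. dv y)))"
  proof (intro Bochner_Integration.integrable_add dui)
   show "integrable m (\<lambda>x. (\<E> y. abs (W x y)))"
   proof (rule integrable_bounded)
    show "(\<lambda>x. (\<E> y. abs (W x y))) \<in> borel_measurable m" unfolding W_def by measurable
    show "abs (\<E> y. abs (W x y)) <= card A" if "x \<in> space m" for x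
     by (rule integral_le_bound) (use W_bd that in auto)
   qed
  qed auto
  fix x assume x: "x \<in> space m"
  have "(\<E> y. w (\<kappa> p x) (\<kappa> q y)) <= (\<E> y. abs (W x y) + (du x + dv y))"
  proof (rule integral_mono)
   show "integrable m (\<lambda>y. w (\<kappa> p x) (\<kappa> q y))"
    by (rule integrable_bounded[of _ "card A"]) (use w_bd in \<open>auto simp: w_def\<close>)
   show "integrable m (\<lambda>y. abs (W x y) + (du x + dv y))"
   proof (intro Bochner_Integration.integrable_add dvi)
    show "integrable m (\<lambda>y. abs (W x y))"
     by (rule integrable_bounded[of _ "card A"]) (use W_bd x in \<open>auto simp: W_def\<close>)
   qed auto
   show "w (\<kappa> p x) (\<kappa> q y) <= abs (W x y) + (du x + dv y)" if "y \<in> space m" for y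
    using diff[OF x that] by (simp add: w_def)
  qed
  also have "... = (\<E> y. abs (W x y)) + (du x + (\<E> y. dv y))"
  proof -
   have "integrable m (\<lambda>y. abs (W x y))"
    by (rule integrable_bounded[of _ "card A"]) (use W_bd x in \<open>auto simp: W_def\<close>)
   then show ?thesis using dvi by (simp add: prob_space)
  qed
  finally show "(\<E> y. w (\<kappa> p x) (\<kappa> q y)) <= (\<E> y. abs (W x y)) + (du x + (\<E> y. dv y))" .
 qed
 also have "... = (\<E> x. (\<E> y. abs (W x y))) + ((\<E> y. du y) + (\<E> y. dv y))"
 proof -
  have "integrable m (\<lambda>x. (\<E> y. abs (W x y)))"
  proof (rule integrable_bounded)
   show "(\<lambda>x. (\<E> y. abs (W x y))) \<in> borel_measurable m" unfolding W_def by measurable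
   show "abs (\<E> y. abs (W x y)) <= card A" if "x \<in> space m" for x
    by (rule integral_le_bound) (use W_bd that in auto)
  qed
  then show ?thesis using dui by (simp add: prob_space)
 qed
 also have "... <= (\<E> x. (\<E> y. abs (W x y))) + (card A * eps + card A * eps)"
  using duE dvE by linarith
 also have "(\<E> x. (\<E> y. abs (W x y))) <=
   sqrt (\<Sum>a\<in>A. \<Sum>b\<in>A. (\<E> x. u a x * u b x) * (\<E> x. v a x * v b x))"
 proof (rule real_le_rsqrt)
  let ?g = "\<lambda>x. (\<E> y. abs (W x y))"
  have gm: "?g \<in> borel_measurable m" unfolding W_def by measurable
  have gb: "abs (?g x) <= card A" if "x \<in> space m" for x
   by (rule integral_le_bound) (use W_bd that in auto)
  have uvi: "integrable m (\<lambda>x. u a x * u b x)" "integrable m (\<lambda>x. v a x * v b x)" if "a \<in> A" "b \<in> A" for a b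
   using unit_bounded_mult[OF u u, OF that] unit_bounded_mult[OF v v, OF that]
   by (auto simp: unit_bounded_def intro!: integrable_bounded[of _ 1])
  \<comment> \<open>Jensen's inequality is used in each variable separately, which avoids forming
    the product measure.\<close>
  have "(\<E> x. ?g x)^2 <= (\<E> x. (?g x)^2)" by (rule integral_square_le[OF gm gb])
  also have "... <= (\<E> x. (\<Sum>a\<in>A. \<Sum>b\<in>A. u a x * u b x * (\<E> y. v a y * v b y)))"
  proof (rule integral_mono)
   show "integrable m (\<lambda>x. (?g x)^2)"
   proof (rule integrable_bounded[of _ "(card A)^2"])
    show "(\<lambda>x. (?g x)^2) \<in> borel_measurable m" using gm by measurable
    show "abs ((?g x)^2) <= real ((card A)^2)" if "x \<in> space m" for x
     using power_mono[OF gb[OF that], of 2] by simp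
   qed
   show "integrable m (\<lambda>x. \<Sum>a\<in>A. \<Sum>b\<in>A. u a x * u b x * (\<E> y. v a y * v b y))"
    using uvi by (intro Bochner_Integration.integrable_sum integrable_mult_left) auto
   fix x assume x: "x \<in> space m"
   have "(?g x)^2 <= (\<E> y. abs (W x y)^2)"
    by (rule integral_square_le[of _ "card A"]) (use W_bd x in \<open>auto simp: W_def\<close>)
   also have "... = (\<E> y. (\<Sum>a\<in>A. \<Sum>b\<in>A. u a x * u b x * (v a y * v b y)))"
    unfolding W_def by (simp add: power2_eq_square sum_product ac_simps)
   also have "... = (\<Sum>a\<in>A. \<Sum>b\<in>A. u a x * u b x * (\<E> y. v a y * v b y))"
    using uvi by (simp add: Bochner_Integration.integral_sum)
   finally show "(?g x)^2 <= (\<Sum>a\<in>A. \<Sum>b\<in>A. u a x * u b x * (\<E> y. v a y * v b y))" .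
  qed
  also have "... = (\<Sum>a\<in>A. \<Sum>b\<in>A. (\<E> x. u a x * u b x) * (\<E> x. v a x * v b x))"
   using uvi by (simp add: Bochner_Integration.integral_sum)
  finally show "(\<E> x. ?g x)^2 <= (\<Sum>a\<in>A. \<Sum>b\<in>A. (\<E> x. u a x * u b x) * (\<E> x. v a x * v b x))" .
 qed
 finally have *: "abs (\<Sum>a\<in>A. (\<E> x. u a x * v a ((T^^p) x))) <=
  K^2 * (sqrt (\<Sum>a\<in>A. \<Sum>b\<in>A. (\<E> x. u a x * u b x) * (\<E> x. v a x * v b x)) + (card A * eps + card A * eps))
   + (card A * eps + card A * eps)"
  by (simp add: mult_left_mono)
 \<comment> \<open>The kernel is replaced by its cell version twice, once along the orbit and once
   after the domination, where the error is multiplied by \<open>K^2\<close>. Nonnegativity of the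
   error and \<open>1 <= K^2\<close> merge both into \<open>4 * K^2 * card A * eps\<close>.\<close>
 have "0 <= (\<E> x. du x)" by (rule Bochner_Integration.integral_nonneg) (simp add: du_def sum_nonneg)
 then have "0 <= card A * eps" using duE by linarith
 then have "card A * eps <= K^2 * (card A * eps)" using mult_right_mono[OF K1, of "card A * eps"] by simp
 then show ?thesis using * by (simp add: algebra_simps)
qed

end

section \<open>Functions approximable by cells, and Cesaro averages\<close>

context quasi_bernoulli begin

lemma unit_bounded_integrable: "unit_bounded u ==> integrable m u"
 by (rule integrable_bounded[of _ 1]) (auto simp: unit_bounded_def)

lemma unit_bounded_diff_integrable:
 assumes "unit_bounded u" "unit_bounded v"
 shows "integrable m (\<lambda>x. abs (u x - v x))"
 using unit_bounded_integrable[OF assms(1)] unit_bounded_integrable[OF assms(2)] by auto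

lemma unit_bounded_cell:
 "(\<And>a. abs (\<phi> a) <= 1) ==> unit_bounded (\<lambda>x. \<phi> (\<kappa> p x))"
 by (auto simp: unit_bounded_def)

lemma L1_triangle:
 assumes "unit_bounded u" "unit_bounded v" "unit_bounded w"
 shows "(\<E> x. abs (u x - w x)) <= (\<E> x. abs (u x - v x)) + (\<E> x. abs (v x - w x))"
proof -
 note i = unit_bounded_diff_integrable
 have "(\<E> x. abs (u x - w x)) <= (\<E> x. abs (u x - v x) + abs (v x - w x))"
  by (rule integral_mono) (use i assms in auto)
 then show ?thesis using i assms by simp
qed

lemma L1_sym: "(\<E> x. abs (u x - w x)) = (\<E> x. abs (w x - (u x :: real)))"
 by (simp add: abs_minus_commute)

lemma L1_iter:
 assumes "unit_bounded u" "unit_bounded v"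
 shows "(\<E> x. abs (u ((T^^n) x) - v ((T^^n) x))) = (\<E> x. abs (u x - v x))"
 by (rule integral_iter[of "\<lambda>x. abs (u x - v x)"]) (use assms in \<open>auto simp: unit_bounded_def\<close>)

lemma integral_mult_diff_le:
 assumes "unit_bounded u" "unit_bounded v" "unit_bounded w"
 shows "abs ((\<E> x. u x * w x) - (\<E> x. v x * w x)) <= (\<E> x. abs (u x - v x))"
proof -
 have i: "integrable m (\<lambda>x. u x * w x)" "integrable m (\<lambda>x. v x * w x)"
  using unit_bounded_integrable[OF unit_bounded_mult] assms by blast+
 have "(\<E> x. u x * w x) - (\<E> x. v x * w x) = (\<E> x. u x * w x - v x * w x)"
  using i by simp
 also have "abs ... <= (\<E> x. abs (u x * w x - v x * w x))" by (rule integral_abs_bound)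
 also have "... <= (\<E> x. abs (u x - v x))"
 proof (rule integral_mono)
  show "integrable m (\<lambda>x. abs (u x * w x - v x * w x))" using i by auto
  show "integrable m (\<lambda>x. abs (u x - v x))" using unit_bounded_diff_integrable assms by blast
  show "abs (u x * w x - v x * w x) <= abs (u x - v x)" if "x \<in> space m" for x
   using unit_boundedD(2)[OF assms(3) that]
   by (metis abs_mult abs_ge_zero left_diff_distrib mult.right_neutral mult_left_mono)
 qed
 finally show ?thesis .
qed

lemma adapted_mono: "adapted p eps u ==> eps <= \<delta> ==> adapted p \<delta> u"
 unfolding adapted_def by (meson order_trans)

lemma adaptedE:
 assumes "adapted p eps u"
 obtains \<phi> where "\<And>a. abs (\<phi> a) <= 1" "unit_bounded (\<lambda>x. \<phi> (\<kappa> p x))" "(\<E> x. abs (u x - \<phi> (\<kappa> p x))) <= eps"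
 using assms unit_bounded_cell unfolding adapted_def by metis

lemma adapted_compose2:
 assumes u: "unit_bounded u" and v: "unit_bounded v" and au: "adapted p eps u" and av: "adapted p \<delta> v"
  and g: "\<And>a b. abs a <= 1 ==> abs b <= 1 ==> abs (g a b) <= 1"
  and L: "\<And>a b c d. abs a <= 1 ==> abs b <= 1 ==> abs c <= 1 ==> abs d <= 1 ==>
     abs (g a b - g c d) <= abs (a - c) + abs (b - d)"
  and gu: "unit_bounded (\<lambda>x. g (u x) (v x))"
 shows "adapted p (eps + \<delta>) (\<lambda>x. g (u x) (v x))"
proof -
 obtain \<phi> where \<phi>: "\<And>a. abs (\<phi> a) <= 1" "unit_bounded (\<lambda>x. \<phi> (\<kappa> p x))" "(\<E> x. abs (u x - \<phi> (\<kappa> p x))) <= eps"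
  using adaptedE[OF au] by blast
 obtain \<psi> where \<psi>: "\<And>a. abs (\<psi> a) <= 1" "unit_bounded (\<lambda>x. \<psi> (\<kappa> p x))" "(\<E> x. abs (v x - \<psi> (\<kappa> p x))) <= \<delta>"
  using adaptedE[OF av] by blast
 note i = unit_bounded_diff_integrable
 have gp: "unit_bounded (\<lambda>x. g (\<phi> (\<kappa> p x)) (\<psi> (\<kappa> p x)))"
  by (rule unit_bounded_cell) (use g \<phi>(1) \<psi>(1) in auto)
 have "(\<E> x. abs (g (u x) (v x) - g (\<phi> (\<kappa> p x)) (\<psi> (\<kappa> p x)))) <=
   (\<E> x. abs (u x - \<phi> (\<kappa> p x)) + abs (v x - \<psi> (\<kappa> p x)))"
  by (rule integral_mono)
   (use i[OF gu gp] i[OF u \<phi>(2)] i[OF v \<psi>(2)] \<phi>(1) \<psi>(1) unit_boundedD(2)[OF u] unit_boundedD(2)[OF v]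
    in \<open>auto intro!: L\<close>)
 also have "... <= eps + \<delta>" using i[OF u \<phi>(2)] i[OF v \<psi>(2)] \<phi>(3) \<psi>(3) by simp
 finally show ?thesis using g \<phi>(1) \<psi>(1) unfolding adapted_def
  by (intro exI[of _ "\<lambda>a. g (\<phi> a) (\<psi> a)"]) auto
qed

lemma adapted_close:
 assumes "unit_bounded u" "unit_bounded v" "adapted p eps u" "(\<E> x. abs (v x - u x)) <= \<delta>"
 shows "adapted p (eps + \<delta>) v"
proof -
 obtain \<phi> where \<phi>: "\<And>a. abs (\<phi> a) <= 1" "unit_bounded (\<lambda>x. \<phi> (\<kappa> p x))" "(\<E> x. abs (u x - \<phi> (\<kappa> p x))) <= eps"
  using adaptedE[OF assms(3)] by blast
 have "(\<E> x. abs (v x - \<phi> (\<kappa> p x))) <= eps + \<delta>"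
  using L1_triangle[OF assms(2,1) \<phi>(2)] \<phi>(3) assms(4) by linarith
 then show ?thesis using \<phi>(1) unfolding adapted_def by blast
qed

lemma adapted_compose:
 assumes u: "unit_bounded u" and a: "adapted p eps u" and g: "\<And>a. abs a <= 1 ==> abs (g a) <= 1"
  and L: "\<And>a b. abs a <= 1 ==> abs b <= 1 ==> abs (g a - g b) <= L * abs (a - b)"
  and gu: "unit_bounded (\<lambda>x. g (u x))"
 shows "adapted p (L * eps) (\<lambda>x. g (u x))"
proof -
 obtain \<phi> where \<phi>: "\<And>a. abs (\<phi> a) <= 1" "unit_bounded (\<lambda>x. \<phi> (\<kappa> p x))" "(\<E> x. abs (u x - \<phi> (\<kappa> p x))) <= eps"
  using adaptedE[OF a] by blast
 have gp: "unit_bounded (\<lambda>x. g (\<phi> (\<kappa> p x)))"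
  by (rule unit_bounded_cell) (use g \<phi>(1) in auto)
 have L0: "0 <= L" using order_trans[OF abs_ge_zero L[of 0 1]] by simp
 have "(\<E> x. abs (g (u x) - g (\<phi> (\<kappa> p x)))) <= (\<E> x. L * abs (u x - \<phi> (\<kappa> p x)))"
  by (rule integral_mono)
   (use unit_bounded_diff_integrable[OF gu gp] unit_bounded_diff_integrable[OF u \<phi>(2)] L \<phi>(1) unit_boundedD(2)[OF u] in auto)
 also have "... <= L * eps" using \<phi>(3) L0 by (simp add: mult_left_mono)
 finally show ?thesis using g \<phi>(1) unfolding adapted_def
  by (intro exI[of _ "\<lambda>a. g (\<phi> a)"]) auto
qed

lemma unit_bounded_half_diff:
 assumes "unit_bounded u" "unit_bounded v"
 shows "unit_bounded (\<lambda>x. (u x - v x) / 2)"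
proof -
 have "abs ((u x - v x) / 2) <= 1" if "x \<in> space m" for x
  using unit_boundedD(2)[OF assms(1) that] unit_boundedD(2)[OF assms(2) that] by argo
 then show ?thesis using assms unfolding unit_bounded_def by auto
qed

lemma adapted_oscillation:
 assumes u: "unit_bounded u" and o: "\<And>x y. x \<in> space m ==> y \<in> space m ==> \<kappa> p x = \<kappa> p y ==> abs (u x - u y) <= eps"
 shows "adapted p eps u"
proof -
 \<comment> \<open>A representative of each cell supplies the approximating value; names of empty
   cells get the default 0, which keeps the bound 1.\<close>
 define r where "r a = (SOME x. x \<in> space m \<and> \<kappa> p x = a)" for a
 define \<phi> where "\<phi> a = (if \<exists>x\<in>space m. \<kappa> p x = a then u (r a) else 0)" for a
 have r: "r (\<kappa> p x) \<in> space m" "\<kappa> p (r (\<kappa> p x)) = \<kappa> p x" if "x \<in> space m" for x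
  using someI[of "\<lambda>y. y \<in> space m \<and> \<kappa> p y = \<kappa> p x" x] that unfolding r_def by auto
 have \<phi>1: "abs (\<phi> a) <= 1" for a using r unit_boundedD(2)[OF u] by (auto simp: \<phi>_def)
 have "(\<E> x. abs (u x - \<phi> (\<kappa> p x))) <= (\<E> x. eps)"
 proof (rule integral_mono)
  show "integrable m (\<lambda>x. abs (u x - \<phi> (\<kappa> p x)))"
   by (rule unit_bounded_diff_integrable[OF u unit_bounded_cell[OF \<phi>1]])
  fix x assume x: "x \<in> space m"
  then have "\<phi> (\<kappa> p x) = u (r (\<kappa> p x))" by (auto simp: \<phi>_def)
  then show "abs (u x - \<phi> (\<kappa> p x)) <= eps" using o[OF x r(1)[OF x]] r(2)[OF x] by simp
 qed simp
 then show ?thesis using \<phi>1 unfolding adapted_def by (auto simp: prob_space)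
qed

text \<open>A cell determines the orbit well only in the interior of its window, so u is observed at
  time s with margins s before and e after. The class is closed under products, Lipschitz maps,
  iteration and L1 limits, hence contains ergodic limits.\<close>

definition nice :: "('a => real) => bool" where
 "nice u \<longleftrightarrow> unit_bounded u \<and>
  (\<forall>eps>0. \<exists>R. \<forall>s\<ge>R. \<forall>e\<ge>R. adapted (s + e) eps (\<lambda>x. u ((T^^s) x)))"

lemma nice_unit_bounded: "nice u ==> unit_bounded u" by (simp add: nice_def)

lemma niceD: "nice u ==> eps > 0 ==> \<exists>R. \<forall>s\<ge>R. \<forall>e\<ge>R. adapted (s + e) eps (\<lambda>x. u ((T^^s) x))"
 by (simp add: nice_def)

lemma nice_const: "abs c <= 1 ==> nice (\<lambda>x. c)"
 unfolding nice_def unit_bounded_def adapted_def by (auto intro!: exI[of _ 0] exI[of _ "\<lambda>_. c"])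

lemma nice_compose2:
 assumes nu: "nice u" and nv: "nice v"
  and g: "\<And>a b. abs a <= 1 ==> abs b <= 1 ==> abs (g a b) <= 1"
  and L: "\<And>a b c d. abs a <= 1 ==> abs b <= 1 ==> abs c <= 1 ==> abs d <= 1 ==>
     abs (g a b - g c d) <= abs (a - c) + abs (b - d)"
  and gu: "unit_bounded (\<lambda>x. g (u x) (v x))"
 shows "nice (\<lambda>x. g (u x) (v x))"
 unfolding nice_def
proof (intro conjI allI impI gu)
 note u = nice_unit_bounded[OF nu] and v = nice_unit_bounded[OF nv]
 fix eps :: real assume eps: "eps > 0"
 obtain R1 where R1: "\<And>s e. s >= R1 ==> e >= R1 ==> adapted (s + e) (eps / 2) (\<lambda>x. u ((T^^s) x))"
  using niceD[OF nu, of "eps / 2"] eps by auto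
 obtain R2 where R2: "\<And>s e. s >= R2 ==> e >= R2 ==> adapted (s + e) (eps / 2) (\<lambda>x. v ((T^^s) x))"
  using niceD[OF nv, of "eps / 2"] eps by auto
 show "\<exists>R. \<forall>s\<ge>R. \<forall>e\<ge>R. adapted (s + e) eps (\<lambda>x. g (u ((T^^s) x)) (v ((T^^s) x)))"
 proof (intro exI[of _ "max R1 R2"] allI impI)
  fix s e assume "s >= max R1 R2" "e >= max R1 R2"
  then have "adapted (s + e) (eps / 2) (\<lambda>x. u ((T^^s) x))" "adapted (s + e) (eps / 2) (\<lambda>x. v ((T^^s) x))"
   using R1 R2 by auto
  from adapted_compose2[OF unit_bounded_iter[OF u] unit_bounded_iter[OF v] this g L unit_bounded_iter[OF gu]]
  show "adapted (s + e) eps (\<lambda>x. g (u ((T^^s) x)) (v ((T^^s) x)))" by simp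
 qed
qed

lemma nice_mult: "nice u ==> nice v ==> nice (\<lambda>x. u x * v x)"
 by (rule nice_compose2[of u v "\<lambda>a b. a * b", OF _ _ _ abs_mult_diff_le unit_bounded_mult])
  (simp_all add: abs_mult mult_le_one nice_unit_bounded)

lemma nice_compose:
 assumes nu: "nice u" and g: "\<And>a. abs a <= 1 ==> abs (g a) <= 1"
  and L: "\<And>a b. abs a <= 1 ==> abs b <= 1 ==> abs (g a - g b) <= L * abs (a - b)"
  and gm: "g \<in> borel_measurable borel"
 shows "nice (\<lambda>x. g (u x))"
 unfolding nice_def
proof (intro conjI allI impI)
 note u = nice_unit_bounded[OF nu]
 show gu: "unit_bounded (\<lambda>x. g (u x))"
  using u g measurable_compose[OF unit_boundedD(1)[OF u] gm] unfolding unit_bounded_def by auto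
 fix eps :: real assume eps: "eps > 0"
 have L0: "0 <= L" using order_trans[OF abs_ge_zero L[of 0 1]] by simp
 \<comment> \<open>The divisor is \<open>L + 1\<close> because L may be 0.\<close>
 obtain R where R: "\<And>s e. s >= R ==> e >= R ==> adapted (s + e) (eps / (L + 1)) (\<lambda>x. u ((T^^s) x))"
  using niceD[OF nu, of "eps / (L + 1)"] eps L0 by auto
 have le: "L * (eps / (L + 1)) <= eps" using L0 eps by (simp add: field_simps)
 show "\<exists>R. \<forall>s\<ge>R. \<forall>e\<ge>R. adapted (s + e) eps (\<lambda>x. g (u ((T^^s) x)))"
  by (intro exI[of _ R] allI impI adapted_mono[OF _ le] adapted_compose[OF unit_bounded_iter[OF u] R g L unit_bounded_iter[OF gu]])
qed

lemma nice_iter: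
 assumes "nice u"
 shows "nice (\<lambda>x. u ((T^^n) x))"
 unfolding nice_def
proof (intro conjI allI impI)
 note u = nice_unit_bounded[OF assms(1)]
 show "unit_bounded (\<lambda>x. u ((T^^n) x))" by (rule unit_bounded_iter[OF u])
 fix eps :: real assume "eps > 0"
 obtain R where R: "\<And>s e. s >= R ==> e >= R ==> adapted (s + e) eps (\<lambda>x. u ((T^^s) x))"
  using niceD[OF assms \<open>eps > 0\<close>] by auto
 show "\<exists>R. \<forall>s\<ge>R. \<forall>e\<ge>R. adapted (s + e) eps (\<lambda>x. u ((T^^n) ((T^^s) x)))"
 proof (intro exI[of _ "R + n"] allI impI)
  fix s e assume "s >= R + n" "e >= R + n"
  then show "adapted (s + e) eps (\<lambda>x. u ((T^^n) ((T^^s) x)))"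
   using R[of "n + s" "e - n"] by (simp add: funpow_add)
 qed
qed

lemma nice_limit:
 assumes u: "unit_bounded u" and a: "\<And>eps. eps > 0 ==> \<exists>v. nice v \<and> (\<E> x. abs (u x - v x)) <= eps"
 shows "nice u"
 unfolding nice_def
proof (intro conjI allI impI u)
 fix eps :: real assume "eps > 0"
 obtain v where v: "nice v" "(\<E> x. abs (u x - v x)) <= eps / 2" using a[of "eps / 2"] \<open>eps > 0\<close> by auto
 note v' = nice_unit_bounded[OF v(1)]
 obtain R where R: "\<And>s e. s >= R ==> e >= R ==> adapted (s + e) (eps / 2) (\<lambda>x. v ((T^^s) x))"
  using niceD[OF v(1), of "eps / 2"] \<open>eps > 0\<close> by auto
 show "\<exists>R. \<forall>s\<ge>R. \<forall>e\<ge>R. adapted (s + e) eps (\<lambda>x. u ((T^^s) x))"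
 proof (intro exI[of _ R] allI impI)
  fix s e assume se: "s >= R" "e >= R"
  have "(\<E> x. abs (u ((T^^s) x) - v ((T^^s) x))) <= eps / 2"
   using v(2) L1_iter[OF u v'] by simp
  from adapted_close[OF unit_bounded_iter[OF v'] unit_bounded_iter[OF u] R[OF se] this]
  show "adapted (s + e) eps (\<lambda>x. u ((T^^s) x))" by simp
 qed
qed

definition average :: "nat => ('a => real) => 'a => real" where
 "average n u x = (\<Sum>i<n. u ((T^^i) x)) / real n"

lemma abs_convex_le:
 fixes a b t :: real
 assumes "0 <= t" "t <= 1"
 shows "abs (t * a + (1 - t) * b) <= t * abs a + (1 - t) * abs b"
 using abs_triangle_ineq[of "t * a" "(1 - t) * b"] assms by (simp add: abs_mult)

lemma unit_bounded_convex:
 assumes "unit_bounded u" "unit_bounded v" "0 <= t" "t <= 1"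
 shows "unit_bounded (\<lambda>x. t * u x + (1 - t) * v x)"
 unfolding unit_bounded_def
proof (intro conjI ballI)
 note [measurable] = unit_boundedD(1)[OF assms(1)] unit_boundedD(1)[OF assms(2)]
 show "(\<lambda>x. t * u x + (1 - t) * v x) \<in> borel_measurable m" by measurable
 fix x assume x: "x \<in> space m"
 have "t * abs (u x) <= t * 1" by (rule mult_left_mono[OF unit_boundedD(2)[OF assms(1) x] assms(3)])
 moreover have "(1 - t) * abs (v x) <= (1 - t) * 1"
  by (rule mult_left_mono[OF unit_boundedD(2)[OF assms(2) x]]) (use assms(4) in simp)
 ultimately have "t * abs (u x) + (1 - t) * abs (v x) <= t * 1 + (1 - t) * 1" by (rule add_mono)
 also have "... = 1" by simp
 finally show "abs (t * u x + (1 - t) * v x) <= 1"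
  by (rule order_trans[OF abs_convex_le[OF assms(3,4)]])
qed

lemma half_diff_bounds:
 fixes a b c d :: real
 shows "abs a <= 1 ==> abs b <= 1 ==> abs ((a - b) / 2) <= 1"
  and "abs ((a - b) / 2 - (c - d) / 2) <= abs (a - c) + abs (b - d)"
 by argo+

lemma adapted_half_diff:
 assumes "unit_bounded u" "unit_bounded v" "adapted p eps u" "adapted p \<delta> v"
 shows "adapted p (eps + \<delta>) (\<lambda>x. (u x - v x) / 2)"
 by (rule adapted_compose2[OF assms half_diff_bounds unit_bounded_half_diff[OF assms(1,2)]])

lemma nice_half_diff: "nice u ==> nice v ==> nice (\<lambda>x. (u x - v x) / 2)"
 by (rule nice_compose2[OF _ _ half_diff_bounds unit_bounded_half_diff[OF nice_unit_bounded nice_unit_bounded]])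

lemma nice_convex:
 assumes "nice u" "nice v" and t: "0 <= t" "t <= 1"
 shows "nice (\<lambda>x. t * u x + (1 - t) * v x)"
proof (rule nice_compose2[OF assms(1,2)])
 fix a b c d :: real assume abcd: "abs a <= 1" "abs b <= 1" "abs c <= 1" "abs d <= 1"
 have "abs (t * (a - c) + (1 - t) * (b - d)) <= t * abs (a - c) + (1 - t) * abs (b - d)"
  by (rule abs_convex_le[OF t])
 also have "... <= 1 * abs (a - c) + 1 * abs (b - d)"
  by (intro add_mono mult_right_mono) (use t in auto)
 finally show "abs (t * a + (1 - t) * b - (t * c + (1 - t) * d)) <= abs (a - c) + abs (b - d)"
  by (simp add: algebra_simps)
next
 fix a b :: real assume ab: "abs a <= 1" "abs b <= 1"
 have "t * abs a + (1 - t) * abs b <= t * 1 + (1 - t) * 1"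
  by (intro add_mono mult_left_mono ab) (use t in auto)
 then show "abs (t * a + (1 - t) * b) <= 1" using abs_convex_le[OF t, of a b] by simp
next
 show "unit_bounded (\<lambda>x. t * u x + (1 - t) * v x)"
  using assms by (intro unit_bounded_convex nice_unit_bounded)
qed

text \<open>The set for the proof of the mean ergodic theorem by minimal norm: all convex
  combinations of u and its translates. It contains the averages of its members, and boundedness and
  niceness pass from u to all of it.\<close>

inductive_set convex_hull :: "('a => real) => ('a => real) set" for u where
 base: "u \<in> convex_hull u"
| shift: "v \<in> convex_hull u ==> (\<lambda>x. v (T x)) \<in> convex_hull u"
| convex: "v \<in> convex_hull u ==> w \<in> convex_hull u ==> 0 <= t ==> t <= 1 ==>
  (\<lambda>x. t * v x + (1 - t) * w x) \<in> convex_hull u"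

lemma convex_hull_unit_bounded: "v \<in> convex_hull u ==> unit_bounded u ==> unit_bounded v"
proof (induction rule: convex_hull.induct)
 case (shift v)
 then show ?case using unit_bounded_iter[of v 1] by simp
next
 case (convex v w t)
 show ?case by (rule unit_bounded_convex[OF convex.IH(1)[OF convex.prems] convex.IH(2)[OF convex.prems] convex.hyps(3,4)])
qed

lemma convex_hull_iter: "v \<in> convex_hull u ==> (\<lambda>x. v ((T^^n) x)) \<in> convex_hull u"
proof (induction n arbitrary: v)
 case (Suc n)
 from convex_hull.shift[OF Suc.IH[OF Suc.prems]]
 show ?case by (simp only: funpow_Suc_right comp_def)
qed simp

lemma convex_hull_nice: "v \<in> convex_hull u ==> nice u ==> nice v"
proof (induction rule: convex_hull.induct)
 case (shift v)
 then show ?case using nice_iter[of v 1] by simp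
next
 case (convex v w t)
 show ?case by (rule nice_convex[OF convex.IH(1)[OF convex.prems] convex.IH(2)[OF convex.prems] convex.hyps(3,4)])
qed

lemma average_Suc:
 "n > 0 ==> average (Suc n) v = (\<lambda>x. (real n / real (Suc n)) * average n v x + (1 - real n / real (Suc n)) * v ((T^^n) x))"
proof (rule ext)
 fix x assume "n > 0"
 have "1 - real n / real (Suc n) = 1 / real (Suc n)" by (simp add: field_simps)
 moreover have "(real n / real (Suc n)) * average n v x = (\<Sum>i<n. v ((T^^i) x)) / real (Suc n)"
  using \<open>n > 0\<close> by (simp add: average_def)
 moreover have "average (Suc n) v x = (\<Sum>i<n. v ((T^^i) x)) / real (Suc n) + (1 / real (Suc n)) * v ((T^^n) x)"
  unfolding average_def sum.lessThan_Suc add_divide_distrib by simp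
 ultimately show "average (Suc n) v x = (real n / real (Suc n)) * average n v x + (1 - real n / real (Suc n)) * v ((T^^n) x)"
  by metis
qed

lemma average_in_convex_hull: "v \<in> convex_hull u ==> n > 0 ==> average n v \<in> convex_hull u"
proof (induction n)
 case 0
 from less_irrefl 0(2) show ?case by (rule notE)
next
 case (Suc n)
 show ?case
 proof (cases "n = 0")
  case True
  have "average (Suc n) v = v" by (rule ext) (simp add: average_def True)
  then show ?thesis using Suc by simp
 next
  case False
  then have n: "n > 0" by simp
  show ?thesis unfolding average_Suc[OF n]
   by (rule convex_hull.convex[OF Suc.IH[OF Suc.prems(1) n] convex_hull_iter[OF Suc.prems(1)]]) auto
 qed
qed

lemma average_unit_bounded: "unit_bounded u ==> n > 0 ==> unit_bounded (average n u)"
 by (rule convex_hull_unit_bounded[OF average_in_convex_hull[OF convex_hull.base]])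

lemma average_shift_diff:
 assumes "unit_bounded u" "x \<in> space m"
 shows "abs (average n u (T x) - average n u x) <= 2 / real n"
proof -
 have "(\<Sum>i<n. u ((T^^i) (T x))) - (\<Sum>i<n. u ((T^^i) x)) = u ((T^^n) x) - u x"
 proof -
  have "(\<Sum>i<n. u ((T^^i) (T x))) = (\<Sum>i<n. u ((T^^Suc i) x))"
   by (simp only: funpow_Suc_right comp_def)
  then show ?thesis using sum_lessThan_telescope[of "\<lambda>i. u ((T^^i) x)" n] by (simp add: sum_subtractf)
 qed
 then have "average n u (T x) - average n u x = (u ((T^^n) x) - u x) / real n"
  by (simp add: average_def diff_divide_distrib[symmetric])
 moreover have "abs (u ((T^^n) x) - u x) <= 2"
  using unit_boundedD(2)[OF assms] unit_boundedD(2)[OF assms(1) iter_space[OF assms(2), of n]] by linarith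
 ultimately show ?thesis by (simp add: divide_right_mono)
qed

text \<open>A shift changes an average of length n only by its two end terms, divided by n, so every
  member of the hull has asymptotically the same averages as u.\<close>

lemma average_convex_hull_close:
 assumes "v \<in> convex_hull u" "unit_bounded u"
 shows "\<exists>c\<ge>0. \<forall>n. \<forall>x\<in>space m. abs (average n v x - average n u x) <= c / real n"
 using assms
proof (induction rule: convex_hull.induct)
 case base
 show ?case by (auto intro!: exI[of _ 0])
next
 case (shift v)
 then obtain c where c: "c >= 0" "\<And>n x. x \<in> space m ==> abs (average n v x - average n u x) <= c / real n" by blast
 have v: "unit_bounded v" using shift convex_hull_unit_bounded by blast
 have eq: "average n (\<lambda>x. v (T x)) x = average n v (T x)" for n x
  by (simp add: average_def funpow_swap1)
 show ?case
 proof (intro exI[of _ "c + 2"] conjI allI ballI)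
  fix n x assume x: "x \<in> space m"
  show "abs (average n (\<lambda>x. v (T x)) x - average n u x) <= (c + 2) / real n"
   using c(2)[OF x, of n] average_shift_diff[OF v x, of n] unfolding eq add_divide_distrib by linarith
 qed (use c in auto)
next
 case (convex v w t)
 obtain c where c: "c >= 0" "\<And>n x. x \<in> space m ==> abs (average n v x - average n u x) <= c / real n" using convex by blast
 obtain d where d: "d >= 0" "\<And>n x. x \<in> space m ==> abs (average n w x - average n u x) <= d / real n" using convex by blast
 show ?case
 proof (intro exI[of _ "c + d"] conjI allI ballI)
  fix n x assume x: "x \<in> space m"
  have "average n (\<lambda>x. t * v x + (1 - t) * w x) x = t * average n v x + (1 - t) * average n w x"
   by (simp add: average_def sum.distrib sum_distrib_left[symmetric] add_divide_distrib)
  then have "average n (\<lambda>x. t * v x + (1 - t) * w x) x - average n u x =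
   t * (average n v x - average n u x) + (1 - t) * (average n w x - average n u x)" by (simp add: algebra_simps)
  also have "abs ... <= t * abs (average n v x - average n u x) + (1 - t) * abs (average n w x - average n u x)"
   by (rule abs_convex_le[OF convex.hyps(3,4)])
  also have "... <= 1 * (c / real n) + 1 * (d / real n)"
   using convex.hyps(3,4) c d x by (intro add_mono mult_mono) auto
  finally show "abs (average n (\<lambda>x. t * v x + (1 - t) * w x) x - average n u x) <= (c + d) / real n"
   by (simp add: add_divide_distrib)
 qed (use c d in auto)
qed

lemma square_convex: "0 <= t ==> t <= 1 ==> (t * a + (1 - t) * b)^2 <= t * a^2 + (1 - t) * (b :: real)^2"
proof -
 assume t: "0 <= t" "t <= 1"
 have "t * a^2 + (1 - t) * b^2 - (t * a + (1 - t) * b)^2 = t * (1 - t) * (a - b)^2"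
  by (simp add: power2_eq_square algebra_simps)
 moreover have "... >= 0" using t by simp
 ultimately show ?thesis by linarith
qed

lemma average_L2_le:
 assumes v: "unit_bounded v" and n: "n > 0"
 shows "(\<E> x. (average n v x)^2) <= (\<E> x. (v x)^2)"
 using n
proof (induction n)
 case (Suc n)
 show ?case
 proof (cases "n = 0")
  case True
  have "average (Suc n) v = v" by (rule ext) (simp add: average_def True)
  then show ?thesis by simp
 next
  case False
  then have n: "n > 0" by simp
  let ?t = "real n / real (Suc n)"
  have t: "0 <= ?t" "?t <= 1" by auto
  have i: "integrable m (\<lambda>x. (average n v x)^2)" "integrable m (\<lambda>x. (v ((T^^n) x))^2)" "integrable m (\<lambda>x. (average (Suc n) v x)^2)"
   using unit_bounded_integrable[OF unit_bounded_mult] average_unit_bounded[OF v] n unit_bounded_iter[OF v]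
   unfolding power2_eq_square by blast+
  have "(\<E> x. (average (Suc n) v x)^2) <= (\<E> x. ?t * (average n v x)^2 + (1 - ?t) * (v ((T^^n) x))^2)"
  proof (rule integral_mono[OF i(3)])
   show "integrable m (\<lambda>x. ?t * (average n v x)^2 + (1 - ?t) * (v ((T^^n) x))^2)"
    using i(1,2) by (intro Bochner_Integration.integrable_add integrable_mult_right)
   show "(average (Suc n) v x)^2 <= ?t * (average n v x)^2 + (1 - ?t) * (v ((T^^n) x))^2" for x
    unfolding average_Suc[OF n] by (rule square_convex[OF t])
  qed
  also have "... = ?t * (\<E> x. (average n v x)^2) + (1 - ?t) * (\<E> x. (v ((T^^n) x))^2)"
   using i by (subst Bochner_Integration.integral_add) auto
  also have "(\<E> x. (v ((T^^n) x))^2) = (\<E> x. (v x)^2)"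
   by (rule integral_iter[of "\<lambda>x. (v x)^2"]) (use v in \<open>auto simp: unit_bounded_def\<close>)
  also have "?t * (\<E> x. (average n v x)^2) + (1 - ?t) * (\<E> x. (v x)^2) <= ?t * (\<E> x. (v x)^2) + (1 - ?t) * (\<E> x. (v x)^2)"
   using Suc.IH[OF n] t by (intro add_mono mult_left_mono) auto
  finally show ?thesis by (simp add: algebra_simps)
 qed
qed simp

text \<open>For g of nearly minimal L2 norm in the hull, the averages of g are nearly minimal too,
  and so is the midpoint of two of them; the parallelogram law makes them close to each other. The
  averages of u follow those of g.\<close>

lemma average_Cauchy:
 assumes u: "unit_bounded u" and eps: "eps > 0"
 shows "\<exists>N. \<forall>i\<ge>N. \<forall>j\<ge>N. (\<E> x. abs (average i u x - average j u x)) < eps"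
proof -
 define nn where "nn v = (\<E> x. (v x)^2)" for v :: "'a => real"
 define d where "d = (INF v\<in>convex_hull u. nn v)"
 have bdd: "bdd_below (nn ` convex_hull u)" by (rule bdd_belowI[of _ 0]) (auto simp: nn_def)
 have d_le: "d <= nn v" if "v \<in> convex_hull u" for v unfolding d_def by (rule cINF_lower[OF bdd that])
 \<comment> \<open>The parallelogram law bounds the squared L2 distance of two averages by
   \<open>4 * \<eta>\<close>, which is meant to be \<open>(eps / 4)^2\<close>.\<close>
 define \<eta> where "\<eta> = (eps / 4)^2 / 4"
 have \<eta>: "\<eta> > 0" using eps by (simp add: \<eta>_def)
 have "\<exists>g\<in>convex_hull u. nn g < d + \<eta>"
  using cINF_less_iff[OF _ bdd, of "d + \<eta>"] convex_hull.base \<eta> unfolding d_def by auto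
 then obtain g where g: "g \<in> convex_hull u" "nn g < d + \<eta>" by blast
 obtain c where c: "c >= 0" "\<And>n x. x \<in> space m ==> abs (average n g x - average n u x) <= c / real n"
  using average_convex_hull_close[OF g(1) u] by blast
 have gb: "unit_bounded g" by (rule convex_hull_unit_bounded[OF g(1) u])
 have close: "(\<E> x. abs (average n u x - average n g x)) <= c / real n" if "n > 0" for n
 proof -
  have "(\<E> x. abs (average n u x - average n g x)) <= (\<E> x. c / real n)"
   by (rule integral_mono) (use c(2) unit_bounded_diff_integrable[OF average_unit_bounded average_unit_bounded, OF u that gb that] in \<open>auto simp: abs_minus_commute\<close>)
  then show ?thesis by (simp add: prob_space)
 qed
 have main: "(\<E> x. abs (average i g x - average j g x)) <= eps / 4" if ij: "i > 0" "j > 0" for i j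
 proof -
  let ?v = "average i g" and ?w = "average j g"
  have vw: "?v \<in> convex_hull u" "?w \<in> convex_hull u" using average_in_convex_hull g(1) ij by auto
  have vb: "unit_bounded ?v" "unit_bounded ?w" using vw convex_hull_unit_bounded u by blast+
  have i: "integrable m (\<lambda>x. (?v x)^2)" "integrable m (\<lambda>x. (?w x)^2)"
   "integrable m (\<lambda>x. ?v x * ?w x)"
   using unit_bounded_integrable[OF unit_bounded_mult] vb unfolding power2_eq_square by blast+
  have mid: "(\<lambda>x. (1/2) * ?v x + (1 - 1/2) * ?w x) \<in> convex_hull u"
   by (rule convex_hull.convex[OF vw]) auto
  have "nn ?v <= nn g" "nn ?w <= nn g" unfolding nn_def using average_L2_le[OF gb] ij by auto
  moreover have "d <= nn (\<lambda>x. (1/2) * ?v x + (1 - 1/2) * ?w x)" by (rule d_le[OF mid])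
  moreover have "(\<E> x. (?v x - ?w x)^2) = 2 * nn ?v + 2 * nn ?w - 4 * nn (\<lambda>x. (1/2) * ?v x + (1 - 1/2) * ?w x)"
  proof -
   have "(\<lambda>x. (?v x - ?w x)^2) = (\<lambda>x. (?v x)^2 + (?w x)^2 - 2 * (?v x * ?w x))"
    by (auto simp: power2_diff)
   then have 1: "(\<E> x. (?v x - ?w x)^2) = nn ?v + nn ?w - 2 * (\<E> x. ?v x * ?w x)"
    using i by (simp add: nn_def)
   have "(\<lambda>x. ((1/2) * ?v x + (1 - 1/2) * ?w x)^2) = (\<lambda>x. (1/4) * (?v x)^2 + (1/4) * (?w x)^2 + (1/2) * (?v x * ?w x))"
    by (auto simp: power2_eq_square algebra_simps)
   then have 2: "nn (\<lambda>x. (1/2) * ?v x + (1 - 1/2) * ?w x) = (1/4) * nn ?v + (1/4) * nn ?w + (1/2) * (\<E> x. ?v x * ?w x)"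
    using i by (simp add: nn_def)
   show ?thesis unfolding 1 2 by (simp add: algebra_simps)
  qed
  ultimately have "(\<E> x. (?v x - ?w x)^2) <= 4 * \<eta>" using g(2) by linarith
  then have *: "(\<E> x. (abs (?v x - ?w x))^2) <= (eps / 4)^2" by (simp add: \<eta>_def)
  have "(\<E> x. abs (?v x - ?w x))^2 <= (\<E> x. (abs (?v x - ?w x))^2)"
  proof (rule integral_square_le[of _ 2])
   note [measurable] = unit_boundedD(1)[OF vb(1)] unit_boundedD(1)[OF vb(2)]
   show "(\<lambda>x. abs (?v x - ?w x)) \<in> borel_measurable m" by measurable
   show "abs ( abs (?v x - ?w x)) <= 2" if "x \<in> space m" for x
    using unit_boundedD(2)[OF vb(1) that] unit_boundedD(2)[OF vb(2) that] by argo
  qed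
  then have "(\<E> x. abs (?v x - ?w x))^2 <= (eps / 4)^2" using * by (rule order_trans)
  then show ?thesis by (rule power2_le_imp_le) (use eps in simp)
 qed
 obtain N :: nat where N: "real N > 4 * c / eps" using reals_Archimedean2 by blast
 show ?thesis
 proof (intro exI[of _ "Suc N"] allI impI)
  fix i j assume ij: "i >= Suc N" "j >= Suc N"
  have small: "c / real n <= eps / 4" if "n >= Suc N" for n
  proof -
   have "4 * c < eps * real N" using N eps by (simp add: field_simps)
   also have "... <= eps * real n" using that eps by simp
   finally show ?thesis using that by (simp add: field_simps)
  qed
  have ub: "unit_bounded (average i u)" "unit_bounded (average j u)" "unit_bounded (average i g)" "unit_bounded (average j g)"
   using average_unit_bounded[OF u] average_unit_bounded[OF gb] ij by auto
  have pos: "i > 0" "j > 0" using ij by auto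
  have "(\<E> x. abs (average i u x - average j u x)) <= c / real i + (eps / 4 + c / real j)"
   using L1_triangle[OF ub(1,3,2)] L1_triangle[OF ub(3,4,2)] close[OF pos(1)] close[OF pos(2)] main[OF pos]
   unfolding L1_sym[of "average j g" "average j u"] by linarith
  also have "... < eps" using small[OF ij(1)] small[OF ij(2)] eps by linarith
  finally show "(\<E> x. abs (average i u x - average j u x)) < eps" .
 qed
qed

end

section \<open>Ergodic averages and decoupling\<close>

context quasi_bernoulli begin

lemma iter_commute: "(T^^i) ((T^^j) x) = (T^^j) ((T^^i) x)"
 by (metis add.commute comp_apply funpow_add)

lemma average_measurable [measurable]: "u \<in> borel_measurable m ==> average n u \<in> borel_measurable m"
proof -
 assume u: "u \<in> borel_measurable m"
 have "(\<lambda>x. u ((T^^i) x)) \<in> borel_measurable m" for i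
  by (rule measurable_compose[OF iter_measurable u])
 then show ?thesis unfolding average_def[abs_def] by measurable
qed

text \<open>The limit is taken pointwise along a fast subsequence, which makes h invariant at every
  point: since \<open>X k (T x) - X k x\<close> tends to 0, the sequences at x and at
  \<open>T x\<close> have the same limits, and \<open>lim\<close> selects the same value even where
  none exists.\<close>

lemma mean_ergodic:
 assumes u: "unit_bounded u"
 obtains h where "unit_bounded h" "\<And>x. x \<in> space m ==> h (T x) = h x"
  "(\<lambda>n. (\<E> x. abs (average n u x - h x))) \<leadsto> 0"
proof -
 have "\<forall>k. \<exists>N. \<forall>i\<ge>N. \<forall>j\<ge>N. (\<E> x. abs (average i u x - average j u x)) < (1/2)^k"
  using average_Cauchy[OF u] by simp
 then obtain N where N: "\<And>k i j. i >= N k ==> j >= N k ==> (\<E> x. abs (average i u x - average j u x)) < (1/2)^k"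
  by metis
 \<comment> \<open>Adding up the thresholds makes L monotone, above N, and at least k; the last
   property makes the shift error \<open>2 / L k\<close> vanish.\<close>
 define L where "L k = (\<Sum>i\<le>k. N i) + Suc k" for k
 have LN: "L k >= N k" for k unfolding L_def using member_le_sum[of k "{..k}" N] by simp
 have L_mono: "L k <= L (Suc k)" for k by (simp add: L_def)
 have L_pos: "L k > 0" for k by (simp add: L_def)
 have L_ge: "L k >= k" for k by (simp add: L_def)
 define X where "X k x = average (L k) u x" for k x
 have Xb: "unit_bounded (X k)" for k unfolding X_def[abs_def] using average_unit_bounded[OF u L_pos] by simp
 note Xm [measurable] = unit_boundedD(1)[OF Xb]
 have X_inv: "(\<lambda>k. X k (T x) - X k x) \<leadsto> 0" if "x \<in> space m" for x
 proof (rule Lim_null_comparison)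
  show "EV k. norm (X k (T x) - X k x) <= 2 * inverse (real k)"
  proof (rule eventually_sequentiallyI[of 1])
   fix k :: nat assume "1 <= k"
   have "norm (X k (T x) - X k x) <= 2 / real (L k)"
    using average_shift_diff[OF u that, of "L k"] by (simp add: X_def)
   also have "... <= 2 / real k" using L_ge[of k] \<open>1 <= k\<close> by (intro divide_left_mono) auto
   finally show "norm (X k (T x) - X k x) <= 2 * inverse (real k)" by (simp add: field_simps)
  qed
  show "(\<lambda>k. 2 * inverse (real k)) \<leadsto> 0"
   using tendsto_mult_right[OF lim_inverse_n, of 2] by simp
 qed
 \<comment> \<open>Clipping keeps the bound 1 at points where the subsequence diverges and changes
   nothing elsewhere.\<close>
 define h where "h x = max (-1) (min 1 (lim (\<lambda>k. X k x)))" for x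
 have h_meas [measurable]: "h \<in> borel_measurable m" unfolding h_def[abs_def] by measurable
 have hb: "unit_bounded h" unfolding unit_bounded_def using h_meas by (auto simp: h_def)
 have h_inv: "h (T x) = h x" if "x \<in> space m" for x
 proof -
  have "((\<lambda>k. X k (T x)) \<leadsto> l) = ((\<lambda>k. X k x) \<leadsto> l)" for l
  proof
   assume "(\<lambda>k. X k (T x)) \<leadsto> l"
   from tendsto_diff[OF this X_inv[OF that]] show "(\<lambda>k. X k x) \<leadsto> l" by simp
  next
   assume "(\<lambda>k. X k x) \<leadsto> l"
   from tendsto_add[OF this X_inv[OF that]] show "(\<lambda>k. X k (T x)) \<leadsto> l" by simp
  qed
  then show ?thesis by (simp add: h_def lim_def)
 qed
 have "(\<integral>\<^sup>+x. (\<Sum>k. ennreal (abs (X (Suc k) x - X k x))) \<partial>m) = (\<Sum>k. \<integral>\<^sup>+x. ennreal (abs (X (Suc k) x - X k x)) \<partial>m)"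
  by (rule nn_integral_suminf) measurable
 also have "... <= (\<Sum>k. ennreal ((1/2)^k))"
 proof (intro suminf_le)
  fix k
  have "(\<integral>\<^sup>+x. ennreal (abs (X (Suc k) x - X k x)) \<partial>m) = ennreal (\<E> x. abs (X (Suc k) x - X k x))"
   by (rule nn_integral_eq_integral) (use unit_bounded_diff_integrable[OF Xb Xb] in auto)
  also have "... <= ennreal ((1/2)^k)"
  proof (rule ennreal_leI, rule less_imp_le)
   have "L (Suc k) >= N k" using LN[of k] L_mono[of k] by simp
   then show "(\<E> x. abs (X (Suc k) x - X k x)) < (1/2)^k" unfolding X_def by (rule N[OF _ LN])
  qed
  finally show "(\<integral>\<^sup>+x. ennreal (abs (X (Suc k) x - X k x)) \<partial>m) <= ennreal ((1/2)^k)" .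
 qed auto
 also have "... = ennreal (\<Sum>k. (1/2)^k)"
  by (rule suminf_ennreal2) (auto intro: summable_geometric)
 also have "... < \<infinity>" by simp
 finally have fin: "(\<integral>\<^sup>+x. (\<Sum>k. ennreal (abs (X (Suc k) x - X k x))) \<partial>m) \<noteq> \<infinity>" by simp
 have "AE x in m. (\<Sum>k. ennreal (abs (X (Suc k) x - X k x))) \<noteq> \<infinity>"
  by (rule nn_integral_PInf_AE[OF _ fin]) measurable
 then have conv: "AE x in m. (\<lambda>k. X k x) \<leadsto> h x"
 proof (rule AE_mp, intro AE_I2 impI)
  fix x assume x: "x \<in> space m" and f: "(\<Sum>k. ennreal (abs (X (Suc k) x - X k x))) \<noteq> \<infinity>"
  have "summable (\<lambda>k. abs (X (Suc k) x - X k x))"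
   by (rule summable_suminf_not_top) (use f in auto)
  then have "summable (\<lambda>k. X (Suc k) x - X k x)" by (rule summable_rabs_cancel)
  then have "convergent (\<lambda>n. \<Sum>k<n. X (Suc k) x - X k x)" by (simp add: summable_iff_convergent)
  then have "convergent (\<lambda>n. X n x - X 0 x)" by (simp only: sum_lessThan_telescope[of "\<lambda>k. X k x"])
  then have c: "convergent (\<lambda>n. X n x)" by (simp add: convergent_diff_const_right_iff)
  then have l: "(\<lambda>n. X n x) \<leadsto> lim (\<lambda>n. X n x)" by (simp add: convergent_LIMSEQ_iff)
  have "abs (lim (\<lambda>n. X n x)) <= 1"
   by (rule LIMSEQ_le_const2[OF tendsto_rabs[OF l]]) (use unit_boundedD(2)[OF Xb x] in auto)
  moreover have "max (-1) (min 1 a) = a" if "abs a <= 1" for a :: real using that by (auto simp: max_def min_def)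
  ultimately have "h x = lim (\<lambda>n. X n x)" by (simp add: h_def)
  then show "(\<lambda>k. X k x) \<leadsto> h x" using l by simp
 qed
 have XL1: "(\<lambda>k. (\<E> x. abs (X k x - h x))) \<leadsto> (\<E> x. 0)"
 proof (rule integral_dominated_convergence[where w = "\<lambda>_. 2"])
  show "AE x in m. (\<lambda>k. abs (X k x - h x)) \<leadsto> 0"
   using conv by (rule AE_mp) (auto intro!: AE_I2 tendsto_rabs_zero simp: LIM_zero_iff)
  show "AE x in m. norm (abs (X k x - h x)) <= 2" for k
  proof (rule AE_I2)
   fix x assume "x \<in> space m"
   then have "abs (X k x) <= 1" "abs (h x) <= 1" using unit_boundedD(2)[OF Xb] unit_boundedD(2)[OF hb] by auto
   then have "abs (X k x - h x) <= 2" by argo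
   then show "norm (abs (X k x - h x)) <= 2" by simp
  qed
 qed auto
 have "(\<lambda>n. (\<E> x. abs (average n u x - h x))) \<leadsto> 0"
 proof (rule LIMSEQ_I)
  fix r :: real assume r: "r > 0"
  obtain N where N: "\<And>i j. i >= N ==> j >= N ==> (\<E> x. abs (average i u x - average j u x)) < r / 2"
   using average_Cauchy[OF u, of "r / 2"] r by auto
  have "EV k. (\<E> x. abs (X k x - h x)) < r / 2"
   using order_tendstoD(2)[OF XL1, of "r / 2"] r by simp
  then obtain k where k: "k >= N" "(\<E> x. abs (X k x - h x)) < r / 2"
   unfolding eventually_sequentially by (meson linear)
  show "\<exists>no. \<forall>n\<ge>no. norm ((\<E> x. abs (average n u x - h x)) - 0) < r"
  proof (intro exI[of _ "Suc N"] allI impI)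
   fix n assume n: "n >= Suc N"
   have "(\<E> x. abs (average n u x - h x)) <= (\<E> x. abs (average n u x - X k x)) + (\<E> x. abs (X k x - h x))"
    by (rule L1_triangle[OF average_unit_bounded[OF u] Xb hb]) (use n in auto)
   also have "(\<E> x. abs (average n u x - X k x)) < r / 2"
    unfolding X_def by (rule N) (use n k L_ge[of k] in auto)
   finally have "(\<E> x. abs (average n u x - h x)) < r" using k(2) by simp
   moreover have "0 <= (\<E> x. abs (average n u x - h x))" by (rule Bochner_Integration.integral_nonneg) auto
   ultimately show "norm ((\<E> x. abs (average n u x - h x)) - 0) < r" by simp
  qed
 qed
 with that hb h_inv show thesis by blast
qed

definition ergodic_limit :: "('a => real) => ('a => real) => bool" where
 "ergodic_limit u h \<longleftrightarrow> unit_bounded h \<and> (\<forall>x\<in>space m. h (T x) = h x) \<and>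
  (\<lambda>n. (\<E> x. abs (average n u x - h x))) \<leadsto> 0"

lemma ergodic_limit_exists:
 assumes "unit_bounded u"
 shows "\<exists>h. ergodic_limit u h"
proof (rule mean_ergodic[OF assms])
 fix h assume "unit_bounded h" "\<And>x. x \<in> space m ==> h (T x) = h x"
  "(\<lambda>n. (\<E> x. abs (average n u x - h x))) \<leadsto> 0"
 then show ?thesis by (intro exI[of _ h]) (simp add: ergodic_limit_def)
qed

lemma average_nice: "nice u ==> n > 0 ==> nice (average n u)"
 by (rule convex_hull_nice[OF average_in_convex_hull[OF convex_hull.base]])

lemma ergodic_limit_nice:
 assumes "nice u" "ergodic_limit u h"
 shows "nice h"
proof (rule nice_limit)
 show h: "unit_bounded h" using assms(2) by (simp add: ergodic_limit_def)
 fix eps :: real assume "eps > 0"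
 have "(\<lambda>n. (\<E> x. abs (average n u x - h x))) \<leadsto> 0" using assms(2) by (simp add: ergodic_limit_def)
 from order_tendstoD(2)[OF this \<open>eps > 0\<close>] obtain N where
  "\<And>n. n >= N ==> (\<E> x. abs (average n u x - h x)) < eps" by (auto simp: eventually_sequentially)
 from this[of "Suc N"] show "\<exists>v. nice v \<and> (\<E> x. abs (h x - v x)) <= eps"
  using average_nice[OF assms(1), of "Suc N"] by (auto simp: L1_sym[of h] intro!: exI[of _ "average (Suc N) u"])
qed

lemma invariant_iter:
 assumes "\<forall>x\<in>space m. h (T x) = h x" "x \<in> space m"
 shows "h ((T^^n) x) = h x"
 by (induction n) (use assms in auto)

lemma integral_shift_average:
 assumes g: "unit_bounded g" and u: "unit_bounded u" and ginv: "\<forall>x\<in>space m. g (T x) = g x" and n: "n > 0"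
 shows "(\<E> x. average n u x * g x) = (\<E> x. u x * g x)"
proof -
 have gu: "unit_bounded (\<lambda>x. u x * g x)" by (rule unit_bounded_mult[OF u g])
 have "(\<E> x. average n u x * g x) = (\<E> x. (\<Sum>i<n. u ((T^^i) x) * g ((T^^i) x)) / real n)"
  by (rule Bochner_Integration.integral_cong) (auto simp: average_def sum_distrib_right invariant_iter[OF ginv])
 also have "... = (\<Sum>i<n. (\<E> x. u ((T^^i) x) * g ((T^^i) x))) / real n"
  using unit_bounded_integrable[OF unit_bounded_iter[OF gu]] by simp
 also have "... = (\<Sum>i<n. (\<E> x. u x * g x)) / real n"
  using integral_iter[OF unit_boundedD(1)[OF gu]] by simp
 finally show ?thesis using n by simp
qed

lemma ergodic_limit_integral:
 assumes h: "ergodic_limit u h" and u: "unit_bounded u"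
  and g: "unit_bounded g" and ginv: "\<forall>x\<in>space m. g (T x) = g x"
 shows "(\<E> x. u x * g x) = (\<E> x. h x * g x)"
proof -
 have hb: "unit_bounded h" and lim: "(\<lambda>n. (\<E> x. abs (average n u x - h x))) \<leadsto> 0"
  using h by (auto simp: ergodic_limit_def)
 have "abs ((\<E> x. u x * g x) - (\<E> x. h x * g x)) <= (\<E> x. abs (average n u x - h x))" if "n > 0" for n
  using integral_mult_diff_le[OF average_unit_bounded[OF u that] hb g] integral_shift_average[OF g u ginv that] by simp
 then have "abs ((\<E> x. u x * g x) - (\<E> x. h x * g x)) <= 0"
  by (intro LIMSEQ_le_const[OF lim]) (auto intro!: exI[of _ 1])
 then show ?thesis by simp
qed

text \<open>Eagleson's argument: near-invariance allows one to replace the first function by its ergodic averages.\<close>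

lemma near_invariant_correlation:
 assumes w: "unit_bounded w" and h: "ergodic_limit w h"
  and v: "\<And>k. unit_bounded (v k)" and \<delta>: "\<delta> \<leadsto> 0"
  and near: "\<And>k x. x \<in> space m ==> abs (v k (T x) - v k x) <= \<delta> k" and eps: "eps > 0"
 shows "EV k. \<forall>s s'.
  abs ((\<E> x. w ((T^^s) x) * v k ((T^^s') x)) - (\<E> x. h x * v k x)) <= eps"
proof -
 have hb: "unit_bounded h" and hinv: "\<forall>x\<in>space m. h (T x) = h x"
  and lim: "(\<lambda>n. (\<E> x. abs (average n w x - h x))) \<leadsto> 0"
  using h by (auto simp: ergodic_limit_def)
 obtain N where "\<And>n. n >= N ==> (\<E> x. abs (average n w x - h x)) < eps / 2"
  using order_tendstoD(2)[OF lim, of "eps / 2"] eps by (auto simp: eventually_sequentially)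
 then have L: "(\<E> x. abs (average (Suc N) w x - h x)) < eps / 2" by simp
 define L where "L = Suc N"
 have Lpos: "L > 0" by (simp add: L_def)
 have "EV k. \<delta> k < eps / (2 * real L)"
  using order_tendstoD(2)[OF \<delta>, of "eps / (2 * real L)"] eps Lpos by simp
 then show ?thesis
 proof (eventually_elim, intro allI)
  fix k s s' assume dk: "\<delta> k < eps / (2 * real L)"
  obtain x0 where x0: "x0 \<in> space m" using not_empty by auto
  have d0: "\<delta> k >= 0" by (rule order_trans[OF abs_ge_zero near[OF x0]])
  have drift: "abs (v k ((T^^i) x) - v k x) <= real i * \<delta> k" if "x \<in> space m" for i x
  proof (induction i)
   case (Suc i)
   then show ?case using near[OF iter_space[OF that, of i], of k] by (simp add: algebra_simps)
  qed simp
  let ?c = "(\<E> x. w ((T^^s) x) * v k ((T^^s') x))"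
  let ?V = "\<lambda>x. v k ((T^^s') x)" and ?W = "\<lambda>x. w ((T^^s) x)"
  note ub = unit_bounded_iter[OF v, of k s'] unit_bounded_iter[OF w, of s]
  \<comment> \<open>Moving both factors by i steps does not change the integral; moving v back costs
    at most \<open>L * \<delta> k\<close>. So only w is moved, and averaging over
    \<open>i < L\<close> yields an ergodic average. The cost does not depend on s and s'.\<close>
  have c_eq: "?c = (\<E> x. ?W ((T^^i) x) * ?V ((T^^i) x))" for i
   by (rule integral_iter[symmetric, of "\<lambda>x. ?W x * ?V x"]) (rule unit_boundedD(1)[OF unit_bounded_mult[OF ub(2,1)]])
  have ci: "abs (?c - (\<E> x. ?W ((T^^i) x) * ?V x)) <= eps / 2" if "i < L" for i
  proof -
   have "abs (?c - (\<E> x. ?W ((T^^i) x) * ?V x)) <= (\<E> x. abs (?V ((T^^i) x) - ?V x))"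
    unfolding c_eq[of i]
    using integral_mult_diff_le[OF unit_bounded_iter[OF ub(1)] ub(1) unit_bounded_iter[OF ub(2)], of i i]
    by (simp add: mult.commute)
   also have "... <= (\<E> x. eps / 2)"
   proof (rule integral_mono)
    show "integrable m (\<lambda>x. abs (?V ((T^^i) x) - ?V x))"
     by (rule unit_bounded_diff_integrable[OF unit_bounded_iter[OF ub(1)] ub(1)])
    fix x assume x: "x \<in> space m"
    have "(T^^s') ((T^^i) x) = (T^^i) ((T^^s') x)" by (rule iter_commute)
    then have "abs (?V ((T^^i) x) - ?V x) <= real i * \<delta> k"
     using drift[OF iter_space[OF x, of s'], of i] by simp
    also have "... <= real L * \<delta> k" using that d0 by (intro mult_right_mono) auto
    also have "... <= eps / 2" using dk Lpos by (simp add: field_simps)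
    finally show "abs (?V ((T^^i) x) - ?V x) <= eps / 2" .
   qed simp
   finally show ?thesis by (simp add: prob_space)
  qed
  have avg: "(\<E> x. average L ?W x * ?V x) = (\<Sum>i<L. (\<E> x. ?W ((T^^i) x) * ?V x)) / real L"
  proof -
   have "(\<E> x. average L ?W x * ?V x) = (\<E> x. (\<Sum>i<L. ?W ((T^^i) x) * ?V x) / real L)"
    by (simp add: average_def sum_distrib_right)
   also have "... = (\<Sum>i<L. (\<E> x. ?W ((T^^i) x) * ?V x)) / real L"
    using unit_bounded_integrable[OF unit_bounded_mult[OF unit_bounded_iter[OF ub(2)] ub(1)]] by simp
   finally show ?thesis .
  qed
  have "abs (?c - (\<E> x. average L ?W x * ?V x)) = abs (\<Sum>i<L. ?c - (\<E> x. ?W ((T^^i) x) * ?V x)) / real L"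
  proof -
   define c where "c = ?c"
   define a where "a i = (\<E> x. ?W ((T^^i) x) * ?V x)" for i
   have "c - (\<Sum>i<L. a i) / real L = (\<Sum>i<L. c - a i) / real L"
    using Lpos by (simp add: sum_subtractf diff_divide_distrib)
   then show ?thesis using Lpos unfolding avg a_def[symmetric] c_def[symmetric] by simp
  qed
  also have "... <= (\<Sum>i<L. eps / 2) / real L"
   by (intro divide_right_mono order_trans[OF sum_abs] sum_mono ci) auto
  also have "... = eps / 2" using Lpos by simp
  finally have 1: "abs (?c - (\<E> x. average L ?W x * ?V x)) <= eps / 2" .
  have "average L ?W x = average L w ((T^^s) x)" for x
   unfolding average_def iter_commute[of s] ..
  then have "abs ((\<E> x. average L ?W x * ?V x) - (\<E> x. h ((T^^s) x) * ?V x)) <= (\<E> x. abs (average L w ((T^^s) x) - h ((T^^s) x)))"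
   using integral_mult_diff_le[OF unit_bounded_iter[OF average_unit_bounded[OF w Lpos]] unit_bounded_iter[OF hb] ub(1), of s s] by simp
  also have "... = (\<E> x. abs (average L w x - h x))"
   by (rule L1_iter[OF average_unit_bounded[OF w Lpos] hb])
  also have "... <= eps / 2" using L by (simp add: L_def)
  finally have 2: "abs ((\<E> x. average L ?W x * ?V x) - (\<E> x. h ((T^^s) x) * ?V x)) <= eps / 2" .
  have "(\<E> x. h ((T^^s) x) * ?V x) = (\<E> x. h ((T^^s') x) * v k ((T^^s') x))"
   by (rule Bochner_Integration.integral_cong) (auto simp: invariant_iter[OF hinv])
  also have "... = (\<E> x. h x * v k x)"
   by (rule integral_iter[of "\<lambda>x. h x * v k x"]) (rule unit_boundedD(1)[OF unit_bounded_mult[OF hb v]])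
  finally have 3: "(\<E> x. h ((T^^s) x) * ?V x) = (\<E> x. h x * v k x)" .
  have tri: "abs (a - d) <= eps" if "abs (a - b) <= eps / 2" "abs (b - c) <= eps / 2" "c = d" for a b c d :: real
   using that by argo
  show "abs (?c - (\<E> x. h x * v k x)) <= eps" by (rule tri[OF 1 2 3])
 qed
qed

text \<open>Weak convergence to 0 against nice functions. Uniformity in the shifts is what allows
  functions with windows of different lengths to be aligned in \<open>decoupling\<close> without
  losing their near orthogonality.\<close>

definition weakly_null :: "(nat => 'a => real) => bool" where
 "weakly_null u \<longleftrightarrow> (\<forall>w eps. nice w --> eps > 0 -->
  (EV n. \<forall>s s'. abs (\<E> x. w ((T^^s) x) * u n ((T^^s') x)) <= eps))"

lemma weakly_null_near_invariant:
 assumes v: "\<And>k. unit_bounded (v k)" and \<delta>: "\<delta> \<leadsto> 0"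
  and near: "\<And>k x. x \<in> space m ==> abs (v k (T x) - v k x) <= \<delta> k"
  and h: "\<And>w h. nice w ==> ergodic_limit w h ==> (\<lambda>k. (\<E> x. h x * v k x)) \<leadsto> 0"
 shows "weakly_null v"
 unfolding weakly_null_def
proof (intro allI impI)
 fix w and eps :: real assume w: "nice w" and eps: "eps > 0"
 obtain h where hw: "ergodic_limit w h" using ergodic_limit_exists nice_unit_bounded w by blast
 have "EV k. abs (\<E> x. h x * v k x) < eps / 2"
  using order_tendstoD(2)[OF tendsto_rabs_zero[OF h[OF w hw]], of "eps / 2"] eps by simp
 moreover have "EV k. \<forall>s s'.
  abs ((\<E> x. w ((T^^s) x) * v k ((T^^s') x)) - (\<E> x. h x * v k x)) <= eps / 2"
  by (rule near_invariant_correlation[OF nice_unit_bounded[OF w] hw v \<delta> near]) (use eps in auto)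
 ultimately show "EV n. \<forall>s s'. abs (\<E> x. w ((T^^s) x) * v n ((T^^s') x)) <= eps"
 proof (eventually_elim, intro allI)
  fix n s s'
  assume 1: "abs (\<E> x. h x * v n x) < eps / 2" and
   2: "\<forall>s s'. abs ((\<E> x. w ((T^^s) x) * v n ((T^^s') x)) - (\<E> x. h x * v n x)) <= eps / 2"
  have tri: "abs a <= eps" if "abs b < eps / 2" "abs (a - b) <= eps / 2" for a b :: real
   using that by argo
  show "abs (\<E> x. w ((T^^s) x) * v n ((T^^s') x)) <= eps"
   by (rule tri[OF 1 2[rule_format]])
 qed
qed

end

context quasi_bernoulli begin

lemma adapted_cong:
 assumes "\<And>x. x \<in> space m ==> u x = v x"
 shows "adapted p eps u \<longleftrightarrow> adapted p eps v"
proof -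
 have "(\<E> x. abs (u x - \<phi> (\<kappa> p x))) = (\<E> x. abs (v x - \<phi> (\<kappa> p x)))" for \<phi>
  by (rule Bochner_Integration.integral_cong) (use assms in auto)
 then show ?thesis by (simp add: adapted_def)
qed

lemma integral_unit_bounded: "unit_bounded u ==> abs (\<E> x. u x) <= 1"
 by (rule integral_le_bound) (rule unit_boundedD(2))

text \<open>Greedy choice: the finitely many functions chosen so far are nice, hence serve as test
  functions, and a late enough member of the sequence is nearly orthogonal to all of them, in all
  relative positions. Property Q only needs to hold infinitely often.\<close>

lemma weakly_null_family:
 assumes null: "weakly_null u" and nice: "\<And>n. nice (u n)" and eps: "eps > 0"
  and freq: "\<exists>\<^sub>F n in sequentially. Q n" and ev: "EV n. R n"
 shows "\<exists>A. finite A \<and> card A = r \<and> (\<forall>n\<in>A. Q n \<and> R n) \<and>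
  (\<forall>a\<in>A. \<forall>b\<in>A. a \<noteq> b --> (\<forall>s s'. abs (\<E> x. u a ((T^^s) x) * u b ((T^^s') x)) <= eps))"
proof (induction r)
 case 0
 show ?case by (rule exI[of _ "{}"]) simp
next
 case (Suc r)
 then obtain A where A: "finite A" "card A = r" "\<forall>n\<in>A. Q n \<and> R n"
  "\<forall>a\<in>A. \<forall>b\<in>A. a \<noteq> b --> (\<forall>s s'. abs (\<E> x. u a ((T^^s) x) * u b ((T^^s') x)) <= eps)"
  by (elim exE conjE)
 have "EV n. \<forall>a\<in>A. \<forall>s s'. abs (\<E> x. u a ((T^^s) x) * u n ((T^^s') x)) <= eps"
  by (rule eventually_ball_finite[OF A(1)]) (intro ballI null[unfolded weakly_null_def, rule_format, OF nice eps])
 moreover have "EV n. \<forall>a\<in>A. n \<noteq> a"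
  by (rule eventually_ball_finite[OF A(1)]) (auto intro: eventually_mono[OF eventually_gt_at_top])
 ultimately have "EV n. R n \<and> (\<forall>a\<in>A. n \<noteq> a) \<and>
  (\<forall>a\<in>A. \<forall>s s'. abs (\<E> x. u a ((T^^s) x) * u n ((T^^s') x)) <= eps)"
  using ev by eventually_elim auto
 from frequently_ex[OF frequently_eventually_frequently[OF freq this]]
 obtain n where n: "Q n" "R n" "\<forall>a\<in>A. n \<noteq> a"
  "\<forall>a\<in>A. \<forall>s s'. abs (\<E> x. u a ((T^^s) x) * u n ((T^^s') x)) <= eps" by (elim exE conjE)
 have n': "\<forall>a\<in>A. \<forall>s s'. abs (\<E> x. u n ((T^^s) x) * u a ((T^^s') x)) <= eps"
  using n(4) by (simp add: mult.commute)
 show ?case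
 proof (intro exI[of _ "insert n A"] conjI)
  show "card (insert n A) = Suc r" using A(1,2) n(3) by auto
  show "\<forall>k\<in>insert n A. Q k \<and> R k" using A(3) n(1,2) by simp
  show "\<forall>a\<in>insert n A. \<forall>b\<in>insert n A. a \<noteq> b --> (\<forall>s s'. abs (\<E> x. u a ((T^^s) x) * u b ((T^^s') x)) <= eps)"
   using A(4) n(4) n' by simp
 qed (use A(1) in simp)
qed

text \<open>Otherwise, many pairs with large correlations but nearly orthogonal first components would
 contradict the correlation bound.\<close>

lemma decoupling:
 fixes p e :: "nat => nat"
 assumes u: "\<And>n. nice (u n)" and v: "\<And>n. unit_bounded (v n)" and null: "weakly_null u"
  and au: "\<And>eps. eps > 0 ==> EV n. \<forall>s. adapted (s + p n) eps (\<lambda>x. u n ((T^^s) x))"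
  and av: "\<And>eps. eps > 0 ==> EV n. \<forall>q\<ge>e n. adapted q eps (v n)"
 shows "(\<lambda>n. (\<E> x. u n x * v n ((T^^p n) x))) \<leadsto> 0"
proof -
 define c where "c n = (\<E> x. u n x * v n ((T^^p n) x))" for n
 note ub = nice_unit_bounded[OF u]
 \<comment> \<open>Only correlations of one sign can add up to a contradiction; \<theta> is 1 or -1
   and treats the two signs separately.\<close>
 have key: "EV n. \<theta> * c n < \<eta>" if \<theta>: "abs \<theta> = 1" and \<eta>: "\<eta> > 0" for \<theta> \<eta> :: real
 proof (rule ccontr)
  assume "\<not> (EV n. \<theta> * c n < \<eta>)"
  then have freq: "\<exists>\<^sub>F n in sequentially. \<eta> <= \<theta> * c n" by (simp add: frequently_def not_le)
  \<comment> \<open>r correlations of size \<eta> add up to \<open>r * \<eta>\<close>, against an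
    upper bound of order \<open>sqrt r\<close>; r is chosen so large that this fails.\<close>
  have "LIM r sequentially. real r * \<eta> - K^2 * sqrt (2 * real r) :> at_top" using \<eta> by real_asymp
  then have "EV r. real r * \<eta> - K^2 * sqrt (2 * real r) > 4 * K^2"
   by (simp add: filterlim_at_top_dense)
  then have "EV r. r > 0 \<and> real r * \<eta> - K^2 * sqrt (2 * real r) > 4 * K^2"
   using eventually_gt_at_top[of "0::nat"] by eventually_elim auto
  then obtain r :: nat where r: "r > 0" "real r * \<eta> - K^2 * sqrt (2 * real r) > 4 * K^2"
   using eventually_happens'[OF sequentially_bot] by blast
  define eps where "eps = 1 / real r"
  have eps: "eps > 0" using r by (simp add: eps_def)
  have ev: "EV n. (\<forall>s. adapted (s + p n) eps (\<lambda>x. u n ((T^^s) x))) \<and> (\<forall>q\<ge>e n. adapted q eps (v n))"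
   using au[OF eps] av[OF eps] by eventually_elim auto
  from weakly_null_family[OF null u eps freq ev, of r] obtain A where A': "finite A" "card A = r"
   "\<forall>n\<in>A. \<eta> <= \<theta> * c n \<and> (\<forall>s. adapted (s + p n) eps (\<lambda>x. u n ((T^^s) x))) \<and> (\<forall>q\<ge>e n. adapted q eps (v n))"
   "\<forall>a\<in>A. \<forall>b\<in>A. a \<noteq> b --> (\<forall>s s'. abs (\<E> x. u a ((T^^s) x) * u b ((T^^s') x)) <= eps)"
   by (elim exE conjE)
  have A: "finite A" "card A = r" "\<And>n. n \<in> A ==> \<eta> <= \<theta> * c n"
   "\<And>n s. n \<in> A ==> adapted (s + p n) eps (\<lambda>x. u n ((T^^s) x))" "\<And>n q. n \<in> A ==> q >= e n ==> adapted q eps (v n)"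
   "\<And>a b s s'. a \<in> A ==> b \<in> A ==> a \<noteq> b ==> abs (\<E> x. u a ((T^^s) x) * u b ((T^^s') x)) <= eps"
   using A' by simp_all
  \<comment> \<open>Shifting \<open>u a\<close> by \<open>P - p a\<close> makes all first windows
    end at the same time P and leaves the correlations unchanged by invariance of m. Likewise E is a
    common length for the second windows.\<close>
  define P where "P = (\<Sum>a\<in>A. p a)"
  define E where "E = (\<Sum>a\<in>A. e a)"
  have P: "p a <= P" and E: "e a <= E" if "a \<in> A" for a
   unfolding P_def E_def using that A(1) member_le_sum[of a A p] member_le_sum[of a A e] by auto
  define U where "U a x = u a ((T^^(P - p a)) x)" for a x
  have Ub: "unit_bounded (U a)" for a unfolding U_def[abs_def] by (rule unit_bounded_iter[OF ub])
  have c_eq: "(\<E> x. U a x * v a ((T^^P) x)) = c a" if "a \<in> A" for a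
  proof -
   have "(T^^P) x = (T^^p a) ((T^^(P - p a)) x)" for x
    using P[OF that] by (metis comp_apply funpow_add le_add_diff_inverse)
   then have "(\<E> x. U a x * v a ((T^^P) x)) = (\<E> x. (\<lambda>y. u a y * v a ((T^^p a) y)) ((T^^(P - p a)) x))"
    by (simp add: U_def)
   also have "... = c a"
    unfolding c_def by (rule integral_iter) (rule unit_boundedD(1)[OF unit_bounded_mult[OF ub unit_bounded_iter[OF v]]])
   finally show ?thesis .
  qed
  have au': "adapted P eps (U a)" if "a \<in> A" for a
   using A(4)[OF that, of "P - p a"] P[OF that] by (simp add: U_def[abs_def])
  \<comment> \<open>A row of the Gram matrix has diagonal entry at most 1 and off-diagonal entries
    at most \<open>eps = 1 / r\<close>, so its sum is at most 2.\<close>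
  have gram: "(\<Sum>b\<in>A. (\<E> x. U a x * U b x) * (\<E> x. v a x * v b x)) <= 2" if a: "a \<in> A" for a
  proof -
   have v1: "abs (\<E> x. v a x * v b x) <= 1" for b by (rule integral_unit_bounded[OF unit_bounded_mult[OF v v]])
   have "(\<Sum>b\<in>A. (\<E> x. U a x * U b x) * (\<E> x. v a x * v b x)) <= (\<Sum>b\<in>A. abs (\<E> x. U a x * U b x) * 1)"
   proof (rule sum_mono)
    fix b
    have "(\<E> x. U a x * U b x) * (\<E> x. v a x * v b x) <= abs ((\<E> x. U a x * U b x) * (\<E> x. v a x * v b x))"
     by (rule abs_ge_self)
    also have "... <= abs (\<E> x. U a x * U b x) * 1" unfolding abs_mult by (intro mult_left_mono v1) simp
    finally show "(\<E> x. U a x * U b x) * (\<E> x. v a x * v b x) <= abs (\<E> x. U a x * U b x) * 1" .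
   qed
   also have "... <= (\<Sum>b\<in>A. (if b = a then 1 else 0) + eps)"
   proof (rule sum_mono)
    fix b assume b: "b \<in> A"
    have "abs (\<E> x. U a x * U a x) <= 1" by (rule integral_unit_bounded[OF unit_bounded_mult[OF Ub Ub]])
    moreover have "abs (\<E> x. U a x * U b x) <= eps" if "b \<noteq> a"
     unfolding U_def by (rule A(6)[OF a b]) (use that in auto)
    ultimately show "abs (\<E> x. U a x * U b x) * 1 <= (if b = a then 1 else 0) + eps" using eps by auto
   qed
   also have "... = 1 + real r * eps" using a A(1,2) by (simp add: sum.distrib)
   also have "... = 2" using r by (simp add: eps_def)
   finally show ?thesis .
  qed
  have "real r * \<eta> = (\<Sum>a\<in>A. \<eta>)" using A(2) by simp
  also have "... <= (\<Sum>a\<in>A. \<theta> * c a)" by (intro sum_mono A(3))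
  also have "... = \<theta> * (\<Sum>a\<in>A. (\<E> x. U a x * v a ((T^^P) x)))" by (simp add: sum_distrib_left c_eq)
  also have "... <= abs (\<Sum>a\<in>A. (\<E> x. U a x * v a ((T^^P) x)))"
   using abs_ge_self[of "\<theta> * (\<Sum>a\<in>A. (\<E> x. U a x * v a ((T^^P) x)))"] \<theta> by (simp add: abs_mult)
  also have "... <= K^2 * sqrt (\<Sum>a\<in>A. \<Sum>b\<in>A. (\<E> x. U a x * U b x) * (\<E> x. v a x * v b x)) + 4 * K^2 * card A * eps"
   by (rule correlation_bound[OF A(1) Ub v au' A(5)[OF _ E]])
  also have "... <= K^2 * sqrt (\<Sum>a\<in>A. 2) + 4 * K^2 * card A * eps"
   by (intro add_right_mono mult_left_mono real_sqrt_le_mono sum_mono gram) auto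
  also have "... = K^2 * sqrt (2 * real r) + 4 * K^2" using A(2) r by (simp add: eps_def mult.commute)
  finally show False using r(2) by linarith
 qed
 have "(\<lambda>n. c n) \<leadsto> 0"
 proof (rule tendstoI)
  fix \<eta> :: real assume \<eta>: "\<eta> > 0"
  have "EV n. 1 * c n < \<eta>" "EV n. - 1 * c n < \<eta>"
   by (rule key; use \<eta> in simp)+
  then show "EV n. dist (c n) 0 < \<eta>" by eventually_elim auto
 qed
 then show ?thesis by (simp add: c_def)
qed

text \<open>Niceness is included since \<open>correlation_bound\<close> sees functions only through
  cells; sublevel sets of ergodic limits of nice functions qualify.\<close>

definition invariant_event :: "'a set => bool" where
 "invariant_event A \<longleftrightarrow> A \<in> sets m \<and> (\<forall>x\<in>space m. T x \<in> A \<longleftrightarrow> x \<in> A) \<and> nice (indicator A)"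

lemma invariant_event_indicator:
 assumes "invariant_event A"
 shows "A \<in> sets m" "nice (indicator A)" "unit_bounded (indicator A)"
  "\<forall>x\<in>space m. indicator A (T x) = (indicator A x :: real)"
 using assms nice_unit_bounded unfolding invariant_event_def by (auto simp: indicator_def)

lemma invariant_event_Int:
 assumes "invariant_event A" "invariant_event A'"
 shows "invariant_event (A \<inter> A')"
proof -
 have "nice (\<lambda>x. indicator A x * indicator A' x)"
  by (rule nice_mult[OF invariant_event_indicator(2)[OF assms(1)] invariant_event_indicator(2)[OF assms(2)]])
 moreover have "(\<lambda>x. indicator A x * indicator A' x) = (indicator (A \<inter> A') :: 'a => real)"
  by (auto simp: indicator_def)
 ultimately show ?thesis using assms by (auto simp: invariant_event_def)
qed

lemma invariant_event_Compl:
 assumes "invariant_event A"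
 shows "invariant_event (space m - A)"
proof -
 have n: "nice (\<lambda>x. 1 - abs (indicator A x :: real))"
  by (rule nice_compose[of _ "\<lambda>a. 1 - abs a" 1, OF invariant_event_indicator(2)[OF assms]]) auto
 have "nice (indicator (space m - A))"
 proof (rule nice_limit)
  show "unit_bounded (indicator (space m - A))"
   using assms by (auto simp: unit_bounded_def invariant_event_def indicator_def)
  have "(\<E> x. abs (indicator (space m - A) x - (1 - abs (indicator A x :: real)))) = (\<E> x. 0)"
   by (rule Bochner_Integration.integral_cong) (auto simp: indicator_def)
  then show "\<exists>v. nice v \<and> (\<E> x. abs (indicator (space m - A) x - v x)) <= eps" if "eps > 0" for eps :: real
   using n that by (intro exI[of _ "\<lambda>x. 1 - abs (indicator A x)"]) auto
 qed
 then show ?thesis using assms by (auto simp: invariant_event_def measurable_space[OF T_measurable])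
qed

text \<open>The inequality is strict, so the Lipschitz ramps \<open>g n\<close> converge pointwise
  to the indicator for every q, with no exceptional levels.\<close>

lemma nice_indicator_level:
 assumes h: "nice h"
 shows "nice (indicator {x \<in> space m. h x < q})"
proof (rule nice_limit)
 note hb = nice_unit_bounded[OF h]
 note [measurable] = unit_boundedD(1)[OF hb]
 show ub: "unit_bounded (indicator {x \<in> space m. h x < q})"
  unfolding unit_bounded_def by (auto simp: indicator_def)
 define g where "g n a = max 0 (min 1 (real n * (q - a)))" for n a
 have g_nice: "nice (\<lambda>x. g n (h x))" for n
 proof (rule nice_compose[OF h])
  show "abs (g n a - g n b) <= real n * abs (a - b)" for a b
  proof -
   have "abs (g n a - g n b) <= abs (real n * (q - a) - real n * (q - b))" unfolding g_def by linarith
   also have "... = real n * abs (a - b)" by (simp add: right_diff_distrib[symmetric] abs_mult abs_minus_commute)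
   finally show ?thesis .
  qed
  show "g n \<in> borel_measurable borel" unfolding g_def[abs_def] by measurable
 qed (auto simp: g_def)
 have pt: "(\<lambda>n. abs (indicator {x \<in> space m. h x < q} x - g n (h x))) \<leadsto> 0" if x: "x \<in> space m" for x
 proof (cases "h x < q")
  case True
  obtain N :: nat where N: "real N > 1 / (q - h x)" using reals_Archimedean2 by blast
  have "EV n. abs (indicator {x \<in> space m. h x < q} x - g n (h x)) = 0"
  proof (rule eventually_sequentiallyI[of N])
   fix n assume "N <= n"
   then have "real n > 1 / (q - h x)" using N by linarith
   then have "real n * (q - h x) > 1" using True by (simp add: field_simps)
   then show "abs (indicator {x \<in> space m. h x < q} x - g n (h x)) = 0" using True x by (simp add: g_def)
  qed
  then show ?thesis by (rule tendsto_eventually)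
 next
  case False
  have "g n (h x) = 0" for n
  proof -
   have "real n * (q - h x) <= 0" by (rule mult_nonneg_nonpos) (use False in auto)
   then show ?thesis by (simp add: g_def)
  qed
  then show ?thesis using False by simp
 qed
 have L1: "(\<lambda>n. (\<E> x. abs (indicator {x \<in> space m. h x < q} x - g n (h x)))) \<leadsto> (\<E> x. 0)"
 proof (rule integral_dominated_convergence[where w = "\<lambda>_. 2"])
  show "AE x in m. norm (abs (indicator {x \<in> space m. h x < q} x - g n (h x))) <= 2" for n
  proof (rule AE_I2)
   fix x
   have "0 <= g n (h x)" "g n (h x) <= 1" by (auto simp: g_def)
   moreover have "0 <= (indicator {x \<in> space m. h x < q} x :: real)" "indicator {x \<in> space m. h x < q} x <= (1 :: real)"
    by (auto simp: indicator_def)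
   ultimately show "norm (abs (indicator {x \<in> space m. h x < q} x - g n (h x))) <= 2"
    unfolding real_norm_def abs_abs abs_le_iff by linarith
  qed
  show "(\<lambda>x. abs (indicator {x \<in> space m. h x < q} x - g n (h x))) \<in> borel_measurable m" for n
   unfolding g_def by measurable
 qed (use pt in auto)
 fix eps :: real assume "eps > 0"
 then obtain n where "(\<E> x. abs (indicator {x \<in> space m. h x < q} x - g n (h x))) < eps"
  using eventually_happens'[OF sequentially_bot order_tendstoD(2)[OF L1, of eps]] by auto
 then show "\<exists>v. nice v \<and> (\<E> x. abs (indicator {x \<in> space m. h x < q} x - v x)) <= eps"
  using g_nice less_imp_le by blast
qed

lemma invariant_event_level:
 assumes "nice h" "\<forall>x\<in>space m. h (T x) = h x"
 shows "invariant_event {x \<in> space m. h x < q}"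
proof -
 note [measurable] = unit_boundedD(1)[OF nice_unit_bounded[OF assms(1)]]
 have "{x \<in> space m. h x < q} \<in> sets m" by measurable
 then show ?thesis unfolding invariant_event_def
  using nice_indicator_level[OF assms(1)] assms(2) measurable_space[OF T_measurable] by auto
qed

lemma invariant_event_adapted:
 assumes A: "invariant_event A" and eps: "eps > 0"
 shows "\<exists>R. \<forall>q\<ge>R. adapted q eps (indicator A)"
proof -
 obtain R where R: "\<And>s e. s >= R ==> e >= R ==> adapted (s + e) eps (\<lambda>x. indicator A ((T^^s) x))"
  using niceD[OF invariant_event_indicator(2)[OF A] eps] by auto
 show ?thesis
 proof (intro exI[of _ "2 * R"] allI impI)
  fix q assume "q >= 2 * R"
  then have "adapted q eps (\<lambda>x. indicator A ((T^^R) x))" using R[of R "q - R"] by simp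
  then show "adapted q eps (indicator A)"
   by (subst adapted_cong[of _ "\<lambda>x. indicator A ((T^^R) x)"])
    (auto simp: invariant_iter[OF invariant_event_indicator(4)[OF A]])
 qed
qed

text \<open>An invariant set is perfectly correlated with itself at all times, while disjoint ones
  are orthogonal. With n sets of equalized weights the left side of \<open>correlation_bound\<close>
  grows like n and the right side like \<open>K^2 * sqrt n\<close>, so
  \<open>n <= K^4\<close>.\<close>

lemma card_disjoint_invariant_events:
 assumes fin: "finite \<A>" and dis: "disjoint \<A>" and inv: "\<And>A. A \<in> \<A> ==> invariant_event A"
  and pos: "\<And>A. A \<in> \<A> ==> measure m A > 0"
 shows "real (card \<A>) <= K^4"
proof (cases "\<A> = {}")
 case True
 then show ?thesis using K_ge_1 by simp
next
 case ne: False
 define \<mu> where "\<mu> = Min (measure m ` \<A>)"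
 have \<mu>: "\<mu> > 0" unfolding \<mu>_def using fin ne pos by simp
 have \<mu>le: "\<mu> <= measure m A" if "A \<in> \<A>" for A unfolding \<mu>_def using fin that by simp
 \<comment> \<open>The weights make every diagonal correlation equal to \<mu>, the smallest mass;
   dividing by the mass alone would destroy the bound 1.\<close>
 define c where "c A = \<mu> / measure m A" for A
 have c: "0 <= c A" "c A <= 1" if "A \<in> \<A>" for A
  using pos[OF that] \<mu>le[OF that] \<mu> by (auto simp: c_def)
 define v where "v A x = c A * indicator A x" for A and x :: 'a
 note ind = invariant_event_indicator[OF inv]
 have v_nice: "nice (v A)" if "A \<in> \<A>" for A
 proof -
  have "nice (\<lambda>x. (\<lambda>_. c A) x * indicator A x)"
   by (rule nice_mult[OF nice_const ind(2)[OF that]]) (use c[OF that] in auto)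
  then show ?thesis by (simp add: v_def[abs_def])
 qed
 note vb = nice_unit_bounded[OF v_nice]
 have main: "real (card \<A>) * \<mu> <= K^2 * sqrt (real (card \<A>) * \<mu>^2) + 4 * K^2 * card \<A> * eps" if eps: "eps > 0" for eps
 proof -
  have "\<forall>A\<in>\<A>. \<exists>R. \<forall>q\<ge>R. adapted q eps (indicator A)"
   using invariant_event_adapted[OF inv eps] by blast
  from bchoice[OF this] obtain R where R: "\<And>A q. A \<in> \<A> ==> q >= R A ==> adapted q eps (indicator A)" by blast
  define q where "q = (\<Sum>A\<in>\<A>. R A)"
  have q: "adapted q eps (indicator A)" if "A \<in> \<A>" for A
   using that fin member_le_sum[of A \<A> R] R[of A q] by (auto simp: q_def)
  have qv: "adapted q eps (v A)" if "A \<in> \<A>" for A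
  proof -
   have "adapted q (1 * eps) (\<lambda>x. (\<lambda>a. c A * a) (indicator A x))"
   proof (rule adapted_compose[OF ind(3)[OF that] q[OF that]])
    fix a b :: real
    show "abs (c A * a) <= 1" if "abs a <= 1" using c[OF \<open>A \<in> \<A>\<close>] that by (simp add: abs_mult mult_le_one)
    have "abs (c A * a - c A * b) = c A * abs (a - b)" using c[OF that] by (simp add: right_diff_distrib[symmetric] abs_mult)
    also have "... <= 1 * abs (a - b)" using c[OF that] by (intro mult_right_mono) auto
    finally show "abs (c A * a - c A * b) <= 1 * abs (a - b)" .
   qed (use vb[OF that] in \<open>simp add: v_def[abs_def]\<close>)
   then show ?thesis by (simp add: v_def[abs_def])
  qed
  have 1: "(\<E> x. indicator A x * v A ((T^^q) x)) = \<mu>" if "A \<in> \<A>" for A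
  proof -
   have "(\<E> x. indicator A x * v A ((T^^q) x)) = (\<E> x. c A * indicator A x)"
    by (rule Bochner_Integration.integral_cong) (simp_all add: v_def invariant_iter[OF ind(4)[OF that]], simp add: indicator_def)
   also have "... = c A * measure m A" using ind(1)[OF that] by simp
   finally show ?thesis using pos[OF that] by (simp add: c_def)
  qed
  have 2: "(\<E> x. indicator A x * indicator A' x) * (\<E> x. v A x * v A' x) = (if A = A' then \<mu>^2 else 0)"
   if "A \<in> \<A>" "A' \<in> \<A>" for A A'
  proof (cases "A = A'")
   case True
   have "(\<E> x. indicator A x * indicator A x) = measure m A" using ind(1)[OF that(1)]
    by (simp add: indicator_inter_arith[symmetric])
   moreover have "(\<E> x. v A x * v A x) = (c A)^2 * measure m A"
   proof -
    have "(\<E> x. v A x * v A x) = (\<E> x. (c A)^2 * indicator A x)"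
     by (rule Bochner_Integration.integral_cong) (auto simp: v_def indicator_def power2_eq_square)
    then show ?thesis using ind(1)[OF that(1)] by simp
   qed
   moreover have "measure m A * ((c A)^2 * measure m A) = \<mu>^2"
    using pos[OF that(1)] by (simp add: c_def power2_eq_square)
   ultimately show ?thesis using True by simp
  next
   case False
   then have "A \<inter> A' = {}" using dis that by (auto simp: disjoint_def)
   then have "(\<E> x. indicator A x * (indicator A' x :: real)) = 0"
    by (simp add: indicator_inter_arith[symmetric])
   then show ?thesis using False by simp
  qed
  have "real (card \<A>) * \<mu> = (\<Sum>A\<in>\<A>. (\<E> x. indicator A x * v A ((T^^q) x)))" using 1 by simp
  also have "... <= abs (\<Sum>A\<in>\<A>. (\<E> x. indicator A x * v A ((T^^q) x)))" by simp
  also have "... <= K^2 * sqrt (\<Sum>A\<in>\<A>. \<Sum>A'\<in>\<A>. (\<E> x. indicator A x * indicator A' x) * (\<E> x. v A x * v A' x)) + 4 * K^2 * card \<A> * eps"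
   by (rule correlation_bound[OF fin ind(3) vb q qv])
  also have "(\<Sum>A\<in>\<A>. \<Sum>A'\<in>\<A>. (\<E> x. indicator A x * indicator A' x) * (\<E> x. v A x * v A' x)) = (\<Sum>A\<in>\<A>. \<Sum>A'\<in>\<A>. (if A = A' then \<mu>^2 else 0))"
   by (intro sum.cong refl 2)
  also have "... = real (card \<A>) * \<mu>^2" using fin by simp
  finally show ?thesis .
 qed
 have "real (card \<A>) * \<mu> <= K^2 * sqrt (real (card \<A>) * \<mu>^2)"
 proof (rule tendsto_lowerbound)
  have "((\<lambda>eps. K^2 * sqrt (real (card \<A>) * \<mu>^2) + 4 * K^2 * card \<A> * eps) \<longlongrightarrow> K^2 * sqrt (real (card \<A>) * \<mu>^2) + 4 * K^2 * card \<A> * 0) (at_right 0)"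
   by (intro tendsto_intros)
  then show "((\<lambda>eps. K^2 * sqrt (real (card \<A>) * \<mu>^2) + 4 * K^2 * card \<A> * eps) \<longlongrightarrow> K^2 * sqrt (real (card \<A>) * \<mu>^2)) (at_right 0)"
   by simp
  show "\<forall>\<^sub>F eps in at_right 0. real (card \<A>) * \<mu> <= K^2 * sqrt (real (card \<A>) * \<mu>^2) + 4 * K^2 * card \<A> * eps"
   unfolding eventually_at_right_field by (intro exI[of _ 1]) (use main in auto)
 qed simp
 then have "real (card \<A>) * \<mu> <= (K^2 * sqrt (card \<A>)) * \<mu>" using \<mu> by (simp add: real_sqrt_mult)
 then have "real (card \<A>) <= K^2 * sqrt (card \<A>)" using \<mu> by simp
 then have "sqrt (card \<A>) * sqrt (card \<A>) <= K^2 * sqrt (card \<A>)" by simp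
 then have "sqrt (card \<A>) <= K^2" using fin ne by (simp add: card_gt_0_iff del: real_sqrt_mult_self)
 then have "(sqrt (card \<A>))^2 <= (K^2)^2" by (intro power_mono) auto
 then show ?thesis by simp
qed

end

section \<open>Ergodic components\<close>

context quasi_bernoulli begin

definition ergodic_atoms :: "'a set set => bool" where
 "ergodic_atoms \<A> \<longleftrightarrow> finite \<A> \<and> disjoint \<A> \<and> (\<forall>A\<in>\<A>. invariant_event A \<and> measure m A > 0) \<and>
  measure m (space m - \<Union>\<A>) = 0 \<and>
  (\<forall>A\<in>\<A>. \<forall>E. invariant_event E --> measure m (A \<inter> E) = 0 \<or> measure m (A - E) = 0)"

lemma invariant_event_space: "invariant_event (space m)"
proof -
 have "nice (indicator (space m))"
 proof (rule nice_limit)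
  show "unit_bounded (indicator (space m))" by (auto simp: unit_bounded_def)
  have "(\<E> x. abs (indicator (space m) x - (1 :: real))) = (\<E> x. 0)"
   by (rule Bochner_Integration.integral_cong) auto
  then show "\<exists>v. nice v \<and> (\<E> x. abs (indicator (space m) x - v x)) <= eps" if "eps > 0" for eps :: real
   using that by (intro exI[of _ "\<lambda>_. 1"]) (auto intro: nice_const)
 qed
 then show ?thesis by (auto simp: invariant_event_def measurable_space[OF T_measurable])
qed

lemma invariant_event_Compl_Union:
 assumes "finite \<A>" "\<And>A. A \<in> \<A> ==> invariant_event A"
 shows "invariant_event (space m - \<Union>\<A>)"
 using assms
proof (induction \<A> rule: finite_induct)
 case empty
 show ?case using invariant_event_space by simp
next
 case (insert A \<A>)
 have "invariant_event ((space m - A) \<inter> (space m - \<Union>\<A>))"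
  by (rule invariant_event_Int[OF invariant_event_Compl]) (use insert in auto)
 moreover have "(space m - A) \<inter> (space m - \<Union>\<A>) = space m - \<Union>(insert A \<A>)" by auto
 ultimately show ?case by simp
qed

text \<open>A disjoint family of maximal cardinality works: an uncovered set of positive mass could
  be added, and a member cut by an invariant event into two parts of positive mass could be replaced
  by the parts.\<close>

lemma ergodic_atoms_exist: "\<exists>\<A>. ergodic_atoms \<A>"
proof -
 define Q where "Q \<A> \<longleftrightarrow> finite \<A> \<and> disjoint \<A> \<and> (\<forall>A\<in>\<A>. invariant_event A \<and> measure m A > 0)" for \<A>
 have Q0: "Q {}" by (simp add: Q_def)
 have Qb: "card \<A> <= nat \<lceil>K^4\<rceil>" if "Q \<A>" for \<A>
 proof -
  have "real (card \<A>) <= K^4"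
   by (rule card_disjoint_invariant_events) (use that in \<open>auto simp: Q_def\<close>)
  then show ?thesis by linarith
 qed
 have "\<exists>\<A>. Q \<A> \<and> (\<forall>\<B>. Q \<B> --> card \<B> <= card \<A>)"
  by (rule ex_has_greatest_nat[of Q "{}" card "Suc (nat \<lceil>K^4\<rceil>)"]) (use Q0 Qb in \<open>auto simp: less_Suc_eq_le\<close>)
 then obtain \<A> where QA: "Q \<A>" and max: "\<And>\<B>. Q \<B> ==> card \<B> <= card \<A>" by blast
 have fin: "finite \<A>" and dis: "disjoint \<A>" and inv: "\<And>A. A \<in> \<A> ==> invariant_event A"
  and pos: "\<And>A. A \<in> \<A> ==> measure m A > 0" using QA by (auto simp: Q_def)
 have rest: "measure m (space m - \<Union>\<A>) = 0"
 proof (rule ccontr)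
  assume nz: "measure m (space m - \<Union>\<A>) \<noteq> 0"
  then have p: "measure m (space m - \<Union>\<A>) > 0" by (simp add: zero_less_measure_iff)
  have ne: "space m - \<Union>\<A> \<noteq> {}" using nz by (metis measure_empty)
  have nin: "space m - \<Union>\<A> \<notin> \<A>" using ne by blast
  have "Q (insert (space m - \<Union>\<A>) \<A>)"
   unfolding Q_def using fin dis inv pos p invariant_event_Compl_Union[OF fin inv]
   by (auto simp: disjoint_def pairwise_def disjnt_def)
  from max[OF this] show False using fin nin by simp
 qed
 have split: "measure m (A \<inter> E) = 0 \<or> measure m (A - E) = 0" if A: "A \<in> \<A>" and E: "invariant_event E" for A E
 proof (rule ccontr)
  assume "\<not> (measure m (A \<inter> E) = 0 \<or> measure m (A - E) = 0)"
  then have p: "measure m (A \<inter> E) > 0" "measure m (A - E) > 0" by (simp_all add: zero_less_measure_iff)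
  then have ne: "A \<inter> E \<noteq> {}" "A - E \<noteq> {}" by (metis less_irrefl measure_empty)+
  have "A \<subseteq> space m" using inv[OF A] sets.sets_into_space by (auto simp: invariant_event_def)
  then have "A - E = A \<inter> (space m - E)" by auto
  then have i: "invariant_event (A \<inter> E)" "invariant_event (A - E)"
   using invariant_event_Int[OF inv[OF A] E] invariant_event_Int[OF inv[OF A] invariant_event_Compl[OF E]] by auto
  have other: "A \<inter> E' = {}" if "E' \<in> \<A>" "E' \<noteq> A" for E' using dis A that by (auto simp: disjoint_def)
  have nin: "A \<inter> E \<notin> \<A> - {A}" "A - E \<notin> insert (A \<inter> E) (\<A> - {A})"
   using other[of "A \<inter> E"] other[of "A - E"] ne by blast+
  have "Q (insert (A - E) (insert (A \<inter> E) (\<A> - {A})))"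
   unfolding Q_def
  proof (intro conjI)
   show "disjoint (insert (A - E) (insert (A \<inter> E) (\<A> - {A})))"
    using dis other by (auto simp: disjoint_def)
  qed (use fin inv pos p i in auto)
  from max[OF this] have "Suc (Suc (card (\<A> - {A}))) <= card \<A>" using fin nin by simp
  moreover have "card \<A> = Suc (card (\<A> - {A}))" using card.remove[OF fin A] by simp
  ultimately show False by simp
 qed
 show ?thesis
  by (intro exI[of _ \<A>]) (use fin dis inv pos rest split in \<open>auto simp: ergodic_atoms_def\<close>)
qed

definition atoms :: "'a set set" where "atoms = (SOME \<A>. ergodic_atoms \<A>)"

lemma ergodic_atoms: "ergodic_atoms atoms"
 unfolding atoms_def using ergodic_atoms_exist by (rule someI_ex)

lemma finite_atoms: "finite atoms" and disjoint_atoms: "disjoint atoms"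
 and atom_invariant: "A \<in> atoms ==> invariant_event A" and atom_pos: "A \<in> atoms ==> measure m A > 0"
 and atoms_cover: "measure m (space m - \<Union>atoms) = 0"
 and atom_ergodic: "A \<in> atoms ==> invariant_event E ==> measure m (A \<inter> E) = 0 \<or> measure m (A - E) = 0"
 using ergodic_atoms by (auto simp: ergodic_atoms_def)

lemma atom_sets [measurable]: "A \<in> atoms ==> A \<in> sets m"
 using atom_invariant by (simp add: invariant_event_def)

lemma atoms_disjoint: "A \<in> atoms ==> A' \<in> atoms ==> A \<noteq> A' ==> A \<inter> A' = {}"
 using disjoint_atoms by (auto simp: disjoint_def)

text \<open>Up to null sets each sublevel set of h misses or contains the atom. The level where it
  switches from one to the other is the value of h.\<close>

lemma constant_on_atom:
 assumes h: "nice h" "\<forall>x\<in>space m. h (T x) = h x" and A: "A \<in> atoms"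
 shows "\<exists>c. AE x in m. x \<in> A --> h x = c"
proof -
 note hb = nice_unit_bounded[OF h(1)]
 note [measurable] = unit_boundedD(1)[OF hb] atom_sets[OF A]
 have Asub: "A \<subseteq> space m" using sets.sets_into_space[OF atom_sets[OF A]] .
 define H where "H q = {x \<in> space m. h x < q}" for q
 have Hm [measurable]: "H q \<in> sets m" for q unfolding H_def by measurable
 define Z where "Z = {q. measure m (A \<inter> H q) = 0}"
 have "-1 \<in> Z"
 proof -
  have "A \<inter> H (-1) = {}" using unit_boundedD(2)[OF hb] by (force simp: H_def abs_le_iff)
  then show ?thesis by (simp add: Z_def)
 qed
 have Zle: "q <= 1" if "q \<in> Z" for q
 proof (rule ccontr)
  assume "\<not> q <= 1"
  then have "A \<inter> H q = A" using unit_boundedD(2)[OF hb] Asub by (force simp: H_def abs_le_iff)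
  then show False using that atom_pos[OF A] by (simp add: Z_def)
 qed
 define c where "c = Sup Z"
 have bdd: "bdd_above Z" using Zle by (auto simp: bdd_above_def)
 have low: "measure m (A \<inter> H q) = 0" if q: "q < c" for q
 proof -
  obtain q' where "q' \<in> Z" "q < q'" using less_cSupD[OF _ q[unfolded c_def]] \<open>-1 \<in> Z\<close> by blast
  then have "measure m (A \<inter> H q) <= measure m (A \<inter> H q')" by (intro finite_measure_mono) (auto simp: H_def)
  then show ?thesis using \<open>q' \<in> Z\<close> by (simp add: Z_def measure_le_0_iff)
 qed
 have high: "measure m (A - H q) = 0" if "q > c" for q
 proof -
  have "q \<notin> Z" using that cSup_upper[OF _ bdd, of q] unfolding c_def by auto
  moreover have "invariant_event (H q)" unfolding H_def by (rule invariant_event_level[OF h])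
  ultimately show ?thesis using atom_ergodic[OF A] by (auto simp: Z_def)
 qed
 have "AE x in m. x \<notin> A \<inter> H (c - 1 / real (Suc n))" for n
  by (rule AE_not_in) (use low[of "c - 1 / real (Suc n)"] in \<open>auto simp: null_sets_def emeasure_eq_measure\<close>)
 moreover have "AE x in m. x \<notin> A - H (c + 1 / real (Suc n))" for n
  by (rule AE_not_in) (use high[of "c + 1 / real (Suc n)"] in \<open>auto simp: null_sets_def emeasure_eq_measure\<close>)
 ultimately have "AE x in m. \<forall>n. x \<notin> A \<inter> H (c - 1 / real (Suc n)) \<and> x \<notin> A - H (c + 1 / real (Suc n))"
  by (simp add: AE_all_countable)
 then have "AE x in m. x \<in> A --> h x = c"
 proof (rule AE_mp, intro AE_I2 impI)
  fix x assume x: "x \<in> space m" "\<forall>n. x \<notin> A \<inter> H (c - 1 / real (Suc n)) \<and> x \<notin> A - H (c + 1 / real (Suc n))" "x \<in> A"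
  have b: "c - 1 / real (Suc n) <= h x \<and> h x <= c + 1 / real (Suc n)" for n
   using x(2)[rule_format, of n] x(1,3) by (auto simp: H_def)
  have l: "(\<lambda>n. c + 1 / real (Suc n)) \<leadsto> c + 0" "(\<lambda>n. c - 1 / real (Suc n)) \<leadsto> c - 0"
   by (intro tendsto_intros LIMSEQ_Suc[OF lim_inverse_n, unfolded inverse_eq_divide])+
  have "h x <= c" by (rule LIMSEQ_le_const[of _ c]) (use l(1) b in auto)
  moreover have "c <= h x" by (rule LIMSEQ_le_const2[of _ c]) (use l(2) b in auto)
  ultimately show "h x = c" by simp
 qed
 then show ?thesis by blast
qed

definition coef :: "'a set => ('a => real) => real" where
 "coef A u = (\<E> x. u x * indicator A x) / measure m A"

lemma coef_le: "A \<in> atoms ==> unit_bounded u ==> abs (coef A u) <= 1"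
proof -
 assume A: "A \<in> atoms" and u: "unit_bounded u"
 have "abs (\<E> x. u x * indicator A x) <= (\<E> x. abs (u x * indicator A x))" by (rule integral_abs_bound)
 also have "... <= (\<E> x. indicator A x)"
 proof (rule integral_mono)
  show "integrable m (\<lambda>x. abs (u x * indicator A x))"
   using unit_bounded_integrable[OF unit_bounded_mult[OF u invariant_event_indicator(3)[OF atom_invariant[OF A]]]] by simp
  show "integrable m (indicator A :: _ => real)"
   by (rule unit_bounded_integrable[OF invariant_event_indicator(3)[OF atom_invariant[OF A]]])
  show "abs (u x * indicator A x) <= indicator A x" if "x \<in> space m" for x
   using unit_boundedD(2)[OF u that] by (auto simp: indicator_def)
 qed
 also have "... = measure m A" using atom_sets[OF A] by simp
 finally show ?thesis using atom_pos[OF A] by (simp add: coef_def)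
qed

lemma coef_iter:
 assumes A: "A \<in> atoms" and u: "unit_bounded u"
 shows "coef A (\<lambda>x. u ((T^^n) x)) = coef A u"
proof -
 note ind = invariant_event_indicator[OF atom_invariant[OF A]]
 have "(\<E> x. u ((T^^n) x) * indicator A x) = (\<E> x. u ((T^^n) x) * indicator A ((T^^n) x))"
  by (rule Bochner_Integration.integral_cong) (auto simp: invariant_iter[OF ind(4)])
 also have "... = (\<E> x. u x * indicator A x)"
  by (rule integral_iter[of "\<lambda>x. u x * indicator A x"]) (rule unit_boundedD(1)[OF unit_bounded_mult[OF u ind(3)]])
 finally show ?thesis by (simp add: coef_def)
qed

definition invariant_part :: "('a set => real) => 'a => real" where
 "invariant_part c x = (\<Sum>A\<in>atoms. c A * indicator A x)"

lemma invariant_part_on_atom: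
 assumes "A \<in> atoms" "x \<in> A"
 shows "invariant_part c x = c A"
proof -
 have "invariant_part c x = (\<Sum>A'\<in>atoms. if A' = A then c A else 0)"
  unfolding invariant_part_def by (rule sum.cong) (use assms atoms_disjoint in \<open>auto simp: indicator_def\<close>)
 then show ?thesis using finite_atoms assms by simp
qed

lemma invariant_part_cases:
 obtains A where "A \<in> atoms" "x \<in> A" "invariant_part c x = c A" | "invariant_part c x = 0"
proof (cases "\<exists>A\<in>atoms. x \<in> A")
 case True
 then show thesis using that(1) invariant_part_on_atom by blast
next
 case False
 then have "invariant_part c x = 0" by (auto simp: invariant_part_def intro!: sum.neutral)
 then show thesis by (rule that(2))
qed

lemma invariant_part_unit_bounded:
 assumes "\<And>A. A \<in> atoms ==> abs (c A) <= 1"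
 shows "unit_bounded (invariant_part c)"
proof -
 have "invariant_part c \<in> borel_measurable m" unfolding invariant_part_def[abs_def] by measurable
 moreover have "abs (invariant_part c x) <= 1" for x
  by (rule invariant_part_cases[of x c]) (use assms in auto)
 ultimately show ?thesis by (simp add: unit_bounded_def)
qed

lemma invariant_part_invariant: "x \<in> space m ==> invariant_part c (T x) = invariant_part c x"
 unfolding invariant_part_def
 using invariant_event_indicator(4)[OF atom_invariant] by (intro sum.cong) auto

text \<open>R is uniform in the coefficients because only the finitely many indicators of atoms are
  approximated. In \<open>coef_product\<close> the coefficients change with n.\<close>

lemma invariant_part_adapted:
 assumes eps: "eps > 0"
 shows "\<exists>R. \<forall>q\<ge>R. \<forall>c. (\<forall>A\<in>atoms. abs (c A) <= 1) --> adapted q eps (invariant_part c)"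
proof -
 define \<delta> where "\<delta> = eps / (real (card atoms) + 1)"
 have \<delta>: "\<delta> > 0" using eps by (simp add: \<delta>_def)
 have "\<forall>A\<in>atoms. \<exists>R. \<forall>q\<ge>R. adapted q \<delta> (indicator A)"
  using invariant_event_adapted[OF atom_invariant \<delta>] by blast
 from bchoice[OF this] obtain R where R: "\<And>A q. A \<in> atoms ==> q >= R A ==> adapted q \<delta> (indicator A)" by blast
 define R' where "R' = (\<Sum>A\<in>atoms. R A)"
 have R': "R A <= R'" if "A \<in> atoms" for A
  unfolding R'_def using that finite_atoms member_le_sum[of A atoms R] by auto
 show ?thesis
 proof (intro exI[of _ R'] allI impI)
  fix q and c :: "'a set => real" assume q: "q >= R'" and c: "\<forall>A\<in>atoms. abs (c A) <= 1"
  have "\<forall>A\<in>atoms. \<exists>\<phi>. (\<forall>a. abs (\<phi> a) <= 1) \<and> (\<E> x. abs (indicator A x - \<phi> (\<kappa> q x))) <= \<delta>"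
   using R order_trans[OF R' q] by (auto simp: adapted_def)
  from bchoice[OF this] obtain \<phi> where \<phi>1: "\<And>A a. A \<in> atoms ==> abs (\<phi> A a) <= 1"
   and \<phi>2: "\<And>A. A \<in> atoms ==> (\<E> x. abs (indicator A x - \<phi> A (\<kappa> q x))) <= \<delta>" by blast
  define \<psi> where "\<psi> a = max (-1) (min 1 (\<Sum>A\<in>atoms. c A * \<phi> A a))" for a
  have \<psi>1: "abs (\<psi> a) <= 1" for a by (auto simp: \<psi>_def)
  note ipb = invariant_part_unit_bounded[of c, OF c[rule_format]]
  have i: "integrable m (\<lambda>x. abs (indicator A x - \<phi> A (\<kappa> q x)))" if "A \<in> atoms" for A
   by (rule unit_bounded_diff_integrable[OF invariant_event_indicator(3)[OF atom_invariant[OF that]] unit_bounded_cell[OF \<phi>1[OF that]]])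
  have "(\<E> x. abs (invariant_part c x - \<psi> (\<kappa> q x))) <= (\<E> x. (\<Sum>A\<in>atoms. abs (indicator A x - \<phi> A (\<kappa> q x))))"
  proof (rule integral_mono)
   show "integrable m (\<lambda>x. abs (invariant_part c x - \<psi> (\<kappa> q x)))"
    by (rule unit_bounded_diff_integrable[OF ipb unit_bounded_cell[OF \<psi>1]])
   show "integrable m (\<lambda>x. \<Sum>A\<in>atoms. abs (indicator A x - \<phi> A (\<kappa> q x)))" by (rule Bochner_Integration.integrable_sum[OF i])
   fix x assume x: "x \<in> space m"
   \<comment> \<open>Truncation to the interval from -1 to 1 does not increase the distance to a
     value in that interval.\<close>
   have clip: "abs (a - max (-1) (min 1 b)) <= abs (a - b)" if "abs a <= 1" for a b :: real using that by linarith
   have "abs (invariant_part c x - \<psi> (\<kappa> q x)) <= abs (invariant_part c x - (\<Sum>A\<in>atoms. c A * \<phi> A (\<kappa> q x)))"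
    unfolding \<psi>_def by (rule clip[OF unit_boundedD(2)[OF ipb x]])
   also have "... = abs (\<Sum>A\<in>atoms. c A * (indicator A x - \<phi> A (\<kappa> q x)))"
    by (simp add: invariant_part_def sum_subtractf right_diff_distrib)
   also have "... <= (\<Sum>A\<in>atoms. abs (c A * (indicator A x - \<phi> A (\<kappa> q x))))" by (rule sum_abs)
   also have "... <= (\<Sum>A\<in>atoms. abs (indicator A x - \<phi> A (\<kappa> q x)))"
    by (rule sum_mono) (use c in \<open>auto simp: abs_mult intro: mult_left_le_one_le\<close>)
   finally show "abs (invariant_part c x - \<psi> (\<kappa> q x)) <= (\<Sum>A\<in>atoms. abs (indicator A x - \<phi> A (\<kappa> q x)))" .
  qed
  also have "... = (\<Sum>A\<in>atoms. (\<E> x. abs (indicator A x - \<phi> A (\<kappa> q x))))" by (rule Bochner_Integration.integral_sum[OF i])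
  also have "... <= (\<Sum>A\<in>atoms. \<delta>)" by (rule sum_mono[OF \<phi>2])
  also have "... <= eps" using eps by (simp add: \<delta>_def field_simps)
  finally show "adapted q eps (invariant_part c)" using \<psi>1 unfolding adapted_def by blast
 qed
qed

lemma invariant_part_iter: "x \<in> space m ==> invariant_part c ((T^^n) x) = invariant_part c x"
 by (rule invariant_iter) (auto simp: invariant_part_invariant)

lemma invariant_part_nice:
 assumes "\<And>A. A \<in> atoms ==> abs (c A) <= 1"
 shows "nice (invariant_part c)"
 unfolding nice_def
proof (intro conjI allI impI)
 show "unit_bounded (invariant_part c)" by (rule invariant_part_unit_bounded[OF assms])
 fix eps :: real assume "eps > 0"
 from invariant_part_adapted[OF this] assms obtain R where R: "\<And>q. q >= R ==> adapted q eps (invariant_part c)" by blast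
 show "\<exists>R. \<forall>s\<ge>R. \<forall>e\<ge>R. adapted (s + e) eps (\<lambda>x. invariant_part c ((T^^s) x))"
 proof (intro exI[of _ R] allI impI)
  fix s e assume "R <= s" "R <= e"
  then show "adapted (s + e) eps (\<lambda>x. invariant_part c ((T^^s) x))"
   by (subst adapted_cong[of _ "invariant_part c"]) (auto simp: invariant_part_iter intro: R)
 qed
qed

lemma integral_invariant_part:
 assumes v: "unit_bounded v"
 shows "(\<E> x. invariant_part c x * v x) = (\<Sum>A\<in>atoms. c A * (\<E> x. v x * indicator A x))"
proof -
 have "(\<E> x. invariant_part c x * v x) = (\<E> x. (\<Sum>A\<in>atoms. c A * (v x * indicator A x)))"
  unfolding invariant_part_def sum_distrib_right by (simp add: ac_simps)
 also have "... = (\<Sum>A\<in>atoms. (\<E> x. c A * (v x * indicator A x)))"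
  by (intro Bochner_Integration.integral_sum integrable_mult_right
    unit_bounded_integrable[OF unit_bounded_mult[OF v invariant_event_indicator(3)[OF atom_invariant]]])
 finally show ?thesis by simp
qed

lemma ergodic_limit_atoms:
 assumes u: "nice u" and h: "ergodic_limit u h"
 shows "AE x in m. h x = invariant_part (\<lambda>A. coef A u) x"
proof -
 have hn: "nice h" by (rule ergodic_limit_nice[OF u h])
 have hinv: "\<forall>x\<in>space m. h (T x) = h x" using h by (simp add: ergodic_limit_def)
 have "AE x in m. x \<in> A --> h x = coef A u" if A: "A \<in> atoms" for A
 proof -
  note ind = invariant_event_indicator[OF atom_invariant[OF A]]
  obtain c where c: "AE x in m. x \<in> A --> h x = c" using constant_on_atom[OF hn hinv A] by blast
  have "(\<E> x. u x * indicator A x) = (\<E> x. h x * indicator A x)"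
   by (rule ergodic_limit_integral[OF h nice_unit_bounded[OF u] ind(3,4)])
  also have "... = (\<E> x. c * indicator A x)"
  proof (rule integral_cong_AE)
   show "AE x in m. h x * indicator A x = c * indicator A x" using c by (rule AE_mp) (auto simp: indicator_def)
  qed (use ind(1) unit_boundedD(1)[OF nice_unit_bounded[OF hn]] in auto)
  also have "... = c * measure m A" using ind(1) by simp
  finally have "coef A u = c" using atom_pos[OF A] by (simp add: coef_def)
  then show ?thesis using c by simp
 qed
 then have "AE x in m. \<forall>A\<in>atoms. x \<in> A --> h x = coef A u"
  by (intro AE_finite_allI[OF finite_atoms])
 moreover have "AE x in m. x \<notin> space m - \<Union>atoms"
 proof (rule AE_not_in)
  have "space m - \<Union>atoms \<in> sets m"
   using finite_atoms atom_sets by (intro sets.Diff sets.finite_Union) auto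
  then show "space m - \<Union>atoms \<in> null_sets m" using atoms_cover by (auto simp: null_sets_def emeasure_eq_measure)
 qed
 ultimately show ?thesis using AE_space[of m]
 proof eventually_elim
  case (elim x)
  then obtain A where "A \<in> atoms" "x \<in> A" by auto
  then show ?case using elim(1) invariant_part_on_atom by simp
 qed
qed

text \<open>An ergodic limit is constant on each atom, so a nearly invariant sequence is weakly null
  once its integrals over the atoms tend to 0.\<close>

lemma weakly_null_atoms:
 assumes v: "\<And>k. unit_bounded (v k)" and \<delta>: "\<delta> \<leadsto> 0"
  and near: "\<And>k x. x \<in> space m ==> abs (v k (T x) - v k x) <= \<delta> k"
  and lim: "\<And>A. A \<in> atoms ==> (\<lambda>k. (\<E> x. v k x * indicator A x)) \<leadsto> 0"
 shows "weakly_null v"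
proof (rule weakly_null_near_invariant[OF v \<delta> near])
 fix w h assume w: "nice w" and h: "ergodic_limit w h"
 have hb: "unit_bounded h" using h by (simp add: ergodic_limit_def)
 have ipb: "unit_bounded (invariant_part (\<lambda>A. coef A w))"
  by (rule invariant_part_unit_bounded) (rule coef_le[OF _ nice_unit_bounded[OF w]])
 have "(\<E> x. h x * v k x) = (\<E> x. invariant_part (\<lambda>A. coef A w) x * v k x)" for k
 proof (rule integral_cong_AE)
  show "AE x in m. h x * v k x = invariant_part (\<lambda>A. coef A w) x * v k x"
   using ergodic_limit_atoms[OF w h] by eventually_elim simp
  show "(\<lambda>x. h x * v k x) \<in> borel_measurable m" by (rule unit_boundedD(1)[OF unit_bounded_mult[OF hb v]])
  show "(\<lambda>x. invariant_part (\<lambda>A. coef A w) x * v k x) \<in> borel_measurable m"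
   by (rule unit_boundedD(1)[OF unit_bounded_mult[OF ipb v]])
 qed
 then have eq: "(\<lambda>k. (\<E> x. h x * v k x)) = (\<lambda>k. \<Sum>A\<in>atoms. coef A w * (\<E> x. v k x * indicator A x))"
  by (simp add: integral_invariant_part[OF v])
 have "(\<lambda>k. \<Sum>A\<in>atoms. coef A w * (\<E> x. v k x * indicator A x)) \<leadsto> (\<Sum>A\<in>atoms. coef A w * 0)"
  by (intro tendsto_intros lim)
 then show "(\<lambda>k. (\<E> x. h x * v k x)) \<leadsto> 0" unfolding eq by simp
qed

text \<open>Asymptotic independence under the conditional measure of an atom. Subtracting from
  \<open>u n\<close> its conditional means on the atoms leaves a weakly null sequence, to which
  \<open>decoupling\<close> applies with v cut off to A. The half in w preserves the bound
  1.\<close>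

lemma coef_product:
 fixes p e :: "nat => nat"
 assumes u: "\<And>n. nice (u n)" and v: "\<And>n. unit_bounded (v n)"
  and \<delta>: "\<delta> \<leadsto> 0" and near: "\<And>k x. x \<in> space m ==> abs (u k (T x) - u k x) <= \<delta> k"
  and p: "filterlim p at_top sequentially"
  and au: "\<And>eps. eps > 0 ==> EV n. \<forall>s. adapted (s + p n) eps (\<lambda>x. u n ((T^^s) x))"
  and av: "\<And>eps. eps > 0 ==> EV n. \<forall>q\<ge>e n. adapted q eps (v n)"
  and A: "A \<in> atoms"
 shows "(\<lambda>n. coef A (\<lambda>x. u n x * v n ((T^^p n) x)) - coef A (u n) * coef A (v n)) \<leadsto> 0"
proof -
 note ub = nice_unit_bounded[OF u]
 note indA = invariant_event_indicator[OF atom_invariant[OF A]]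
 define I where "I n = invariant_part (\<lambda>A. coef A (u n))" for n
 have I_nice: "nice (I n)" for n
  unfolding I_def by (rule invariant_part_nice) (rule coef_le[OF _ ub])
 note Ib = nice_unit_bounded[OF I_nice]
 define w where "w n x = (u n x - I n x) / 2" for n x
 have w_nice: "nice (w n)" for n unfolding w_def[abs_def] by (rule nice_half_diff[OF u I_nice])
 note wb = nice_unit_bounded[OF w_nice]
 define v' where "v' n x = v n x * indicator A x" for n x
 have v'b: "unit_bounded (v' n)" for n unfolding v'_def[abs_def] by (rule unit_bounded_mult[OF v indA(3)])
 have I_int: "(\<E> x. I n x * indicator A' x) = (\<E> x. u n x * indicator A' x)" if A': "A' \<in> atoms" for n A'
 proof -
  have "(\<E> x. I n x * indicator A' x) = (\<E> x. coef A' (u n) * indicator A' x)"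
   by (rule Bochner_Integration.integral_cong)
    (use invariant_part_on_atom[OF A'] in \<open>auto simp: I_def indicator_def\<close>)
  also have "... = coef A' (u n) * measure m A'" using atom_sets[OF A'] by simp
  finally show ?thesis using atom_pos[OF A'] by (simp add: coef_def)
 qed
 have null: "weakly_null w"
 proof (rule weakly_null_atoms[OF wb \<delta>])
  fix k x assume x: "x \<in> space m"
  have "w k (T x) - w k x = (u k (T x) - u k x) / 2"
   by (simp add: w_def I_def invariant_part_invariant[OF x] field_simps)
  then have "abs (w k (T x) - w k x) = abs (u k (T x) - u k x) / 2"
   by (simp only: abs_divide abs_numeral)
  then show "abs (w k (T x) - w k x) <= \<delta> k"
   using near[OF x, of k] abs_ge_zero[of "u k (T x) - u k x"] by argo
 next
  fix A' assume A': "A' \<in> atoms"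
  note ind' = invariant_event_indicator(3)[OF atom_invariant[OF A']]
  have "(\<E> x. w k x * indicator A' x) = (\<E> x. (1/2) * (u k x * indicator A' x - I k x * indicator A' x))" for k
   by (rule Bochner_Integration.integral_cong) (simp_all add: w_def left_diff_distrib[symmetric])
  also have "(\<E> x. (1/2) * (u k x * indicator A' x - I k x * indicator A' x)) = 0" for k
   using unit_bounded_integrable[OF unit_bounded_mult[OF ub[of k] ind']]
    unit_bounded_integrable[OF unit_bounded_mult[OF Ib[of k] ind']] I_int[OF A', of k] by simp
  finally show "(\<lambda>k. (\<E> x. w k x * indicator A' x)) \<leadsto> 0" by simp
 qed
 have aw: "EV n. \<forall>s. adapted (s + p n) eps (\<lambda>x. w n ((T^^s) x))" if eps: "eps > 0" for eps
 proof -
  have "eps / 2 > 0" using eps by simp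
  from invariant_part_adapted[OF this] obtain R where
   R': "\<forall>q\<ge>R. \<forall>c. (\<forall>A\<in>atoms. abs (c A) <= 1) --> adapted q (eps / 2) (invariant_part c)" by (elim exE)
  have R: "adapted q (eps / 2) (invariant_part c)" if "q >= R" "\<And>A. A \<in> atoms ==> abs (c A) <= 1" for q c
   using R' that by simp
  have "EV n. p n >= R" using p by (simp add: filterlim_at_top)
  moreover have "EV n. \<forall>s. adapted (s + p n) (eps / 2) (\<lambda>x. u n ((T^^s) x))" using au[of "eps / 2"] eps by simp
  ultimately show ?thesis
  proof (eventually_elim, intro allI)
   fix n s assume pn: "R <= p n" and a: "\<forall>s. adapted (s + p n) (eps / 2) (\<lambda>x. u n ((T^^s) x))"
   have "adapted (s + p n) (eps / 2) (I n)"
    unfolding I_def by (rule R) (use pn coef_le[OF _ ub] in auto)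
   then have "adapted (s + p n) (eps / 2) (\<lambda>x. I n ((T^^s) x))"
    by (subst adapted_cong[of _ "I n"]) (auto simp: I_def invariant_part_iter)
   from adapted_half_diff[OF unit_bounded_iter[OF ub] unit_bounded_iter[OF Ib] a[rule_format] this]
   show "adapted (s + p n) eps (\<lambda>x. w n ((T^^s) x))" by (simp add: w_def)
  qed
 qed
 \<comment> \<open>The indicator of A is adapted only beyond some fixed length; with
   \<open>max (e n) n\<close> every admissible q eventually exceeds it.\<close>
 have av': "EV n. \<forall>q\<ge>max (e n) n. adapted q eps (v' n)" if eps: "eps > 0" for eps
 proof -
  obtain R where R: "\<And>q. q >= R ==> adapted q (eps / 2) (indicator A)"
   using invariant_event_adapted[OF atom_invariant[OF A], of "eps / 2"] eps by auto
  have "EV n. n >= R" by (rule eventually_ge_at_top)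
  moreover have "EV n. \<forall>q\<ge>e n. adapted q (eps / 2) (v n)" using av[of "eps / 2"] eps by simp
  ultimately show ?thesis
  proof (eventually_elim, intro allI impI)
   fix n q assume "R <= n" "\<forall>q\<ge>e n. adapted q (eps / 2) (v n)" "max (e n) n <= q"
   then have "adapted q (eps / 2) (v n)" "adapted q (eps / 2) (indicator A)" using R by auto
   from adapted_compose2[OF v indA(3) this, of "\<lambda>a b. a * b", OF _ abs_mult_diff_le unit_bounded_mult[OF v indA(3)]]
   show "adapted q eps (v' n)" by (simp add: v'_def[abs_def] abs_mult mult_le_one)
  qed
 qed
 have lim: "(\<lambda>n. (\<E> x. w n x * v' n ((T^^p n) x))) \<leadsto> 0"
  by (rule decoupling[OF w_nice v'b null aw av'])
 have eq: "coef A (\<lambda>x. u n x * v n ((T^^p n) x)) - coef A (u n) * coef A (v n) =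
   2 / measure m A * (\<E> x. w n x * v' n ((T^^p n) x))" for n
 proof -
  let ?V = "\<lambda>x. v n ((T^^p n) x)"
  note Vb = unit_bounded_iter[OF v, of n "p n"]
  have "(\<E> x. w n x * v' n ((T^^p n) x)) =
    (\<E> x. (1/2) * (u n x * ?V x * indicator A x - coef A (u n) * (?V x * indicator A x)))"
  proof (rule Bochner_Integration.integral_cong)
   fix x assume x: "x \<in> space m"
   have "indicator A ((T^^p n) x) = (indicator A x :: real)" by (rule invariant_iter[OF indA(4) x])
   then show "w n x * v' n ((T^^p n) x) = (1/2) * (u n x * ?V x * indicator A x - coef A (u n) * (?V x * indicator A x))"
    using invariant_part_on_atom[OF A, of x] by (cases "x \<in> A") (simp_all add: w_def v'_def I_def left_diff_distrib)
  qed simp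
  also have "... = (1/2) * ((\<E> x. u n x * ?V x * indicator A x) - coef A (u n) * (\<E> x. ?V x * indicator A x))"
   using unit_bounded_integrable[OF unit_bounded_mult[OF unit_bounded_mult[OF ub Vb] indA(3)], of n]
    unit_bounded_integrable[OF unit_bounded_mult[OF Vb indA(3)]] by simp
  finally have "2 / measure m A * (\<E> x. w n x * v' n ((T^^p n) x)) =
   coef A (\<lambda>x. u n x * ?V x) - coef A (u n) * coef A ?V"
   by (simp add: coef_def diff_divide_distrib)
  then show ?thesis using coef_iter[OF A v] by simp
 qed
 show ?thesis unfolding eq using tendsto_mult_right_zero[OF lim] by blast
qed

end

section \<open>Rigidity of power moments, normal laws and Lipschitz test functions\<close>

lemma common_convergent_subsequence:
 fixes z :: "'i => nat => complex"
 assumes "finite I" "\<And>i n. i \<in> I ==> norm (z i n) <= 1"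
 shows "\<exists>r l. strict_mono r \<and> (\<forall>i\<in>I. (\<lambda>n. z i (r n)) \<leadsto> l i)"
 using assms
proof (induction I rule: finite_induct)
 case empty
 show ?case by (auto intro: exI[of _ id] strict_mono_id)
next
 case (insert j I)
 have "\<exists>r l. strict_mono r \<and> (\<forall>i\<in>I. (\<lambda>n. z i (r n)) \<leadsto> l i)"
  by (rule insert.IH) (use insert.prems in auto)
 then obtain r l where r: "strict_mono r" "\<And>i. i \<in> I ==> (\<lambda>n. z i (r n)) \<leadsto> l i" by blast
 have "\<forall>n. z j (r n) \<in> cball 0 1" using insert.prems by auto
 then obtain a s where s: "strict_mono s" "((\<lambda>n. z j (r n)) \<circ> s) \<leadsto> a"
  using compact_cball[of "0::complex" 1] unfolding compact_def by metis
 have "(\<lambda>n. z i ((r \<circ> s) n)) \<leadsto> (if i = j then a else l i)" if "i \<in> insert j I" for i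
 proof (cases "i = j")
  case True
  then show ?thesis using s(2) by (simp add: comp_def)
 next
  case False
  then have "((\<lambda>n. z i (r n)) \<circ> s) \<leadsto> l i" using r(2) that s(1) by (intro LIMSEQ_subseq_LIMSEQ) auto
  then show ?thesis using False by (simp add: comp_def)
 qed
 then have "\<forall>i\<in>insert j I. (\<lambda>n. z i ((r \<circ> s) n)) \<leadsto> (if i = j then a else l i)" by (rule ballI)
 with strict_mono_o[OF r(1) s(1)] show ?case by (intro exI conjI)
qed

text \<open>Along a subsequence keeping \<open>z j\<close> away from c, limits \<open>l i\<close>
  exist and satisfy \<open>(\<Sum>i\<in>I. p i * R (l i)) = R c\<close> for every polynomial R. If R
  vanishes at all limits except c, the weights of the indices with limit c sum to 1, the total mass,
  which leaves none for j.\<close>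

lemma power_moments_rigidity:
 fixes z :: "'i => nat => complex" and p :: "'i => real"
 assumes fin: "finite I" and z: "\<And>i n. i \<in> I ==> norm (z i n) <= 1"
  and p: "\<And>i. i \<in> I ==> p i > 0"
  and mom: "\<And>k. (\<lambda>n. \<Sum>i\<in>I. of_real (p i) * z i n^k) \<leadsto> c^k" and j: "j \<in> I"
 shows "z j \<leadsto> c"
proof (rule ccontr)
 assume "\<not> z j \<leadsto> c"
 then obtain eps where eps: "eps > 0" "\<not> (EV n. dist (z j n) c < eps)" by (auto simp: tendsto_iff)
 define Q where "Q n \<longleftrightarrow> eps <= dist (z j n) c" for n
 have "\<exists>\<^sub>F n in sequentially. Q n" using eps(2) by (simp add: frequently_def not_le Q_def)
 then have "\<exists>\<^sub>\<infinity> n. Q n" by (simp add: cofinite_eq_sequentially)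
 then obtain s :: "nat => nat" where s: "strict_mono s" "\<And>n. Q (s n)"
  using infinite_enumerate[of "{n. Q n}"] by (auto simp: INFM_iff_infinite)
 have "\<exists>r l. strict_mono r \<and> (\<forall>i\<in>I. (\<lambda>n. z i (s (r n))) \<leadsto> l i)"
  by (rule common_convergent_subsequence[OF fin z])
 then obtain r l where r: "strict_mono r" and l: "\<And>i. i \<in> I ==> (\<lambda>n. z i (s (r n))) \<leadsto> l i" by blast
 have sr: "strict_mono (s \<circ> r)" using s(1) r by (rule strict_mono_o)
 have eq: "(\<Sum>i\<in>I. of_real (p i) * l i^k) = c^k" for k
 proof (rule LIMSEQ_unique)
  show "(\<lambda>n. \<Sum>i\<in>I. of_real (p i) * z i (s (r n))^k) \<leadsto> (\<Sum>i\<in>I. of_real (p i) * l i^k)"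
   by (intro tendsto_intros l)
  show "(\<lambda>n. \<Sum>i\<in>I. of_real (p i) * z i (s (r n))^k) \<leadsto> c^k"
   using LIMSEQ_subseq_LIMSEQ[OF mom sr] by (simp add: comp_def)
 qed
 have poly_eq: "(\<Sum>i\<in>I. of_real (p i) * poly R (l i)) = poly R c" for R
 proof -
  have "(\<Sum>i\<in>I. of_real (p i) * poly R (l i)) = (\<Sum>i\<in>I. \<Sum>k\<le>degree R. coeff R k * (of_real (p i) * l i^k))"
   by (simp add: poly_altdef sum_distrib_left ac_simps)
  also have "... = (\<Sum>k\<le>degree R. coeff R k * (\<Sum>i\<in>I. of_real (p i) * l i^k))"
   by (subst sum.swap) (simp add: sum_distrib_left)
  also have "... = poly R c" by (simp add: eq poly_altdef)
  finally show ?thesis .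
 qed
 define R where "R = (\<Prod>w\<in>l ` I - {c}. [:- w, 1:])"
 have R: "poly R x = (\<Prod>w\<in>l ` I - {c}. x - w)" for x by (simp add: R_def poly_prod)
 have Rc: "poly R c \<noteq> 0" unfolding R using fin by (auto simp: prod_zero_iff)
 have R0: "poly R (l i) = 0" if "i \<in> I" "l i \<noteq> c" for i
  unfolding R using fin that by (auto simp: prod_zero_iff)
 have lj: "l j \<noteq> c"
 proof
  assume "l j = c"
  then have "(\<lambda>n. dist (z j (s (r n))) c) \<leadsto> 0" using l[OF j] by (simp only: tendsto_dist_iff[THEN iffD1])
  then have "eps <= 0" by (rule LIMSEQ_le_const) (use s(2) in \<open>auto simp: Q_def\<close>)
  then show False using eps(1) by simp
 qed
 have "poly R c = (\<Sum>i\<in>I. of_real (p i) * poly R (l i))" by (rule poly_eq[symmetric])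
 also have "... = (\<Sum>i\<in>{i\<in>I. l i = c}. of_real (p i) * poly R (l i))"
  by (rule sum.mono_neutral_right) (use fin R0 in auto)
 also have "... = of_real (\<Sum>i\<in>{i\<in>I. l i = c}. p i) * poly R c"
  by (simp add: sum_distrib_right)
 finally have "of_real (\<Sum>i\<in>{i\<in>I. l i = c}. p i) = (1 :: complex)" using Rc by simp
 then have a: "(\<Sum>i\<in>{i\<in>I. l i = c}. p i) = 1" using of_real_eq_1_iff by blast
 have "of_real (\<Sum>i\<in>I. p i) = (1 :: complex)" using eq[of 0] by simp
 then have "(\<Sum>i\<in>I. p i) = 1" using of_real_eq_1_iff by blast
 moreover have "(\<Sum>i\<in>{i\<in>I. l i = c}. p i) < (\<Sum>i\<in>I. p i)"
  by (rule sum_strict_mono2[of _ _ j]) (use fin j lj p less_imp_le in auto)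
 ultimately show False using a by simp
qed

lemma normal_law_eq_distr:
 assumes "\<sigma> > 0"
 shows "normal_law 0 (\<sigma>^2) = distr std_normal_distribution borel (\<lambda>x. \<sigma> * x)"
proof -
 interpret std: prob_space std_normal_distribution by (rule prob_space_normal_density) simp
 have "distributed std_normal_distribution lborel (\<lambda>x. x) std_normal_density"
  by (auto simp: distributed_def distr_id2)
 from std.normal_density_affine[OF this, of \<sigma> 0]
 have "distributed std_normal_distribution lborel (\<lambda>x. \<sigma> * x) (normal_density 0 \<sigma>)" using assms by simp
 from distributed_distr_eq_density[OF this]
 have "density lborel (normal_density 0 \<sigma>) = distr std_normal_distribution lborel (\<lambda>x. \<sigma> * x)" by simp
 also have "... = distr std_normal_distribution borel (\<lambda>x. \<sigma> * x)" by (rule distr_cong) auto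
 finally show ?thesis using assms by (simp add: normal_law_def)
qed

lemma real_distribution_normal_law: "\<sigma> >= 0 ==> real_distribution (normal_law 0 (\<sigma>^2))"
proof (cases "\<sigma> = 0")
 case True
 then show ?thesis
  by (simp add: normal_law_def real_distribution_def real_distribution_axioms_def prob_space_return)
next
 case False
 assume "\<sigma> >= 0"
 with False have "\<sigma> > 0" by simp
 interpret std: prob_space std_normal_distribution by (rule prob_space_normal_density) simp
 show ?thesis unfolding normal_law_eq_distr[OF \<open>\<sigma> > 0\<close>]
  by (rule std.real_distribution_distr) simp
qed

lemma char_normal_law:
 assumes "\<sigma> >= 0"
 shows "char (normal_law 0 (\<sigma>^2)) t = of_real (exp (- ((\<sigma> * t)^2) / 2))"
proof (cases "\<sigma> = 0")
 case True
 then show ?thesis by (simp add: normal_law_def char_def integral_return)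
next
 case False
 with assms have \<sigma>: "\<sigma> > 0" by simp
 have "char (normal_law 0 (\<sigma>^2)) t = char std_normal_distribution (\<sigma> * t)"
  unfolding normal_law_eq_distr[OF \<sigma>] char_def by (subst integral_distr) (auto simp: ac_simps)
 then show ?thesis by (simp add: char_std_normal_distribution)
qed

definition bounded_lipschitz :: "real => (real => real) => bool" where
 "bounded_lipschitz L g \<longleftrightarrow> (\<forall>a. abs (g a) <= 1) \<and> (\<forall>a b. abs (g a - g b) <= L * abs (a - b))"

lemma bounded_lipschitzD:
 assumes "bounded_lipschitz L g"
 shows "abs (g a) <= 1" "abs (g a - g b) <= L * abs (a - b)"
 using assms by (auto simp: bounded_lipschitz_def)

lemma bounded_lipschitz_nonneg: "bounded_lipschitz L g ==> 0 <= L"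
 using order_trans[OF abs_ge_zero bounded_lipschitzD(2)[of L g 0 1]] by simp

lemma bounded_lipschitz_isCont:
 assumes g: "bounded_lipschitz L g"
 shows "isCont g x"
proof -
 have "L-lipschitz_on UNIV g"
  by (rule lipschitz_onI) (use bounded_lipschitzD(2)[OF g] bounded_lipschitz_nonneg[OF g] in \<open>auto simp: dist_real_def\<close>)
 then have "continuous_on UNIV g" by (rule lipschitz_on_continuous_on)
 then show ?thesis by (simp add: continuous_on_eq_continuous_at)
qed

lemma bounded_lipschitz_measurable: "bounded_lipschitz L g ==> g \<in> borel_measurable borel"
 by (intro borel_measurable_continuous_onI continuous_at_imp_continuous_on) (auto intro: bounded_lipschitz_isCont)

lemma bounded_lipschitz_cos: "bounded_lipschitz 1 cos"
proof -
 have "abs (cos a - cos b) <= abs (a - b)" for a b :: real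
 proof -
  have "abs (cos a - cos b) = 2 * abs (sin ((a + b) / 2)) * abs (sin ((b - a) / 2))"
   by (simp add: cos_diff_cos abs_mult)
  also have "... <= 2 * 1 * abs ((b - a) / 2)"
   by (intro mult_mono abs_sin_le_one abs_sin_x_le_abs_x) auto
  finally show ?thesis by simp
 qed
 then show ?thesis by (simp add: bounded_lipschitz_def)
qed

lemma bounded_lipschitz_sin: "bounded_lipschitz 1 sin"
proof -
 have "abs (sin a - sin b) <= abs (a - b)" for a b :: real
 proof -
  have "abs (sin a - sin b) = 2 * abs (sin ((a - b) / 2)) * abs (cos ((a + b) / 2))"
   by (simp add: sin_diff_sin abs_mult)
  also have "... <= 2 * abs ((a - b) / 2) * 1"
   by (intro mult_mono abs_cos_le_one abs_sin_x_le_abs_x) auto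
  finally show ?thesis by simp
 qed
 then show ?thesis by (simp add: bounded_lipschitz_def)
qed

section \<open>Lipschitz functions of Birkhoff sums, and conditional laws on the atoms\<close>

context quasi_bernoulli begin

lemma lipschitz_S_unit_bounded:
 assumes g: "bounded_lipschitz L g"
 shows "unit_bounded (\<lambda>x. g (\<theta> * S n x))"
proof -
 note [measurable] = bounded_lipschitz_measurable[OF g]
 have "(\<lambda>x. g (\<theta> * S n x)) \<in> borel_measurable m" by measurable
 then show ?thesis using bounded_lipschitzD(1)[OF g] by (simp add: unit_bounded_def)
qed

lemma lipschitz_S_diff:
 assumes g: "bounded_lipschitz L g"
 shows "abs (g (\<theta> * a) - g (\<theta> * b)) <= L * abs \<theta> * abs (a - b)"
proof -
 have "abs (g (\<theta> * a) - g (\<theta> * b)) <= L * abs (\<theta> * a - \<theta> * b)" by (rule bounded_lipschitzD(2)[OF g])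
 also have "... = L * abs \<theta> * abs (a - b)" by (simp add: right_diff_distrib[symmetric] abs_mult)
 finally show ?thesis .
qed

lemma lipschitz_S_nice:
 assumes g: "bounded_lipschitz L g"
 shows "nice (\<lambda>x. g (\<theta> * S n x))"
 unfolding nice_def
proof (intro conjI allI impI)
 show ub: "unit_bounded (\<lambda>x. g (\<theta> * S n x))" by (rule lipschitz_S_unit_bounded[OF g])
 note L0 = bounded_lipschitz_nonneg[OF g]
 fix eps :: real assume eps: "eps > 0"
 have "(\<lambda>k. L * abs \<theta> * (D * (2 * \<rho> ^ k))) \<leadsto> L * abs \<theta> * (D * (2 * 0))"
  by (intro tendsto_intros LIMSEQ_realpow_zero) (use rho in auto)
 then have "EV k. L * abs \<theta> * (D * (2 * \<rho> ^ k)) < eps"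
  using eps by (intro order_tendstoD(2)) auto
 then obtain R where R: "L * abs \<theta> * (D * (2 * \<rho> ^ R)) < eps" by (auto simp: eventually_sequentially)
 show "\<exists>R. \<forall>s\<ge>R. \<forall>e\<ge>R. adapted (s + e) eps (\<lambda>x. g (\<theta> * S n ((T^^s) x)))"
 \<comment> \<open>The sum occupies n places after time s, so the margin behind it is only
   \<open>e - n\<close>.\<close>
 proof (intro exI[of _ "R + n"] allI impI)
  fix s e assume se: "s >= R + n" "e >= R + n"
  show "adapted (s + e) eps (\<lambda>x. g (\<theta> * S n ((T^^s) x)))"
  proof (rule adapted_oscillation[OF unit_bounded_iter[OF ub]])
   fix x y assume x: "x \<in> space m" "y \<in> space m" "\<kappa> (s + e) x = \<kappa> (s + e) y"
   have "abs (S n ((T^^s) x) - S n ((T^^s) y)) <= D * (\<rho> ^ s + \<rho> ^ (e - n))"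
    by (rule S_oscillation_general[OF x]) (use se in auto)
   also have "... <= D * (\<rho> ^ R + \<rho> ^ R)"
    using se rho D_nonneg by (intro mult_left_mono add_mono power_decreasing) auto
   finally have "abs (S n ((T^^s) x) - S n ((T^^s) y)) <= D * (2 * \<rho> ^ R)" by simp
   then have "L * abs \<theta> * abs (S n ((T^^s) x) - S n ((T^^s) y)) <= L * abs \<theta> * (D * (2 * \<rho> ^ R))"
    using L0 by (intro mult_left_mono) auto
   then show "abs (g (\<theta> * S n ((T^^s) x)) - g (\<theta> * S n ((T^^s) y))) <= eps"
    using lipschitz_S_diff[OF g, of \<theta> "S n ((T^^s) x)" "S n ((T^^s) y)"] R by simp
  qed
 qed
qed

lemma S_shift_diff:
 assumes "x \<in> space m"
 shows "abs (S n (T x) - S n x) <= 2 * B"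
proof -
 have "S (1 + n) x = S 1 x + S n ((T^^1) x)" by (rule S_add)
 moreover have "S (n + 1) x = S n x + S 1 ((T^^n) x)" by (rule S_add)
 ultimately have "S n (T x) - S n x = S 1 ((T^^n) x) - S 1 x" by simp
 moreover have "abs (S 1 ((T^^n) x)) <= B" "abs (S 1 x) <= B"
  using S_bound[OF assms, of 1] S_bound[OF iter_space[OF assms], of 1 n] by auto
 ultimately show ?thesis by linarith
qed

lemma lipschitz_S_near:
 assumes g: "bounded_lipschitz L g" and x: "x \<in> space m"
 shows "abs (g (\<theta> * S n (T x)) - g (\<theta> * S n x)) <= L * abs \<theta> * (2 * B)"
proof -
 have "L * abs \<theta> * abs (S n (T x) - S n x) <= L * abs \<theta> * (2 * B)"
  using S_shift_diff[OF x] bounded_lipschitz_nonneg[OF g] by (intro mult_left_mono) auto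
 then show ?thesis using lipschitz_S_diff[OF g, of \<theta> "S n (T x)" "S n x"] by simp
qed

lemma lipschitz_S_adapted:
 assumes g: "bounded_lipschitz L g" and n: "s + n <= q"
 shows "adapted q (L * abs \<theta> * (2 * D)) (\<lambda>x. g (\<theta> * S n ((T^^s) x)))"
proof (rule adapted_oscillation[OF unit_bounded_iter[OF lipschitz_S_unit_bounded[OF g]]])
 fix x y assume x: "x \<in> space m" "y \<in> space m" "\<kappa> q x = \<kappa> q y"
 have "L * abs \<theta> * abs (S n ((T^^s) x) - S n ((T^^s) y)) <= L * abs \<theta> * (2 * D)"
  using S_oscillation[OF x n] bounded_lipschitz_nonneg[OF g] by (intro mult_left_mono) auto
 then show "abs (g (\<theta> * S n ((T^^s) x)) - g (\<theta> * S n ((T^^s) y))) <= L * abs \<theta> * (2 * D)"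
  using lipschitz_S_diff[OF g, of \<theta> "S n ((T^^s) x)" "S n ((T^^s) y)"] by simp
qed

text \<open>The factor \<open>\<theta> n\<close> tending to 0 does two things: it makes the
  functions nearly invariant, as T changes a Birkhoff sum by at most \<open>2 * B\<close>, and
  nearly constant on cells, where the sum oscillates by at most \<open>2 * D\<close>.\<close>

lemma lipschitz_S_coef_product:
 assumes g: "bounded_lipschitz L g" and h: "bounded_lipschitz L' h" and \<theta>: "\<theta> \<leadsto> 0"
  and k: "k > 0" and A: "A \<in> atoms"
 shows "(\<lambda>n. coef A (\<lambda>x. g (\<theta> n * S (k * n) x) * h (\<theta> n * S n ((T^^(k * n)) x))) -
  coef A (\<lambda>x. g (\<theta> n * S (k * n) x)) * coef A (\<lambda>x. h (\<theta> n * S n x))) \<leadsto> 0"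
proof (rule coef_product[where \<delta> = "\<lambda>n. L * abs (\<theta> n) * (2 * B)" and e = "\<lambda>n. n"])
 show "nice (\<lambda>x. g (\<theta> n * S (k * n) x))" for n by (rule lipschitz_S_nice[OF g])
 show "unit_bounded (\<lambda>x. h (\<theta> n * S n x))" for n by (rule lipschitz_S_unit_bounded[OF h])
 have small: "(\<lambda>n. c * abs (\<theta> n) * d) \<leadsto> 0" for c d
  using tendsto_mult[OF tendsto_mult[OF tendsto_const tendsto_rabs[OF \<theta>]] tendsto_const, of c d] by simp
 show "(\<lambda>n. L * abs (\<theta> n) * (2 * B)) \<leadsto> 0" by (rule small)
 show "abs (g (\<theta> n * S (k * n) (T x)) - g (\<theta> n * S (k * n) x)) <= L * abs (\<theta> n) * (2 * B)" if "x \<in> space m" for n x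
  by (rule lipschitz_S_near[OF g that])
 show "filterlim (\<lambda>n. k * n) at_top sequentially" using k by (intro mult_nat_left_at_top)
 show "EV n. \<forall>s. adapted (s + k * n) eps (\<lambda>x. g (\<theta> n * S (k * n) ((T^^s) x)))" if "eps > 0" for eps
  using order_tendstoD(2)[OF small \<open>eps > 0\<close>, of L "2 * D"]
  by eventually_elim (auto intro!: adapted_mono[OF lipschitz_S_adapted[OF g]])
 show "EV n. \<forall>q\<ge>n. adapted q eps (\<lambda>x. h (\<theta> n * S n x))" if "eps > 0" for eps
  using order_tendstoD(2)[OF small \<open>eps > 0\<close>, of L' "2 * D"]
 proof (eventually_elim, intro allI impI)
  fix n q assume "L' * abs (\<theta> n) * (2 * D) < eps" "n <= q"
  then show "adapted q eps (\<lambda>x. h (\<theta> n * S n x))"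
   using adapted_mono[OF lipschitz_S_adapted[OF h, of 0 n q "\<theta> n"]] by simp
 qed
qed (rule A)

lemma coef_add:
 assumes "A \<in> atoms" "unit_bounded u" "unit_bounded v"
 shows "coef A (\<lambda>x. u x + v x) = coef A u + coef A v" "coef A (\<lambda>x. u x - v x) = coef A u - coef A v"
proof -
 note i = unit_bounded_integrable[OF unit_bounded_mult[OF assms(2) invariant_event_indicator(3)[OF atom_invariant[OF assms(1)]]]]
  unit_bounded_integrable[OF unit_bounded_mult[OF assms(3) invariant_event_indicator(3)[OF atom_invariant[OF assms(1)]]]]
 show "coef A (\<lambda>x. u x + v x) = coef A u + coef A v" "coef A (\<lambda>x. u x - v x) = coef A u - coef A v"
  using i by (simp_all add: coef_def distrib_right left_diff_distrib add_divide_distrib diff_divide_distrib)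
qed

lemma integral_eq_sum_coef:
 assumes u: "unit_bounded u"
 shows "(\<E> x. u x) = (\<Sum>A\<in>atoms. measure m A * coef A u)"
proof -
 have one: "unit_bounded (invariant_part (\<lambda>_. 1))" by (rule invariant_part_unit_bounded) simp
 have "AE x in m. x \<notin> space m - \<Union>atoms"
 proof (rule AE_not_in)
  have "space m - \<Union>atoms \<in> sets m"
   using finite_atoms atom_sets by (intro sets.Diff sets.finite_Union) auto
  then show "space m - \<Union>atoms \<in> null_sets m" using atoms_cover by (auto simp: null_sets_def emeasure_eq_measure)
 qed
 with AE_space have ae: "AE x in m. u x = invariant_part (\<lambda>_. 1) x * u x"
 proof eventually_elim
  case (elim x)
  then obtain A where "A \<in> atoms" "x \<in> A" by auto
  then show ?case using invariant_part_on_atom[of A x "\<lambda>_. 1"] by simp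
 qed
 have "(\<E> x. u x) = (\<E> x. invariant_part (\<lambda>_. 1) x * u x)"
  by (rule integral_cong_AE[OF unit_boundedD(1)[OF u] unit_boundedD(1)[OF unit_bounded_mult[OF one u]] ae])
 also have "... = (\<Sum>A\<in>atoms. 1 * (\<E> x. u x * indicator A x))" by (rule integral_invariant_part[OF u])
 also have "... = (\<Sum>A\<in>atoms. measure m A * coef A u)"
  by (rule sum.cong) (use atom_pos in \<open>auto simp: coef_def less_imp_neq[THEN not_sym]\<close>)
 finally show ?thesis .
qed

definition atom_measure :: "'a set => 'a measure" where
 "atom_measure A = density m (\<lambda>x. ennreal (indicator A x / measure m A))"

lemma atom_measure_sets [simp, measurable_cong]: "sets (atom_measure A) = sets m"
 by (simp add: atom_measure_def)

lemma atom_measure_space [simp]: "space (atom_measure A) = space m"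
 by (simp add: atom_measure_def)

lemma prob_space_atom_measure: "A \<in> atoms ==> prob_space (atom_measure A)"
proof (rule prob_spaceI)
 assume A: "A \<in> atoms"
 note [measurable] = atom_sets[OF A]
 have "emeasure (atom_measure A) (space (atom_measure A)) = (\<integral>\<^sup>+x. ennreal (indicator A x / measure m A) \<partial>m)"
  unfolding atom_measure_def by (subst emeasure_density) (auto intro!: nn_integral_cong)
 also have "... = (\<integral>\<^sup>+x. ennreal (1 / measure m A) * indicator A x \<partial>m)"
  by (rule nn_integral_cong) (auto simp: indicator_def)
 also have "... = ennreal (1 / measure m A) * ennreal (measure m A)"
  by (subst nn_integral_cmult_indicator) (auto simp: emeasure_eq_measure)
 also have "... = 1" using atom_pos[OF A] by (simp add: ennreal_mult[symmetric])
 finally show "emeasure (atom_measure A) (space (atom_measure A)) = 1" .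
qed

lemma integral_atom_measure:
 assumes A: "A \<in> atoms" and u: "u \<in> borel_measurable m"
 shows "(\<integral>x. u x \<partial>atom_measure A) = coef A u"
proof -
 note [measurable] = atom_sets[OF A] u
 have "(\<integral>x. u x \<partial>atom_measure A) = (\<E> x. (indicator A x / measure m A) *\<^sub>R u x)"
  unfolding atom_measure_def by (rule integral_density) auto
 also have "... = (\<E> x. u x * indicator A x / measure m A)" by (simp add: mult.commute)
 finally show ?thesis by (simp add: coef_def)
qed

definition atom_law :: "'a set => nat => real measure" where
 "atom_law A n = distr (atom_measure A) borel (\<lambda>x. S n x / sqrt (real n))"

lemma real_distribution_atom_law: "A \<in> atoms ==> real_distribution (atom_law A n)"
 unfolding atom_law_def by (rule prob_space.real_distribution_distr[OF prob_space_atom_measure]) auto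

lemma integral_atom_law:
 assumes A: "A \<in> atoms" and g: "g \<in> borel_measurable borel"
 shows "(\<integral>y. g y \<partial>atom_law A n) = coef A (\<lambda>x. g (S n x / sqrt (real n)))"
 unfolding atom_law_def
 by (subst integral_distr) (use g in \<open>auto intro!: integral_atom_measure[OF A]\<close>)

lemma real_distribution_law: "real_distribution (distr m borel (\<lambda>x. S n x / sqrt (real n)))"
 by (rule real_distribution_distr) auto

end

lemma char_eq_Complex:
 assumes "real_distribution M"
 shows "char M t = Complex (\<integral>x. cos (t * x) \<partial>M) (\<integral>x. sin (t * x) \<partial>M)"
proof -
 interpret real_distribution M by fact
 have i: "integrable M (\<lambda>x. iexp (t * x))"
  by (rule integrable_const_bound[of _ 1]) (auto intro!: AE_I2)
 show ?thesis
  using integral_Re[OF i] integral_Im[OF i] by (intro complex_eqI) (simp_all add: char_def Re_exp Im_exp)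
qed

locale quasi_bernoulli_clt = quasi_bernoulli +
 fixes \<sigma> :: real
 assumes sigma_nonneg: "\<sigma> >= 0"
  and clt: "weak_conv_m (\<lambda>n. distr m borel (\<lambda>x. birkhoff_sum T f n x / sqrt (real n))) (normal_law 0 (\<sigma>^2))"
begin

abbreviation W :: "real measure" where "W \<equiv> normal_law 0 (\<sigma>^2)"

lemma real_distribution_W: "real_distribution W"
 by (rule real_distribution_normal_law[OF sigma_nonneg])

text \<open>Stability of the normal law converts the central limit theorem into moments: at time
  \<open>k * n\<close> the argument \<open>t * sqrt k\<close> gives the limit \<open>c^k\<close>,
  while on each atom the characteristic function of \<open>S (k * n) / sqrt n\<close> is
  asymptotically the k-th power of that of \<open>S n / sqrt n\<close>.\<close>

lemma char_atom_law:
 assumes A: "A \<in> atoms"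
 shows "(\<lambda>n. char (atom_law A n) t) \<leadsto> char W t"
proof -
 define \<theta> where "\<theta> n = t / sqrt (real n)" for n
 define c where "c = char W t"
 define z where "z k A n = Complex (coef A (\<lambda>x. cos (\<theta> n * S (k * n) x))) (coef A (\<lambda>x. sin (\<theta> n * S (k * n) x)))" for k A n
 have \<theta>: "\<theta> \<leadsto> 0" unfolding \<theta>_def by real_asymp
 note C = bounded_lipschitz_cos and Sn = bounded_lipschitz_sin
 have z1: "z 1 A n = char (atom_law A n) t" if "A \<in> atoms" for A n
  using that by (simp add: char_eq_Complex[OF real_distribution_atom_law] integral_atom_law z_def \<theta>_def)
 \<comment> \<open>The addition formulas reduce the complex product to four real ones, each with
   bounded Lipschitz factors.\<close>
 have mult: "(\<lambda>n. z (Suc k) A n - z k A n * z 1 A n) \<leadsto> 0" if k: "k > 0" and A: "A \<in> atoms" for k A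
 proof -
  let ?a = "\<lambda>n x. \<theta> n * S (k * n) x" and ?b = "\<lambda>n x. \<theta> n * S n ((T^^(k * n)) x)" and ?e = "\<lambda>n x. \<theta> n * S n x"
  have add: "\<theta> n * S (Suc k * n) x = ?a n x + ?b n x" for n x
   using S_add[of "k * n" n x] by (simp add: add.commute distrib_left)
  have ub: "unit_bounded (\<lambda>x. cos (?a n x))" "unit_bounded (\<lambda>x. sin (?a n x))"
   "unit_bounded (\<lambda>x. cos (?b n x))" "unit_bounded (\<lambda>x. sin (?b n x))" for n
   using lipschitz_S_unit_bounded[OF C] lipschitz_S_unit_bounded[OF Sn]
    unit_bounded_iter[OF lipschitz_S_unit_bounded[OF C, of "\<theta> n" n], of "k * n"]
    unit_bounded_iter[OF lipschitz_S_unit_bounded[OF Sn, of "\<theta> n" n], of "k * n"] by auto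
  define d where "d n u v = coef A (\<lambda>x. u (?a n x) * v (?b n x)) - coef A (\<lambda>x. u (?a n x)) * coef A (\<lambda>x. v (?e n x))"
   for n and u v :: "real => real"
  have d: "(\<lambda>n. d n cos cos) \<leadsto> 0" "(\<lambda>n. d n sin sin) \<leadsto> 0" "(\<lambda>n. d n cos sin) \<leadsto> 0" "(\<lambda>n. d n sin cos) \<leadsto> 0"
   unfolding d_def by (rule lipschitz_S_coef_product[OF _ _ \<theta> k A], rule C Sn, rule C Sn)+
  have "z (Suc k) A n - z k A n * z 1 A n = Complex (d n cos cos - d n sin sin) (d n sin cos + d n cos sin)" for n
   unfolding z_def d_def add cos_add sin_add
   using coef_add[OF A unit_bounded_mult[OF ub(1,3)] unit_bounded_mult[OF ub(2,4)], of n]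
    coef_add[OF A unit_bounded_mult[OF ub(2,3)] unit_bounded_mult[OF ub(1,4)], of n]
   by (intro complex_eqI) simp_all
  moreover have "(\<lambda>n. Complex (d n cos cos - d n sin sin) (d n sin cos + d n cos sin)) \<leadsto> Complex (0 - 0) (0 + 0)"
   by (intro tendsto_Complex tendsto_intros d)
  ultimately show ?thesis by (simp add: zero_complex.code)
 qed
 have z_le: "norm (z 1 A n) <= 1" if "A \<in> atoms" for A n
  unfolding z1[OF that] by (rule real_distribution.cmod_char_le_1[OF real_distribution_atom_law[OF that]])
 have powers: "(\<lambda>n. z k A n - z 1 A n^k) \<leadsto> 0" if k: "k > 0" and A: "A \<in> atoms" for k A
  using k
 proof (induction k rule: nat_induct_non_zero)
  case 1
  show ?case by simp
 next
  case (Suc k)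
  have "(\<lambda>n. (z k A n - z 1 A n^k) * z 1 A n) \<leadsto> 0"
  proof (rule Lim_null_comparison[OF _ tendsto_norm_zero[OF Suc.IH]])
   show "EV n. norm ((z k A n - z 1 A n^k) * z 1 A n) <= norm (z k A n - z 1 A n^k)"
    using z_le[OF A] by (auto simp: norm_mult mult_left_le)
  qed
  from tendsto_add[OF mult[OF Suc.hyps A] this] show ?case by (simp add: algebra_simps)
 qed
 have total: "(\<Sum>A\<in>atoms. of_real (measure m A) * z k A n) = char (distr m borel (\<lambda>x. S (k * n) x / sqrt (real (k * n)))) (t * sqrt (real k))"
  if k: "k > 0" for k n
 proof -
  have eq: "t * sqrt (real k) * (S (k * n) x / sqrt (real (k * n))) = \<theta> n * S (k * n) x" for x
   using k by (simp add: \<theta>_def real_sqrt_mult)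
  have "(\<Sum>A\<in>atoms. of_real (measure m A) * z k A n) =
    Complex (\<Sum>A\<in>atoms. measure m A * coef A (\<lambda>x. cos (\<theta> n * S (k * n) x))) (\<Sum>A\<in>atoms. measure m A * coef A (\<lambda>x. sin (\<theta> n * S (k * n) x)))"
   by (intro complex_eqI) (simp_all add: z_def)
  also have "... = Complex (\<E> x. cos (\<theta> n * S (k * n) x)) (\<E> x. sin (\<theta> n * S (k * n) x))"
   by (simp add: integral_eq_sum_coef[OF lipschitz_S_unit_bounded[OF C]] integral_eq_sum_coef[OF lipschitz_S_unit_bounded[OF Sn]])
  also have "... = char (distr m borel (\<lambda>x. S (k * n) x / sqrt (real (k * n)))) (t * sqrt (real k))"
  proof -
   have d: "(\<integral>y. h (t * sqrt (real k) * y) \<partial>distr m borel (\<lambda>x. S (k * n) x / sqrt (real (k * n)))) = (\<E> x. h (\<theta> n * S (k * n) x))"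
    if [measurable]: "h \<in> borel_measurable borel" for h :: "real => real"
    unfolding eq[symmetric] by (rule integral_distr) measurable
   show ?thesis unfolding char_eq_Complex[OF real_distribution_law] by (subst (1 2) d) auto
  qed
  finally show ?thesis .
 qed
 have mom: "(\<lambda>n. \<Sum>A\<in>atoms. of_real (measure m A) * z 1 A n^k) \<leadsto> c^k" for k
 proof (cases "k = 0")
  case True
  have "unit_bounded (\<lambda>_. 1)" by (simp add: unit_bounded_def)
  from integral_eq_sum_coef[OF this] have "(\<Sum>A\<in>atoms. measure m A * coef A (\<lambda>_. 1)) = 1" by (simp add: prob_space)
  moreover have "coef A (\<lambda>_. 1) = 1" if "A \<in> atoms" for A
   using atom_pos[OF that] atom_sets[OF that] by (simp add: coef_def)
  ultimately have "(\<Sum>A\<in>atoms. measure m A) = 1" by simp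
  then have "(\<Sum>A\<in>atoms. of_real (measure m A)) = (1 :: complex)" by (metis of_real_1 of_real_sum)
  then show ?thesis using True by simp
 next
  case False
  then have k: "k > 0" by simp
  have "(\<lambda>n. char (distr m borel (\<lambda>x. S n x / sqrt (real n))) (t * sqrt (real k))) \<leadsto> char W (t * sqrt (real k))"
   by (rule levy_continuity1[OF real_distribution_law real_distribution_W clt])
  from filterlim_compose[OF this mult_nat_left_at_top[OF k]]
  have "(\<lambda>n. \<Sum>A\<in>atoms. of_real (measure m A) * z k A n) \<leadsto> char W (t * sqrt (real k))"
   by (simp add: total[OF k])
  moreover have "(\<lambda>n. \<Sum>A\<in>atoms. of_real (measure m A) * (z k A n - z 1 A n^k)) \<leadsto> (\<Sum>A\<in>atoms. of_real (measure m A) * 0)"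
   by (intro tendsto_intros powers[OF k])
  ultimately have "(\<lambda>n. (\<Sum>A\<in>atoms. of_real (measure m A) * z k A n) - (\<Sum>A\<in>atoms. of_real (measure m A) * (z k A n - z 1 A n^k)))
    \<leadsto> char W (t * sqrt (real k)) - (\<Sum>A\<in>atoms. of_real (measure m A) * 0)" by (rule tendsto_diff)
  moreover have "char W (t * sqrt (real k)) = c^k"
  proof -
   have "exp (- ((\<sigma> * (t * sqrt (real k)))^2) / 2) = exp (real k * (- ((\<sigma> * t)^2) / 2))"
    by (simp add: power_mult_distrib)
   also have "... = exp (- ((\<sigma> * t)^2) / 2)^k" by (rule exp_of_nat_mult)
   finally show ?thesis by (simp add: c_def char_normal_law[OF sigma_nonneg] del: of_real_exp)
  qed
  ultimately show ?thesis by (simp add: right_diff_distrib sum_subtractf)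
 qed
 have "z 1 A \<leadsto> c"
  by (rule power_moments_rigidity[OF finite_atoms z_le _ mom A]) (use atom_pos in auto)
 moreover have "z 1 A = (\<lambda>n. char (atom_law A n) t)" by (rule ext) (rule z1[OF A])
 ultimately show ?thesis by (simp only: c_def)
qed

lemma clt_on_atoms:
 assumes g: "bounded_lipschitz L g" and A: "A \<in> atoms"
 shows "(\<lambda>n. coef A (\<lambda>x. g (S n x / sqrt (real n)))) \<leadsto> (\<integral>y. g y \<partial>W)"
proof -
 have w: "weak_conv_m (atom_law A) W"
  by (rule levy_continuity[OF real_distribution_atom_law[OF A] real_distribution_W char_atom_law[OF A]])
 have "(\<lambda>n. \<integral>y. g y \<partial>atom_law A n) \<leadsto> (\<integral>y. g y \<partial>W)"
  by (rule weak_conv_imp_integral_bdd_continuous_conv[OF real_distribution_atom_law[OF A] real_distribution_W w, of g 1])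
   (use bounded_lipschitz_isCont[OF g] bounded_lipschitzD(1)[OF g] in auto)
 then show ?thesis by (simp add: integral_atom_law[OF A bounded_lipschitz_measurable[OF g]])
qed

end

section \<open>Covariances, moments and large deviations\<close>

context quasi_bernoulli_clt begin

text \<open>Halving the centred function keeps it bounded by 1.\<close>

definition \<xi> :: "(real => real) => nat => 'a => real" where
 "\<xi> g k x = (g (S k x / sqrt (real k)) - (\<integral>y. g y \<partial>W)) / 2"

lemma mean_W_le: "bounded_lipschitz L g ==> abs (\<integral>y. g y \<partial>W) <= 1"
proof -
 assume g: "bounded_lipschitz L g"
 interpret W: real_distribution W by (rule real_distribution_W)
 have i: "integrable W g"
  by (rule W.integrable_const_bound[of _ 1]) (use bounded_lipschitzD(1)[OF g] bounded_lipschitz_measurable[OF g] in auto)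
 have "abs (\<integral>y. g y \<partial>W) <= (\<integral>y. abs (g y) \<partial>W)" by (rule integral_abs_bound)
 also have "... <= (\<integral>y. 1 \<partial>W)" by (rule integral_mono) (use i bounded_lipschitzD(1)[OF g] in auto)
 finally show ?thesis using W.prob_space by simp
qed

lemma \<xi>_alt: "\<xi> g k x = (g ((1 / sqrt (real k)) * S k x) - (\<integral>y. g y \<partial>W)) / 2"
 by (simp add: \<xi>_def)

lemma \<xi>_nice: "bounded_lipschitz L g ==> nice (\<xi> g k)"
 unfolding \<xi>_alt[abs_def] by (intro nice_half_diff lipschitz_S_nice nice_const mean_W_le)

lemma \<xi>_near:
 assumes g: "bounded_lipschitz L g" and x: "x \<in> space m"
 shows "abs (\<xi> g k (T x) - \<xi> g k x) <= L * (1 / sqrt (real k)) * (2 * B)"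
proof -
 have "\<xi> g k (T x) - \<xi> g k x = (g ((1 / sqrt (real k)) * S k (T x)) - g ((1 / sqrt (real k)) * S k x)) / 2"
  unfolding \<xi>_alt by (simp add: diff_divide_distrib)
 then have "abs (\<xi> g k (T x) - \<xi> g k x) = abs (g ((1 / sqrt (real k)) * S k (T x)) - g ((1 / sqrt (real k)) * S k x)) / 2"
  by (simp only: abs_divide abs_numeral)
 also have "... <= abs (g ((1 / sqrt (real k)) * S k (T x)) - g ((1 / sqrt (real k)) * S k x))" by simp
 also have "... <= L * abs (1 / sqrt (real k)) * (2 * B)" by (rule lipschitz_S_near[OF g x])
 finally show ?thesis by simp
qed

lemma \<xi>_adapted:
 assumes g: "bounded_lipschitz L g" and n: "s + k <= q"
 shows "adapted q (L * (1 / sqrt (real k)) * (2 * D)) (\<lambda>x. \<xi> g k ((T^^s) x))"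
proof -
 let ?c = "\<integral>y. g y \<partial>W"
 have c: "unit_bounded (\<lambda>_. ?c)" using mean_W_le[OF g] by (simp add: unit_bounded_def)
 have "adapted q 0 (\<lambda>_. ?c)" unfolding adapted_def using mean_W_le[OF g] by (intro exI[of _ "\<lambda>_. ?c"]) simp
 from adapted_half_diff[OF unit_bounded_iter[OF lipschitz_S_unit_bounded[OF g]] c lipschitz_S_adapted[OF g n] this, of "1 / sqrt (real k)"]
 show ?thesis by (simp add: \<xi>_alt)
qed

lemma inverse_sqrt_small: "(\<lambda>n. c * (1 / sqrt (real n)) * d) \<leadsto> 0"
 by real_asymp

lemma \<xi>_weakly_null:
 assumes g: "bounded_lipschitz L g"
 shows "weakly_null (\<xi> g)"
proof (rule weakly_null_atoms[OF nice_unit_bounded[OF \<xi>_nice[OF g]] inverse_sqrt_small \<xi>_near[OF g]])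
 fix A assume A: "A \<in> atoms"
 have eq: "(\<E> x. \<xi> g k x * indicator A x) = measure m A / 2 * (coef A (\<lambda>x. g (S k x / sqrt (real k))) - (\<integral>y. g y \<partial>W))" for k
 proof -
  let ?c = "\<integral>y. g y \<partial>W"
  have i: "integrable m (\<lambda>x. g (S k x / sqrt (real k)) * indicator A x)"
   using unit_bounded_integrable[OF unit_bounded_mult[OF lipschitz_S_unit_bounded[OF g, of "1 / sqrt (real k)" k]
     invariant_event_indicator(3)[OF atom_invariant[OF A]]]] by simp
  have i2: "integrable m (\<lambda>x. ?c * indicator A x)"
   by (intro integrable_mult_right unit_bounded_integrable[OF invariant_event_indicator(3)[OF atom_invariant[OF A]]])
  have "(\<E> x. \<xi> g k x * indicator A x) = (\<E> x. (1/2) * (g (S k x / sqrt (real k)) * indicator A x - ?c * indicator A x))"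
   by (rule Bochner_Integration.integral_cong) (simp_all add: \<xi>_def left_diff_distrib[symmetric])
  also have "... = (1/2) * ((\<E> x. g (S k x / sqrt (real k)) * indicator A x) - ?c * measure m A)"
   using i i2 atom_sets[OF A] by simp
  finally show ?thesis using atom_pos[OF A] by (simp add: coef_def right_diff_distrib diff_divide_distrib)
 qed
 have "(\<lambda>k. measure m A / 2 * (coef A (\<lambda>x. g (S k x / sqrt (real k))) - (\<integral>y. g y \<partial>W))) \<leadsto>
   measure m A / 2 * ((\<integral>y. g y \<partial>W) - (\<integral>y. g y \<partial>W))"
  by (intro tendsto_intros clt_on_atoms[OF g A])
 then show "(\<lambda>k. (\<E> x. \<xi> g k x * indicator A x)) \<leadsto> 0" unfolding eq by simp
qed

lemma weakly_null_compose:
 assumes "weakly_null u" "filterlim p at_top sequentially"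
 shows "weakly_null (\<lambda>n. u (p n))"
 unfolding weakly_null_def
proof (intro allI impI)
 fix w and eps :: real assume "nice w" "eps > 0"
 then have "EV n. \<forall>s s'. abs (\<E> x. w ((T^^s) x) * u n ((T^^s') x)) <= eps"
  using assms(1) by (simp add: weakly_null_def)
 from eventually_compose_filterlim[OF this assms(2)]
 show "EV n. \<forall>s s'. abs (\<E> x. w ((T^^s) x) * u (p n) ((T^^s') x)) <= eps" .
qed

lemma \<xi>_decoupling:
 assumes g: "bounded_lipschitz L g" and p: "filterlim p at_top sequentially" and q: "filterlim q at_top sequentially"
 shows "(\<lambda>n. (\<E> x. \<xi> g (p n) x * \<xi> g (q n) ((T^^p n) x))) \<leadsto> 0"
proof (rule decoupling[where e = q])
 have small: "EV n. L * (1 / sqrt (real (r n))) * (2 * D) < eps"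
  if "filterlim r at_top sequentially" "eps > 0" for r eps
  by (rule eventually_compose_filterlim[OF order_tendstoD(2)[OF inverse_sqrt_small that(2)] that(1)])
 show "nice (\<xi> g (p n))" "unit_bounded (\<xi> g (q n))" for n
  by (rule \<xi>_nice[OF g], rule nice_unit_bounded[OF \<xi>_nice[OF g]])
 show "weakly_null (\<lambda>n. \<xi> g (p n))" by (rule weakly_null_compose[OF \<xi>_weakly_null[OF g] p])
 show "EV n. \<forall>s. adapted (s + p n) eps (\<lambda>x. \<xi> g (p n) ((T^^s) x))" if "eps > 0" for eps
  using small[OF p that] by eventually_elim (auto intro!: adapted_mono[OF \<xi>_adapted[OF g]])
 show "EV n. \<forall>k\<ge>q n. adapted k eps (\<xi> g (q n))" if "eps > 0" for eps
  using small[OF q that]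
 proof (eventually_elim, intro allI impI)
  fix n k assume "L * (1 / sqrt (real (q n))) * (2 * D) < eps" "q n <= k"
  then show "adapted k eps (\<xi> g (q n))" using adapted_mono[OF \<xi>_adapted[OF g, of 0 "q n" k]] by simp
 qed
qed

lemma \<xi>_decoupling_uniform:
 assumes g: "bounded_lipschitz L g" and eps: "eps > 0"
 shows "\<exists>R. \<forall>j\<ge>R. \<forall>k\<ge>R. abs (\<E> x. \<xi> g j x * \<xi> g k ((T^^j) x)) <= eps"
proof (rule ccontr)
 assume "\<not> ?thesis"
 then have "\<forall>R. \<exists>j k. j >= R \<and> k >= R \<and> abs (\<E> x. \<xi> g j x * \<xi> g k ((T^^j) x)) > eps" by (force simp: not_le)
 then obtain p q where pq: "\<And>R. p R >= R" "\<And>R. q R >= R"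
  "\<And>R. abs (\<E> x. \<xi> g (p R) x * \<xi> g (q R) ((T^^p R) x)) > eps" by metis
 have "filterlim p at_top sequentially" "filterlim q at_top sequentially"
  using pq(1,2) by (auto intro: filterlim_at_top_mono[OF filterlim_ident])
 from tendsto_rabs_zero[OF \<xi>_decoupling[OF g this]]
 have "eps <= 0" by (rule LIMSEQ_le_const) (use pq(3) less_imp_le in auto)
 then show False using eps by simp
qed

lemma integral_event: "A \<in> sets m ==> (\<E> x. indicator A x) = measure m A"
 by simp

text \<open>Convergence in law controls only large n; the finitely many others are covered by the
  trivial bound on S, at the price of a larger a.\<close>

lemma tight_S:
 assumes \<eta>: "\<eta> > 0"
 shows "\<exists>a>0. \<forall>n. measure m {x \<in> space m. abs (S n x) > a * sqrt (real n)} <= \<eta>"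
proof -
 interpret W: real_distribution W by (rule real_distribution_W)
 define g where "g a y = max 0 (min 1 (abs y - a))" for a y :: real
 have g_lip: "bounded_lipschitz 1 (g a)" for a
  unfolding bounded_lipschitz_def g_def by (intro conjI allI) (auto simp: max_def min_def abs_if)
 have gm [measurable]: "g a \<in> borel_measurable borel" for a by (rule bounded_lipschitz_measurable[OF g_lip])
 have "(\<lambda>n. \<integral>y. g (real n) y \<partial>W) \<leadsto> (\<integral>y. 0 \<partial>W)"
 proof (rule integral_dominated_convergence[where w = "\<lambda>_. 1"])
  show "AE y in W. (\<lambda>n. g (real n) y) \<leadsto> 0"
  proof (rule AE_I2)
   fix y :: real
   obtain N :: nat where N: "real N > abs y" using reals_Archimedean2 by blast
   have "EV n. g (real n) y = 0"
    by (rule eventually_sequentiallyI[of N]) (use N in \<open>auto simp: g_def\<close>)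
   then show "(\<lambda>n. g (real n) y) \<leadsto> 0" by (rule tendsto_eventually)
  qed
  show "AE y in W. norm (g (real n) y) <= 1" for n
   using bounded_lipschitzD(1)[OF g_lip] by (auto intro: AE_I2)
 qed auto
 then have "EV n. (\<integral>y. g (real n) y \<partial>W) < \<eta>" using \<eta> by (intro order_tendstoD(2)) auto
 then obtain a0 :: nat where a0: "(\<integral>y. g (real a0) y \<partial>W) < \<eta>" by (auto simp: eventually_sequentially)
 have "(\<lambda>n. \<integral>y. g (real a0) y \<partial>distr m borel (\<lambda>x. S n x / sqrt (real n))) \<leadsto> (\<integral>y. g (real a0) y \<partial>W)"
  by (rule weak_conv_imp_integral_bdd_continuous_conv[OF real_distribution_law real_distribution_W clt, of _ 1])
   (use bounded_lipschitz_isCont[OF g_lip] bounded_lipschitzD(1)[OF g_lip] in auto)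
 then have "(\<lambda>n. (\<E> x. g (real a0) (S n x / sqrt (real n)))) \<leadsto> (\<integral>y. g (real a0) y \<partial>W)"
  by (subst (asm) integral_distr) auto
 from order_tendstoD(2)[OF this a0] obtain N where
  N: "\<And>n. n >= N ==> (\<E> x. g (real a0) (S n x / sqrt (real n))) < \<eta>" by (auto simp: eventually_sequentially)
 \<comment> \<open>The ramp \<open>g a0\<close> equals 1 from \<open>a0 + 1\<close> on. For
   \<open>n < N\<close> the bound \<open>n * B\<close> is at most
   \<open>sqrt n * (sqrt N * B)\<close>, so the event is empty.\<close>
 define a where "a = max (real a0 + 1) (sqrt (real N) * B + 1)"
 have a: "a > 0" "a >= real a0 + 1" "a >= sqrt (real N) * B" by (auto simp: a_def)
 show ?thesis
 proof (intro exI[of _ a] conjI allI)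
  fix n
  show "measure m {x \<in> space m. abs (S n x) > a * sqrt (real n)} <= \<eta>"
  proof (cases "n >= N")
   case True
   have [measurable]: "{x \<in> space m. abs (S n x) > a * sqrt (real n)} \<in> sets m" by measurable
   have "measure m {x \<in> space m. abs (S n x) > a * sqrt (real n)} = (\<E> x. indicator {x \<in> space m. abs (S n x) > a * sqrt (real n)} x)"
    by (rule integral_event[symmetric]) measurable
   also have "... <= (\<E> x. g (real a0) (S n x / sqrt (real n)))"
   proof (rule integral_mono)
    show "integrable m (\<lambda>x. g (real a0) (S n x / sqrt (real n)))"
     by (rule integrable_bounded[of _ 1]) (use bounded_lipschitzD(1)[OF g_lip] in auto)
    show "integrable m (indicator {x \<in> space m. abs (S n x) > a * sqrt (real n)} :: 'a => real)"
     by (rule integrable_bounded[of _ 1]) (auto simp: indicator_def)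
    fix x assume x: "x \<in> space m"
    show "indicator {x \<in> space m. abs (S n x) > a * sqrt (real n)} x <= g (real a0) (S n x / sqrt (real n))"
    proof (cases "abs (S n x) > a * sqrt (real n)")
     case True
     have "n > 0"
     proof (rule ccontr)
      assume "\<not> n > 0"
      then have "S n x = 0" by (simp add: birkhoff_sum_def)
      then show False using True \<open>\<not> n > 0\<close> by simp
     qed
     then have "abs (S n x / sqrt (real n)) > a" using True by (simp add: abs_divide field_simps)
     then have "g (real a0) (S n x / sqrt (real n)) = 1" using a(2) by (simp add: g_def)
     then show ?thesis by (simp add: indicator_def)
    next
     case False
     then show ?thesis by (simp add: g_def)
    qed
   qed
   also have "... <= \<eta>" using N[OF True] by simp
   finally show ?thesis .
  next
   case False
   have "abs (S n x) <= a * sqrt (real n)" if "x \<in> space m" for x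
   proof -
    have "abs (S n x) <= sqrt (real n) * sqrt (real n) * B" using S_bound[OF that] by simp
    also have "... <= sqrt (real n) * (sqrt (real N) * B)"
     unfolding mult.assoc by (intro mult_left_mono mult_right_mono) (use False B_nonneg in auto)
    also have "... <= sqrt (real n) * a" using a(3) by (intro mult_left_mono) auto
    finally show ?thesis by (simp add: mult.commute)
   qed
   then have e: "{x \<in> space m. abs (S n x) > a * sqrt (real n)} = {}" by (auto simp: not_less)
   show ?thesis unfolding e using \<eta> by simp
  qed
 qed (rule a)
qed

lemma small_increment:
 assumes eps: "eps > 0" and L: "L >= 0"
 shows "\<exists>R>0. \<forall>j k. real k >= R * real j --> (\<E> x. min 1 (L * abs (S j x) / sqrt (real k))) <= eps"
proof -
 obtain a where a: "a > 0" "\<And>n. measure m {x \<in> space m. abs (S n x) > a * sqrt (real n)} <= eps / 2"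
  using tight_S[of "eps / 2"] eps by auto
 \<comment> \<open>Increments scale like square roots, hence the square; the summand 1 keeps R
   positive when L is 0.\<close>
 define R where "R = (2 * L * a / eps + 1)^2"
 have base: "2 * L * a / eps + 1 > 0" using a L eps by (intro add_nonneg_pos) auto
 have R: "R > 0" "sqrt R >= 2 * L * a / eps" using base by (auto simp: R_def)
 show ?thesis
 proof (intro exI[of _ R] conjI allI impI R(1))
  fix j k :: nat assume jk: "R * real j <= real k"
  let ?E = "{x \<in> space m. abs (S j x) > a * sqrt (real j)}"
  have pt: "min 1 (L * abs (S j x) / sqrt (real k)) <= indicator ?E x + eps / 2" if x: "x \<in> space m" for x
  proof (cases "x \<in> ?E")
   case True
   then show ?thesis using eps by (simp add: min_def)
  next
   case False
   then have Sj: "abs (S j x) <= a * sqrt (real j)" using x by auto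
   have "L * abs (S j x) / sqrt (real k) <= eps / 2"
   proof (cases "k = 0")
    case True
    then show ?thesis using eps by simp
   next
    case False
    have "sqrt R * sqrt (real j) <= sqrt (real k)" using jk by (simp add: real_sqrt_mult[symmetric])
    moreover have "(2 * L * a / eps) * sqrt (real j) <= sqrt R * sqrt (real j)" using R(2) by (intro mult_right_mono) auto
    ultimately have "(2 * L * a / eps) * sqrt (real j) <= sqrt (real k)" by linarith
    then have "L * (a * sqrt (real j)) <= eps / 2 * sqrt (real k)" using eps by (simp add: field_simps)
    moreover have "L * abs (S j x) <= L * (a * sqrt (real j))" using Sj L by (rule mult_left_mono)
    ultimately show ?thesis using False by (simp add: divide_le_eq)
   qed
   then have "min 1 (L * abs (S j x) / sqrt (real k)) <= eps / 2" by (rule min.coboundedI2)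
   moreover have "indicator ?E x = (0 :: real)" using False by simp
   ultimately show ?thesis by linarith
  qed
  have "(\<E> x. min 1 (L * abs (S j x) / sqrt (real k))) <= (\<E> x. indicator ?E x + eps / 2)"
  proof (rule integral_mono[OF _ _ pt])
   show "integrable m (\<lambda>x. min 1 (L * abs (S j x) / sqrt (real k)))"
    by (rule integrable_bounded[of _ 1]) (use L in auto)
   show "integrable m (\<lambda>x. indicator ?E x + eps / 2)"
    by (intro Bochner_Integration.integrable_add integrable_bounded[of "indicator ?E" 1]) (auto simp: indicator_def)
  qed
  also have "... = measure m ?E + eps / 2"
  proof -
   have "integrable m (indicator ?E :: 'a => real)" by (rule integrable_bounded[of _ 1]) (auto simp: indicator_def)
   moreover have "(\<E> x. indicator ?E x) = measure m ?E" by (rule integral_event) measurable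
   ultimately show ?thesis by (simp add: prob_space)
  qed
  also have "... <= eps" using a(2)[of j] by simp
  finally show "(\<E> x. min 1 (L * abs (S j x) / sqrt (real k))) <= eps" .
 qed
qed

lemma \<xi>_diff_le:
 assumes g: "bounded_lipschitz L g"
 shows "abs ((g (a / c) - w) / 2 - (g (b / c) - w) / 2) <= min 1 (L * abs (a - b) / abs c)"
proof -
 have "abs (g (a / c) - g (b / c)) <= L * abs (a / c - b / c)" by (rule bounded_lipschitzD(2)[OF g])
 also have "L * abs (a / c - b / c) = L * abs (a - b) / abs c" by (simp add: diff_divide_distrib[symmetric])
 finally have 1: "abs (g (a / c) - g (b / c)) <= L * abs (a - b) / abs c" .
 have 2: "abs ((g (a / c) - w) / 2 - (g (b / c) - w) / 2) = abs (g (a / c) - g (b / c)) / 2" by argo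
 have 3: "abs (g (a / c) - g (b / c)) <= 2" using bounded_lipschitzD(1)[OF g, of "a / c"] bounded_lipschitzD(1)[OF g, of "b / c"] by argo
 have "abs (g (a / c) - g (b / c)) / 2 <= abs (g (a / c) - g (b / c))" by simp
 then have "abs (g (a / c) - g (b / c)) / 2 <= L * abs (a - b) / abs c" using 1 by (rule order_trans)
 then show ?thesis unfolding 2 using 3 by (intro min.boundedI) simp
qed

text \<open>\<open>S k x\<close> and \<open>S k\<close> at \<open>(T^^j) x\<close> differ by
  \<open>S j x\<close> minus \<open>S j\<close> at \<open>(T^^k) x\<close>, both of order
  \<open>sqrt j\<close> and thus small against \<open>sqrt k\<close>. So the later function may be
  restarted at time j, where it decouples from the earlier one.\<close>

lemma \<xi>_covariance:
 assumes g: "bounded_lipschitz L g" and eps: "eps > 0"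
 shows "\<exists>R>0. \<forall>j k. real j >= R --> real k >= R * real j --> abs (\<E> x. \<xi> g j x * \<xi> g k x) <= eps"
proof -
 obtain R1 where R1: "\<And>j k. j >= R1 ==> k >= R1 ==> abs (\<E> x. \<xi> g j x * \<xi> g k ((T^^j) x)) <= eps / 3"
  using \<xi>_decoupling_uniform[OF g, of "eps / 3"] eps by auto
 obtain R2 where R2: "R2 > 0" "\<And>j k. real k >= R2 * real j ==> (\<E> x. min 1 (L * abs (S j x) / sqrt (real k))) <= eps / 3"
  using small_increment[of "eps / 3" L] eps bounded_lipschitz_nonneg[OF g] by auto
 note ub = nice_unit_bounded[OF \<xi>_nice[OF g]]
 show ?thesis
 proof (intro exI[of _ "max (max (real R1) R2) 1"] conjI allI impI)
  fix j k :: nat assume j: "max (max (real R1) R2) 1 <= real j" and k: "max (max (real R1) R2) 1 * real j <= real k"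
  have jR: "j >= R1" using j by simp
  have "1 * real j <= max (max (real R1) R2) 1 * real j" by (intro mult_right_mono) auto
  then have "real j <= real k" using k by linarith
  then have kR: "k >= R1" using jR by simp
  have "R2 * real j <= max (max (real R1) R2) 1 * real j" by (intro mult_right_mono) auto
  then have kj: "R2 * real j <= real k" using k by simp
  have meas: "(\<lambda>x. min 1 (L * abs (S j x) / sqrt (real k))) \<in> borel_measurable m" by measurable
  have int: "integrable m (\<lambda>x. min 1 (L * abs (S j ((T^^i) x)) / sqrt (real k)))" for i
   by (rule integrable_bounded[of _ 1]) (use bounded_lipschitz_nonneg[OF g] in auto)
  have "(\<E> x. abs (\<xi> g k x - \<xi> g k ((T^^j) x))) <=
   (\<E> x. min 1 (L * abs (S j x) / sqrt (real k)) + min 1 (L * abs (S j ((T^^k) x)) / sqrt (real k)))"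
  proof (rule integral_mono)
   show "integrable m (\<lambda>x. abs (\<xi> g k x - \<xi> g k ((T^^j) x)))"
    by (rule unit_bounded_diff_integrable[OF ub unit_bounded_iter[OF ub]])
   show "integrable m (\<lambda>x. min 1 (L * abs (S j x) / sqrt (real k)) + min 1 (L * abs (S j ((T^^k) x)) / sqrt (real k)))"
    using int[of 0] int[of k] by simp
   fix x
   have "S (j + k) x = S j x + S k ((T^^j) x)" "S (k + j) x = S k x + S j ((T^^k) x)" by (rule S_add)+
   then have d: "S k x - S k ((T^^j) x) = S j x - S j ((T^^k) x)" by (simp add: add.commute)
   have "abs (\<xi> g k x - \<xi> g k ((T^^j) x)) <= min 1 (L * abs (S j x - S j ((T^^k) x)) / abs (sqrt (real k)))"
    unfolding \<xi>_def d[symmetric] by (rule \<xi>_diff_le[OF g])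
   also have "... <= min 1 (L * abs (S j x) / sqrt (real k) + L * abs (S j ((T^^k) x)) / sqrt (real k))"
   proof (rule min.mono[OF order_refl])
    have "L * abs (S j x - S j ((T^^k) x)) <= L * (abs (S j x) + abs (S j ((T^^k) x)))"
     by (rule mult_left_mono[OF abs_triangle_ineq4 bounded_lipschitz_nonneg[OF g]])
    then show "L * abs (S j x - S j ((T^^k) x)) / abs (sqrt (real k)) <= L * abs (S j x) / sqrt (real k) + L * abs (S j ((T^^k) x)) / sqrt (real k)"
     by (simp add: add_divide_distrib[symmetric] divide_right_mono distrib_left)
   qed
   also have "... <= min 1 (L * abs (S j x) / sqrt (real k)) + min 1 (L * abs (S j ((T^^k) x)) / sqrt (real k))"
   proof -
    have "0 <= L * abs (S j x) / sqrt (real k)" "0 <= L * abs (S j ((T^^k) x)) / sqrt (real k)"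
     using bounded_lipschitz_nonneg[OF g] by auto
    then show ?thesis by linarith
   qed
   finally show "abs (\<xi> g k x - \<xi> g k ((T^^j) x)) <= min 1 (L * abs (S j x) / sqrt (real k)) + min 1 (L * abs (S j ((T^^k) x)) / sqrt (real k))" .
  qed
  also have "... = (\<E> x. min 1 (L * abs (S j x) / sqrt (real k))) + (\<E> x. min 1 (L * abs (S j x) / sqrt (real k)))"
   using int[of 0] int[of k] integral_iter[OF meas, of k] by simp
  also have "... <= eps / 3 + eps / 3" by (intro add_mono R2(2) kj)
  finally have "(\<E> x. abs (\<xi> g k x - \<xi> g k ((T^^j) x))) <= eps / 3 + eps / 3" .
  moreover have "abs ((\<E> x. \<xi> g k x * \<xi> g j x) - (\<E> x. \<xi> g k ((T^^j) x) * \<xi> g j x)) <= (\<E> x. abs (\<xi> g k x - \<xi> g k ((T^^j) x)))"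
   by (rule integral_mult_diff_le[OF ub unit_bounded_iter[OF ub] ub])
  moreover have "abs (\<E> x. \<xi> g k ((T^^j) x) * \<xi> g j x) <= eps / 3"
   using R1[OF jR kR] by (simp add: mult.commute)
  ultimately have "abs (\<E> x. \<xi> g k x * \<xi> g j x) <= eps" by linarith
  then show "abs (\<E> x. \<xi> g j x * \<xi> g k x) <= eps" by (simp add: mult.commute)
 qed simp
qed

end

section \<open>Exponential bounds over windows, and moments\<close>

context quasi_bernoulli begin

lemma window_prod_eq_prod:
 "window_prod T \<kappa> (map (\<lambda>i. (l i, \<phi> i)) [0..<r]) x = (\<Prod>i<r. \<phi> i (\<kappa> (l i) ((T^^(\<Sum>j<i. l j)) x)))"
proof (induction r)
 case (Suc r)
 have "sum_list (map fst (map (\<lambda>i. (l i, \<phi> i)) [0..<r])) = (\<Sum>j<r. l j)"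
  by (simp add: comp_def interv_sum_list_conv_sum_set_nat lessThan_atLeast0)
 then show ?case using Suc by (simp add: window_prod_append)
qed simp

lemma prod_mono_ennreal:
 fixes a b :: "nat => ennreal"
 shows "(\<And>i. a i <= b i) ==> (\<Prod>i<r. a i) <= (\<Prod>i<r. b i)"
 by (induction r) (auto intro: mult_mono)

text \<open>The infimum of \<open>G i\<close> over a cell depends on the name only and lies between
  \<open>F i\<close> and \<open>G i\<close> on that cell, so the bound for window products applies
  to it.\<close>

lemma nn_integral_windows:
 fixes F G :: "nat => 'a => ennreal"
 assumes dom: "\<And>i x y. x \<in> space m ==> y \<in> space m ==> \<kappa> (l i) x = \<kappa> (l i) y ==> F i x <= G i y"
 shows "(\<integral>\<^sup>+x. (\<Prod>i<r. F i ((T^^(\<Sum>j<i. l j)) x)) \<partial>m) <= (\<Prod>i<r. ennreal K * (\<integral>\<^sup>+x. G i x \<partial>m))"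
proof -
 define \<phi> where "\<phi> i a = (INF y\<in>{y \<in> space m. \<kappa> (l i) y = a}. G i y)" for i a
 have F\<phi>: "F i x <= \<phi> i (\<kappa> (l i) x)" if "x \<in> space m" for i x
  unfolding \<phi>_def by (rule INF_greatest) (use dom that in auto)
 have \<phi>G: "\<phi> i (\<kappa> (l i) x) <= G i x" if "x \<in> space m" for i x
  unfolding \<phi>_def by (rule INF_lower) (use that in auto)
 have "(\<integral>\<^sup>+x. (\<Prod>i<r. F i ((T^^(\<Sum>j<i. l j)) x)) \<partial>m) <=
   (\<integral>\<^sup>+x. window_prod T \<kappa> (map (\<lambda>i. (l i, \<phi> i)) [0..<r]) x \<partial>m)"
  unfolding window_prod_eq_prod by (intro nn_integral_mono prod_mono_ennreal) (auto intro!: F\<phi>)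
 also have "... <= (\<Prod>(l, \<phi>)\<leftarrow>map (\<lambda>i. (l i, \<phi> i)) [0..<r]. ennreal K * (\<integral>\<^sup>+x. \<phi> (\<kappa> l x) \<partial>m))"
  by (rule window_prod_bound)
 also have "... = (\<Prod>i<r. ennreal K * (\<integral>\<^sup>+x. \<phi> i (\<kappa> (l i) x) \<partial>m))"
  by (induction r) (auto simp: mult.commute)
 also have "... <= (\<Prod>i<r. ennreal K * (\<integral>\<^sup>+x. G i x \<partial>m))"
  by (intro prod_mono_ennreal mult_left_mono nn_integral_mono) (auto intro!: \<phi>G)
 finally show ?thesis .
qed

text \<open>The constant \<open>ln (4 * K)\<close> absorbs the loss of a factor \<open>K\<close> per window.\<close>

lemma window_large_deviations:
 fixes G H :: "nat => 'a => real" and n :: "nat => nat"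
 assumes n: "\<And>i. n (Suc i) = n i + l i"
  and G [measurable]: "\<And>i. G i \<in> borel_measurable m" 
  and dom: "\<And>i x y. x \<in> space m ==> y \<in> space m ==> \<kappa> (l i) x = \<kappa> (l i) y ==> G i x <= H i y"
  and H: "\<And>i. (\<integral>\<^sup>+x. ennreal (exp (H i x)) \<partial>m) <= 2"
 shows "AE x in m. EV r. (\<Sum>i<r. G i ((T^^n i) x)) <= real r * ln (4 * K)"
proof -
 define Z where "Z r x = (\<Sum>i<r. G i ((T^^(\<Sum>j<i. l j)) x))" for r x
 have [measurable]: "(\<lambda>x. G i ((T^^k) x)) \<in> borel_measurable m" for i k
  by (rule measurable_compose[OF iter_measurable G])
 have Zm [measurable]: "Z r \<in> borel_measurable m" for r unfolding Z_def[abs_def] by measurable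
 define A where "A r = {x \<in> space m. Z r ((T^^n 0) x) > real r * ln (4 * K)}" for r
 have [measurable]: "(\<lambda>x. Z r ((T^^n 0) x)) \<in> borel_measurable m" for r
  by (rule measurable_compose[OF iter_measurable Zm])
 have Am [measurable]: "A r \<in> sets m" for r unfolding A_def by measurable
 have K4: "4 * K > 0" using K_ge_1 by simp
 have bound: "emeasure m (A r) <= ennreal ((1/2)^r)" for r
 proof -
  have "(\<integral>\<^sup>+x. ennreal (exp (Z r x)) \<partial>m) = (\<integral>\<^sup>+x. (\<Prod>i<r. ennreal (exp (G i ((T^^(\<Sum>j<i. l j)) x)))) \<partial>m)"
   by (simp add: Z_def exp_sum prod_ennreal)
  also have "... <= (\<Prod>i<r. ennreal K * (\<integral>\<^sup>+x. ennreal (exp (H i x)) \<partial>m))"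
   by (rule nn_integral_windows) (use dom in \<open>auto intro!: ennreal_leI\<close>)
  also have "... <= (\<Prod>i<r. ennreal K * 2)" by (intro prod_mono_ennreal mult_left_mono H) auto
  also have "... = ennreal ((2 * K)^r)"
  proof -
   have "ennreal K * 2 = ennreal (2 * K)" using K_ge_1 by (simp add: ennreal_mult mult.commute)
   then show ?thesis using K_ge_1 by (simp add: ennreal_power)
  qed
  finally have *: "(\<integral>\<^sup>+x. ennreal (exp (Z r x)) \<partial>m) <= ennreal ((2 * K)^r)" .
  have "emeasure m (A r) = (\<integral>\<^sup>+x. indicator (A r) x \<partial>m)" by simp
  also have "... <= (\<integral>\<^sup>+x. ennreal (exp (- (real r * ln (4 * K)))) * ennreal (exp (Z r ((T^^n 0) x))) \<partial>m)"
  proof (rule nn_integral_mono)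
   fix x
   show "indicator (A r) x <= ennreal (exp (- (real r * ln (4 * K)))) * ennreal (exp (Z r ((T^^n 0) x)))"
    by (auto simp: A_def ennreal_mult[symmetric] exp_add[symmetric] split: split_indicator)
  qed
  also have "... = ennreal (exp (- (real r * ln (4 * K)))) * (\<integral>\<^sup>+x. ennreal (exp (Z r ((T^^n 0) x))) \<partial>m)"
   by (rule nn_integral_cmult) measurable
  also have "(\<integral>\<^sup>+x. ennreal (exp (Z r ((T^^n 0) x))) \<partial>m) = (\<integral>\<^sup>+x. ennreal (exp (Z r x)) \<partial>m)"
   by (rule nn_integral_iter[of "\<lambda>x. ennreal (exp (Z r x))"]) measurable
  also have "ennreal (exp (- (real r * ln (4 * K)))) * ... <= ennreal (exp (- (real r * ln (4 * K)))) * ennreal ((2 * K)^r)"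
   by (rule mult_left_mono[OF *]) simp
  also have "... = ennreal (exp (- (real r * ln (4 * K))) * (2 * K)^r)"
   using K_ge_1 by (simp add: ennreal_mult)
  \<comment> \<open>Each window contributes K from the product bound and 2 from H; one more factor 2
    in the threshold makes the probabilities summable, which explains 4.\<close>
  also have "exp (- (real r * ln (4 * K))) * (2 * K)^r = (1/2)^r"
  proof -
   have "exp (real r * ln (4 * K)) = (4 * K)^r" using K4 by (simp add: exp_of_nat_mult)
   then have "exp (- (real r * ln (4 * K))) = inverse ((4 * K)^r)" by (simp only: exp_minus)
   then have "exp (- (real r * ln (4 * K))) * (2 * K)^r = ((2 * K) / (4 * K))^r"
    by (subst power_divide) (simp only: divide_inverse mult.commute)
   also have "(2 * K) / (4 * K) = 1 / 2" using K_ge_1 by simp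
   finally show ?thesis .
  qed
  finally show ?thesis .
 qed
 have "AE x in m. EV r. x \<in> space m - A r"
 proof (rule borel_cantelli_AE1)
  show "emeasure m (A r) < \<infinity>" for r by (rule order.strict_trans1[OF bound]) simp
  have "summable (\<lambda>r. measure m (A r))"
  proof (rule summable_comparison_test[OF _ summable_geometric[of "1/2"]])
   have "measure m (A r) <= (1/2)^r" for r
    using bound[of r] by (simp add: emeasure_eq_measure)
   then show "\<exists>N. \<forall>r\<ge>N. norm (measure m (A r)) <= (1/2)^r" by auto
  qed simp
  then show "summable (\<lambda>r. measure m (A r))" .
 qed measurable
 then show ?thesis
 proof (rule AE_mp, intro AE_I2 impI)
  fix x assume x: "x \<in> space m" and ev: "EV r. x \<in> space m - A r"
  have ni: "n i = (\<Sum>j<i. l j) + n 0" for i by (induction i) (auto simp: n)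
  have Z_eq: "Z r ((T^^n 0) x) = (\<Sum>i<r. G i ((T^^n i) x))" for r
   unfolding Z_def by (subst (2) ni) (simp add: funpow_add)
  show "EV r. (\<Sum>i<r. G i ((T^^n i) x)) <= real r * ln (4 * K)"
   using ev by (rule eventually_mono) (use x Z_eq in \<open>auto simp: A_def not_less\<close>)
 qed
qed

text \<open>Cauchy-Schwarz for u and an indicator, read off from the square of u minus its best
  multiple of the indicator on A; the null case is separate because that multiple divides by the
  mass.\<close>

lemma integral_event_square:
 assumes u: "u \<in> borel_measurable m" "\<And>x. x \<in> space m ==> abs (u x) <= c" and A: "A \<in> sets m"
 shows "(\<E> x. u x * indicator A x)^2 <= (\<E> x. (u x)^2) * measure m A"
proof -
 note [measurable] = u(1) A
 have iA: "integrable m (indicator A :: 'a => real)" by (rule integrable_bounded[of _ 1]) (auto simp: indicator_def)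
 have c0: "c >= 0" using u(2) not_empty by (meson abs_ge_zero order_trans ex_in_conv)
 have iuA: "integrable m (\<lambda>x. u x * indicator A x)"
  by (rule integrable_bounded[of _ c]) (use u(2) c0 in \<open>auto simp: indicator_def\<close>)
 have iu: "integrable m (\<lambda>x. (u x)^2)"
 proof (rule integrable_bounded[of _ "c^2"])
  show "abs ((u x)^2) <= c^2" if "x \<in> space m" for x using power_mono[OF u(2)[OF that], of 2] by simp
 qed measurable
 let ?I = "(\<E> x. u x * indicator A x)" and ?p = "measure m A"
 show ?thesis
 proof (cases "?p = 0")
  case True
  have "abs ?I <= (\<E> x. abs (u x * indicator A x))" by (rule integral_abs_bound)
  also have "... <= (\<E> x. c * indicator A x)"
   by (rule integral_mono[OF integrable_abs[OF iuA] integrable_mult_right[OF iA]])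
    (use u(2) in \<open>auto simp: indicator_def\<close>)
  also have "... = 0" using True by simp
  finally show ?thesis by simp
 next
  case False
  then have p: "?p > 0" by (simp add: zero_less_measure_iff)
  have "0 <= (\<E> x. (u x - (?I / ?p) * indicator A x)^2)" by simp
  also have "(\<lambda>x. (u x - (?I / ?p) * indicator A x)^2) =
    (\<lambda>x. (u x)^2 - 2 * (?I / ?p) * (u x * indicator A x) + (?I / ?p)^2 * indicator A x)"
   by (auto simp: power2_eq_square algebra_simps indicator_def)
  also have "(\<E> x. (u x)^2 - 2 * (?I / ?p) * (u x * indicator A x) + (?I / ?p)^2 * indicator A x) =
    (\<E> x. (u x)^2) - 2 * (?I / ?p) * ?I + (?I / ?p)^2 * ?p"
   using iA iuA iu by simp
  also have "... = (\<E> x. (u x)^2) - ?I^2 / ?p" using p by (simp add: power2_eq_square field_simps)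
  finally show ?thesis using p by (simp add: field_simps)
 qed
qed

text \<open>Doubling the time turns the coefficient \<open>3 / 2\<close> into 3, below the factor 4
  by which \<open>n^2\<close> grows. This gap carries the induction in
  \<open>fourth_moment_dyadic\<close>. The difference of the sides is a sum of squares.\<close>

lemma power4_add_le: "(s + t)^4 <= 3 / 2 * (s^4 + t^4) + 22 * (s^2 * t^2)" for s t :: real
proof -
 have "3 / 2 * (s^4 + t^4) + 22 * (s^2 * t^2) - (s + t)^4 = 1 / 2 * (s^2 - 4 * s * t)^2 + 1 / 2 * (t^2 - 4 * s * t)^2"
  by (simp add: power2_eq_square power4_eq_xxxx algebra_simps)
 also have "... >= 0" by simp
 finally show ?thesis by simp
qed

lemma integrable_S_power: "integrable m (\<lambda>x. (S n x)^k)"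
proof (rule integrable_bounded)
 show "abs ((S n x)^k) <= (real n * B)^k" if "x \<in> space m" for x
  unfolding power_abs by (intro power_mono S_bound that) simp
qed measurable

text \<open>The mixed term is a product over two adjacent windows, so it is at most
  \<open>K^2\<close> times the square of a second moment, enlarged by the oscillation on
  cells.\<close>

lemma fourth_moment_step:
 "(\<E> x. (S (n + n) x)^4) <= 3 * (\<E> x. (S n x)^4) + 22 * K^2 * (2 * (\<E> x. (S n x)^2) + 8 * D^2)^2"
proof -
 have iT: "integrable m (\<lambda>x. (S n ((T^^n) x))^k)" for k
 proof (rule integrable_bounded)
  show "abs ((S n ((T^^n) x))^k) <= (real n * B)^k" if "x \<in> space m" for x
   unfolding power_abs by (intro power_mono S_bound iter_space that) simp
 qed measurable
 have ip: "integrable m (\<lambda>x. (S n x)^2 * (S n ((T^^n) x))^2)"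
 proof (rule integrable_bounded)
  show "abs ((S n x)^2 * (S n ((T^^n) x))^2) <= (real n * B)^2 * (real n * B)^2" if "x \<in> space m" for x
   unfolding abs_mult power_abs by (intro mult_mono power_mono S_bound iter_space that) auto
 qed measurable
 let ?V = "\<lambda>y. 2 * (S n y)^2 + 8 * D^2"
 have iV: "integrable m ?V" using integrable_S_power[of n 2] by simp
 have V0: "0 <= (\<E> x. ?V x)" by (rule Bochner_Integration.integral_nonneg) auto
 have dom: "(S n x)^2 <= ?V y" if "x \<in> space m" "y \<in> space m" "\<kappa> n x = \<kappa> n y" for x y
 proof -
  have "abs (S n x - S n y) <= 2 * D" using S_oscillation[OF that, of 0 n] by simp
  then have "abs (S n x) <= abs (S n y) + 2 * D" by linarith
  then have "abs (S n x)^2 <= (abs (S n y) + 2 * D)^2" by (rule power_mono) simp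
  also have "... <= 2 * abs (S n y)^2 + 8 * D^2"
   using zero_le_power2[of "abs (S n y) - 2 * D"] by (simp add: power2_eq_square algebra_simps)
  finally show ?thesis by simp
 qed
 have "ennreal (\<E> x. (S n x)^2 * (S n ((T^^n) x))^2) = (\<integral>\<^sup>+x. ennreal ((S n x)^2 * (S n ((T^^n) x))^2) \<partial>m)"
  by (rule nn_integral_eq_integral[symmetric]) (use ip in auto)
 also have "... = (\<integral>\<^sup>+x. (\<Prod>i<2::nat. ennreal ((S n ((T^^(\<Sum>j<i. n)) x))^2)) \<partial>m)"
  by (simp add: numeral_2_eq_2 ennreal_mult lessThan_Suc mult.commute)
 also have "... <= (\<Prod>i<2::nat. ennreal K * (\<integral>\<^sup>+x. ennreal (?V x) \<partial>m))"
  by (rule nn_integral_windows[where l = "\<lambda>_. n" and F = "\<lambda>_ x. ennreal ((S n x)^2)"]) (intro ennreal_leI dom)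
 also have "(\<integral>\<^sup>+x. ennreal (?V x) \<partial>m) = ennreal (\<E> x. ?V x)"
  by (rule nn_integral_eq_integral[OF iV]) auto
 also have "(\<Prod>i<2::nat. ennreal K * ennreal (\<E> x. ?V x)) = ennreal ((K * (\<E> x. ?V x))^2)"
  using K_ge_1 V0 by (simp add: ennreal_mult[symmetric] ennreal_power)
 finally have "(\<E> x. (S n x)^2 * (S n ((T^^n) x))^2) <= (K * (\<E> x. ?V x))^2"
  by (subst (asm) ennreal_le_iff) auto
 also have "(\<E> x. ?V x) = 2 * (\<E> x. (S n x)^2) + 8 * D^2"
  using integrable_S_power[of n 2] by (simp add: prob_space)
 finally have p: "(\<E> x. (S n x)^2 * (S n ((T^^n) x))^2) <= K^2 * (2 * (\<E> x. (S n x)^2) + 8 * D^2)^2"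
  by (simp add: power_mult_distrib)
 have "(\<E> x. (S (n + n) x)^4) <= (\<E> x. 3 / 2 * ((S n x)^4 + (S n ((T^^n) x))^4) + 22 * ((S n x)^2 * (S n ((T^^n) x))^2))"
 proof (rule integral_mono)
  show "integrable m (\<lambda>x. 3 / 2 * ((S n x)^4 + (S n ((T^^n) x))^4) + 22 * ((S n x)^2 * (S n ((T^^n) x))^2))"
   using integrable_S_power[of n 4] iT[of 4] ip by simp
  show "(S (n + n) x)^4 <= 3 / 2 * ((S n x)^4 + (S n ((T^^n) x))^4) + 22 * ((S n x)^2 * (S n ((T^^n) x))^2)" for x
   unfolding S_add by (rule power4_add_le)
 qed (rule integrable_S_power)
 also have "... = 3 / 2 * ((\<E> x. (S n x)^4) + (\<E> x. (S n ((T^^n) x))^4)) + 22 * (\<E> x. (S n x)^2 * (S n ((T^^n) x))^2)"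
  using integrable_S_power[of n 4] iT[of 4] ip by simp
 also have "(\<E> x. (S n ((T^^n) x))^4) = (\<E> x. (S n x)^4)"
  by (rule integral_iter[of "\<lambda>x. (S n x)^4"]) measurable
 finally show ?thesis using p by simp
qed

end

context quasi_bernoulli_clt begin

text \<open>Below the level \<open>a * sqrt n\<close> the square is trivially bounded; above it
  Cauchy-Schwarz brings in the fourth moment, multiplied by the small tail probability.\<close>

lemma second_moment_le:
 assumes a: "measure m {x \<in> space m. abs (S n x) > a * sqrt (real n)} <= \<eta>" "a > 0"
 shows "(\<E> x. (S n x)^2)^2 <= 2 * a^4 * (real n)^2 + 2 * \<eta> * (\<E> x. (S n x)^4)"
proof -
 let ?E = "{x \<in> space m. abs (S n x) > a * sqrt (real n)}"
 have E [measurable]: "?E \<in> sets m" by measurable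
 have iE: "integrable m (\<lambda>x. (S n x)^2 * indicator ?E x)"
  using integrable_S_power[of n 2] by (intro integrable_real_mult_indicator) auto
 have "(\<E> x. (S n x)^2) <= (\<E> x. a^2 * real n + (S n x)^2 * indicator ?E x)"
 proof (rule integral_mono)
  fix x assume x: "x \<in> space m"
  show "(S n x)^2 <= a^2 * real n + (S n x)^2 * indicator ?E x"
  proof (cases "x \<in> ?E")
   case False
   then have "abs (S n x) <= a * sqrt (real n)" using x by auto
   then have "abs (S n x)^2 <= (a * sqrt (real n))^2" by (rule power_mono) simp
   then show ?thesis using False by (simp add: power_mult_distrib)
  qed simp
 qed (use integrable_S_power[of n 2] iE in auto)
 also have "... = a^2 * real n + (\<E> x. (S n x)^2 * indicator ?E x)" using iE by (simp add: prob_space)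
 finally have 1: "(\<E> x. (S n x)^2) <= a^2 * real n + (\<E> x. (S n x)^2 * indicator ?E x)" (is "?u <= ?b + ?v") .
 have "?v^2 <= (\<E> x. ((S n x)^2)^2) * measure m ?E"
 proof (rule integral_event_square[OF _ _ E])
  show "abs ((S n x)^2) <= (real n * B)^2" if "x \<in> space m" for x
   unfolding power_abs by (intro power_mono S_bound that) simp
 qed measurable
 also have "... <= (\<E> x. (S n x)^4) * \<eta>"
  using a(1) by (simp add: power_mult[symmetric] mult_left_mono)
 finally have v: "?v^2 <= (\<E> x. (S n x)^4) * \<eta>" .
 have "?u^2 <= (?b + ?v)^2" using 1 by (rule power_mono) simp
 also have "... <= 2 * ?b^2 + 2 * ?v^2"
  using zero_le_power2[of "?b - ?v"] by (simp add: power2_eq_square algebra_simps)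
 also have "?b^2 = a^4 * (real n)^2" by (simp add: power_mult_distrib power_mult[symmetric])
 also have "2 * (a^4 * (real n)^2) + 2 * ?v^2 <= 2 * (a^4 * (real n)^2) + 2 * ((\<E> x. (S n x)^4) * \<eta>)"
  by (intro add_left_mono mult_left_mono v) simp
 also have "... = 2 * a^4 * (real n)^2 + 2 * \<eta> * (\<E> x. (S n x)^4)" by simp
 finally show ?thesis .
qed

lemma fourth_moment_dyadic: "\<exists>Y\<ge>0. \<forall>k. (\<E> x. (S (2^k) x)^4) <= Y * (2^k)^2"
proof -
 have K1: "1 <= K^2" using K_ge_1 by (simp add: one_le_power)
 \<comment> \<open>The tail enters with the factor \<open>22 * K^2 * 16 * \<eta> = 1 / 2\<close>,
   raising the coefficient of the fourth moment from 3 to \<open>7 / 2\<close>, still below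
   4.\<close>
 define \<eta> where "\<eta> = 1 / (704 * K^2)"
 have \<eta>: "\<eta> > 0" using K_ge_1 by (simp add: \<eta>_def)
 obtain a where a: "a > 0" "\<And>n. measure m {x \<in> space m. abs (S n x) > a * sqrt (real n)} <= \<eta>"
  using tight_S[OF \<eta>] by auto
 \<comment> \<open>\<open>4 * C0\<close> collects the terms free of the fourth moment. The step
   \<open>7 / 2 * Y + 4 * C0 <= 4 * Y\<close> asks for \<open>8 * C0 <= Y\<close>, and
   \<open>B^4\<close> covers the first moment of time.\<close>
 define C0 where "C0 = 88 * K^2 * a^4 + 704 * K^2 * D^4"
 define Y where "Y = B^4 + 8 * C0"
 have C0: "C0 >= 0" using a D_nonneg by (simp add: C0_def)
 have Y0: "Y >= 0" using C0 B_nonneg by (simp add: Y_def)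
 have "(\<E> x. (S (2^k) x)^4) <= Y * (2^k)^2" for k
 proof (induction k)
  case 0
  have "(\<E> x. (S 1 x)^4) <= (\<E> x. B^4)"
  proof (rule integral_mono[OF integrable_S_power])
   show "(S 1 x)^4 <= B^4" if "x \<in> space m" for x
    using power_mono[OF S_bound[OF that, of 1] abs_ge_zero, of 4] by (simp add: power_even_abs)
  qed simp
  then show ?case using C0 by (simp add: prob_space Y_def)
 next
  case (Suc k)
  let ?n = "2^k :: nat" and ?N = "2^k :: real"
  let ?e = "(\<E> x. (S ?n x)^4)" and ?u = "(\<E> x. (S ?n x)^2)"
  have N1: "?N >= 1" by simp
  have u: "?u^2 <= 2 * a^4 * ?N^2 + 2 * \<eta> * ?e"
   using second_moment_le[OF a(2) a(1), of ?n] by simp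
  have "(2 * ?u + 8 * D^2)^2 <= 8 * ?u^2 + 128 * D^4"
   using zero_le_power2[of "2 * ?u - 8 * D^2"] by (simp add: power2_eq_square power4_eq_xxxx algebra_simps)
  also have "... <= 8 * (2 * a^4 * ?N^2 + 2 * \<eta> * ?e) + 128 * D^4 * ?N^2"
  proof (intro add_mono mult_left_mono u)
   have "128 * D^4 * 1 <= 128 * D^4 * ?N^2" using N1 by (intro mult_left_mono one_le_power) auto
   then show "128 * D^4 <= 128 * D^4 * ?N^2" by simp
  qed simp
  finally have sq: "(2 * ?u + 8 * D^2)^2 <= 8 * (2 * a^4 * ?N^2 + 2 * \<eta> * ?e) + 128 * D^4 * ?N^2" .
  have "(\<E> x. (S (?n + ?n) x)^4) <= 3 * ?e + 22 * K^2 * (2 * ?u + 8 * D^2)^2" by (rule fourth_moment_step)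
  also have "... <= 3 * ?e + 22 * K^2 * (8 * (2 * a^4 * ?N^2 + 2 * \<eta> * ?e) + 128 * D^4 * ?N^2)"
   by (intro add_left_mono mult_left_mono sq) simp
  also have "3 * ?e + 22 * K^2 * (8 * (2 * a^4 * ?N^2 + 2 * \<eta> * ?e) + 128 * D^4 * ?N^2) = 7 / 2 * ?e + 4 * C0 * ?N^2"
   using K_ge_1 by (simp add: \<eta>_def C0_def field_simps)
  also have "... <= 7 / 2 * (Y * ?N^2) + 4 * C0 * ?N^2" using Suc by simp
  also have "... <= 4 * Y * ?N^2"
  proof -
   have "8 * C0 <= Y" using B_nonneg by (simp add: Y_def)
   then have "(8 * C0) * ?N^2 <= Y * ?N^2" by (intro mult_right_mono) auto
   then show ?thesis by argo
  qed
  also have "... = Y * (2^Suc k)^2" by (simp add: power2_eq_square)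
  finally show ?case by (simp add: mult_2[symmetric])
 qed
 then show ?thesis using Y0 by blast
qed

lemma second_moment_dyadic: "\<exists>V\<ge>0. \<forall>k. (\<E> x. (S (2^k) x)^2) <= V * 2^k"
proof -
 obtain Y where Y: "Y >= 0" "\<And>k. (\<E> x. (S (2^k) x)^4) <= Y * (2^k)^2" using fourth_moment_dyadic by blast
 have "(\<E> x. (S (2^k) x)^2) <= sqrt Y * 2^k" for k
 proof (rule power2_le_imp_le)
  have "(\<E> x. (S (2^k) x)^2)^2 <= (\<E> x. ((S (2^k) x)^2)^2)"
  proof (rule integral_square_le)
   show "abs ((S (2^k) x)^2) <= (real (2^k) * B)^2" if "x \<in> space m" for x
    unfolding power_abs by (intro power_mono S_bound that) simp
  qed measurable
  also have "... <= Y * (2^k)^2" using Y(2)[of k] by (simp add: power_mult[symmetric])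
  also have "... = (sqrt Y * 2^k)^2" using Y(1) by (simp add: power_mult_distrib)
  finally show "(\<E> x. (S (2^k) x)^2)^2 <= (sqrt Y * 2^k)^2" .
 qed (use Y in auto)
 then show ?thesis using Y(1) by (intro exI[of _ "sqrt Y"]) auto
qed

end

section \<open>Harmonic sums over blocks, and the duration of excursions\<close>

lemma harmonic_block_le:
 assumes "1 <= a"
 shows "(\<Sum>k=a..<a + Suc d. 1 / real k) <= 1 + ln (real (a + d) / real a)"
proof (induction d)
 case 0
 then show ?case using assms by simp
next
 case (Suc d)
 have pos: "real (a + d) > 0" using assms by simp
 have "1 / real (a + Suc d) = 1 - real (a + d) / real (a + Suc d)" using assms by (simp add: field_simps)
 also have "... <= - ln (real (a + d) / real (a + Suc d))"
  using ln_le_minus_one[of "real (a + d) / real (a + Suc d)"] pos by simp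
 also have "... = ln (real (a + Suc d)) - ln (real (a + d))" using pos by (subst ln_div) auto
 finally have s: "1 / real (a + Suc d) <= ln (real (a + Suc d)) - ln (real (a + d))" .
 have l: "ln (real (a + e) / real a) = ln (real (a + e)) - ln (real a)" for e using assms by (subst ln_div) auto
 show ?case using Suc s unfolding l by simp
qed

lemma harmonic_block:
 assumes "1 <= a" "a <= b"
 shows "(\<Sum>k=a..<b. 1 / real k) <= 1 + ln (real b / real a)"
proof (cases "a = b")
 case True
 then show ?thesis using assms by simp
next
 case False
 then obtain d where d: "b = a + Suc d" using assms(2) less_imp_Suc_add[of a b] by auto
 have "ln (real (a + d) / real a) <= ln (real b / real a)" using assms d by (intro ln_mono divide_right_mono) auto
 moreover have "(\<Sum>k=a..<b. 1 / real k) <= 1 + ln (real (a + d) / real a)"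
  unfolding d by (rule harmonic_block_le[OF assms(1)])
 ultimately show ?thesis by linarith
qed

lemma harmonic_block_ratio:
 assumes "1 <= a" "1 <= R"
 shows "(\<Sum>k\<in>{k\<in>{a..<b}. real k < R * real a}. 1 / real k) <= 1 + ln R"
proof -
 define d where "d = nat \<lceil>R * real a\<rceil> - a"
 have Ra: "real a <= R * real a" using assms by simp
 have c1: "a <= nat \<lceil>R * real a\<rceil>" using Ra by linarith
 show ?thesis
 proof (cases "d = 0")
  case True
  have "k < a" if "real k < R * real a" for k
  proof -
   have "nat \<lceil>R * real a\<rceil> = a" using True c1 unfolding d_def by linarith
   then have "R * real a <= real a" by linarith
   then show ?thesis using that by simp
  qed
  then have e: "{k\<in>{a..<b}. real k < R * real a} = {}" by fastforce
  show ?thesis unfolding e using assms(2) by simp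
 next
  case False
  then obtain e where e: "d = Suc e" using not0_implies_Suc by auto
  have nt: "nat \<lceil>R * real a\<rceil> = a + Suc e" using c1 e by (simp add: d_def)
  have "{k\<in>{a..<b}. real k < R * real a} \<subseteq> {a..<a + Suc e}"
  proof
   fix k assume "k \<in> {k\<in>{a..<b}. real k < R * real a}"
   then have "a <= k" "real k < R * real a" by auto
   then have "k < nat \<lceil>R * real a\<rceil>" by linarith
   then show "k \<in> {a..<a + Suc e}" using nt \<open>a <= k\<close> by simp
  qed
  then have "(\<Sum>k\<in>{k\<in>{a..<b}. real k < R * real a}. 1 / real k) <= (\<Sum>k=a..<a + Suc e. 1 / real k)"
   by (intro sum_mono2) auto
  also have "... <= 1 + ln (real (a + e) / real a)" by (rule harmonic_block_le[OF assms(1)])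
  also have "real (a + e) / real a <= R"
  proof -
   have "real (a + e) <= R * real a" using nt by linarith
   then show ?thesis using assms(1) by (simp add: divide_le_eq)
  qed
  then have "ln (real (a + e) / real a) <= ln R" using assms by (intro ln_mono) auto
  finally show ?thesis by simp
 qed
qed

lemma inverse_sqrt_cube_block:
 assumes "1 <= a"
 shows "(\<Sum>k=a..<b. 1 / (real k * sqrt (real k))) <= 3 / sqrt (real a)"
proof -
 \<comment> \<open>The subtracted term is the integral of \<open>x powr (-3/2)\<close> beyond
   \<open>a + d\<close>; keeping it makes the induction close.\<close>
 have "(\<Sum>k=a..<a + Suc d. 1 / (real k * sqrt (real k))) <= 3 / sqrt (real a) - 2 / sqrt (real (a + d))" for d
 proof (induction d)
  case 0
  have "1 / (real a * sqrt (real a)) <= 1 / (1 * sqrt (real a))"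
   using assms by (intro divide_left_mono mult_right_mono) auto
  then show ?case using assms by simp
 next
  case (Suc d)
  let ?u = "sqrt (real (a + d))" and ?v = "sqrt (real (a + Suc d))"
  have uv: "0 < ?u" "?u <= ?v" "?v^2 = ?u^2 + 1" using assms by auto
  have "?v^2 = ?v * ?v" "?u^2 = ?u * ?u" by (simp_all add: power2_eq_square)
  have le: "?u <= 2 * ?v * ?v * (?v - ?u)"
  proof -
   have d1: "(?v - ?u) * (?v + ?u) = 1" using uv(3) by (simp add: power2_eq_square algebra_simps)
   have "?u * 1 = ?u * ((?v - ?u) * (?v + ?u))" using d1 by simp
   also have "... <= ?v * ((?v - ?u) * (?v + ?v))" using uv by (intro mult_mono) auto
   finally show ?thesis by (simp add: algebra_simps)
  qed
  have key: "1 / (v * v * v) <= 2 / u - 2 / v" if "0 < u" "0 < v" "u <= 2 * v * v * (v - u)" for u v :: real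
  proof -
   have "2 / u - 2 / v - 1 / (v * v * v) = (2 * v * v * (v - u) - u) / (u * v * v * v)"
    using that by (simp add: field_simps)
   moreover have "... >= 0" using that by (intro divide_nonneg_pos) auto
   ultimately show ?thesis by linarith
  qed
  have "1 / (?v * ?v * ?v) <= 2 / ?u - 2 / ?v"
   by (rule key[OF uv(1) less_le_trans[OF uv(1,2)] le])
  moreover have "real (a + Suc d) = ?v * ?v" by simp
  ultimately have s: "1 / (real (a + Suc d) * ?v) <= 2 / ?u - 2 / ?v" by metis
  have "(\<Sum>k=a..<a + Suc (Suc d). 1 / (real k * sqrt (real k))) =
    (\<Sum>k=a..<a + Suc d. 1 / (real k * sqrt (real k))) + 1 / (real (a + Suc d) * ?v)" by simp
  then show ?case using Suc s by linarith
 qed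
 then have *: "(\<Sum>k=a..<a + Suc d. 1 / (real k * sqrt (real k))) <= 3 / sqrt (real a)" for d
  by (rule order_trans) simp
 have "(\<Sum>k=a..<b. 1 / (real k * sqrt (real k))) <= (\<Sum>k=a..<a + Suc b. 1 / (real k * sqrt (real k)))"
  by (intro sum_mono2) auto
 then show ?thesis using * by (rule order_trans)
qed

text \<open>Since \<open>M\<close> is contracted at every step, an excursion above the level \<open>A\<close> started by a large
 increment \<open>d\<close> lasts only logarithmically long.\<close>

lemma excursion_count:
 fixes M d :: "nat => real"
 assumes A: "A > 0" and q: "q > 2" and M: "\<And>i. 0 <= M i" and d: "\<And>i. 0 <= d i"
  and step: "\<And>i. M (Suc i) <= d i + M i / q"
 shows "ln (q / 2) * real (card {i. i < r \<and> A < M (Suc i)}) <=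
  ln (q / 2) * (\<Sum>i<r. if A < 2 * d i then 1 + ln (2 * d i / A) / ln (q / 2) else 0) + max 0 (ln (M 0 / A))"
proof -
 define \<beta> where "\<beta> = ln (q / 2)"
 have \<beta>: "\<beta> > 0" using q by (simp add: \<beta>_def)
 \<comment> \<open>\<Lambda> is a potential: the logarithmic height above A. A step that ends above
   A lowers it by at least \<beta> when contraction dominates, and otherwise the increment pays with
   \<open>\<beta> * l i\<close>.\<close>
 define \<Lambda> where "\<Lambda> i = (if A < M i then ln (M i / A) else 0)" for i
 define l where "l i = (if A < 2 * d i then 1 + ln (2 * d i / A) / \<beta> else 0)" for i
 have l0: "0 <= l i" for i using A \<beta> by (auto simp: l_def intro!: add_nonneg_nonneg divide_nonneg_pos ln_ge_zero)
 have \<Lambda>0: "0 <= \<Lambda> i" for i using A by (auto simp: \<Lambda>_def intro!: ln_ge_zero)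
 have main: "\<Lambda> (Suc i) + \<beta> * (if A < M (Suc i) then 1 else 0) <= \<Lambda> i + \<beta> * l i" for i
 proof (cases "A < M (Suc i)")
  case False
  then show ?thesis using l0[of i] \<Lambda>0[of i] \<beta> by (simp add: \<Lambda>_def)
 next
  case True
  show ?thesis
  \<comment> \<open>Whichever summand of \<open>d i + M i / q\<close> is larger bounds
    \<open>M (Suc i)\<close> by twice itself; this is why the contraction factor counts as
    \<open>q / 2\<close>.\<close>
  proof (cases "M i / q <= d i")
   case True': True
   have le: "M (Suc i) <= 2 * d i" using step[of i] True' by linarith
   then have "A < 2 * d i" using True by simp
   then have "\<beta> * l i = \<beta> + ln (2 * d i / A)" using \<beta> by (simp add: l_def distrib_left)
   moreover have "ln (M (Suc i) / A) <= ln (2 * d i / A)"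
    using le True A by (intro ln_mono divide_right_mono) auto
   ultimately show ?thesis using True \<Lambda>0[of i] by (simp add: \<Lambda>_def)
  next
   case False
   have le: "M (Suc i) <= 2 * (M i / q)" using step[of i] False by linarith
   have "A < 2 * (M i / q)" using le True by simp
   then have "A * q < 2 * M i" using q by (simp add: field_simps)
   moreover have "A * 2 < A * q" using A q by simp
   ultimately have AM: "A < M i" by simp
   have "ln (M (Suc i) / A) <= ln ((M i / A) / (q / 2))"
    using le True A q by (intro ln_mono) (auto simp: field_simps)
   also have "... = ln (M i / A) - \<beta>" unfolding \<beta>_def using AM A q by (subst ln_div) auto
   finally have "\<Lambda> (Suc i) + \<beta> <= \<Lambda> i" using True AM by (simp add: \<Lambda>_def)
   moreover have "0 <= \<beta> * l i" using l0[of i] \<beta> by simp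
   ultimately show ?thesis using True by simp
  qed
 qed
 have "\<Lambda> r + \<beta> * (\<Sum>i<r. if A < M (Suc i) then 1 else 0) <= \<Lambda> 0 + \<beta> * (\<Sum>i<r. l i)"
 proof (induction r)
  case (Suc r)
  then show ?case using main[of r] by (simp add: distrib_left)
 qed simp
 moreover have card_eq: "(\<Sum>i<r. if A < M (Suc i) then 1 else 0) = real (card {i. i < r \<and> A < M (Suc i)})"
 proof -
  have "(\<Sum>i<r. if A < M (Suc i) then 1 else 0 :: real) = (\<Sum>i\<in>{i\<in>{..<r}. A < M (Suc i)}. 1)"
   by (rule sum.inter_filter[symmetric]) simp
  also have "{i\<in>{..<r}. A < M (Suc i)} = {i. i < r \<and> A < M (Suc i)}" by auto
  finally show ?thesis by simp
 qed
 moreover have "\<Lambda> 0 <= max 0 (ln (M 0 / A))" by (simp add: \<Lambda>_def)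
 ultimately show ?thesis using \<Lambda>0[of r] unfolding \<beta>_def[symmetric] l_def card_eq by linarith
qed

section \<open>Blocks of the logarithmic sum\<close>

context quasi_bernoulli_clt begin

definition block :: "(real => real) => nat => nat => 'a => real" where
 "block g a b x = (\<Sum>k=a..<b. 1 / real k * \<xi> g k x)"

text \<open>Summation starts afresh at time a while the normalization stays \<open>sqrt k\<close>.
  Evaluated at \<open>(T^^a) x\<close>, the block depends on the window from a to b only and can be
  used in products over windows.\<close>

definition restarted_block :: "(real => real) => nat => nat => 'a => real" where
 "restarted_block g a b x = (\<Sum>k=a..<b. 1 / real k * ((g (S (k - a) x / sqrt (real k)) - (\<integral>y. g y \<partial>W)) / 2))"

lemma \<xi>_measurable: "bounded_lipschitz L g ==> \<xi> g k \<in> borel_measurable m"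
 by (rule unit_boundedD(1)[OF nice_unit_bounded[OF \<xi>_nice]])

lemma block_measurable: "bounded_lipschitz L g ==> block g a b \<in> borel_measurable m"
 unfolding block_def[abs_def] by (intro borel_measurable_sum borel_measurable_times borel_measurable_const \<xi>_measurable)

lemma restarted_block_measurable:
 assumes g: "bounded_lipschitz L g"
 shows "restarted_block g a b \<in> borel_measurable m"
proof -
 note [measurable] = bounded_lipschitz_measurable[OF g]
 show ?thesis unfolding restarted_block_def[abs_def] by measurable
qed

lemma restarted_term_le:
 assumes g: "bounded_lipschitz L g"
 shows "abs ((g a - (\<integral>y. g y \<partial>W)) / 2) <= 1"
 using bounded_lipschitzD(1)[OF g, of a] mean_W_le[OF g] by argo

lemma \<xi>_le: "bounded_lipschitz L g ==> abs (\<xi> g k x) <= 1"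
 unfolding \<xi>_def by (rule restarted_term_le)

lemma harmonic_sum_le:
 assumes "\<And>k. abs (v k) <= 1"
 shows "abs (\<Sum>k\<in>A. 1 / real k * v k) <= (\<Sum>k\<in>A. 1 / real k)"
proof -
 have "abs (\<Sum>k\<in>A. 1 / real k * v k) <= (\<Sum>k\<in>A. abs (1 / real k * v k))" by (rule sum_abs)
 also have "... <= (\<Sum>k\<in>A. 1 / real k)"
  by (rule sum_mono) (use assms in \<open>auto simp: abs_mult divide_right_mono\<close>)
 finally show ?thesis .
qed

text \<open>Pairs with ratio at least R have covariance at most eps. For the others the covariance
  is bounded by 1, and given j the harmonic weight of the k with \<open>j <= k < R * j\<close> is at
  most \<open>1 + ln R\<close>; the factor 2 accounts for both orders.\<close>

lemma block_second_moment:
 assumes g: "bounded_lipschitz L g" and eps: "eps > 0"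
 shows "\<exists>R\<ge>1. \<forall>a b. R <= real a --> a <= b -->
  (\<E> x. (block g a b x)^2) <= eps * (1 + ln (real b / real a))^2 + 2 * (1 + ln (real b / real a)) * (1 + ln R)"
proof -
 obtain R0 where R0: "R0 > 0" "\<And>j k. real j >= R0 ==> real k >= R0 * real j ==> abs (\<E> x. \<xi> g j x * \<xi> g k x) <= eps"
  using \<xi>_covariance[OF g eps] by blast
 define R where "R = max 1 R0"
 have R1: "R >= 1" by (simp add: R_def)
 define c where "c j k = (\<E> x. \<xi> g j x * \<xi> g k x)" for j k
 have c_sym: "c j k = c k j" for j k by (simp add: c_def mult.commute)
 have c1: "abs (c j k) <= 1" for j k
  unfolding c_def by (rule integral_unit_bounded[OF unit_bounded_mult[OF nice_unit_bounded[OF \<xi>_nice[OF g]] nice_unit_bounded[OF \<xi>_nice[OF g]]]])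
 have cR: "abs (c j k) <= eps" if "R <= real j" "R * real j <= real k" for j k
 proof -
  have "R0 * real j <= R * real j" by (intro mult_right_mono) (auto simp: R_def)
  then have "R0 * real j <= real k" using that(2) by linarith
  moreover have "R0 <= real j" using that(1) by (simp add: R_def)
  ultimately show ?thesis unfolding c_def by (intro R0(2))
 qed
 show ?thesis
 proof (intro exI[of _ R] conjI allI impI R1)
  fix a b :: nat assume Ra: "R <= real a" and ab: "a <= b"
  have a1: "1 <= a" using Ra R1 by simp
  define h where "h = (\<Sum>k=a..<b. 1 / real k)"
  have h0: "0 <= h" by (simp add: h_def sum_nonneg)
  have h: "h <= 1 + ln (real b / real a)" unfolding h_def by (rule harmonic_block[OF a1 ab])
  have int: "integrable m (\<lambda>x. \<xi> g j x * \<xi> g k x)" for j k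
   by (rule unit_bounded_integrable[OF unit_bounded_mult[OF nice_unit_bounded[OF \<xi>_nice[OF g]] nice_unit_bounded[OF \<xi>_nice[OF g]]]])
  have "(\<E> x. (block g a b x)^2) = (\<E> x. (\<Sum>j=a..<b. \<Sum>k=a..<b. (1 / real j * (1 / real k)) * (\<xi> g j x * \<xi> g k x)))"
   by (simp add: block_def power2_eq_square sum_product ac_simps)
  also have "... = (\<Sum>j=a..<b. \<Sum>k=a..<b. (1 / real j * (1 / real k)) * c j k)"
   using int by (simp add: Bochner_Integration.integral_sum c_def del: times_divide_eq_left times_divide_eq_right)
  also have "... <= (\<Sum>j=a..<b. \<Sum>k=a..<b. eps * (1 / real j * (1 / real k)) +
    ((if k \<in> {j..<b} \<and> real k < R * real j then 1 / real j * (1 / real k) else 0) +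
    (if j \<in> {k..<b} \<and> real j < R * real k then 1 / real j * (1 / real k) else 0)))"
  proof (intro sum_mono)
   fix j k assume jk: "j \<in> {a..<b}" "k \<in> {a..<b}"
   define p where "p = 1 / real j * (1 / real k)"
   have p0: "0 <= p" by (simp add: p_def)
   have Rj: "R <= real j" "R <= real k" using Ra jk by auto
   have "p * c j k <= p * abs (c j k)" using p0 by (intro mult_left_mono) auto
   also have "... <= eps * p + ((if k \<in> {j..<b} \<and> real k < R * real j then p else 0) + (if j \<in> {k..<b} \<and> real j < R * real k then p else 0))"
   proof (cases "(k \<in> {j..<b} \<and> real k < R * real j) \<or> (j \<in> {k..<b} \<and> real j < R * real k)")
    case True
    have "p * abs (c j k) <= p * 1" using p0 c1 by (intro mult_left_mono) auto
    moreover have "0 <= eps * p" using p0 eps by simp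
    moreover have "p <= (if k \<in> {j..<b} \<and> real k < R * real j then p else 0) + (if j \<in> {k..<b} \<and> real j < R * real k then p else 0)"
     using True p0 by auto
    ultimately show ?thesis by linarith
   next
    case False
    have "abs (c j k) <= eps"
    proof (cases "j <= k")
     case True
     then have "R * real j <= real k" using False jk by auto
     then show ?thesis by (rule cR[OF Rj(1)])
    next
     case F: False
     then have "R * real k <= real j" using False jk by auto
     then show ?thesis using cR[OF Rj(2)] c_sym by metis
    qed
    then have "p * abs (c j k) <= p * eps" using p0 by (intro mult_left_mono) auto
    moreover have "0 <= (if k \<in> {j..<b} \<and> real k < R * real j then p else 0) + (if j \<in> {k..<b} \<and> real j < R * real k then p else 0)"
     using p0 by auto
    ultimately show ?thesis by (simp add: mult.commute)
   qed
   finally show "1 / real j * (1 / real k) * c j k <= eps * (1 / real j * (1 / real k)) +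
    ((if k \<in> {j..<b} \<and> real k < R * real j then 1 / real j * (1 / real k) else 0) +
    (if j \<in> {k..<b} \<and> real j < R * real k then 1 / real j * (1 / real k) else 0))"
    unfolding p_def .
  qed
  also have "... = eps * (h * h) +
    ((\<Sum>j=a..<b. \<Sum>k=a..<b. if k \<in> {j..<b} \<and> real k < R * real j then 1 / real j * (1 / real k) else 0) +
    (\<Sum>j=a..<b. \<Sum>k=a..<b. if j \<in> {k..<b} \<and> real j < R * real k then 1 / real j * (1 / real k) else 0))"
  proof -
   have "(\<Sum>j=a..<b. \<Sum>k=a..<b. eps * (1 / real j * (1 / real k))) = eps * (h * h)"
    by (simp only: h_def sum_product) (simp only: sum_distrib_left)
   then show ?thesis by (simp only: sum.distrib)
  qed
  also have "(\<Sum>j=a..<b. \<Sum>k=a..<b. if j \<in> {k..<b} \<and> real j < R * real k then 1 / real j * (1 / real k) else 0) =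
    (\<Sum>j=a..<b. \<Sum>k=a..<b. if k \<in> {j..<b} \<and> real k < R * real j then 1 / real j * (1 / real k) else 0)"
   by (subst sum.swap) (simp add: mult.commute cong: if_cong)
  also have "(\<Sum>j=a..<b. \<Sum>k=a..<b. if k \<in> {j..<b} \<and> real k < R * real j then 1 / real j * (1 / real k) else 0) <= (\<Sum>j=a..<b. 1 / real j * (1 + ln R))" (is "?D <= _")
  proof (rule sum_mono)
   fix j assume j: "j \<in> {a..<b}"
   have "(\<Sum>k=a..<b. if k \<in> {j..<b} \<and> real k < R * real j then 1 / real j * (1 / real k) else 0) =
    (\<Sum>k\<in>{k\<in>{a..<b}. k \<in> {j..<b} \<and> real k < R * real j}. 1 / real j * (1 / real k))"
    by (rule sum.inter_filter[symmetric]) simp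
   also have "{k\<in>{a..<b}. k \<in> {j..<b} \<and> real k < R * real j} = {k\<in>{j..<b}. real k < R * real j}" using j by auto
   also have "(\<Sum>k\<in>{k\<in>{j..<b}. real k < R * real j}. 1 / real j * (1 / real k)) = 1 / real j * (\<Sum>k\<in>{k\<in>{j..<b}. real k < R * real j}. 1 / real k)"
    by (rule sum_distrib_left[symmetric])
   also have "... <= 1 / real j * (1 + ln R)"
    using a1 j R1 by (intro mult_left_mono harmonic_block_ratio) auto
   finally show "(\<Sum>k=a..<b. if k \<in> {j..<b} \<and> real k < R * real j then 1 / real j * (1 / real k) else 0) <= 1 / real j * (1 + ln R)" .
  qed
  also have "(\<Sum>j=a..<b. 1 / real j * (1 + ln R)) = h * (1 + ln R)" by (simp add: h_def sum_distrib_right)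
  finally have *: "(\<E> x. (block g a b x)^2) <= eps * (h * h) + (h * (1 + ln R) + h * (1 + ln R))"
   by simp
  have "eps * (h * h) <= eps * (1 + ln (real b / real a))^2"
   unfolding power2_eq_square using h h0 eps by (intro mult_left_mono mult_mono) auto
  moreover have "h * (1 + ln R) <= (1 + ln (real b / real a)) * (1 + ln R)"
   using h R1 by (intro mult_right_mono) auto
  ultimately show "(\<E> x. (block g a b x)^2) <= eps * (1 + ln (real b / real a))^2 + 2 * (1 + ln (real b / real a)) * (1 + ln R)"
   using * by linarith
 qed
qed

lemma block_restarted_diff:
 assumes g: "bounded_lipschitz L g" and ab: "a <= b"
 shows "abs (block g a b x - restarted_block g a b ((T^^a) x)) <= (\<Sum>k=a..<b. 1 / real k * min 1 (L * abs (S a x) / sqrt (real k)))"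
proof -
 have "abs (block g a b x - restarted_block g a b ((T^^a) x)) <=
  (\<Sum>k=a..<b. abs (1 / real k * (\<xi> g k x - (g (S (k - a) ((T^^a) x) / sqrt (real k)) - (\<integral>y. g y \<partial>W)) / 2)))"
  unfolding block_def restarted_block_def sum_subtractf[symmetric] right_diff_distrib[symmetric] by (rule sum_abs)
 also have "... <= (\<Sum>k=a..<b. 1 / real k * min 1 (L * abs (S a x) / sqrt (real k)))"
 proof (rule sum_mono)
  fix k assume k: "k \<in> {a..<b}"
  have "S (a + (k - a)) x = S a x + S (k - a) ((T^^a) x)" by (rule S_add)
  then have d: "S k x - S (k - a) ((T^^a) x) = S a x" using k by simp
  have "abs (\<xi> g k x - (g (S (k - a) ((T^^a) x) / sqrt (real k)) - (\<integral>y. g y \<partial>W)) / 2) <= min 1 (L * abs (S k x - S (k - a) ((T^^a) x)) / abs (sqrt (real k)))"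
   unfolding \<xi>_def by (rule \<xi>_diff_le[OF g])
  then have "abs (\<xi> g k x - (g (S (k - a) ((T^^a) x) / sqrt (real k)) - (\<integral>y. g y \<partial>W)) / 2) <= min 1 (L * abs (S a x) / sqrt (real k))"
   unfolding d by simp
  then show "abs (1 / real k * (\<xi> g k x - (g (S (k - a) ((T^^a) x) / sqrt (real k)) - (\<integral>y. g y \<partial>W)) / 2)) <= 1 / real k * min 1 (L * abs (S a x) / sqrt (real k))"
   unfolding abs_mult by (intro mult_mono) auto
 qed
 finally show ?thesis .
qed

lemma block_restarted_L1:
 assumes g: "bounded_lipschitz L g" and eps: "eps > 0"
 shows "\<exists>R\<ge>1. \<forall>a b. 1 <= a --> a <= b -->
  (\<E> x. abs (block g a b x - restarted_block g a b ((T^^a) x))) <= (1 + ln R) + eps * (1 + ln (real b / real a))"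
proof -
 note L0 = bounded_lipschitz_nonneg[OF g]
 obtain R0 where R0: "R0 > 0" "\<And>j k. real k >= R0 * real j ==> (\<E> x. min 1 (L * abs (S j x) / sqrt (real k))) <= eps"
  using small_increment[OF eps L0] by blast
 define R where "R = max 1 R0"
 have R1: "R >= 1" by (simp add: R_def)
 show ?thesis
 proof (intro exI[of _ R] conjI allI impI R1)
  fix a b :: nat assume a1: "1 <= a" and ab: "a <= b"
  let ?w = "\<lambda>k x. min 1 (L * abs (S a x) / sqrt (real k))"
  have iw: "integrable m (?w k)" for k by (rule integrable_bounded[of _ 1]) (use L0 in auto)
  have w1: "(\<E> x. ?w k x) <= 1" for k
  proof -
   have "(\<E> x. ?w k x) <= (\<E> x. 1)" by (rule integral_mono[OF iw]) auto
   then show ?thesis by (simp add: prob_space)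
  qed
  have "(\<E> x. abs (block g a b x - restarted_block g a b ((T^^a) x))) <= (\<E> x. (\<Sum>k=a..<b. 1 / real k * ?w k x))"
  proof (rule integral_mono)
   have hb: "abs (block g a b x) <= (\<Sum>k=a..<b. 1 / real k)" "abs (restarted_block g a b x) <= (\<Sum>k=a..<b. 1 / real k)" for x
    unfolding block_def restarted_block_def by (rule harmonic_sum_le; rule \<xi>_le[OF g] restarted_term_le[OF g])+
   note [measurable] = block_measurable[OF g] restarted_block_measurable[OF g]
   have [measurable]: "(\<lambda>x. restarted_block g a b ((T^^a) x)) \<in> borel_measurable m"
    by (rule measurable_compose[OF iter_measurable restarted_block_measurable[OF g]])
   have "integrable m (block g a b)" "integrable m (\<lambda>x. restarted_block g a b ((T^^a) x))"
    by (rule integrable_bounded[OF _ hb(1)]; measurable) (rule integrable_bounded[OF _ hb(2)]; measurable)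
   then show "integrable m (\<lambda>x. abs (block g a b x - restarted_block g a b ((T^^a) x)))" by auto
   show "integrable m (\<lambda>x. \<Sum>k=a..<b. 1 / real k * ?w k x)"
    by (intro Bochner_Integration.integrable_sum integrable_mult_right iw)
  qed (rule block_restarted_diff[OF g ab])
  also have "... = (\<Sum>k=a..<b. 1 / real k * (\<E> x. ?w k x))"
   using iw by (simp add: Bochner_Integration.integral_sum del: times_divide_eq_left)
  also have "... <= (\<Sum>k=a..<b. (if real k < R * real a then 1 / real k else 0) + eps * (1 / real k))"
  proof (rule sum_mono)
   fix k assume "k \<in> {a..<b}"
   show "1 / real k * (\<E> x. ?w k x) <= (if real k < R * real a then 1 / real k else 0) + eps * (1 / real k)"
   proof (cases "real k < R * real a")
    case True
    have "1 / real k * (\<E> x. ?w k x) <= 1 / real k * 1" by (intro mult_left_mono w1) auto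
    moreover have "0 <= eps * (1 / real k)" using eps by simp
    ultimately show ?thesis using True by simp
   next
    case False
    have "R0 * real a <= R * real a" by (intro mult_right_mono) (auto simp: R_def)
    then have "1 / real k * (\<E> x. ?w k x) <= 1 / real k * eps" using False by (intro mult_left_mono R0(2)) auto
    then show ?thesis using False by simp
   qed
  qed
  also have "... = (\<Sum>k\<in>{k\<in>{a..<b}. real k < R * real a}. 1 / real k) + eps * (\<Sum>k=a..<b. 1 / real k)"
  proof -
   have "(\<Sum>k=a..<b. if real k < R * real a then 1 / real k else 0) = (\<Sum>k\<in>{k\<in>{a..<b}. real k < R * real a}. 1 / real k)"
    by (rule sum.inter_filter[symmetric]) simp
   then show ?thesis by (simp add: sum.distrib sum_distrib_left)
  qed
  also have "... <= (1 + ln R) + eps * (1 + ln (real b / real a))"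
   using eps by (intro add_mono mult_left_mono harmonic_block_ratio harmonic_block a1 ab R1) auto
  finally show "(\<E> x. abs (block g a b x - restarted_block g a b ((T^^a) x))) <= (1 + ln R) + eps * (1 + ln (real b / real a))" .
 qed
qed

end

context quasi_bernoulli_clt begin

text \<open>Since m is invariant, the restarted block may be evaluated at time a and compared there
  with the true block. All errors are of lower order than \<open>ln (2^q)\<close>, apart from two
  terms with small coefficients.\<close>

lemma restarted_block_L1_small:
 assumes g: "bounded_lipschitz L g" and \<eta>: "\<eta> > 0"
 shows "EV q. \<exists>a0. \<forall>a\<ge>a0. (\<E> x. abs (restarted_block g a (a * 2^q) x)) <= \<eta> * ln (2^q)"
proof -
 \<comment> \<open>The square root of the second moment contributes \<open>t * h\<close> and
   restarting contributes \<open>t^2 * h <= t * h\<close>; the slack \<open>\<eta> - 2 * t\<close>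
   absorbs the constants and the term of order \<open>sqrt h\<close>.\<close>
 define t where "t = min 1 \<eta> / 3"
 have t: "t > 0" "t <= 1" "2 * t < \<eta>" using \<eta> by (auto simp: t_def min_def)
 have t2: "t^2 > 0" "t^2 <= t" using t by (auto simp: power2_eq_square mult_left_le)
 obtain R where R: "R >= 1" "\<And>a b. R <= real a ==> a <= b ==>
  (\<E> x. (block g a b x)^2) <= t^2 * (1 + ln (real b / real a))^2 + 2 * (1 + ln (real b / real a)) * (1 + ln R)"
  using block_second_moment[OF g t2(1)] by blast
 obtain R' where R': "R' >= 1" "\<And>a b. 1 <= a ==> a <= b ==>
  (\<E> x. abs (block g a b x - restarted_block g a b ((T^^a) x))) <= (1 + ln R') + t^2 * (1 + ln (real b / real a))"
  using block_restarted_L1[OF g t2(1)] by blast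
 define w where "w = \<eta> - 2 * t"
 define d where "d = sqrt (2 * (1 + ln R))"
 define c where "c = \<eta> + (1 + ln R')"
 have w: "w > 0" using t by (simp add: w_def)
 have "LIM q sequentially. w * (1 + real q * ln 2) - c - d * sqrt (1 + real q * ln 2) :> at_top"
  using w by real_asymp
 then have "EV q. w * (1 + real q * ln 2) - c - d * sqrt (1 + real q * ln 2) >= 0"
  unfolding filterlim_at_top by (rule spec)
 then show ?thesis
 proof eventually_elim
  case (elim q)
  define h where "h = 1 + real q * ln 2"
  have lnq: "ln (2^q) = real q * ln (2 :: real)" by (simp add: ln_realpow)
  have h1: "h >= 1" by (simp add: h_def)
  have e: "w * h - c - d * sqrt h >= 0" using elim by (simp add: h_def)
  show ?case
  proof (intro exI[of _ "nat \<lceil>R\<rceil>"] allI impI)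
   fix a assume "a >= nat \<lceil>R\<rceil>"
   then have Ra: "R <= real a" by linarith
   then have a1: "1 <= a" using R(1) by simp
   let ?b = "a * 2^q"
   have ab: "a <= ?b" by simp
   have ratio: "1 + ln (real ?b / real a) = h" using a1 by (simp add: h_def lnq)
   note [measurable] = block_measurable[OF g] restarted_block_measurable[OF g]
   have hb: "abs (block g a ?b x) <= (\<Sum>k\<in>{a..<?b}. 1 / real k)" "abs (restarted_block g a ?b x) <= (\<Sum>k\<in>{a..<?b}. 1 / real k)" for x
    unfolding block_def restarted_block_def by (rule harmonic_sum_le; rule \<xi>_le[OF g] restarted_term_le[OF g])+
   have i1: "integrable m (block g a ?b)" by (rule integrable_bounded[OF _ hb(1)]) measurable
   have [measurable]: "(\<lambda>x. restarted_block g a ?b ((T^^a) x)) \<in> borel_measurable m"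
    by (rule measurable_compose[OF iter_measurable restarted_block_measurable[OF g]])
   have i2: "integrable m (\<lambda>x. restarted_block g a ?b ((T^^a) x))" by (rule integrable_bounded[OF _ hb(2)]) measurable
   have abs2: "(\<E> x. abs (block g a ?b x)) <= t * h + d * sqrt h"
   proof -
    have "(\<E> x. abs (block g a ?b x))^2 <= (\<E> x. abs (block g a ?b x)^2)"
     by (rule integral_square_le) (use hb(1) in auto)
    also have "... <= t^2 * h^2 + 2 * h * (1 + ln R)" using R(2)[OF Ra ab] unfolding ratio by simp
    finally have "(\<E> x. abs (block g a ?b x)) <= sqrt (t^2 * h^2 + 2 * h * (1 + ln R))" by (rule real_le_rsqrt)
    also have "... <= sqrt (t^2 * h^2) + sqrt (2 * h * (1 + ln R))"
     using R(1) h1 by (intro sqrt_add_le_add_sqrt mult_nonneg_nonneg) auto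
    also have "sqrt (t^2 * h^2) = t * h" using t h1 by (simp add: real_sqrt_mult)
    also have "sqrt (2 * h * (1 + ln R)) = d * sqrt h"
     unfolding d_def real_sqrt_mult[symmetric] by (simp add: ac_simps)
    finally show ?thesis .
   qed
   have "(\<E> x. abs (restarted_block g a ?b x)) = (\<E> x. abs (restarted_block g a ?b ((T^^a) x)))"
    by (rule integral_iter[symmetric, of "\<lambda>x. abs (restarted_block g a ?b x)"]) measurable
   also have "... <= (\<E> x. abs (block g a ?b x - restarted_block g a ?b ((T^^a) x)) + abs (block g a ?b x))"
    by (rule integral_mono) (use i1 i2 in auto)
   also have "... = (\<E> x. abs (block g a ?b x - restarted_block g a ?b ((T^^a) x))) + (\<E> x. abs (block g a ?b x))"
    using i1 i2 by simp
   also have "... <= ((1 + ln R') + t^2 * h) + (t * h + d * sqrt h)"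
    by (rule add_mono[OF R'(2)[OF a1 ab, unfolded ratio] abs2])
   also have "... <= (1 + ln R') + 2 * t * h + d * sqrt h"
    using mult_right_mono[OF t2(2), of h] h1 by simp
   also have "... <= \<eta> * (h - 1)"
   proof -
    have "w * h = \<eta> * h - 2 * t * h" by (simp add: w_def left_diff_distrib)
    moreover have "\<eta> * (h - 1) = \<eta> * h - \<eta>" by (simp add: right_diff_distrib)
    ultimately show ?thesis using e unfolding c_def by linarith
   qed
   also have "... = \<eta> * ln (2^q)" by (simp add: h_def lnq)
   finally show "(\<E> x. abs (restarted_block g a ?b x)) <= \<eta> * ln (2^q)" .
  qed
 qed
qed

text \<open>On a cell each Birkhoff sum oscillates by at most \<open>2 * D\<close>, so the k-th term
  varies by a multiple of \<open>1 / (k * sqrt k)\<close>. This is summable, so the bound is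
  independent of a and b.\<close>

lemma restarted_block_oscillation:
 assumes g: "bounded_lipschitz L g" and x: "x \<in> space m" "y \<in> space m" "\<kappa> (b - a) x = \<kappa> (b - a) y" and a: "1 <= a"
 shows "abs (restarted_block g a b x - restarted_block g a b y) <= 6 * D * L"
proof -
 note L0 = bounded_lipschitz_nonneg[OF g]
 have "abs (restarted_block g a b x - restarted_block g a b y) <=
  (\<Sum>k=a..<b. abs (1 / real k * ((g (S (k - a) x / sqrt (real k)) - (\<integral>y. g y \<partial>W)) / 2 - (g (S (k - a) y / sqrt (real k)) - (\<integral>y. g y \<partial>W)) / 2)))"
  unfolding restarted_block_def sum_subtractf[symmetric] right_diff_distrib[symmetric] by (rule sum_abs)
 also have "... <= (\<Sum>k=a..<b. (2 * D * L) * (1 / (real k * sqrt (real k))))"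
 proof (rule sum_mono)
  fix k assume k: "k \<in> {a..<b}"
  have o: "abs (S (k - a) x - S (k - a) y) <= 2 * D"
   using S_oscillation[OF x, of 0 "k - a"] k by auto
  have "abs ((g (S (k - a) x / sqrt (real k)) - (\<integral>y. g y \<partial>W)) / 2 - (g (S (k - a) y / sqrt (real k)) - (\<integral>y. g y \<partial>W)) / 2)
    <= min 1 (L * abs (S (k - a) x - S (k - a) y) / abs (sqrt (real k)))" by (rule \<xi>_diff_le[OF g])
  also have "... <= L * abs (S (k - a) x - S (k - a) y) / abs (sqrt (real k))" by simp
  also have "... <= L * (2 * D) / abs (sqrt (real k))" using o L0 by (intro divide_right_mono mult_left_mono) auto
  finally have "1 / real k * abs ((g (S (k - a) x / sqrt (real k)) - (\<integral>y. g y \<partial>W)) / 2 - (g (S (k - a) y / sqrt (real k)) - (\<integral>y. g y \<partial>W)) / 2)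
    <= 1 / real k * (L * (2 * D) / abs (sqrt (real k)))" by (rule mult_left_mono) simp
  then show "abs (1 / real k * ((g (S (k - a) x / sqrt (real k)) - (\<integral>y. g y \<partial>W)) / 2 - (g (S (k - a) y / sqrt (real k)) - (\<integral>y. g y \<partial>W)) / 2))
    <= (2 * D * L) * (1 / (real k * sqrt (real k)))"
   unfolding abs_mult by (simp add: ac_simps)
 qed
 also have "... = (2 * D * L) * (\<Sum>k=a..<b. 1 / (real k * sqrt (real k)))" by (rule sum_distrib_left[symmetric])
 also have "... <= (2 * D * L) * (3 / sqrt (real a))"
  using D_nonneg L0 by (intro mult_left_mono inverse_sqrt_cube_block a) auto
 also have "... <= (2 * D * L) * (3 / 1)"
  using D_nonneg L0 a by (intro mult_left_mono divide_left_mono) auto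
 finally show ?thesis by simp
qed

text \<open>Each bad block gets weight s in the exponent. By Markov's inequality its exponential
  moment exceeds 1 by at most \<open>exp s\<close> times the relative L1 norm, and the factor
  \<open>exp (- s)\<close> in the hypothesis brings this down to 1. The threshold falls from
  \<open>2 * eps\<close> to eps when another point of the cell is taken.\<close>

lemma bad_blocks_rare:
 assumes g: "bounded_lipschitz L g" and eps: "eps > 0" and s: "s > 0"
  and n: "\<And>i. n (Suc i) = n i * 2^q" and n1: "\<And>i. 1 <= n i"
  and small: "\<And>i. (\<E> x. abs (restarted_block g (n i) (n (Suc i)) x)) <= eps * exp (- s) * ln (2^q)"
  and q: "6 * D * L <= eps * ln (2^q)" "ln (2^q) >= (1 :: real)"
 shows "AE x in m. \<forall>\<^sub>F r in sequentially.
  s * real (card {i. i < r \<and> abs (restarted_block g (n i) (n (Suc i)) ((T^^n i) x)) > 2 * eps * ln (2^q)}) <= real r * ln (4 * K)"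
proof -
 define lq where "lq = ln (2^q :: real)"
 have lq: "lq >= 1" "6 * D * L <= eps * lq" using q by (auto simp: lq_def)
 define Y where "Y i = restarted_block g (n i) (n (Suc i))" for i
 note Ym [measurable] = restarted_block_measurable[OF g, of "n i" "n (Suc i)" for i, folded Y_def]
 define G where "G i x = s * (if abs (Y i x) > 2 * eps * lq then 1 else 0)" for i x
 define H where "H i x = s * (if abs (Y i x) > eps * lq then 1 else 0)" for i x
 have n': "n (Suc i) = n i + (n (Suc i) - n i)" for i by (simp add: n)
 have ae: "AE x in m. EV r. (\<Sum>i<r. G i ((T^^n i) x)) <= real r * ln (4 * K)"
 proof (rule window_large_deviations[where n = n and l = "\<lambda>i. n (Suc i) - n i" and H = H, OF n'])
  show "G i \<in> borel_measurable m" for i unfolding G_def[abs_def] by measurable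
  show "G i x <= H i y" if "x \<in> space m" "y \<in> space m" "\<kappa> (n (Suc i) - n i) x = \<kappa> (n (Suc i) - n i) y" for i x y
  proof -
   have "abs (Y i x - Y i y) <= eps * lq"
    using restarted_block_oscillation[OF g that n1] lq(2) unfolding Y_def by linarith
   moreover have "abs (Y i x) <= abs (Y i x - Y i y) + abs (Y i y)" by linarith
   ultimately have "abs (Y i y) > eps * lq" if "abs (Y i x) > 2 * eps * lq" using that by linarith
   then show ?thesis using s by (auto simp: G_def H_def)
  qed
  show "(\<integral>\<^sup>+x. ennreal (exp (H i x)) \<partial>m) <= 2" for i
  proof -
   have Yb: "abs (Y i x) <= (\<Sum>k=n i..<n (Suc i). 1 / real k)" for x
    unfolding Y_def restarted_block_def by (rule harmonic_sum_le) (rule restarted_term_le[OF g])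
   have iY: "integrable m (\<lambda>x. abs (Y i x))" by (rule integrable_abs, rule integrable_bounded[OF _ Yb]) measurable
   have el: "eps * lq > 0" using eps lq by simp
   let ?c = "exp s / (eps * lq)"
   have "(\<integral>\<^sup>+x. ennreal (exp (H i x)) \<partial>m) <= (\<integral>\<^sup>+x. ennreal (1 + ?c * abs (Y i x)) \<partial>m)"
   proof (intro nn_integral_mono ennreal_leI)
    fix x
    show "exp (H i x) <= 1 + ?c * abs (Y i x)"
    proof (cases "abs (Y i x) > eps * lq")
     case True
     then have "exp s * 1 <= exp s * (abs (Y i x) / (eps * lq))" using el by (intro mult_left_mono) (auto simp: le_divide_eq)
     then show ?thesis using True by (simp add: H_def)
    next
     case False
     then show ?thesis using el by (simp add: H_def)
    qed
   qed
   also have "... = ennreal (\<E> x. 1 + ?c * abs (Y i x))"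
    by (rule nn_integral_eq_integral) (use iY el in \<open>auto intro!: add_nonneg_nonneg\<close>)
   also have "(\<E> x. 1 + ?c * abs (Y i x)) = 1 + ?c * (\<E> x. abs (Y i x))" using iY by (simp add: prob_space)
   also have "... <= 1 + ?c * (eps * exp (- s) * lq)"
    using small[of i] el unfolding Y_def lq_def by (intro add_left_mono mult_left_mono) auto
   also have "... = 2" using eps lq(1) by (simp add: exp_minus)
   finally show ?thesis by (simp add: ennreal_leI)
  qed
 qed
 then show ?thesis
 proof (rule AE_mp, intro AE_I2 impI)
  fix x assume "EV r. (\<Sum>i<r. G i ((T^^n i) x)) <= real r * ln (4 * K)"
  moreover have "(\<Sum>i<r. G i ((T^^n i) x)) = s * real (card {i. i < r \<and> abs (Y i ((T^^n i) x)) > 2 * eps * lq})" for r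
  proof -
   have "(\<Sum>i<r. G i ((T^^n i) x)) = s * (\<Sum>i<r. if abs (Y i ((T^^n i) x)) > 2 * eps * lq then 1 else 0)"
    by (simp only: G_def sum_distrib_left)
   also have "(\<Sum>i<r. if abs (Y i ((T^^n i) x)) > 2 * eps * lq then 1 else 0 :: real) = (\<Sum>i\<in>{i\<in>{..<r}. abs (Y i ((T^^n i) x)) > 2 * eps * lq}. 1)"
    by (rule sum.inter_filter[symmetric]) simp
   also have "{i\<in>{..<r}. abs (Y i ((T^^n i) x)) > 2 * eps * lq} = {i. i < r \<and> abs (Y i ((T^^n i) x)) > 2 * eps * lq}" by auto
   finally show ?thesis by simp
  qed
  ultimately show "\<forall>\<^sub>F r in sequentially.
   s * real (card {i. i < r \<and> abs (restarted_block g (n i) (n (Suc i)) ((T^^n i) x)) > 2 * eps * ln (2^q)}) <= real r * ln (4 * K)"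
   by (simp add: Y_def lq_def)
 qed
qed

text \<open>The normalized sums at the block ends satisfy the contraction of
  \<open>excursion_count\<close> with ratio \<open>sqrt (2^q)\<close>, so their large values are
  charged to large increments. The charge is logarithmic and \<open>s / b <= 2\<close>, so its
  exponential is at most quadratic in the increment and second moments suffice.\<close>

lemma large_starts_rare:
 assumes V: "V >= 0" "\<And>k. (\<E> x. (S (2^k) x)^2) <= V * 2^k" and s: "s > 0"
  and n: "\<And>i. n i = 2^(q * (i0 + i))" and q: "q > 0"
  and A: "A > 0" "A^2 >= 4 * exp s * (8 * V + 8 * D^2)" and \<beta>: "s / 2 <= ln (sqrt (2^q) / 2)"
 shows "AE x in m. \<exists>c. \<forall>\<^sub>F r in sequentially.
  s * real (card {i. i < r \<and> A < abs (S (n i) x) / sqrt (real (n i))}) <= real r * ln (4 * K) + c"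
proof -
 define b where "b = ln (sqrt (2^q) / 2)"
 have b: "b > 0" "s / b <= 2" using s \<beta> unfolding b_def[symmetric] by (auto simp: field_simps)
 have n1: "1 <= n i" for i by (simp add: n)
 have nS: "n (Suc i) = n i * 2^q" for i by (simp add: n power_add)
 have nle: "n i <= n (Suc i)" for i by (simp add: nS)
 define l where "l i = n (Suc i) - n i" for i
 have nl: "n (Suc i) = n i + l i" for i using nle[of i] by (simp add: l_def)
 \<comment> \<open>The charge per increment in \<open>excursion_count\<close>, with b in the role of
   the logarithmic contraction.\<close>
 define E where "E d = (if A < 2 * d then 1 + ln (2 * d / A) / b else 0)" for d
 have E_mono: "E d <= E d'" if "0 <= d" "d <= d'" for d d'
 proof (cases "A < 2 * d")
  case True
  then have "ln (2 * d / A) <= ln (2 * d' / A)" using that A by (intro ln_mono divide_right_mono) auto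
  then show ?thesis using True that b by (simp add: E_def divide_right_mono)
 next
  case False
  moreover have "0 <= E d'" using A b by (auto simp: E_def intro!: add_nonneg_nonneg divide_nonneg_pos ln_ge_zero)
  ultimately show ?thesis by (simp add: E_def)
 qed
 have E_exp: "exp (s * E d) <= 1 + exp s * (2 * d / A)^2" if "0 <= d" for d
 proof (cases "A < 2 * d")
  case True
  then have r: "2 * d / A > 1" using A by simp
  have "s * E d = s + (s / b) * ln (2 * d / A)" using True b by (simp add: E_def distrib_left)
  also have "... <= s + 2 * ln (2 * d / A)" using b r by (intro add_left_mono mult_right_mono) auto
  finally have "exp (s * E d) <= exp (s + 2 * ln (2 * d / A))" by simp
  also have "... = exp s * (2 * d / A)^2"
   using r by (simp add: exp_add exp_double)
  finally show ?thesis by simp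
 qed (simp add: E_def)
 define \<delta> where "\<delta> i x = abs (S (l i) x) / sqrt (real (n (Suc i)))" for i x
 have \<delta>0: "0 <= \<delta> i x" for i x by (simp add: \<delta>_def)
 have Em [measurable]: "E \<in> borel_measurable borel" unfolding E_def[abs_def] by measurable
 have \<delta>m [measurable]: "\<delta> i \<in> borel_measurable m" for i unfolding \<delta>_def[abs_def] by measurable
 have int\<delta>: "integrable m (\<lambda>x. (\<delta> i x)^2)" for i
  using integrable_S_power[of "l i" 2] by (simp add: \<delta>_def power_divide)
 have \<delta>2: "(\<E> x. (\<delta> i x)^2) <= 4 * V" for i
 proof -
  have "(\<E> x. (S (l i) x)^2) = (\<E> x. (S (l i) ((T^^n i) x))^2)"
   by (rule integral_iter[symmetric, of "\<lambda>x. (S (l i) x)^2"]) measurable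
  also have "... <= (\<E> x. 2 * (S (n (Suc i)) x)^2 + 2 * (S (n i) x)^2)"
  proof (rule integral_mono)
   fix x
   have "S (l i) ((T^^n i) x) = S (n (Suc i)) x - S (n i) x" using S_add[of "n i" "l i" x] by (simp add: nl)
   moreover have "(a - b)^2 <= 2 * a^2 + 2 * b^2" for a b :: real
    using zero_le_power2[of "a + b"] by (simp add: power2_eq_square algebra_simps)
   ultimately show "(S (l i) ((T^^n i) x))^2 <= 2 * (S (n (Suc i)) x)^2 + 2 * (S (n i) x)^2" by simp
  next
   show "integrable m (\<lambda>x. (S (l i) ((T^^n i) x))^2)"
   proof (rule integrable_bounded)
    show "abs ((S (l i) ((T^^n i) x))^2) <= (real (l i) * B)^2" if "x \<in> space m" for x
     unfolding power_abs by (intro power_mono S_bound iter_space that) simp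
   qed measurable
  qed (use integrable_S_power in simp)
  also have "... = 2 * (\<E> x. (S (n (Suc i)) x)^2) + 2 * (\<E> x. (S (n i) x)^2)"
   using integrable_S_power[of _ 2] by simp
  also have "... <= 2 * (V * real (n (Suc i))) + 2 * (V * real (n i))"
   using V(2)[of "q * (i0 + Suc i)"] V(2)[of "q * (i0 + i)"] by (simp add: n)
  also have "... <= 2 * (V * real (n (Suc i))) + 2 * (V * real (n (Suc i)))"
   using V(1) nle[of i] by (intro add_left_mono mult_left_mono) auto
  finally have "(\<E> x. (S (l i) x)^2) <= 4 * V * real (n (Suc i))" by simp
  then have "(\<E> x. (S (l i) x)^2) / real (n (Suc i)) <= 4 * V" using n1[of "Suc i"] by (simp add: divide_le_eq)
  moreover have "(\<E> x. (\<delta> i x)^2) = (\<E> x. (S (l i) x)^2) / real (n (Suc i))" by (simp add: \<delta>_def power_divide)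
  ultimately show ?thesis by simp
 qed
 have ae: "AE x in m. EV r. (\<Sum>i<r. s * E (\<delta> i ((T^^n i) x))) <= real r * ln (4 * K)"
 proof (rule window_large_deviations[where n = n and l = l and H = "\<lambda>i x. s * E (\<delta> i x + 2 * D)", OF nl])
  show "(\<lambda>x. s * E (\<delta> i x)) \<in> borel_measurable m" for i by measurable
  show "s * E (\<delta> i x) <= s * E (\<delta> i y + 2 * D)" if "x \<in> space m" "y \<in> space m" "\<kappa> (l i) x = \<kappa> (l i) y" for i x y
  proof (intro mult_left_mono E_mono \<delta>0)
   have "abs (S (l i) x - S (l i) y) <= 2 * D" using S_oscillation[OF that, of 0 "l i"] by simp
   then have "abs (S (l i) x) <= abs (S (l i) y) + 2 * D" by linarith
   then have "\<delta> i x <= (abs (S (l i) y) + 2 * D) / sqrt (real (n (Suc i)))"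
    unfolding \<delta>_def by (intro divide_right_mono) auto
   also have "... = \<delta> i y + 2 * D / sqrt (real (n (Suc i)))" by (simp add: \<delta>_def add_divide_distrib)
   also have "... <= \<delta> i y + 2 * D / 1"
    using D_nonneg n1[of "Suc i"] by (intro add_left_mono divide_left_mono) auto
   finally show "\<delta> i x <= \<delta> i y + 2 * D" by simp
  qed (use s in simp)
  show "(\<integral>\<^sup>+x. ennreal (exp (s * E (\<delta> i x + 2 * D))) \<partial>m) <= 2" for i
  proof -
   let ?c = "4 * exp s / A^2"
   have c0: "?c >= 0" by simp
   have "(\<integral>\<^sup>+x. ennreal (exp (s * E (\<delta> i x + 2 * D))) \<partial>m) <= (\<integral>\<^sup>+x. ennreal (1 + ?c * (2 * (\<delta> i x)^2 + 8 * D^2)) \<partial>m)"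
   proof (intro nn_integral_mono ennreal_leI)
    fix x
    have "exp (s * E (\<delta> i x + 2 * D)) <= 1 + exp s * (2 * (\<delta> i x + 2 * D) / A)^2"
     by (rule E_exp) (use \<delta>0 D_nonneg in simp)
    also have "exp s * (2 * (\<delta> i x + 2 * D) / A)^2 = ?c * (\<delta> i x + 2 * D)^2"
    proof -
     have "exp s * (2 * u / A)^2 = ?c * u^2" for u by (simp add: power_divide power_mult_distrib)
     then show ?thesis .
    qed
    also have "1 + ?c * (\<delta> i x + 2 * D)^2 <= 1 + ?c * (2 * (\<delta> i x)^2 + 8 * D^2)"
     using zero_le_power2[of "\<delta> i x - 2 * D"] by (intro add_left_mono mult_left_mono c0) (simp add: power2_eq_square algebra_simps)
    finally show "exp (s * E (\<delta> i x + 2 * D)) <= 1 + ?c * (2 * (\<delta> i x)^2 + 8 * D^2)" .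
   qed
   also have "... = ennreal (\<E> x. 1 + ?c * (2 * (\<delta> i x)^2 + 8 * D^2))"
    by (rule nn_integral_eq_integral) (use int\<delta>[of i] c0 in \<open>auto intro!: add_nonneg_nonneg mult_nonneg_nonneg\<close>)
   also have "(\<E> x. 1 + ?c * (2 * (\<delta> i x)^2 + 8 * D^2)) = 1 + ?c * (2 * (\<E> x. (\<delta> i x)^2) + 8 * D^2)"
    using int\<delta>[of i] by (simp add: prob_space)
   also have "... <= 1 + ?c * (8 * V + 8 * D^2)" using \<delta>2[of i] by (intro add_left_mono mult_left_mono c0) auto
   also have "... <= 2" using A by (simp add: divide_le_eq)
   finally show ?thesis by (simp add: ennreal_leI)
  qed
 qed
 then show ?thesis
 proof (rule AE_mp, intro AE_I2 impI)
  fix x assume x: "x \<in> space m" and ev: "EV r. (\<Sum>i<r. s * E (\<delta> i ((T^^n i) x))) <= real r * ln (4 * K)"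
  define M where "M i = abs (S (n i) x) / sqrt (real (n i))" for i
  define c where "c = s + s / b * max 0 (ln (M 0 / A))"
  have q2: "sqrt (2^q) > 2"
  proof (rule ccontr)
   assume "\<not> sqrt (2^q) > 2"
   then have "ln (sqrt (2^q) / 2) <= ln 1" by (intro ln_mono) auto
   then show False using b(1) by (simp add: b_def)
  qed
  have step: "M (Suc i) <= \<delta> i ((T^^n i) x) + M i / sqrt (2^q)" for i
  proof -
   have "abs (S (n (Suc i)) x) <= abs (S (l i) ((T^^n i) x)) + abs (S (n i) x)"
    using S_add[of "n i" "l i" x] by (simp add: nl)
   then have "M (Suc i) <= (abs (S (l i) ((T^^n i) x)) + abs (S (n i) x)) / sqrt (real (n (Suc i)))"
    unfolding M_def by (rule divide_right_mono) simp
   also have "... = \<delta> i ((T^^n i) x) + M i / sqrt (2^q)"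
    by (simp add: \<delta>_def M_def add_divide_distrib nS real_sqrt_mult)
   finally show ?thesis .
  qed
  have count: "b * real (card {i. i < r \<and> A < M (Suc i)}) <= b * (\<Sum>i<r. E (\<delta> i ((T^^n i) x))) + max 0 (ln (M 0 / A))" for r
   using excursion_count[OF A(1) q2, of M "\<lambda>i. \<delta> i ((T^^n i) x)" r] step \<delta>0
   unfolding b_def[symmetric] E_def by (simp add: M_def)
  have "s * real (card {i. i < r \<and> A < M i}) <= real r * ln (4 * K) + c"
   if "(\<Sum>i<r. s * E (\<delta> i ((T^^n i) x))) <= real r * ln (4 * K)" for r
  proof -
   \<comment> \<open>\<open>excursion_count\<close> sees only the indices \<open>Suc i\<close>;
     index 0 is added by hand and accounts for the summand s in c.\<close>
   have "{i. i < r \<and> A < M i} \<subseteq> insert 0 (Suc ` {i. i < r \<and> A < M (Suc i)})"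
   proof
    fix i assume "i \<in> {i. i < r \<and> A < M i}"
    then show "i \<in> insert 0 (Suc ` {i. i < r \<and> A < M (Suc i)})" by (cases i) auto
   qed
   then have "card {i. i < r \<and> A < M i} <= card (insert 0 (Suc ` {i. i < r \<and> A < M (Suc i)}))"
    by (intro card_mono) auto
   also have "... <= Suc (card (Suc ` {i. i < r \<and> A < M (Suc i)}))" by (rule card_insert_le_m1) auto
   also have "card (Suc ` {i. i < r \<and> A < M (Suc i)}) = card {i. i < r \<and> A < M (Suc i)}" by (intro card_image) auto
   finally have c1: "real (card {i. i < r \<and> A < M i}) <= 1 + real (card {i. i < r \<and> A < M (Suc i)})" by simp
   have "real (card {i. i < r \<and> A < M (Suc i)}) <= (\<Sum>i<r. E (\<delta> i ((T^^n i) x))) + max 0 (ln (M 0 / A)) / b"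
    using count[of r] b(1) by (simp add: field_simps)
   then have "s * real (card {i. i < r \<and> A < M i}) <= s * (1 + ((\<Sum>i<r. E (\<delta> i ((T^^n i) x))) + max 0 (ln (M 0 / A)) / b))"
    using c1 s by (intro mult_left_mono) auto
   also have "... = (\<Sum>i<r. s * E (\<delta> i ((T^^n i) x))) + c"
    by (simp add: c_def distrib_left sum_distrib_left)
   finally show ?thesis using that by linarith
  qed
  then have "EV r. s * real (card {i. i < r \<and> A < M i}) <= real r * ln (4 * K) + c"
   using ev by (rule eventually_mono[rotated])
  then show "\<exists>c. EV r. s * real (card {i. i < r \<and> A < abs (S (n i) x) / sqrt (real (n i))}) <= real r * ln (4 * K) + c"
   unfolding M_def by blast
 qed
qed

end

section \<open>Logarithmic averages\<close>

lemma bracket_strict_mono: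
 fixes n :: "nat => nat"
 assumes n: "strict_mono n" and N: "n 0 <= N"
 obtains r where "n r <= N" "N < n (Suc r)"
proof -
 have "N < n (Suc N)" using strict_mono_imp_increasing[OF n, of "Suc N"] by simp
 then have ex: "\<exists>j. N < n j" by blast
 define j where "j = (LEAST j. N < n j)"
 have j: "N < n j" unfolding j_def using ex by (rule LeastI_ex)
 have j0: "j \<noteq> 0" using j N by (metis not_le)
 then have "\<not> N < n (j - 1)" unfolding j_def by (intro not_less_Least) simp
 then show thesis using that[of "j - 1"] j j0 by simp
qed

context quasi_bernoulli_clt begin

text \<open>A block sum never exceeds \<open>1 + lq <= 2 * lq\<close>, and so much is paid for a bad
  block and again for a large start. Otherwise the restarted block contributes
  \<open>2 * eps * lq\<close> and the restart error \<open>eps * lq\<close>, since it is at most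
  \<open>3 * L * A\<close>.\<close>

lemma block_le:
 assumes g: "bounded_lipschitz L g" and A: "A > 0" and a: "1 <= a" and b: "b = a * 2^q" and q: "1 <= ln (2^q :: real)"
  and LA: "3 * L * A <= eps * ln (2^q)" and eps: "eps > 0"
 shows "abs (block g a b x) <= 3 * eps * ln (2^q) +
  (2 * ln (2^q)) * (if abs (restarted_block g a b ((T^^a) x)) > 2 * eps * ln (2^q) then 1 else 0) +
  (2 * ln (2^q)) * (if A < abs (S a x) / sqrt (real a) then 1 else 0)"
proof -
 note L0 = bounded_lipschitz_nonneg[OF g]
 define lq where "lq = ln (2^q :: real)"
 have lq: "1 <= lq" "3 * L * A <= eps * lq" using q LA by (simp_all add: lq_def)
 have ab: "a <= b" by (simp add: b)
 have "real b / real a = 2^q" using a by (simp add: b)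
 then have h: "(\<Sum>k=a..<b. 1 / real k) <= 1 + lq" using harmonic_block[OF a ab] by (simp add: lq_def)
 let ?Y = "restarted_block g a b ((T^^a) x)"
 have "abs ?Y <= (\<Sum>k=a..<b. 1 / real k)"
  unfolding restarted_block_def by (rule harmonic_sum_le) (rule restarted_term_le[OF g])
 then have Y: "abs ?Y <= 2 * eps * lq + (2 * lq) * (if abs ?Y > 2 * eps * lq then 1 else 0)"
 proof (cases "abs ?Y > 2 * eps * lq")
  case True
  have "0 <= 2 * eps * lq" using eps lq by simp
  then show ?thesis using True \<open>abs ?Y <= _\<close> h lq(1) by (simp only: if_True)
 qed simp
 have "(\<Sum>k=a..<b. 1 / real k * min 1 (L * abs (S a x) / sqrt (real k))) <= eps * lq + (2 * lq) * (if A < abs (S a x) / sqrt (real a) then 1 else 0)"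
 proof (cases "A < abs (S a x) / sqrt (real a)")
  case True
  have "(\<Sum>k=a..<b. 1 / real k * min 1 (L * abs (S a x) / sqrt (real k))) <= (\<Sum>k=a..<b. 1 / real k)"
  proof (rule sum_mono)
   fix k
   have "1 / real k * min 1 (L * abs (S a x) / sqrt (real k)) <= 1 / real k * 1" by (intro mult_left_mono) auto
   then show "1 / real k * min 1 (L * abs (S a x) / sqrt (real k)) <= 1 / real k" by simp
  qed
  moreover have "0 <= eps * lq" using eps lq by simp
  ultimately show ?thesis using True h lq by auto
 next
  case False
  then have Sa: "abs (S a x) <= A * sqrt (real a)" using a by (simp add: field_simps)
  have "(\<Sum>k=a..<b. 1 / real k * min 1 (L * abs (S a x) / sqrt (real k))) <= (\<Sum>k=a..<b. (L * A * sqrt (real a)) * (1 / (real k * sqrt (real k))))"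
  proof (rule sum_mono)
   fix k assume "k \<in> {a..<b}"
   have "1 / real k * min 1 (L * abs (S a x) / sqrt (real k)) <= 1 / real k * (L * abs (S a x) / sqrt (real k))"
    by (intro mult_left_mono) auto
   also have "... <= 1 / real k * (L * (A * sqrt (real a)) / sqrt (real k))"
    using Sa L0 by (intro mult_left_mono divide_right_mono) auto
   finally show "1 / real k * min 1 (L * abs (S a x) / sqrt (real k)) <= (L * A * sqrt (real a)) * (1 / (real k * sqrt (real k)))"
    by (simp add: ac_simps)
  qed
  also have "... = (L * A * sqrt (real a)) * (\<Sum>k=a..<b. 1 / (real k * sqrt (real k)))" by (rule sum_distrib_left[symmetric])
  also have "... <= (L * A * sqrt (real a)) * (3 / sqrt (real a))"
   using L0 A by (intro mult_left_mono inverse_sqrt_cube_block a) auto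
  also have "... = 3 * L * A" using a by simp
  finally show ?thesis using False lq by simp
 qed
 then have "abs (block g a b x - ?Y) <= eps * lq + (2 * lq) * (if A < abs (S a x) / sqrt (real a) then 1 else 0)"
  using block_restarted_diff[OF g ab, of x] by linarith
 moreover have "abs (block g a b x) <= abs (block g a b x - ?Y) + abs ?Y" by linarith
 ultimately show ?thesis using Y unfolding lq_def[symmetric] by linarith
qed

text \<open>The order of choices is essential: s from eps, then A from s, then q from all of them,
  and only then the first block. The constant is 3 for ordinary blocks, 2 for bad blocks, 2 for
  large starts and 1 for bounded terms.\<close>

lemma log_average_small:
 assumes g: "bounded_lipschitz L g" and eps: "eps > 0"
 shows "AE x in m. EV N. abs (\<Sum>k=1..N. 1 / real k * \<xi> g k x) <= 8 * eps * ln (real N)"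
proof -
 note L0 = bounded_lipschitz_nonneg[OF g]
 \<comment> \<open>With this s the large deviation bounds say that the frequency of bad blocks, and
   of large starts, is asymptotically at most eps.\<close>
 define s where "s = ln (4 * K) / eps"
 have lK: "ln (4 * K) > 0" using K_ge_1 by simp
 have s: "s > 0" using lK eps by (simp add: s_def)
 have seps: "ln (4 * K) = s * eps" using eps by (simp add: s_def)
 obtain V where V: "V >= 0" "\<And>k. (\<E> x. (S (2^k) x)^2) <= V * 2^k" using second_moment_dyadic by blast
 define v where "v = 4 * exp s * (8 * V + 8 * D^2)"
 have v: "v >= 0" using V by (simp add: v_def)
 define A where "A = sqrt v + 1"
 have A: "A > 0" using v by (simp add: A_def add_nonneg_pos)
 have A2: "A^2 >= v"
 proof -
  have "(sqrt v)^2 <= A^2" using v by (intro power_mono) (auto simp: A_def)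
  then show ?thesis using v by simp
 qed
 \<comment> \<open>The factor \<open>exp (- s)\<close> is the one demanded by
   \<open>bad_blocks_rare\<close>.\<close>
 define e2 where "e2 = eps * exp (- s)"
 have e2: "e2 > 0" using eps by (simp add: e2_def)
 have ev1: "EV q. s / 2 <= ln (sqrt (2^q) / 2)"
 proof -
  have "LIM q sequentially. ln (sqrt (2^q) / 2) :> at_top" by real_asymp
  then show ?thesis unfolding filterlim_at_top by (rule spec)
 qed
 have lim: "LIM q sequentially. ln (2^q :: real) :> at_top" by real_asymp
 have ev: "EV q. c <= eps * ln (2^q)" for c
 proof -
  have "EV q. c / eps <= ln (2^q)" using lim unfolding filterlim_at_top by (rule spec)
  then show ?thesis by eventually_elim (use eps in \<open>simp add: divide_le_eq mult.commute\<close>)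
 qed
 have ev4: "EV q. (1 :: real) <= ln (2^q)" using lim unfolding filterlim_at_top by (rule spec)
 have "EV q. q > 0 \<and> s / 2 <= ln (sqrt (2^q) / 2) \<and> 3 * L * A <= eps * ln (2^q) \<and> 6 * D * L <= eps * ln (2^q) \<and>
   (1 :: real) <= ln (2^q) \<and> (\<exists>a0. \<forall>a\<ge>a0. (\<E> x. abs (restarted_block g a (a * 2^q) x)) <= e2 * ln (2^q))"
  by (intro eventually_conj eventually_gt_at_top ev1 ev ev4 restarted_block_L1_small[OF g e2])
 then obtain q where q: "q > 0" "s / 2 <= ln (sqrt (2^q) / 2)" "3 * L * A <= eps * ln (2^q)" "6 * D * L <= eps * ln (2^q)"
   "(1 :: real) <= ln (2^q)" "\<exists>a0. \<forall>a\<ge>a0. (\<E> x. abs (restarted_block g a (a * 2^q) x)) <= e2 * ln (2^q)"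
  using eventually_happens'[OF sequentially_bot] by blast
 from q(6) obtain a0 where a0: "\<And>a. a >= a0 ==> (\<E> x. abs (restarted_block g a (a * 2^q) x)) <= e2 * ln (2^q)" by blast
 \<comment> \<open>Powers of 2 are the times at which second moments are controlled; the offset a0
   places all blocks in the range where restarted blocks have small L1 norm.\<close>
 define n where "n i = (2 :: nat)^(q * (a0 + i))" for i
 have nS: "n (Suc i) = n i * 2^q" for i by (simp add: n_def power_add)
 have n1: "1 <= n i" for i by (simp add: n_def)
 have n_a0: "a0 <= n i" for i
 proof -
  have "a0 <= q * (a0 + i)" using q(1) by (metis le_add1 mult_le_mono1 nat_mult_1 One_nat_def Suc_leI order_trans)
  also have "... < 2^(q * (a0 + i))" by (rule less_exp)
  finally show ?thesis by (simp add: n_def)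
 qed
 have n_mono: "strict_mono n"
  unfolding n_def by (rule strict_monoI) (use q(1) in auto)
 have small: "(\<E> x. abs (restarted_block g (n i) (n (Suc i)) x)) <= eps * exp (- s) * ln (2^q)" for i
  unfolding nS e2_def[symmetric] by (rule a0[OF n_a0])
 define lq where "lq = ln (2^q :: real)"
 have lq1: "1 <= lq" using q(5) by (simp add: lq_def)
 define bad where "bad x r = real (card {i. i < r \<and> abs (restarted_block g (n i) (n (Suc i)) ((T^^n i) x)) > 2 * eps * lq})" for x r
 define far where "far x r = real (card {i. i < r \<and> A < abs (S (n i) x) / sqrt (real (n i))})" for x r
 have ae1: "AE x in m. EV r. s * bad x r <= real r * ln (4 * K)"
  unfolding bad_def lq_def by (rule bad_blocks_rare[where n = n and q = q, OF g eps s nS n1 small q(4,5)])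
 have ae2: "AE x in m. \<exists>c. EV r. s * far x r <= real r * ln (4 * K) + c"
  unfolding far_def
  by (rule large_starts_rare[OF V s, where n = n and q = q, OF n_def q(1) A A2[unfolded v_def] q(2)])
 from ae1 ae2 show ?thesis
 proof eventually_elim
  case (elim x)
  then obtain c where ev_far: "EV r. s * far x r <= real r * ln (4 * K) + c" by blast
  from eventually_conj[OF elim(1) this] obtain r0 where
   r0: "\<And>r. r >= r0 ==> s * bad x r <= real r * ln (4 * K)" "\<And>r. r >= r0 ==> s * far x r <= real r * ln (4 * K) + c"
   by (auto simp: eventually_sequentially)
  have bad_le: "bad x r <= real r * eps" if "r >= r0" for r
  proof -
   have "s * bad x r <= s * (real r * eps)" using r0(1)[OF that] unfolding seps by (simp add: ac_simps)
   then show ?thesis using s by simp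
  qed
  have far_le: "far x r <= real r * eps + c / s" if "r >= r0" for r
  proof -
   have "s * far x r <= s * (real r * eps + c / s)" using r0(2)[OF that] s unfolding seps by (simp add: distrib_left ac_simps)
   then show ?thesis using s by simp
  qed
  have sum_if: "(\<Sum>i<r. if P i then 1 else 0 :: real) = real (card {i. i < r \<and> P i})" for P and r :: nat
  proof -
   have "(\<Sum>i<r. if P i then 1 else 0 :: real) = (\<Sum>i\<in>{i\<in>{..<r}. P i}. 1)"
    by (rule sum.inter_filter[symmetric]) simp
   also have "{i\<in>{..<r}. P i} = {i. i < r \<and> P i}" by auto
   finally show ?thesis by simp
  qed
  \<comment> \<open>Contributions bounded in N: times before the first block, the incomplete last
    block, and the constant in the count of large starts.\<close>
  define C1 where "C1 = real (n 0) + 2 * lq + 2 * lq * abs (c / s)"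
  have bound: "abs (\<Sum>k=1..N. 1 / real k * \<xi> g k x) <= 7 * eps * ln (real N) + C1" if N: "N >= n r0" for N
  proof -
   have "n 0 <= N" using N strict_mono_less_eq[OF n_mono, of 0 r0] by simp
   then obtain r where r: "n r <= N" "N < n (Suc r)" by (rule bracket_strict_mono[OF n_mono])
   have "n r0 < n (Suc r)" using N r(2) by simp
   then have rr0: "r >= r0" using strict_mono_less[OF n_mono] by auto
   have split: "(\<Sum>k=1..<b. 1 / real k * \<xi> g k x) = (\<Sum>k=1..<a. 1 / real k * \<xi> g k x) + block g a b x"
    if "1 <= a" "a <= b" for a b
    unfolding block_def by (rule sum.atLeastLessThan_concat[OF that, symmetric])
   have blocks: "(\<Sum>k=1..<n r. 1 / real k * \<xi> g k x) = (\<Sum>k=1..<n 0. 1 / real k * \<xi> g k x) + (\<Sum>i<r. block g (n i) (n (Suc i)) x)" for r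
   proof (induction r)
    case (Suc r)
    then show ?case using split[of "n r" "n (Suc r)"] n1[of r] by (simp add: nS)
   qed simp
   have "{1..N} = {1..<Suc N}" by auto
   then have eq: "(\<Sum>k=1..N. 1 / real k * \<xi> g k x) =
     (\<Sum>k=1..<n 0. 1 / real k * \<xi> g k x) + (\<Sum>i<r. block g (n i) (n (Suc i)) x) + block g (n r) (Suc N) x"
    using split[of "n r" "Suc N"] n1[of r] r blocks[of r] by simp
   have p1: "abs (\<Sum>k=1..<n 0. 1 / real k * \<xi> g k x) <= real (n 0)"
   proof -
    have "abs (\<Sum>k=1..<n 0. 1 / real k * \<xi> g k x) <= (\<Sum>k=1..<n 0. 1 / real k)" by (rule harmonic_sum_le) (rule \<xi>_le[OF g])
    also have "... <= (\<Sum>k=1..<n 0. 1)" by (intro sum_mono) auto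
    finally show ?thesis by simp
   qed
   have p3: "abs (block g (n r) (Suc N) x) <= 2 * lq"
   proof -
    have "abs (block g (n r) (Suc N) x) <= (\<Sum>k=n r..<Suc N. 1 / real k)"
     unfolding block_def by (rule harmonic_sum_le) (rule \<xi>_le[OF g])
    also have "... <= 1 + ln (real (Suc N) / real (n r))" using r by (intro harmonic_block n1) auto
    also have "ln (real (Suc N) / real (n r)) <= lq"
    proof -
     have "Suc N <= n r * 2^q" using r(2) nS[of r] by simp
     then have "real (Suc N) <= real (n r) * 2^q" by (metis of_nat_le_iff of_nat_mult of_nat_numeral of_nat_power)
     then have "real (Suc N) / real (n r) <= 2^q" using n1[of r] by (simp add: divide_le_eq mult.commute)
     then show ?thesis unfolding lq_def using n1[of r] by (intro ln_mono) auto
    qed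
    finally show ?thesis using lq1 by simp
   qed
   have "abs (\<Sum>i<r. block g (n i) (n (Suc i)) x) <= (\<Sum>i<r. abs (block g (n i) (n (Suc i)) x))" by (rule sum_abs)
   also have "... <= (\<Sum>i<r. 3 * eps * lq +
     (2 * lq) * (if abs (restarted_block g (n i) (n (Suc i)) ((T^^n i) x)) > 2 * eps * lq then 1 else 0) +
     (2 * lq) * (if A < abs (S (n i) x) / sqrt (real (n i)) then 1 else 0))"
    unfolding lq_def by (intro sum_mono block_le[OF g A n1 nS q(5) q(3) eps])
   also have "... = real r * (3 * eps * lq) + (2 * lq) * bad x r + (2 * lq) * far x r"
    by (simp only: sum.distrib sum_distrib_left[symmetric] sum_if bad_def far_def) simp
   also have "... <= real r * (3 * eps * lq) + (2 * lq) * (real r * eps) + (2 * lq) * (real r * eps + abs (c / s))"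
    using bad_le[OF rr0] order_trans[OF far_le[OF rr0] add_left_mono[OF abs_ge_self]] lq1 by (intro add_mono mult_left_mono order_refl) simp_all
   also have "... = 7 * eps * (real r * lq) + 2 * lq * abs (c / s)" by (simp add: algebra_simps)
   also have "... <= 7 * eps * ln (real N) + 2 * lq * abs (c / s)"
   proof -
    have "(2 :: nat)^(q * r) <= n r" by (simp add: n_def)
    then have "(2 :: nat)^(q * r) <= N" using r(1) by simp
    then have le: "(2 :: real)^(q * r) <= real N" by (metis of_nat_le_iff of_nat_numeral of_nat_power)
    have "real r * lq = ln (2^(q * r))" by (simp add: lq_def ln_realpow)
    also have "... <= ln (real N)" using le by (intro ln_mono) auto
    finally show ?thesis using eps by (intro add_right_mono mult_left_mono) auto
   qed
   finally have p2: "abs (\<Sum>i<r. block g (n i) (n (Suc i)) x) <= 7 * eps * ln (real N) + 2 * lq * abs (c / s)" .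
   show ?thesis unfolding eq C1_def using p1 p2 p3 by linarith
  qed
  have "LIM N sequentially. ln (real N) :> at_top" by real_asymp
  then have "EV N. C1 / eps <= ln (real N)" unfolding filterlim_at_top by (rule spec)
  then show ?case using eventually_ge_at_top[of "n r0"]
  proof eventually_elim
   case (elim N)
   have "C1 <= eps * ln (real N)" using elim(1) eps by (simp add: divide_le_eq mult.commute)
   then show ?case using bound[OF elim(2)] by simp
  qed
 qed
qed

lemma log_average_tendsto:
 assumes g: "bounded_lipschitz L g"
 shows "AE x in m. (\<lambda>N. (\<Sum>k=1..N. 1 / real k * \<xi> g k x) / ln (real N)) \<leadsto> 0"
proof -
 have "AE x in m. \<forall>i. EV N. abs (\<Sum>k=1..N. 1 / real k * \<xi> g k x) <= 8 * (1 / real (Suc i)) * ln (real N)"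
  unfolding AE_all_countable by (intro allI log_average_small[OF g]) simp
 then show ?thesis
 proof eventually_elim
  case (elim x)
  show ?case
  proof (rule tendstoI)
   fix e :: real assume e: "e > 0"
   obtain i :: nat where i: "8 / e < real i" using reals_Archimedean2 by blast
   have i': "8 * (1 / real (Suc i)) < e"
   proof -
    have "8 < e * real i" using i e by (simp add: divide_less_eq mult.commute)
    also have "... <= e * real (Suc i)" using e by simp
    finally show ?thesis by (simp add: divide_less_eq)
   qed
   from elim[rule_format, of i] show "EV N. dist ((\<Sum>k=1..N. 1 / real k * \<xi> g k x) / ln (real N)) 0 < e"
    using eventually_ge_at_top[of "2 :: nat"]
   proof eventually_elim
    case (elim N)
    have l: "ln (real N) > 0" using elim(2) by simp
    have "abs (\<Sum>k=1..N. 1 / real k * \<xi> g k x) / ln (real N) <= 8 * (1 / real (Suc i))"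
     using elim(1) l by (simp add: divide_le_eq)
    then show ?case using i' l by (simp add: dist_real_def abs_divide)
   qed
  qed
 qed
qed

end

section \<open>Weak convergence of logarithmic averages\<close>

lemma integral_log_average:
 fixes h :: "real => real"
 assumes h: "h \<in> borel_measurable borel" and N: "N >= 1"
 shows "(\<integral>y. h y \<partial>log_average a N) = (\<Sum>k=1..N. 1 / real k * h (a k)) / ln (real N)"
proof -
 have l: "ln (real N) >= 0" using N by simp
 have "(\<integral>y. h y \<partial>log_average a N) = (\<integral>k. h (a k) \<partial>density (count_space {1..N}) (\<lambda>k. ennreal (1 / ln (real N) * (1 / real k))))"
  unfolding log_average_def by (rule integral_distr) (use h in auto)
 also have "... = (\<integral>k. (1 / ln (real N) * (1 / real k)) *\<^sub>R h (a k) \<partial>count_space {1..N})"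
  by (rule integral_density) (use l in auto)
 also have "... = (\<Sum>k=1..N. (1 / ln (real N) * (1 / real k)) *\<^sub>R h (a k))"
  by (rule lebesgue_integral_count_space_finite) simp
 also have "... = (\<Sum>k=1..N. 1 / real k * h (a k)) / ln (real N)"
  by (simp add: sum_divide_distrib ac_simps)
 finally show ?thesis .
qed

lemma harmonic_asymp: "(\<lambda>N. (\<Sum>k=1..N. 1 / real k) / ln (real N)) \<leadsto> 1"
proof -
 have "(\<lambda>N. harm N - ln (real N)) \<leadsto> (euler_mascheroni :: real)" by (rule euler_mascheroni_LIMSEQ)
 moreover have "LIM N sequentially. ln (real N) :> at_top" by real_asymp
 ultimately have "(\<lambda>N. (harm N - ln (real N)) / ln (real N)) \<leadsto> (0 :: real)"
  by (rule tendsto_divide_0[OF _ filterlim_at_top_imp_at_infinity])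
 then have "(\<lambda>N. (harm N - ln (real N)) / ln (real N) + 1) \<leadsto> (0 + 1 :: real)" by (intro tendsto_add tendsto_const)
 moreover have "EV N. (harm N - ln (real N)) / ln (real N) + 1 = (\<Sum>k=1..N. 1 / real k) / ln (real N)"
 proof (rule eventually_sequentiallyI[of 2])
  fix N :: nat assume "2 <= N"
  then have "ln (real N) \<noteq> 0" by simp
  then show "(harm N - ln (real N)) / ln (real N) + 1 = (\<Sum>k=1..N. 1 / real k) / ln (real N)"
   by (simp add: harm_def field_simps)
 qed
 ultimately show ?thesis using Lim_transform_eventually by fastforce
qed

text \<open>Logarithmic averages have mass asymptotic to 1 but not equal to it. Dividing by the
  exact harmonic sum gives probability measures, to which \<open>weak_conv_m\<close>
  applies.\<close>

definition normalized_log_average :: "(nat => real) => nat => real measure" where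
 "normalized_log_average a N =
  distr (density (count_space {1..N}) (\<lambda>k. ennreal (1 / real k / (\<Sum>k=1..N. 1 / real k)))) borel a"

lemma real_distribution_normalized_log_average:
 assumes "N >= 1"
 shows "real_distribution (normalized_log_average a N)"
proof -
 let ?H = "\<Sum>k=1..N. 1 / real k"
 have H: "?H > 0" using assms by (intro sum_pos) auto
 have "prob_space (density (count_space {1..N}) (\<lambda>k. ennreal (1 / real k / ?H)))"
 proof (rule prob_spaceI)
  have "emeasure (density (count_space {1..N}) (\<lambda>k. ennreal (1 / real k / ?H))) (space (density (count_space {1..N}) (\<lambda>k. ennreal (1 / real k / ?H)))) =
    (\<Sum>k=1..N. ennreal (1 / real k / ?H))"
   by (simp add: emeasure_density nn_integral_count_space_finite)
  also have "... = ennreal (\<Sum>k=1..N. 1 / real k / ?H)" using H by (intro sum_ennreal) auto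
  also have "(\<Sum>k=1..N. 1 / real k / ?H) = ?H / ?H" by (rule sum_divide_distrib[symmetric])
  also have "ennreal (?H / ?H) = 1" using H by simp
  finally show "emeasure (density (count_space {1..N}) (\<lambda>k. ennreal (1 / real k / ?H))) (space (density (count_space {1..N}) (\<lambda>k. ennreal (1 / real k / ?H)))) = 1" .
 qed
 then show ?thesis unfolding normalized_log_average_def by (rule prob_space.real_distribution_distr) simp
qed

lemma integral_normalized_log_average:
 fixes h :: "real => real"
 assumes h: "h \<in> borel_measurable borel"
 shows "(\<integral>y. h y \<partial>normalized_log_average a N) = (\<Sum>k=1..N. 1 / real k * h (a k)) / (\<Sum>k=1..N. 1 / real k)"
proof -
 let ?H = "\<Sum>k=1..N. 1 / real k"
 have H: "?H >= 0" by (intro sum_nonneg) auto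
 have "(\<integral>y. h y \<partial>normalized_log_average a N) = (\<integral>k. h (a k) \<partial>density (count_space {1..N}) (\<lambda>k. ennreal (1 / real k / ?H)))"
  unfolding normalized_log_average_def by (rule integral_distr) (use h in auto)
 also have "... = (\<integral>k. (1 / real k / ?H) *\<^sub>R h (a k) \<partial>count_space {1..N})"
  by (rule integral_density) (use H in auto)
 also have "... = (\<Sum>k=1..N. (1 / real k / ?H) *\<^sub>R h (a k))"
  by (rule lebesgue_integral_count_space_finite) simp
 also have "... = (\<Sum>k=1..N. 1 / real k * h (a k)) / ?H"
  by (simp add: sum_divide_distrib ac_simps)
 finally show ?thesis .
qed

text \<open>Ramps with rational ends on either side of a continuity point squeeze the distribution
  function. They are countable in number, so the exceptional null sets can be united, and they are
  Lipschitz.\<close>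

lemma weak_conv_m_rational_steps:
 assumes M: "\<And>n. real_distribution (M n)" "real_distribution N"
  and steps: "\<And>p q. p \<in> \<rat> ==> q \<in> \<rat> ==> p < q ==>
   (\<lambda>n. \<integral>y. cts_step p q y \<partial>M n) \<leadsto> (\<integral>y. cts_step p q y \<partial>N)"
 shows "weak_conv_m M N"
 unfolding weak_conv_m_def weak_conv_def
proof (intro allI impI tendstoI)
 fix x e :: real assume cont: "isCont (cdf N) x" and e: "e > 0"
 interpret N: real_distribution N by (rule M)
 obtain d where d: "d > 0" "\<And>z. dist z x < d ==> dist (cdf N z) (cdf N x) < e / 2"
  using cont[unfolded continuous_at_eps_delta, rule_format, of "e / 2"] e by auto
 obtain p q where pq: "p \<in> \<rat>" "q \<in> \<rat>" "x < p" "p < q" "q < x + d"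
 proof -
  obtain p where p: "p \<in> \<rat>" "x < p" "p < x + d" using Rats_dense_in_real[of x "x + d"] d(1) by auto
  obtain q where "q \<in> \<rat>" "p < q" "q < x + d" using Rats_dense_in_real[OF p(3)] by auto
  then show ?thesis using that p by auto
 qed
 obtain p' q' where pq': "p' \<in> \<rat>" "q' \<in> \<rat>" "x - d < p'" "p' < q'" "q' < x"
 proof -
  obtain p where p: "p \<in> \<rat>" "x - d < p" "p < x" using Rats_dense_in_real[of "x - d" x] d(1) by auto
  obtain q where "q \<in> \<rat>" "p < q" "q < x" using Rats_dense_in_real[OF p(3)] by auto
  then show ?thesis using that p by auto
 qed
 have "(\<integral>y. cts_step p q y \<partial>N) <= cdf N q" by (rule N.cdf_cts_step[OF pq(4)])
 also have "... < cdf N x + e / 2" 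
 proof -
  have "dist (cdf N q) (cdf N x) < e / 2" by (rule d(2)) (use pq in \<open>simp add: dist_real_def\<close>)
  then have "cdf N q - cdf N x < e / 2" unfolding dist_real_def by (rule order_le_less_trans[OF abs_ge_self])
  then show ?thesis by linarith
 qed
 finally have "(\<integral>y. cts_step p q y \<partial>N) < cdf N x + e" using e by simp
 then have 1: "EV n. (\<integral>y. cts_step p q y \<partial>M n) < cdf N x + e"
  by (rule order_tendstoD(2)[OF steps[OF pq(1,2,4)]])
 have "cdf N x - e / 2 < cdf N p'" 
 proof -
  have "dist (cdf N p') (cdf N x) < e / 2" by (rule d(2)) (use pq' in \<open>simp add: dist_real_def\<close>)
  then have "- (cdf N p' - cdf N x) < e / 2" unfolding dist_real_def by (rule order_le_less_trans[OF abs_ge_minus_self])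
  then show ?thesis by linarith
 qed
 also have "... <= (\<integral>y. cts_step p' q' y \<partial>N)" by (rule N.cdf_cts_step[OF pq'(4)])
 finally have "cdf N x - e < (\<integral>y. cts_step p' q' y \<partial>N)" using e by simp
 then have 2: "EV n. cdf N x - e < (\<integral>y. cts_step p' q' y \<partial>M n)"
  by (rule order_tendstoD(1)[OF steps[OF pq'(1,2,4)]])
 from 1 2 show "EV n. dist (cdf (M n) x) (cdf N x) < e"
 proof eventually_elim
  case (elim n)
  interpret Mn: real_distribution "M n" by (rule M)
  have "cdf (M n) x <= cdf (M n) p" using pq by (intro Mn.cdf_nondecreasing) auto
  also have "... <= (\<integral>y. cts_step p q y \<partial>M n)" by (rule Mn.cdf_cts_step[OF pq(4)])
  finally have u: "cdf (M n) x < cdf N x + e" using elim by simp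
  have "(\<integral>y. cts_step p' q' y \<partial>M n) <= cdf (M n) q'" by (rule Mn.cdf_cts_step[OF pq'(4)])
  also have "... <= cdf (M n) x" using pq' by (intro Mn.cdf_nondecreasing) auto
  finally show ?case using u elim by (auto simp: dist_real_def)
 qed
qed

lemma bounded_lipschitz_cts_step:
 assumes pq: "p < q"
 shows "bounded_lipschitz (1 / (q - p)) (cts_step p q)"
 unfolding bounded_lipschitz_def
proof (intro conjI allI)
 have eq: "cts_step p q a = max 0 (min 1 ((q - a) / (q - p)))" for a
  using pq by (auto simp: cts_step_def max_def min_def field_simps)
 show "abs (cts_step p q a) <= 1" for a unfolding eq by (auto simp: max_def min_def)
 show "abs (cts_step p q a - cts_step p q b) <= 1 / (q - p) * abs (a - b)" for a b
 proof -
  have "abs (max 0 (min 1 u) - max 0 (min 1 v)) <= abs (u - v)" for u v :: real by (auto simp: max_def min_def abs_if)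
  then have "abs (cts_step p q a - cts_step p q b) <= abs ((q - a) / (q - p) - (q - b) / (q - p))" unfolding eq .
  also have "(q - a) / (q - p) - (q - b) / (q - p) = (b - a) / (q - p)" by (simp add: diff_divide_distrib)
  also have "abs ... = 1 / (q - p) * abs (a - b)" using pq by (simp add: abs_divide abs_minus_commute)
  finally show ?thesis .
 qed
qed

lemma converges_weakly_log_average:
 assumes N: "real_distribution \<nu>"
  and steps: "\<And>p q. p \<in> \<rat> ==> q \<in> \<rat> ==> p < q ==>
   (\<lambda>N. (\<Sum>k=1..N. 1 / real k * cts_step p q (a k)) / ln (real N)) \<leadsto> (\<integral>y. cts_step p q y \<partial>\<nu>)"
 shows "converges_weakly (log_average a) \<nu>"
proof -
 define H where "H N = (\<Sum>k=1..N. 1 / real k)" for N :: nat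
 have Hpos: "H (Suc N) > 0" for N unfolding H_def by (intro sum_pos) auto
 have H: "(\<lambda>N. H N / ln (real N)) \<leadsto> 1" unfolding H_def by (rule harmonic_asymp)
 \<comment> \<open>The index is shifted because the average over the empty range is the zero
   measure.\<close>
 have wc: "weak_conv_m (\<lambda>N. normalized_log_average a (Suc N)) \<nu>"
 proof (rule weak_conv_m_rational_steps[OF real_distribution_normalized_log_average N])
  fix p q :: real assume pq: "p \<in> \<rat>" "q \<in> \<rat>" "p < q"
  have "(\<lambda>N. ((\<Sum>k=1..N. 1 / real k * cts_step p q (a k)) / ln (real N)) / (H N / ln (real N))) \<leadsto> (\<integral>y. cts_step p q y \<partial>\<nu>) / 1"
   by (intro tendsto_divide steps pq H) auto
  moreover have "EV N. ((\<Sum>k=1..N. 1 / real k * cts_step p q (a k)) / ln (real N)) / (H N / ln (real N)) = (\<integral>y. cts_step p q y \<partial>normalized_log_average a N)"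
  proof (rule eventually_sequentiallyI[of 2])
   fix N :: nat assume "2 <= N"
   then have "ln (real N) \<noteq> 0" by simp
   then show "((\<Sum>k=1..N. 1 / real k * cts_step p q (a k)) / ln (real N)) / (H N / ln (real N)) = (\<integral>y. cts_step p q y \<partial>normalized_log_average a N)"
    using integral_normalized_log_average[OF bounded_lipschitz_measurable[OF bounded_lipschitz_cts_step[OF pq(3)]], of a N]
    by (simp add: H_def)
  qed
  ultimately have "(\<lambda>N. \<integral>y. cts_step p q y \<partial>normalized_log_average a N) \<leadsto> (\<integral>y. cts_step p q y \<partial>\<nu>)"
   using Lim_transform_eventually by fastforce
  then show "(\<lambda>n. \<integral>y. cts_step p q y \<partial>normalized_log_average a (Suc n)) \<leadsto> (\<integral>y. cts_step p q y \<partial>\<nu>)"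
   by (rule LIMSEQ_Suc)
 qed simp
 show ?thesis
  unfolding converges_weakly_def
 proof (intro allI impI)
  fix h :: "real => real" assume h: "continuous_on UNIV h \<and> bounded (range h)"
  then obtain b where b: "\<And>y. norm (h y) <= b" by (auto simp: bounded_iff)
  have hc: "isCont h y" for y using h by (simp add: continuous_on_eq_continuous_at)
  have hm: "h \<in> borel_measurable borel" using h by (intro borel_measurable_continuous_onI) auto
  have "(\<lambda>N. \<integral>y. h y \<partial>normalized_log_average a (Suc N)) \<leadsto> (\<integral>y. h y \<partial>\<nu>)"
   by (rule weak_conv_imp_integral_bdd_continuous_conv[OF real_distribution_normalized_log_average N wc hc b]) simp
  then have "(\<lambda>N. (\<integral>y. h y \<partial>normalized_log_average a (Suc N)) * (H (Suc N) / ln (real (Suc N)))) \<leadsto> (\<integral>y. h y \<partial>\<nu>) * 1"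
   by (intro tendsto_mult LIMSEQ_Suc[OF H])
  moreover have "(\<integral>y. h y \<partial>normalized_log_average a (Suc N)) * (H (Suc N) / ln (real (Suc N))) = (\<integral>y. h y \<partial>log_average a (Suc N))" for N
   using integral_normalized_log_average[OF hm, of a "Suc N"] integral_log_average[OF hm, of "Suc N" a] Hpos[of N]
   by (simp add: H_def)
  ultimately have "(\<lambda>N. \<integral>y. h y \<partial>log_average a (Suc N)) \<leadsto> (\<integral>y. h y \<partial>\<nu>)" by simp
  then show "(\<lambda>N. \<integral>y. h y \<partial>log_average a N) \<leadsto> (\<integral>y. h y \<partial>\<nu>)" by (rule LIMSEQ_imp_Suc)
 qed
qed

theorem (in quasi_bernoulli_clt) almost_sure_limit:
 "almost_sure_limit_theorem m (\<lambda>n x. birkhoff_sum T f n x / sqrt (real n)) (normal_law 0 (\<sigma>^2))"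
proof -
 have "AE x in m. \<forall>p\<in>\<rat>. \<forall>q\<in>\<rat>. p < q --> (\<lambda>N. (\<Sum>k=1..N. 1 / real k * \<xi> (cts_step p q) k x) / ln (real N)) \<leadsto> 0"
  by (intro AE_ball_countable[THEN iffD2] ballI countable_rat AE_impI log_average_tendsto[OF bounded_lipschitz_cts_step])
 then show ?thesis unfolding almost_sure_limit_theorem_def
 proof eventually_elim
  case (elim x)
  show ?case
  proof (rule converges_weakly_log_average[OF real_distribution_W])
   fix p q :: real assume pq: "p \<in> \<rat>" "q \<in> \<rat>" "p < q"
   let ?h = "cts_step p q" and ?w = "\<integral>y. cts_step p q y \<partial>W"
   have "(\<lambda>N. (\<Sum>k=1..N. 1 / real k * \<xi> ?h k x) / ln (real N)) \<leadsto> 0" using elim pq by blast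
   \<comment> \<open>This undoes the centring and halving in \<xi>; the mean reappears multiplied by
     the normalized harmonic sum.\<close>
   then have "(\<lambda>N. 2 * ((\<Sum>k=1..N. 1 / real k * \<xi> ?h k x) / ln (real N)) + ?w * ((\<Sum>k=1..N. 1 / real k) / ln (real N))) \<leadsto> 2 * 0 + ?w * 1"
    by (intro tendsto_intros harmonic_asymp)
   moreover have "2 * ((\<Sum>k=1..N. 1 / real k * \<xi> ?h k x) / ln (real N)) + ?w * ((\<Sum>k=1..N. 1 / real k) / ln (real N)) =
     (\<Sum>k=1..N. 1 / real k * ?h (S k x / sqrt (real k))) / ln (real N)" for N
   proof -
    have "2 * (\<Sum>k=1..N. 1 / real k * \<xi> ?h k x) + ?w * (\<Sum>k=1..N. 1 / real k) = (\<Sum>k=1..N. 1 / real k * ?h (S k x / sqrt (real k)))"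
     unfolding sum_distrib_left sum.distrib[symmetric]
     by (rule sum.cong) (auto simp: \<xi>_def field_simps)
    then show ?thesis by (simp add: add_divide_distrib[symmetric])
   qed
   ultimately show "(\<lambda>N. (\<Sum>k=1..N. 1 / real k * ?h (S k x / sqrt (real k))) / ln (real N)) \<leadsto> ?w" by simp
  qed
 qed
qed

section \<open>Derivatives in charts\<close>

definition chart_deriv ::
 "('a, 'e::euclidean_space) chart => ('a, 'e) chart => ('a => 'a) => 'a => 'e => 'e" where
 "chart_deriv c d G p = frechet_derivative (snd d \<circ> G \<circ> chart_inv c) (at (snd c p))"

definition differentiable_map ::
 "'a::t2_space set => ('a, 'e::euclidean_space) chart set => ('a => 'a) => bool" where
 "differentiable_map M A G \<longleftrightarrow> G ` M \<subseteq> M \<and> continuous_on M G \<and>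
  (\<forall>c\<in>A. \<forall>d\<in>A. \<forall>p\<in>fst c. G p \<in> fst d --> (snd d \<circ> G \<circ> chart_inv c) differentiable at (snd c p))"

lemma tangent_map_eq: "tangent_map A G p = chart_deriv (chart_at A p) (chart_at A (G p)) G p"
 by (simp add: tangent_map_def chart_deriv_def)

text \<open>Seeing the change of coordinates as a derivative of the identity map makes all
  coordinate changes instances of the chain rule.\<close>

lemma to_tangent_eq: "to_tangent A c p = chart_deriv c (chart_at A p) id p"
 by (simp add: to_tangent_def chart_deriv_def)

locale manifold =
 fixes M :: "'a::t2_space set" and A :: "('a, 'e::euclidean_space) chart set"
 assumes manifold: "closed_manifold M A"
begin

lemma chart_homeo: "c \<in> A ==> homeomorphism (fst c) (snd c ` fst c) (snd c) (chart_inv c)"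
 using manifold by (simp add: closed_manifold_def)

lemma chart_inv_chart [simp]: "c \<in> A ==> p \<in> fst c ==> chart_inv c (snd c p) = p"
 using homeomorphism_apply1[OF chart_homeo] by auto

lemma chart_chart_inv [simp]: "c \<in> A ==> z \<in> snd c ` fst c ==> snd c (chart_inv c z) = z"
 using homeomorphism_apply2[OF chart_homeo] by auto

lemma chart_inv_in: "c \<in> A ==> z \<in> snd c ` fst c ==> chart_inv c z \<in> fst c"
 using homeomorphism_image2[OF chart_homeo] by blast

lemma chart_subset: "c \<in> A ==> fst c \<subseteq> M"
 using manifold by (auto simp: closed_manifold_def)

lemma chart_in_M: "c \<in> A ==> p \<in> fst c ==> p \<in> M"
 using chart_subset by blast

lemma ex_chart: "p \<in> M ==> \<exists>c\<in>A. p \<in> fst c"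
 using manifold by (auto simp: closed_manifold_def)

lemma chart_at: "p \<in> M ==> chart_at A p \<in> A" "p \<in> M ==> p \<in> fst (chart_at A p)"
 using someI_ex[of "\<lambda>c. c \<in> A \<and> p \<in> fst c"] ex_chart unfolding chart_at_def by blast+

lemma chart_openin: "c \<in> A ==> openin (top_of_set M) (fst c)"
 using manifold by (simp add: closed_manifold_def)

lemma chart_image_open: "c \<in> A ==> open (snd c ` fst c)"
 using manifold by (simp add: closed_manifold_def)

lemma open_chart_image:
 assumes c: "c \<in> A" and W: "openin (top_of_set M) W" "W \<subseteq> fst c"
 shows "open (snd c ` W)"
proof -
 have "openin (top_of_set (fst c)) W"
  using W chart_subset[OF c] by (meson openin_subset_trans)
 from homeomorphism_imp_open_map[OF chart_homeo[OF c] this]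
 show ?thesis using chart_image_open[OF c] by (rule openin_open_trans)
qed

lemma openin_chart_inv_image:
 assumes c: "c \<in> A" and W: "open W" "W \<subseteq> snd c ` fst c"
 shows "openin (top_of_set M) (chart_inv c ` W)"
proof -
 have "openin (top_of_set (snd c ` fst c)) W" using W chart_image_open[OF c] by (simp add: openin_open_eq)
 from homeomorphism_imp_open_map[OF homeomorphism_symD[OF chart_homeo[OF c]] this]
 show ?thesis using chart_openin[OF c] by (rule openin_trans)
qed

lemma compact_chart_inv_image:
 assumes c: "c \<in> A" and K: "compact K" "K \<subseteq> snd c ` fst c"
 shows "compact (chart_inv c ` K)"
 by (rule compact_continuous_image[OF _ K(1)])
  (rule continuous_on_subset[OF homeomorphism_cont2[OF chart_homeo[OF c]] K(2)])

lemma chart_inv_image_iff: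
 assumes c: "c \<in> A" and W: "W \<subseteq> snd c ` fst c"
 shows "p \<in> chart_inv c ` W \<longleftrightarrow> p \<in> fst c \<and> snd c p \<in> W"
proof
 assume "p \<in> chart_inv c ` W"
 then show "p \<in> fst c \<and> snd c p \<in> W" using c W chart_inv_in by auto
next
 assume "p \<in> fst c \<and> snd c p \<in> W"
 then have "p = chart_inv c (snd c p)" using c by simp
 then show "p \<in> chart_inv c ` W" using \<open>p \<in> fst c \<and> _\<close> by blast
qed

lemma openin_preimage:
 assumes G: "continuous_on M G" "G ` M \<subseteq> M" and cW: "c \<in> A" "openin (top_of_set M) W"
 shows "openin (top_of_set M) {p \<in> fst c. G p \<in> W}"
proof -
 have "openin (top_of_set M) (M \<inter> G -` W)"
  by (rule continuous_openin_preimage[OF G(1) _ cW(2)]) (use G(2) in auto)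
 then have "openin (top_of_set M) (fst c \<inter> (M \<inter> G -` W))" using chart_openin[OF cW(1)] by (rule openin_Int[rotated])
 also have "fst c \<inter> (M \<inter> G -` W) = {p \<in> fst c. G p \<in> W}" using chart_subset[OF cW(1)] by auto
 finally show ?thesis .
qed

lemma C1_map_differentiable: "C1_map M A G ==> differentiable_map M A G"
 unfolding C1_map_def differentiable_map_def C1_on_def differentiable_def by blast

lemma chart_deriv:
 assumes "differentiable_map M A G" "c \<in> A" "d \<in> A" "p \<in> fst c" "G p \<in> fst d"
 shows "((snd d \<circ> G \<circ> chart_inv c) has_derivative chart_deriv c d G p) (at (snd c p))"
 using assms unfolding differentiable_map_def chart_deriv_def frechet_derivative_works[symmetric] by blast

lemma has_derivative_chart_compose:
 assumes G: "differentiable_map M A G" and H: "differentiable_map M A H"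
  and cde: "c \<in> A" "d \<in> A" "e \<in> A" "p \<in> fst c" "H p \<in> fst d" "G (H p) \<in> fst e"
 shows "((snd e \<circ> (G \<circ> H) \<circ> chart_inv c) has_derivative chart_deriv d e G (H p) \<circ> chart_deriv c d H p) (at (snd c p))"
proof -
 have H1: "((snd d \<circ> H \<circ> chart_inv c) has_derivative chart_deriv c d H p) (at (snd c p))"
  by (rule chart_deriv[OF H cde(1,2,4,5)])
 have "(snd d \<circ> H \<circ> chart_inv c) (snd c p) = snd d (H p)" using cde by simp
 with chart_deriv[OF G cde(2,3,5,6)]
 have "((snd e \<circ> G \<circ> chart_inv d) has_derivative chart_deriv d e G (H p)) (at ((snd d \<circ> H \<circ> chart_inv c) (snd c p)))" by simp
 from diff_chain_at[OF H1 this]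
 have comp: "((snd e \<circ> G \<circ> chart_inv d) \<circ> (snd d \<circ> H \<circ> chart_inv c) has_derivative chart_deriv d e G (H p) \<circ> chart_deriv c d H p) (at (snd c p))" .
 \<comment> \<open>The chart d can be inserted between H and G only where H lands in its domain;
   this set is open in c-coordinates, which is enough for a derivative at p.\<close>
 let ?W = "{p \<in> fst c. H p \<in> fst d}"
 have "openin (top_of_set M) ?W"
  by (rule openin_preimage) (use H cde chart_openin in \<open>auto simp: differentiable_map_def\<close>)
 then have "open (snd c ` ?W)" by (intro open_chart_image cde) auto
 then show ?thesis
  by (rule has_derivative_transform_within_open[OF comp]) (use cde in auto)
qed

lemma chart_deriv_compose:
 assumes "differentiable_map M A G" "differentiable_map M A H"
  and "c \<in> A" "d \<in> A" "e \<in> A" "p \<in> fst c" "H p \<in> fst d" "G (H p) \<in> fst e"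
 shows "chart_deriv c e (G \<circ> H) p = chart_deriv d e G (H p) \<circ> chart_deriv c d H p"
 unfolding chart_deriv_def[of c e]
 by (rule frechet_derivative_at[symmetric, OF has_derivative_chart_compose[OF assms]])

lemma differentiable_map_compose:
 assumes G: "differentiable_map M A G" and H: "differentiable_map M A H"
 shows "differentiable_map M A (G \<circ> H)"
 unfolding differentiable_map_def
proof (intro conjI ballI impI)
 show "(G \<circ> H) ` M \<subseteq> M" using G H by (force simp: differentiable_map_def)
 show "continuous_on M (G \<circ> H)"
  using G H by (intro continuous_on_compose) (auto simp: differentiable_map_def intro: continuous_on_subset)
 fix c d p assume c: "c \<in> A" "d \<in> A" "p \<in> fst c" "(G \<circ> H) p \<in> fst d"
 have "H p \<in> M" using H chart_in_M[OF c(1,3)] by (auto simp: differentiable_map_def)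
 then obtain e where "e \<in> A" "H p \<in> fst e" using ex_chart by blast
 then show "(snd d \<circ> (G \<circ> H) \<circ> chart_inv c) differentiable at (snd c p)"
  using has_derivative_chart_compose[OF G H c(1) _ c(2,3)] c(4) unfolding differentiable_def comp_apply by blast
qed

lemma differentiable_map_id: "differentiable_map M A id"
 unfolding differentiable_map_def
proof (intro conjI ballI impI)
 fix c d p assume c: "c \<in> A" "d \<in> A" "p \<in> fst c" "id p \<in> fst d"
 have "C1_on (snd d \<circ> chart_inv c) (snd c ` (fst c \<inter> fst d))"
  using manifold c unfolding closed_manifold_def by blast
 then show "(snd d \<circ> id \<circ> chart_inv c) differentiable at (snd c p)"
  using c unfolding C1_on_def differentiable_def by auto
qed auto

lemma differentiable_map_funpow: "differentiable_map M A G ==> differentiable_map M A (G^^n)"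
 by (induction n) (auto simp: differentiable_map_compose differentiable_map_id)

lemma chart_deriv_cong:
 assumes "\<And>q. q \<in> M ==> G q = H q" "c \<in> A" "p \<in> fst c"
 shows "chart_deriv c d G p = chart_deriv c d H p"
proof -
 have "((snd d \<circ> G \<circ> chart_inv c) has_derivative D) (at (snd c p)) \<longleftrightarrow> ((snd d \<circ> H \<circ> chart_inv c) has_derivative D) (at (snd c p))" for D
 proof -
  have "\<And>z. z \<in> snd c ` fst c ==> (snd d \<circ> G \<circ> chart_inv c) z = (snd d \<circ> H \<circ> chart_inv c) z"
   using assms chart_in_M[OF assms(2)] by (auto simp del: split_paired_all)
  then show ?thesis
   using has_derivative_transform_within_open[OF _ chart_image_open[OF assms(2)] imageI[OF assms(3)]] by metis
 qed
 then show ?thesis unfolding chart_deriv_def frechet_derivative_def by simp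
qed

lemma chart_deriv_id:
 assumes "c \<in> A" "p \<in> fst c"
 shows "chart_deriv c c id p = id"
proof -
 have "(id has_derivative id) (at (snd c p))" by (simp add: id_def)
 then have "((snd c \<circ> id \<circ> chart_inv c) has_derivative id) (at (snd c p))"
  by (rule has_derivative_transform_within_open[OF _ chart_image_open[OF assms(1)]]) (use assms in auto)
 from frechet_derivative_at[OF this] show ?thesis by (simp add: chart_deriv_def)
qed

lemma chart_deriv_inverse:
 assumes "c \<in> A" "d \<in> A" "p \<in> fst c" "p \<in> fst d"
 shows "chart_deriv d c id p (chart_deriv c d id p v) = v"
 using chart_deriv_compose[OF differentiable_map_id differentiable_map_id, of c d c p] assms
 by (simp add: chart_deriv_id) (metis comp_apply id_apply)

lemma linear_chart_deriv:
 assumes "differentiable_map M A G" "c \<in> A" "d \<in> A" "p \<in> fst c" "G p \<in> fst d"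
 shows "linear (chart_deriv c d G p)"
 using chart_deriv[OF assms] by (rule has_derivative_linear)

lemma linear_to_tangent: "c \<in> A ==> p \<in> fst c ==> linear (to_tangent A c p)"
 unfolding to_tangent_eq by (intro linear_chart_deriv differentiable_map_id) (simp_all add: chart_at chart_in_M)

lemma bij_to_tangent: "c \<in> A ==> p \<in> fst c ==> bij (to_tangent A c p)"
 unfolding to_tangent_eq
 by (rule o_bij[where g = "chart_deriv (chart_at A p) c id p"])
  (simp_all add: fun_eq_iff chart_deriv_inverse chart_at chart_in_M)

lemma tangent_map_to_tangent:
 assumes G: "differentiable_map M A G" and c: "c \<in> A" "d \<in> A" "p \<in> fst c" "G p \<in> fst d"
 shows "tangent_map A G p (to_tangent A c p v) = to_tangent A d (G p) (chart_deriv c d G p v)"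
proof -
 have pM: "p \<in> M" "G p \<in> M" using c chart_in_M by blast+
 note [simp] = chart_at[OF pM(1)] chart_at[OF pM(2)]
 have "tangent_map A G p \<circ> to_tangent A c p = chart_deriv c (chart_at A (G p)) (G \<circ> id) p"
  unfolding tangent_map_eq to_tangent_eq by (subst chart_deriv_compose[OF G differentiable_map_id, of _ "chart_at A p"]) (use c in auto)
 also have "G \<circ> id = id \<circ> G" by simp
 also have "chart_deriv c (chart_at A (G p)) (id \<circ> G) p = to_tangent A d (G p) \<circ> chart_deriv c d G p"
  unfolding to_tangent_eq by (rule chart_deriv_compose[OF differentiable_map_id G]) (use c in auto)
 finally show ?thesis by (metis comp_apply)
qed

lemma tangent_map_compose:
 assumes G: "differentiable_map M A G" and H: "differentiable_map M A H" and p: "p \<in> M"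
 shows "tangent_map A (G \<circ> H) p v = tangent_map A G (H p) (tangent_map A H p v)"
proof -
 have "H p \<in> M" "G (H p) \<in> M" using G H p by (auto simp: differentiable_map_def)
 then show ?thesis unfolding tangent_map_eq
  using p chart_deriv_compose[OF G H, of "chart_at A p" "chart_at A (H p)" "chart_at A (G (H p))"] by (simp add: chart_at)
qed

lemma tangent_map_ident:
 assumes "\<And>q. q \<in> M ==> G q = q" "p \<in> M"
 shows "tangent_map A G p v = v"
 unfolding tangent_map_eq
 using assms chart_deriv_cong[of G id "chart_at A p" p] by (simp add: chart_at chart_deriv_id)

end

section \<open>Uniform estimates on compact sets\<close>

lemma C1_on_uniform_linearization:
 fixes H :: "'e::euclidean_space => 'e"
 assumes H: "C1_on H W" and W: "open W" and K: "compact K" "K \<subseteq> W" and \<eta>: "\<eta> > 0"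
 shows "\<exists>\<delta>>0. \<forall>z\<in>K. \<forall>z'. norm (z' - z) < \<delta> -->
  z' \<in> W \<and> norm (H z' - H z - frechet_derivative H (at z) (z' - z)) <= \<eta> * norm (z' - z)"
proof -
 obtain H' where H': "\<And>x. x \<in> W ==> (H has_derivative blinfun_apply (H' x)) (at x)" "continuous_on W H'"
  using H unfolding C1_on_def by blast
 obtain e where e: "e > 0" "(\<Union>x\<in>K. ball x e) \<subseteq> W" by (rule compact_subset_open_imp_ball_epsilon_subset[OF K(1) W K(2)])
 \<comment> \<open>A closed neighbourhood of K that is still compact and inside W: uniform
   continuity of the derivative on it gives one \<delta> for all base points, including points z'
   outside K.\<close>
 define K2 where "K2 = {x + y |x y. x \<in> K \<and> y \<in> cball 0 (e / 2)}"
 have sub: "K2 \<subseteq> W"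
 proof (intro subsetI)
  fix w assume "w \<in> K2"
  then obtain x y where xy: "w = x + y" "x \<in> K" "y \<in> cball 0 (e / 2)" unfolding K2_def by blast
  then have "w \<in> ball x e" using e(1) by (simp add: dist_norm)
  then show "w \<in> W" using e(2) xy(2) by blast
 qed
 have "compact K2" unfolding K2_def by (rule compact_sums[OF K(1) compact_cball])
 with continuous_on_subset[OF H'(2) sub] have "uniformly_continuous_on K2 H'" by (rule compact_uniformly_continuous)
 then obtain d where d: "0 < d" "\<And>x x'. x \<in> K2 ==> x' \<in> K2 ==> dist x' x < d ==> dist (H' x') (H' x) < \<eta>"
  using \<eta> unfolding uniformly_continuous_on_def by metis
 have "z' \<in> W \<and> norm (H z' - H z - frechet_derivative H (at z) (z' - z)) <= \<eta> * norm (z' - z)"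
  if z: "z \<in> K" "norm (z' - z) < min d (e / 2)" for z z'
 proof
  have mem: "w \<in> K2" if "norm (w - z) <= norm (z' - z)" for w
   unfolding K2_def using z that by (intro CollectI exI[of _ z] exI[of _ "w - z"]) auto
  show "z' \<in> W" using mem[of z'] sub by blast
  have seg: "z + t *\<^sub>R (z' - z) \<in> {w. norm (w - z) <= norm (z' - z)}" if "t \<in> {0..1}" for t
   using that mult_right_mono[of t 1 "norm (z' - z)"] by auto
  have "frechet_derivative H (at z) = blinfun_apply (H' z)"
   by (rule frechet_derivative_at[symmetric, OF H'(1)]) (use z K in blast)
  moreover have "norm (H z' - H z - blinfun_apply (H' z) (z' - z)) <= norm (z' - z) * \<eta>"
  proof (rule differentiable_bound_linearization[where f' = "\<lambda>w. blinfun_apply (H' w)" and ?x0.0 = z, OF seg])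
   fix w assume w: "w \<in> {w. norm (w - z) <= norm (z' - z)}"
   then show "(H has_derivative blinfun_apply (H' w)) (at w within {w. norm (w - z) <= norm (z' - z)})"
    using H'(1) mem sub by (blast intro: has_derivative_at_withinI)
   have "dist (H' w) (H' z) < \<eta>" using w z by (intro d(2) mem) (auto simp: dist_norm)
   then show "onorm (blinfun_apply (H' w) - blinfun_apply (H' z)) <= \<eta>"
    by (simp add: dist_norm norm_blinfun.rep_eq minus_blinfun.rep_eq fun_diff_def)
  qed auto
  ultimately show "norm (H z' - H z - frechet_derivative H (at z) (z' - z)) <= \<eta> * norm (z' - z)"
   by (simp add: mult.commute)
 qed
 then show ?thesis using d(1) e(1) by (intro exI[of _ "min d (e / 2)"]) auto
qed

lemma C1_on_derivative_bound:
 fixes H :: "'e::euclidean_space => 'e"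
 assumes H: "C1_on H W" and K: "compact K" "K \<subseteq> W"
 shows "\<exists>\<Lambda>. \<forall>z\<in>K. \<forall>v. norm (frechet_derivative H (at z) v) <= \<Lambda> * norm v"
proof -
 obtain H' where H': "\<And>x. x \<in> W ==> (H has_derivative blinfun_apply (H' x)) (at x)" "continuous_on W H'"
  using H unfolding C1_on_def by blast
 have "bounded (H' ` K)"
  by (intro compact_imp_bounded compact_continuous_image continuous_on_subset[OF H'(2)] K)
 then obtain \<Lambda> where \<Lambda>: "\<And>z. z \<in> K ==> norm (H' z) <= \<Lambda>" by (auto simp: bounded_iff)
 have "norm (frechet_derivative H (at z) v) <= \<Lambda> * norm v" if "z \<in> K" for z v
 proof -
  have "frechet_derivative H (at z) = blinfun_apply (H' z)"
   by (rule frechet_derivative_at[symmetric, OF H'(1)]) (use that K in blast)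
  then show ?thesis
   using norm_blinfun[of "H' z" v] mult_right_mono[OF \<Lambda>[OF that], of "norm v"] by simp
 qed
 then show ?thesis by blast
qed

locale riemannian_manifold = manifold M A
 for M :: "'a::t2_space set" and A :: "('a, 'e::euclidean_space) chart set" +
 fixes g :: "'a => 'e => 'e => real"
 assumes riemannian: "riemannian_metric M A g"
begin

text \<open>Continuity of the metric is given only for fixed coordinate vectors; expansion in the
  basis makes the quadratic form jointly continuous on K times the unit sphere, where it attains a
  positive minimum and a maximum. Homogeneity does the rest.\<close>

lemma tangent_norm_equiv:
 assumes c: "c \<in> A" and K: "compact K" "K \<subseteq> fst c"
 shows "\<exists>C\<ge>1. \<forall>p\<in>K. \<forall>v. norm v <= C * tangent_norm g p (to_tangent A c p v) \<and>
  tangent_norm g p (to_tangent A c p v) <= C * norm v"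
proof (cases "K = {}")
 case False
 define h where "h p v w = g p (to_tangent A c p v) (to_tangent A c p w)" for p v w
 have pM: "p \<in> M" "p \<in> fst c" if "p \<in> K" for p using that K chart_subset[OF c] by auto
 have bil: "bilinear (h p)" if "p \<in> K" for p
 proof -
  have "bilinear (g p)" using riemannian pM[OF that] by (simp add: riemannian_metric_def)
  then show ?thesis unfolding bilinear_def h_def
   using linear_compose[OF linear_to_tangent[OF c pM(2)[OF that]], unfolded o_def] by blast
 qed
 have expand: "h p v v = (\<Sum>(i, j)\<in>Basis \<times> Basis. (v \<bullet> i) * (v \<bullet> j) * h p i j)" if "p \<in> K" for p v
 proof -
  have "h p v v = h p (\<Sum>i\<in>Basis. (v \<bullet> i) *\<^sub>R i) (\<Sum>i\<in>Basis. (v \<bullet> i) *\<^sub>R i)" by (simp add: euclidean_representation)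
  also have "... = (\<Sum>(i, j)\<in>Basis \<times> Basis. h p ((v \<bullet> i) *\<^sub>R i) ((v \<bullet> j) *\<^sub>R j))" by (rule bilinear_sum[OF bil[OF that]])
  also have "... = (\<Sum>(i, j)\<in>Basis \<times> Basis. (v \<bullet> i) * (v \<bullet> j) * h p i j)"
   by (intro sum.cong refl) (simp add: case_prod_unfold bilinear_lmul[OF bil[OF that]] bilinear_rmul[OF bil[OF that]])
  finally show ?thesis .
 qed
 let ?S = "K \<times> sphere (0 :: 'e) 1"
 have hc: "continuous_on ?S (\<lambda>x. h (fst x) i j)" for i j
  unfolding h_def using riemannian K c unfolding riemannian_metric_def
  by (intro continuous_on_compose2[where f = fst and g = "\<lambda>p. g p (to_tangent A c p i) (to_tangent A c p j)" and t = "fst c"] continuous_on_fst continuous_on_id) auto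
 have "continuous_on ?S (\<lambda>x. \<Sum>(i, j)\<in>Basis \<times> Basis. (snd x \<bullet> i) * (snd x \<bullet> j) * h (fst x) i j)"
  unfolding case_prod_unfold by (intro continuous_intros hc)
 then have cont: "continuous_on ?S (\<lambda>x. h (fst x) (snd x) (snd x))"
  by (rule continuous_on_eq) (auto simp: expand)
 have cp: "compact ?S" "?S \<noteq> {}" using K(1) False by (auto intro: compact_Times)
 have hpos: "h p v v > 0" if "p \<in> K" "v \<noteq> 0" for p v
 proof -
  have "to_tangent A c p v \<noteq> 0"
   using bij_to_tangent[OF c pM(2)[OF that(1)]] linear_0[OF linear_to_tangent[OF c pM(2)[OF that(1)]]] that(2)
   by (metis bij_is_inj injD)
  then show ?thesis using riemannian pM[OF that(1)] by (simp add: h_def riemannian_metric_def)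
 qed
 obtain x0 x1 where x: "x0 \<in> ?S" "\<And>y. y \<in> ?S ==> h (fst x0) (snd x0) (snd x0) <= h (fst y) (snd y) (snd y)"
   "\<And>y. y \<in> ?S ==> h (fst y) (snd y) (snd y) <= h (fst x1) (snd x1) (snd x1)"
  using continuous_attains_inf[OF cp cont] continuous_attains_sup[OF cp cont] by blast
 define a b where "a = h (fst x0) (snd x0) (snd x0)" and "b = h (fst x1) (snd x1) (snd x1)"
 have a: "a > 0" unfolding a_def using x(1) by (intro hpos) auto
 define C where "C = max 1 (max (1 / sqrt a) (sqrt b))"
 have C: "1 <= C" "1 <= C * sqrt a" "sqrt b <= C"
 proof -
  have "1 / sqrt a <= C" by (simp add: C_def)
  then show "1 <= C * sqrt a" using a by (simp add: divide_le_eq)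
 qed (simp_all add: C_def)
 have "norm v <= C * sqrt (h p v v) \<and> sqrt (h p v v) <= C * norm v" if p: "p \<in> K" for p v
 proof (cases "v = 0")
  case False
  define u where "u = inverse (norm v) *\<^sub>R v"
  have v: "v = norm v *\<^sub>R u" and "(p, u) \<in> ?S" using False p by (auto simp: u_def)
  then have ab: "a <= h p u u" "h p u u <= b" using x(2,3)[of "(p, u)"] by (auto simp: a_def b_def)
  have "h p v v = (norm v)^2 * h p u u"
   by (subst v, subst (2) v) (simp add: bilinear_lmul[OF bil[OF p]] bilinear_rmul[OF bil[OF p]] power2_eq_square)
  then have eq: "sqrt (h p v v) = norm v * sqrt (h p u u)" by (simp add: real_sqrt_mult)
  have "norm v * 1 <= norm v * (C * sqrt (h p u u))"
   using C(1) ab(1) by (intro mult_left_mono order_trans[OF C(2)]) auto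
  moreover have "norm v * sqrt (h p u u) <= norm v * C"
   using ab(2) C(3) order_trans[of "sqrt (h p u u)" "sqrt b" C] by (intro mult_left_mono) auto
  ultimately show ?thesis unfolding eq by (simp add: ac_simps)
 qed (simp add: bilinear_lzero[OF bil[OF p]])
 then show ?thesis using C(1) unfolding tangent_norm_def h_def by blast
qed (auto intro: exI[of _ 1])

end

section \<open>Riemannian distance in charts\<close>

context riemannian_manifold begin

lemma velocity_to_tangent:
 assumes c: "c \<in> A" and I: "open I" "t \<in> I" "\<And>s. s \<in> I ==> \<gamma> s \<in> fst c"
  and D: "((snd c \<circ> \<gamma>) has_vector_derivative v) (at t)"
 shows "velocity A \<gamma> t = to_tangent A c (\<gamma> t) v"
proof -
 let ?d = "chart_at A (\<gamma> t)"
 have p: "\<gamma> t \<in> fst c" "\<gamma> t \<in> M" using I chart_in_M[OF c] by blast+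
 have "((snd ?d \<circ> id \<circ> chart_inv c) has_derivative to_tangent A c (\<gamma> t)) (at ((snd c \<circ> \<gamma>) t))"
  unfolding to_tangent_eq comp_apply[of "snd c"] using p c
  by (intro chart_deriv differentiable_map_id) (simp_all add: chart_at)
 from diff_chain_at[OF D[unfolded has_vector_derivative_def] this]
 have "((snd ?d \<circ> id \<circ> chart_inv c \<circ> (snd c \<circ> \<gamma>)) has_derivative (\<lambda>h. h *\<^sub>R to_tangent A c (\<gamma> t) v)) (at t)"
  by (simp add: o_def linear_cmul[OF linear_to_tangent[OF c p(1)]])
 then have "((snd ?d \<circ> \<gamma>) has_derivative (\<lambda>h. h *\<^sub>R to_tangent A c (\<gamma> t) v)) (at t)"
  by (rule has_derivative_transform_within_open[OF _ I(1,2)]) (use I(3) c in auto)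
 then show ?thesis unfolding velocity_def has_vector_derivative_def[symmetric] by (rule vector_derivative_at)
qed

text \<open>The coordinate velocity is at most C times the metric speed, so finite length makes it
  integrable, and the fundamental theorem of calculus holds across the finitely many
  corners.\<close>

lemma chart_dist_le_length:
 assumes \<gamma>: "piecewise_C1_path M A \<gamma>" and c: "c \<in> A" and ab: "0 <= a" "a <= b" "b <= 1" and K: "\<gamma> ` {a..b} \<subseteq> K" "K \<subseteq> fst c"
  and C: "C >= 1" "\<And>p v. p \<in> K ==> norm v <= C * tangent_norm g p (to_tangent A c p v)"
  and l: "path_length A g \<gamma> < ennreal l"
 shows "norm (snd c (\<gamma> b) - snd c (\<gamma> a)) <= C * l"
proof -
 have pth: "path \<gamma>" using \<gamma> by (simp add: piecewise_C1_path_def)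
 have in_c: "\<gamma> t \<in> fst c" if "t \<in> {a..b}" for t using K that by blast
 obtain S where S: "finite S" "{0, 1} \<subseteq> S" "(snd c \<circ> \<gamma>) C1_differentiable_on {t \<in> {0..1} - S. \<gamma> t \<in> fst c}"
  using \<gamma> c unfolding piecewise_C1_path_def by blast
 from S(3) obtain D where D: "\<And>t. t \<in> {t \<in> {0..1} - S. \<gamma> t \<in> fst c} ==> ((snd c \<circ> \<gamma>) has_vector_derivative D t) (at t)"
   "continuous_on {t \<in> {0..1} - S. \<gamma> t \<in> fst c} D" unfolding C1_differentiable_on_def by (elim exE conjE) blast
 have sub: "{a..b} - S \<subseteq> {t \<in> {0..1} - S. \<gamma> t \<in> fst c}" using ab in_c by auto
 define h where "h t = indicator ({a..b} - S) t *\<^sub>R D t" for t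
 have h_meas: "h \<in> borel_measurable borel"
  unfolding h_def using S(1)
  by (intro borel_measurable_continuous_on_indicator continuous_on_subset[OF D(2) sub] sets.Diff) (simp_all add: finite_imp_closed)
 have "norm (h t) / C <= tangent_norm g (\<gamma> t) (velocity A \<gamma> t)" if t: "t \<in> {a..b} - S" for t
 proof -
  have t01: "t \<in> {0<..<1}" using t ab S(2) by (cases "t = 0 \<or> t = 1") auto
  have "openin (top_of_set {0<..<1}) ({0<..<1} \<inter> \<gamma> -` fst c)"
   by (rule continuous_openin_preimage[OF _ _ chart_openin[OF c]])
    (use pth \<gamma> in \<open>auto simp: path_def piecewise_C1_path_def path_image_def elim!: continuous_on_subset\<close>)
  then have "open ({0<..<1} \<inter> \<gamma> -` fst c)" by (rule openin_open_trans) simp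
  then have "velocity A \<gamma> t = to_tangent A c (\<gamma> t) (D t)"
   by (rule velocity_to_tangent[OF c]) (use t t01 in_c D(1) sub in auto)
  moreover have "norm (D t) <= C * tangent_norm g (\<gamma> t) (to_tangent A c (\<gamma> t) (D t))"
   by (rule C(2)) (use t K in auto)
  ultimately show ?thesis using C(1) t by (simp add: h_def divide_le_eq mult.commute)
 qed
 then have "ennreal (norm (h t) / C) <= ennreal (tangent_norm g (\<gamma> t) (velocity A \<gamma> t)) * indicator {0..1} t" for t
  using ab by (cases "t \<in> {a..b} - S") (auto simp: h_def intro: ennreal_leI)
 then have "(\<integral>\<^sup>+t. ennreal (norm (h t) / C) \<partial>lborel) <= path_length A g \<gamma>"
  unfolding path_length_def by (intro nn_integral_mono)
 then have l': "(\<integral>\<^sup>+t. ennreal (norm (h t) / C) \<partial>lborel) < ennreal l" using l by simp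
 have "(\<integral>\<^sup>+t. ennreal (norm (h t)) \<partial>lborel) = (\<integral>\<^sup>+t. ennreal C * ennreal (norm (h t) / C) \<partial>lborel)"
  using C(1) by (intro nn_integral_cong) (simp add: ennreal_mult[symmetric])
 also have "... = ennreal C * (\<integral>\<^sup>+t. ennreal (norm (h t) / C) \<partial>lborel)"
  using h_meas by (intro nn_integral_cmult) auto
 also have "... <= ennreal C * ennreal l" using l' by (intro mult_left_mono) auto
 finally have int: "(\<integral>\<^sup>+t. ennreal (norm (h t)) \<partial>lborel) <= ennreal C * ennreal l" .
 have "(\<integral>\<^sup>+t. ennreal (norm (h t)) \<partial>lborel) < \<infinity>" by (rule order_le_less_trans[OF int]) (simp add: ennreal_mult_less_top)
 then have ih: "integrable lborel h" using h_meas by (intro integrableI_bounded) auto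
 have "(h has_integral ((snd c \<circ> \<gamma>) b - (snd c \<circ> \<gamma>) a)) {a..b}"
 proof (rule fundamental_theorem_of_calculus_interior_strong[OF S(1) ab(2)])
  show "((snd c \<circ> \<gamma>) has_vector_derivative h t) (at t)" if "t \<in> {a<..<b} - S" for t
   using D(1)[of t] subsetD[OF sub, of t] that by (simp add: h_def)
  show "continuous_on {a..b} (snd c \<circ> \<gamma>)"
   using pth ab in_c homeomorphism_cont1[OF chart_homeo[OF c]]
   by (intro continuous_on_compose) (auto simp: path_def elim!: continuous_on_subset)
 qed
 then have "((\<lambda>t. if t \<in> {a..b} then h t else 0) has_integral ((snd c \<circ> \<gamma>) b - (snd c \<circ> \<gamma>) a)) UNIV"
  by (simp only: has_integral_restrict_UNIV)
 moreover have "(\<lambda>t. if t \<in> {a..b} then h t else 0) = h" by (auto simp: h_def fun_eq_iff)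
 ultimately have "snd c (\<gamma> b) - snd c (\<gamma> a) = (\<integral>t. h t \<partial>lborel)"
  using has_integral_unique[OF has_integral_integral_lborel[OF ih]] by simp
 then have "ennreal (norm (snd c (\<gamma> b) - snd c (\<gamma> a))) <= ennreal C * ennreal l"
  using integral_norm_bound_ennreal[OF ih] int by (simp add: order_trans)
 moreover have "l >= 0" using l by (cases "l >= 0") (auto simp: ennreal_neg)
 ultimately show ?thesis using C(1) by (simp add: ennreal_mult[symmetric])
qed

text \<open>At the time nearest to s0 at which the path is outside radius \<open>3 * r\<close>, all
  earlier positions have coordinates within \<open>2 * r\<close>, because the displacement is at
  most \<open>C * l <= r\<close>. By closedness the same holds at that time, a contradiction. Both
  directions in time are treated, since s0 may be either end.\<close>

lemma path_stays_in_chart: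
 assumes \<gamma>: "piecewise_C1_path M A \<gamma>" and c: "c \<in> A" and r: "r > 0" "cball z (4 * r) \<subseteq> snd c ` fst c"
  and C: "C >= 1" "\<And>p v. p \<in> chart_inv c ` cball z (4 * r) ==> norm v <= C * tangent_norm g p (to_tangent A c p v)"
  and l: "path_length A g \<gamma> < ennreal l" "C * l <= r"
  and s0: "s0 \<in> {0..1}" "\<gamma> s0 \<in> chart_inv c ` cball z r" and t: "t \<in> {0..1}"
 shows "\<gamma> t \<in> fst c \<and> norm (snd c (\<gamma> t) - snd c (\<gamma> s0)) <= C * l"
proof -
 define O3 where "O3 = chart_inv c ` ball z (3 * r)"
 have pth: "continuous_on {0..1} \<gamma>" "\<gamma> ` {0..1} \<subseteq> M" using \<gamma> by (auto simp: piecewise_C1_path_def path_def path_image_def)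
 have sub: "ball z (3 * r) \<subseteq> snd c ` fst c" "cball z (2 * r) \<subseteq> snd c ` fst c" "cball z r \<subseteq> snd c ` fst c"
  using r by (auto elim!: subset_trans[rotated])
 note iff3 = chart_inv_image_iff[OF c sub(1)]
 note iff2 = chart_inv_image_iff[OF c sub(2)]
 note iff1 = chart_inv_image_iff[OF c sub(3)]
 have O3: "openin (top_of_set M) O3" unfolding O3_def by (rule openin_chart_inv_image[OF c _ sub(1)]) simp
 have O3_sub: "O3 \<subseteq> chart_inv c ` cball z (4 * r)" "chart_inv c ` cball z (4 * r) \<subseteq> fst c"
  using r(1) chart_inv_in[OF c] r(2) unfolding O3_def by (auto intro!: image_mono)
 have seg: "norm (snd c (\<gamma> u) - snd c (\<gamma> s0)) <= C * l"
  if u: "u \<in> {0..1}" "\<gamma> ` closed_segment s0 u \<subseteq> O3" for u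
 proof (cases "s0 <= u")
  case True
  then show ?thesis
   using chart_dist_le_length[OF \<gamma> c, of s0 u, OF _ _ _ _ O3_sub(2) C l(1)] u s0 O3_sub(1)
   by (auto simp: closed_segment_eq_real_ivl)
 next
  case False
  then show ?thesis
   using chart_dist_le_length[OF \<gamma> c, of u s0, OF _ _ _ _ O3_sub(2) C l(1)] u s0 O3_sub(1)
   by (auto simp: closed_segment_eq_real_ivl norm_minus_commute)
 qed
 let ?K = "chart_inv c ` cball z (2 * r)"
 have K_O3: "?K \<subseteq> O3" unfolding O3_def using r(1) by (intro image_mono) auto
 have seg2: "\<gamma> u \<in> ?K" if u: "u \<in> {0..1}" "\<gamma> ` closed_segment s0 u \<subseteq> O3" for u
 proof -
  have "\<gamma> u \<in> O3" using u(2) by auto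
  moreover have "dist z (snd c (\<gamma> s0)) <= r" using s0 iff1 by simp
  moreover have "dist (snd c (\<gamma> s0)) (snd c (\<gamma> u)) <= r"
   using seg[OF u] l(2) by (simp add: dist_norm norm_minus_commute)
  ultimately show ?thesis unfolding O3_def iff2 iff3
   using dist_triangle[of z "snd c (\<gamma> u)" "snd c (\<gamma> s0)"] by simp
 qed
 have s0_O3: "\<gamma> s0 \<in> O3" unfolding O3_def iff3 using s0(2) r(1) unfolding iff1 by simp
 define E where "E = {0..1} \<inter> \<gamma> -` (M - O3)"
 have "E = {}"
 proof (rule ccontr)
  assume "E \<noteq> {}"
  have "closedin (top_of_set {0..1}) E" unfolding E_def
   by (rule continuous_closedin_preimage_gen[OF pth(1), of M]) (use O3 pth(2) in \<open>auto intro!: closedin_diff[of "top_of_set M"]\<close>)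
  then have "closed E" by (rule closedin_closed_trans) simp
  then obtain u where u: "u \<in> E" "\<And>y. y \<in> E ==> dist s0 u <= dist s0 y"
   using distance_attains_inf[OF _ \<open>E \<noteq> {}\<close>] by metis
  have u01: "u \<in> {0..1}" "u \<noteq> s0" using u(1) s0_O3 by (auto simp: E_def)
  have inO: "\<gamma> v \<in> O3" if v: "v \<in> closed_segment s0 u" "v \<noteq> u" for v
  proof -
   have "dist s0 v < dist s0 u" "v \<in> {0..1}"
    using v u01 s0 by (auto simp: closed_segment_eq_real_ivl dist_real_def split: if_splits)
   moreover have "\<gamma> v \<in> M" using pth(2) \<open>v \<in> {0..1}\<close> by blast
   ultimately show ?thesis using u(2)[of v] by (force simp: E_def)
  qed
  have "open_segment s0 u \<subseteq> {0..1} \<inter> \<gamma> -` ?K"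
  proof
   fix v assume v: "v \<in> open_segment s0 u"
   have v01: "v \<in> {0..1}" using v u01 s0 by (auto simp: open_segment_eq_real_ivl split: if_splits)
   have "w \<in> closed_segment s0 u \<and> w \<noteq> u" if "w \<in> closed_segment s0 v" for w
    using that v by (auto simp: closed_segment_eq_real_ivl open_segment_eq_real_ivl split: if_splits)
   then have "\<gamma> ` closed_segment s0 v \<subseteq> O3" using inO by blast
   then show "v \<in> {0..1} \<inter> \<gamma> -` ?K" using seg2[OF v01] v01 by simp
  qed
  moreover have "closed ({0..1} \<inter> \<gamma> -` ?K)"
   by (intro continuous_closed_preimage[OF pth(1)] compact_imp_closed compact_chart_inv_image c sub) simp_all
  ultimately have "closure (open_segment s0 u) \<subseteq> {0..1} \<inter> \<gamma> -` ?K" by (rule closure_minimal)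
  then have "\<gamma> u \<in> ?K" using u01(2) by (simp add: closure_open_segment) blast
  then show False using u(1) K_O3 by (auto simp: E_def)
 qed
 then have "\<gamma> v \<in> O3" if "v \<in> {0..1}" for v using that pth(2) unfolding E_def by blast
 moreover have "closed_segment s0 t \<subseteq> {0..1}" using s0 t by (auto simp: closed_segment_eq_real_ivl)
 ultimately have "\<gamma> ` closed_segment s0 t \<subseteq> O3" "\<gamma> t \<in> O3" using t by auto
 then show ?thesis using seg[OF t] O3_sub by blast
qed

end

lemma finite_uniform_pos:
 assumes "finite S" "\<And>i. i \<in> S ==> \<exists>\<delta>>0 :: real. P i \<delta>" "\<And>i \<delta> \<delta>'. P i \<delta> ==> 0 < \<delta>' ==> \<delta>' <= \<delta> ==> P i \<delta>'"
 shows "\<exists>\<delta>>0 :: real. \<forall>i\<in>S. P i \<delta>"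
 using assms(1,2)
proof (induction S rule: finite_induct)
 case (insert x S)
 then obtain a b where a: "a > 0" "\<forall>i\<in>S. P i a" "b > 0" "P x b" by blast
 then have "\<forall>i\<in>insert x S. P i (min a b)" by (auto intro: assms(3))
 then show ?case using a by (intro exI[of _ "min a b"]) auto
qed (auto intro: exI[of _ 1])

lemma C1_on_subset: "C1_on H W ==> W' \<subseteq> W ==> C1_on H W'"
 unfolding C1_on_def by (meson continuous_on_subset subsetD)

context riemannian_manifold begin

abbreviation "d \<equiv> riemannian_dist M A g"

lemma dist_less_path:
 assumes "d x y < e"
 obtains \<gamma> where "piecewise_C1_path M A \<gamma>" "\<gamma> 0 = x" "\<gamma> 1 = y" "path_length A g \<gamma> < e"
 using assms unfolding riemannian_dist_def INF_less_iff pathstart_def pathfinish_def by blast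

text \<open>The straight segment in coordinates stays in the convex ball and is an admissible path
  of the required length.\<close>

lemma dist_le_chart_dist:
 assumes c: "c \<in> A" and sub: "ball z r \<subseteq> snd c ` fst c"
  and C: "C >= 1" "\<And>p v. p \<in> chart_inv c ` ball z r ==> tangent_norm g p (to_tangent A c p v) <= C * norm v"
  and xy: "x \<in> chart_inv c ` ball z r" "y \<in> chart_inv c ` ball z r"
 shows "d x y <= ennreal (C * norm (snd c y - snd c x))"
proof -
 note iff = chart_inv_image_iff[OF c sub]
 define w where "w = snd c y - snd c x"
 define ln where "ln t = snd c x + t *\<^sub>R w" for t
 define \<gamma> where "\<gamma> t = chart_inv c (ln t)" for t
 define J where "J = ln -` ball z r"
 have J: "open J" unfolding J_def ln_def by (intro open_vimage continuous_intros) simp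
 have "ln t \<in> ball z r" if "t \<in> {0..1}" for t
 proof -
  have "ln t = (1 - t) *\<^sub>R snd c x + t *\<^sub>R snd c y" by (simp add: ln_def w_def algebra_simps)
  then show ?thesis using xy that convexD_alt[OF convex_ball, of "snd c x" z r "snd c y" t] unfolding iff by simp
 qed
 then have J01: "{0..1} \<subseteq> J" by (auto simp: J_def)
 have \<gamma>_in: "\<gamma> t \<in> fst c" "snd c (\<gamma> t) = ln t" "\<gamma> t \<in> chart_inv c ` ball z r" if "t \<in> J" for t
  using that sub c chart_inv_in[OF c] by (auto simp: J_def \<gamma>_def)
 have lnd: "(ln has_derivative (\<lambda>h. h *\<^sub>R w)) (at t)" for t unfolding ln_def by (auto intro!: derivative_eq_intros)
 have ln_cont: "continuous_on T ln" for T unfolding ln_def by (intro continuous_intros)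
 have vel: "velocity A \<gamma> t = to_tangent A c (\<gamma> t) w" if "t \<in> J" for t
 proof (rule velocity_to_tangent[OF c J that \<gamma>_in(1)])
  show "((snd c \<circ> \<gamma>) has_vector_derivative w) (at t)" unfolding has_vector_derivative_def
   by (rule has_derivative_transform_within_open[OF lnd J that]) (simp add: \<gamma>_in)
 qed
 have "path \<gamma>" unfolding path_def \<gamma>_def
  by (rule continuous_on_compose2[OF continuous_on_subset[OF homeomorphism_cont2[OF chart_homeo[OF c]] sub] ln_cont])
   (use J01 in \<open>auto simp: J_def\<close>)
 moreover have "path_image \<gamma> \<subseteq> M" using J01 \<gamma>_in(1) chart_in_M[OF c] by (auto simp: path_image_def)
 moreover have "(snd e \<circ> \<gamma>) C1_differentiable_on {t \<in> {0..1} - {0, 1}. \<gamma> t \<in> fst e}" (is "_ C1_differentiable_on ?T") if e: "e \<in> A" for e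
 proof -
  let ?H = "snd e \<circ> chart_inv c"
  have "C1_on ?H (snd c ` (fst c \<inter> fst e))" using manifold c e by (simp add: closed_manifold_def)
  then obtain H' where H': "\<And>x. x \<in> snd c ` (fst c \<inter> fst e) ==> (?H has_derivative blinfun_apply (H' x)) (at x)"
    "continuous_on (snd c ` (fst c \<inter> fst e)) H'" unfolding C1_on_def by blast
  have mem: "ln t \<in> snd c ` (fst c \<inter> fst e)" if "t \<in> ?T" for t
  proof -
   have "t \<in> J" using that J01 by auto
   then show ?thesis using \<gamma>_in[of t] that by (metis (no_types, lifting) IntI imageI mem_Collect_eq)
  qed
  have "((snd e \<circ> \<gamma>) has_vector_derivative H' (ln t) w) (at t)" if "t \<in> ?T" for t
   using diff_chain_at[OF lnd H'(1)[OF mem[OF that]]]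
   by (simp add: has_vector_derivative_def o_def \<gamma>_def blinfun.scaleR_right)
  moreover have "continuous_on ?T (\<lambda>t. H' (ln t) w)"
   by (intro continuous_intros continuous_on_compose2[OF H'(2) ln_cont]) (use mem in blast)
  ultimately show ?thesis unfolding C1_differentiable_on_def by (intro exI[of _ "\<lambda>t. H' (ln t) w"] conjI ballI)
 qed
 ultimately have "piecewise_C1_path M A \<gamma>" unfolding piecewise_C1_path_def by (intro conjI exI[of _ "{0, 1}"]) auto
 moreover have "\<gamma> 0 = x" "\<gamma> 1 = y" using xy c unfolding iff by (simp_all add: \<gamma>_def ln_def w_def)
 ultimately have "d x y <= path_length A g \<gamma>"
  unfolding riemannian_dist_def pathstart_def pathfinish_def by (intro INF_lower) auto
 also have "... <= (\<integral>\<^sup>+t. ennreal (C * norm w) * indicator {0..1 :: real} t \<partial>lborel)"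
  unfolding path_length_def
 proof (intro nn_integral_mono)
  fix t :: real
  show "ennreal (tangent_norm g (\<gamma> t) (velocity A \<gamma> t)) * indicator {0..1} t <= ennreal (C * norm w) * indicator {0..1} t"
  proof (cases "t \<in> {0..1}")
   case True
   then have "t \<in> J" using J01 by blast
   then show ?thesis using vel C(2)[OF \<gamma>_in(3)] True by (simp add: ennreal_leI)
  qed simp
 qed
 also have "... = ennreal (C * norm w)" by (simp add: nn_integral_cmult_indicator)
 finally show ?thesis by (simp add: w_def)
qed

end

section \<open>A finite atlas of concentric coordinate balls\<close>

fun core :: "('a, 'e::euclidean_space) chart \<times> 'e \<times> real => 'a set" where
 "core (c, z, r) = chart_inv c ` cball z r"

fun patch :: "('a, 'e::euclidean_space) chart \<times> 'e \<times> real => 'a set" where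
 "patch (c, z, r) = chart_inv c ` ball z (3 * r)"

text \<open>Three radii are used: cores of radius r cover M, patches of radius \<open>3 * r\<close>
  contain everything closer than \<open>e\<^sub>0\<close> to a core, and norms are comparable up to
  \<open>4 * r\<close>. The condition \<open>C * e\<^sub>0 <= r\<close> says that a path of length
  below \<open>e\<^sub>0\<close> moves by at most r in coordinates.\<close>

locale adapted_charts = riemannian_manifold M A g
 for M :: "'a::t2_space set" and A :: "('a, 'e::euclidean_space) chart set" and g +
 fixes I :: "(('a, 'e) chart \<times> 'e \<times> real) set" and C :: real and e\<^sub>0 :: real
 assumes finite_I: "finite I" and C_ge_1: "C >= 1" and e0_pos: "e\<^sub>0 > 0"
  and I_chart: "\<And>c z r. (c, z, r) \<in> I ==> c \<in> A \<and> r > 0 \<and> cball z (4 * r) \<subseteq> snd c ` fst c \<and> C * e\<^sub>0 <= r"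
  and cover: "M \<subseteq> (\<Union>i\<in>I. core i)"
  and norm_equiv: "\<And>c z r p v. (c, z, r) \<in> I ==> p \<in> chart_inv c ` cball z (4 * r) ==>
   norm v <= C * tangent_norm g p (to_tangent A c p v) \<and> tangent_norm g p (to_tangent A c p v) <= C * norm v"

lemma (in riemannian_manifold) ex_adapted_charts: "\<exists>I C e. adapted_charts M A g I C e"
proof -
 have "\<exists>c z r. c \<in> A \<and> r > 0 \<and> cball z (4 * r) \<subseteq> snd c ` fst c \<and> p \<in> chart_inv c ` ball z r" if p: "p \<in> M" for p
 proof -
  obtain c where c: "c \<in> A" "p \<in> fst c" using ex_chart[OF p] by blast
  obtain e where e: "e > 0" "cball (snd c p) e \<subseteq> snd c ` fst c"
   using chart_image_open[OF c(1)] c(2) by (meson imageI open_contains_cball)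
  have "p \<in> chart_inv c ` ball (snd c p) (e / 4)"
   by (rule image_eqI[of _ _ "snd c p"]) (use c e in auto)
  then show ?thesis using c e by (intro exI[of _ c] exI[of _ "snd c p"] exI[of _ "e / 4"]) auto
 qed
 then obtain c z r where czr: "\<And>p. p \<in> M ==> c p \<in> A \<and> r p > 0 \<and> cball (z p) (4 * r p) \<subseteq> snd (c p) ` fst (c p) \<and> p \<in> chart_inv (c p) ` ball (z p) (r p)"
  by metis
 define U where "U p = chart_inv (c p) ` ball (z p) (r p)" for p
 have "openin (top_of_set M) (U p)" if "p \<in> M" for p
 proof -
  have "ball (z p) (r p) \<subseteq> cball (z p) (4 * r p)" using czr[OF that] by auto
  then show ?thesis unfolding U_def using czr[OF that] by (intro openin_chart_inv_image) auto
 qed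
 moreover have "compact M" using manifold by (simp add: closed_manifold_def)
 moreover have "M \<subseteq> \<Union> (U ` M)" using czr by (auto simp: U_def)
 ultimately obtain D where D: "D \<subseteq> U ` M" "finite D" "M \<subseteq> \<Union> D" unfolding compact_eq_openin_cover by (metis (no_types, lifting) imageE)
 obtain P where "P \<subseteq> M" "finite P" "D = U ` P" using finite_subset_image[OF D(2,1)] by blast
 with D(3) have P: "P \<subseteq> M" "finite P" "M \<subseteq> (\<Union>p\<in>P. chart_inv (c p) ` ball (z p) (r p))" by (auto simp: U_def)
 define I where "I = (\<lambda>p. (c p, z p, r p)) ` P"
 have I: "finite I" "\<And>c z r. (c, z, r) \<in> I ==> c \<in> A \<and> r > 0 \<and> cball z (4 * r) \<subseteq> snd c ` fst c"
  using P(2) czr subsetD[OF P(1)] unfolding I_def by blast+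
 have cov: "M \<subseteq> (\<Union>i\<in>I. core i)"
 proof
  fix x assume "x \<in> M"
  then obtain p where p: "p \<in> P" "x \<in> chart_inv (c p) ` ball (z p) (r p)" using P(3) by blast
  then have "x \<in> core (c p, z p, r p)" using ball_subset_cball[of "z p" "r p"] by auto
  then show "x \<in> (\<Union>i\<in>I. core i)" using p(1) by (auto simp: I_def simp del: core.simps)
 qed
 define Q where "Q i b \<longleftrightarrow> (case i of (c, z, r) => \<forall>p\<in>chart_inv c ` cball z (4 * r). \<forall>v.
  norm v <= b * tangent_norm g p (to_tangent A c p v) \<and> tangent_norm g p (to_tangent A c p v) <= b * norm v)" for i :: "('a, 'e) chart \<times> 'e \<times> real" and b
 have "\<forall>i\<in>I. \<exists>b\<ge>1. Q i b"
 proof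
  fix i assume i: "i \<in> I"
  obtain c z r where czr: "i = (c, z, r)" by (cases i)
  note I' = I(2)[OF i[unfolded czr]]
  have "compact (chart_inv c ` cball z (4 * r))" "chart_inv c ` cball z (4 * r) \<subseteq> fst c"
   using I' chart_inv_in[of c] by (auto intro!: compact_chart_inv_image)
  from tangent_norm_equiv[OF _ this] I' show "\<exists>b\<ge>1. Q i b" unfolding czr Q_def prod.case by blast
 qed
 then obtain b where b: "\<And>i. i \<in> I ==> b i >= 1" "\<And>i. i \<in> I ==> Q i (b i)" by metis
 define B where "B = 1 + (\<Sum>i\<in>I. b i)"
 have B: "B >= 1" unfolding B_def using b(1) by (simp add: sum_nonneg order_trans[OF zero_le_one])
 have bB: "b i <= B" if "i \<in> I" for i
  unfolding B_def using member_le_sum[OF that, of b] I(1) b(1) by (smt (verit) DiffD1)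
 have "\<exists>e>0. \<forall>i\<in>I. B * e <= snd (snd i)"
 proof (rule finite_uniform_pos[OF I(1)])
  show "\<exists>e>0. B * e <= snd (snd i)" if "i \<in> I" for i
   using I(2)[of "fst i" "fst (snd i)" "snd (snd i)"] that B by (intro exI[of _ "snd (snd i) / B"]) auto
  show "B * e' <= snd (snd i)" if "B * e <= snd (snd i)" "0 < e'" "e' <= e" for i :: "('a, 'e) chart \<times> 'e \<times> real" and e e'
   using that B mult_left_mono[of e' e B] by linarith
 qed
 then obtain e where e: "e > 0" "\<And>i. i \<in> I ==> B * e <= snd (snd i)" by blast
 have "adapted_charts M A g I B e"
 proof unfold_locales
  fix c z r p v assume i: "(c, z, r) \<in> I" "p \<in> chart_inv c ` cball z (4 * r)"
  let ?n = "tangent_norm g p (to_tangent A c p v)"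
  have *: "norm v <= b (c, z, r) * ?n" "?n <= b (c, z, r) * norm v"
   using b(2)[OF i(1)] i(2) unfolding Q_def prod.case by blast+
  have "0 <= b (c, z, r) * ?n" using *(1) norm_ge_zero by (rule order_trans[rotated])
  then have "0 <= ?n" using b(1)[OF i(1)] by (simp add: zero_le_mult_iff)
  then show "norm v <= B * ?n \<and> ?n <= B * norm v"
   using * mult_right_mono[OF bB[OF i(1)], of ?n] mult_right_mono[OF bB[OF i(1)], of "norm v"] by auto
 qed (use I cov e B in \<open>force+\<close>)
 then show ?thesis by blast
qed

context adapted_charts begin

text \<open>Each point gets one preferred core. V is the coordinate displacement from p, and L the
  derivative between the preferred charts at p and at its image. The choice may jump with p; all
  estimates below are uniform over the finite atlas.\<close>

definition "idx p = (SOME i. i \<in> I \<and> p \<in> core i)"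
definition "ch p = fst (idx p)"
definition "V p y = snd (ch p) y - snd (ch p) p"
definition "L G p = chart_deriv (ch p) (ch (G p)) G p"

lemma idx: "p \<in> M ==> idx p \<in> I \<and> p \<in> core (idx p)"
 unfolding idx_def by (rule someI_ex) (use cover in blast)

lemma I_subsets:
 assumes "(c, z, r) \<in> I"
 shows "ball z (3 * r) \<subseteq> snd c ` fst c" "cball z r \<subseteq> snd c ` fst c" "core (c, z, r) \<subseteq> patch (c, z, r)"
  "patch (c, z, r) \<subseteq> chart_inv c ` cball z (4 * r)" "patch (c, z, r) \<subseteq> fst c" "core (c, z, r) \<subseteq> fst c"
 using I_chart[OF assms] chart_inv_in[of c] by (auto simp: subset_iff intro!: imageI)

lemma patch_iff: "(c, z, r) \<in> I ==> p \<in> patch (c, z, r) \<longleftrightarrow> p \<in> fst c \<and> snd c p \<in> ball z (3 * r)"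
 unfolding patch.simps using I_chart I_subsets(1) by (intro chart_inv_image_iff) auto

lemma core_iff: "(c, z, r) \<in> I ==> p \<in> core (c, z, r) \<longleftrightarrow> p \<in> fst c \<and> snd c p \<in> cball z r"
 unfolding core.simps using I_chart I_subsets(2) by (intro chart_inv_image_iff) auto

lemma openin_patch: "i \<in> I ==> openin (top_of_set M) (patch i)"
proof -
 obtain c z r where "i = (c, z, r)" by (cases i)
 then show "i \<in> I ==> openin (top_of_set M) (patch i)"
  using I_chart[of c z r] openin_chart_inv_image[OF _ open_ball I_subsets(1)[of c z r]] by simp
qed

lemma patch_in: "i \<in> I ==> p \<in> patch i ==> p \<in> fst (fst i)" "i \<in> I ==> p \<in> core i ==> p \<in> patch i"
 "i \<in> I ==> fst i \<in> A"
proof -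
 obtain c z r where "i = (c, z, r)" by (cases i)
 then show "i \<in> I ==> p \<in> patch i ==> p \<in> fst (fst i)" "i \<in> I ==> p \<in> core i ==> p \<in> patch i" "i \<in> I ==> fst i \<in> A"
  using I_subsets(3,5)[of c z r] I_chart[of c z r] by (simp_all only: fst_conv) blast+
qed

lemma ch: "p \<in> M ==> ch p \<in> A" "p \<in> M ==> p \<in> fst (ch p)" "p \<in> M ==> y \<in> patch (idx p) ==> y \<in> fst (ch p)"
 "p \<in> M ==> p \<in> patch (idx p)"
 unfolding ch_def using idx patch_in by blast+

text \<open>Either endpoint may be the one in the core: the connecting path is followed in both
  directions by \<open>path_stays_in_chart\<close>.\<close>

lemma chart_dist_less:
 assumes i: "i \<in> I" and xy: "x \<in> core i \<or> y \<in> core i" and e: "d x y < ennreal e" "e <= e\<^sub>0"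
 shows "x \<in> patch i" "y \<in> patch i" "norm (snd (fst i) y - snd (fst i) x) <= C * e"
proof -
 obtain c z r where czr: "i = (c, z, r)" by (cases i)
 have ci: "c \<in> A" "r > 0" "cball z (4 * r) \<subseteq> snd c ` fst c" "C * e\<^sub>0 <= r" using I_chart i czr by auto
 have Ce: "C * e <= r" using mult_left_mono[OF e(2), of C] C_ge_1 ci(4) by linarith
 obtain \<gamma> where \<gamma>: "piecewise_C1_path M A \<gamma>" "\<gamma> 0 = x" "\<gamma> 1 = y" "path_length A g \<gamma> < ennreal e" by (rule dist_less_path[OF e(1)])
 have nb: "norm v <= C * tangent_norm g p (to_tangent A c p v)" if "p \<in> chart_inv c ` cball z (4 * r)" for p v
  using norm_equiv[OF i[unfolded czr] that] by simp
 obtain s where s: "s \<in> {0, 1 :: real}" "\<gamma> s \<in> core i" using xy \<gamma>(2,3) by auto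
 then have s': "s \<in> {0..1}" "\<gamma> s \<in> chart_inv c ` cball z r" by (auto simp: czr)
 have stay: "\<gamma> t \<in> fst c \<and> norm (snd c (\<gamma> t) - snd c (\<gamma> s)) <= C * e" if "t \<in> {0..1}" for t
  by (rule path_stays_in_chart[OF \<gamma>(1) ci(1-3) C_ge_1 nb \<gamma>(4) Ce s' that])
 have "\<gamma> t \<in> patch i" if t: "t \<in> {0..1}" for t
 proof -
  have "dist z (snd c (\<gamma> s)) <= r" using s(2) core_iff[OF i[unfolded czr]] unfolding czr by simp
  moreover have "dist (snd c (\<gamma> s)) (snd c (\<gamma> t)) <= r" using stay[OF t] Ce by (simp add: dist_norm norm_minus_commute)
  ultimately show ?thesis
   using stay[OF t] ci(2) dist_triangle[of z "snd c (\<gamma> t)" "snd c (\<gamma> s)"] unfolding czr patch_iff[OF i[unfolded czr]] by simp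
 qed
 from this[of 0] this[of 1] show "x \<in> patch i" "y \<in> patch i" using \<gamma> by auto
 show "norm (snd (fst i) y - snd (fst i) x) <= C * e"
  using stay[of 0] stay[of 1] s(1) \<gamma>(2,3) by (auto simp: czr norm_minus_commute)
qed

lemma dist_le_chart: 
 assumes i: "i \<in> I" and xy: "x \<in> patch i" "y \<in> patch i"
 shows "d x y <= ennreal (C * norm (snd (fst i) y - snd (fst i) x))"
proof -
 obtain c z r where czr: "i = (c, z, r)" by (cases i)
 have i': "(c, z, r) \<in> I" using i czr by simp
 have sub: "chart_inv c ` ball z (3 * r) \<subseteq> chart_inv c ` cball z (4 * r)" using I_subsets(4)[OF i'] by simp
 show ?thesis unfolding czr fst_conv
  by (rule dist_le_chart_dist[OF _ I_subsets(1)[OF i'] C_ge_1])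
   (use I_chart[OF i'] norm_equiv[OF i' subsetD[OF sub]] xy czr in auto)
qed

lemma V_less:
 assumes "p \<in> M" "d p y < ennreal e" "e <= e\<^sub>0"
 shows "y \<in> patch (idx p)" "norm (V p y) <= C * e"
 using chart_dist_less[of "idx p" p y e] idx assms by (auto simp: V_def ch_def)

lemma dist_le_V: "p \<in> M ==> y \<in> patch (idx p) ==> d p y <= ennreal (C * norm (V p y))"
 unfolding V_def ch_def by (rule dist_le_chart) (use idx patch_in in auto)

text \<open>Symmetry and triangle inequality in one, at the price of a smaller radius. Both points
  are viewed in the preferred chart of z, where the norm provides them.\<close>

lemma quasi_triangle:
 assumes e: "e > 0"
 shows "\<exists>e'>0. e' <= e \<and> (\<forall>x y z. z \<in> M --> d x z < ennreal e' --> d y z < ennreal e' --> d y x < ennreal e)"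
proof -
 \<comment> \<open>C is paid on entering and on leaving the chart and the triangle inequality gives
   2, so the distance is at most \<open>2 * C^2 * e' <= e / 2\<close>.\<close>
 define e' where "e' = min e (min e\<^sub>0 (e / (4 * C^2)))"
 have C2: "C^2 > 0" using C_ge_1 by simp
 have e': "e' > 0" "e' <= e\<^sub>0" "e' <= e / (4 * C^2)" "e' <= e" using e e0_pos C2 by (simp_all add: e'_def)
 have "d y x < ennreal e" if z: "z \<in> M" and xz: "d x z < ennreal e'" and yz: "d y z < ennreal e'" for x y z
 proof -
  note i = idx[OF z]
  note X = chart_dist_less[OF conjunct1[OF i] disjI2[OF conjunct2[OF i]] xz e'(2)]
  note Y = chart_dist_less[OF conjunct1[OF i] disjI2[OF conjunct2[OF i]] yz e'(2)]
  have "norm (snd (ch z) x - snd (ch z) y) <= 2 * (C * e')"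
   using X(3) Y(3) norm_triangle_ineq4[of "snd (ch z) z - snd (ch z) y" "snd (ch z) z - snd (ch z) x"] by (simp add: ch_def)
  then have "C * norm (snd (ch z) x - snd (ch z) y) <= C * (2 * (C * e'))" using C_ge_1 by (intro mult_left_mono) auto
  also have "... = 2 * C^2 * e'" by (simp add: power2_eq_square)
  also have "... <= 2 * C^2 * (e / (4 * C^2))" using e'(3) by (intro mult_left_mono) auto
  also have "... < e" using e C2 by (simp add: field_simps)
  finally show ?thesis
   using dist_le_chart[OF conjunct1[OF i] Y(1) X(1)] e by (simp add: ch_def ennreal_lessI order_le_less_trans)
 qed
 then show ?thesis using e'(1,4) by blast
qed

text \<open>Uniform first-order approximation between preferred charts. It is stated so as to be
  stable under composition, because hyperbolicity is visible only for an iterate of F.\<close>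

definition linearizable :: "('a => 'a) => bool" where
 "linearizable G \<longleftrightarrow> differentiable_map M A G \<and> (\<exists>\<Lambda>\<ge>0. \<forall>p\<in>M. \<forall>v. norm (L G p v) <= \<Lambda> * norm v) \<and>
  (\<forall>\<eta>>0. \<exists>\<delta>>0. \<forall>p\<in>M. \<forall>y\<in>patch (idx p). norm (V p y) < \<delta> -->
    G y \<in> patch (idx (G p)) \<and> norm (V (G p) (G y) - L G p (V p y)) <= \<eta> * norm (V p y))"

lemma linear_L: "differentiable_map M A G ==> p \<in> M ==> linear (L G p)"
 unfolding L_def by (rule linear_chart_deriv) (auto simp: ch differentiable_map_def image_subset_iff)

lemma L_compose: "differentiable_map M A G ==> differentiable_map M A H ==> p \<in> M ==> L (G \<circ> H) p v = L G (H p) (L H p v)"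
 using chart_deriv_compose[of G H "ch p" "ch (H p)" "ch (G (H p))" p]
 by (auto simp: L_def ch differentiable_map_def image_subset_iff)

lemma linearizable_id: "linearizable id"
proof -
 have "L id p v = v" if "p \<in> M" for p v unfolding L_def using that by (simp add: chart_deriv_id ch)
 then show ?thesis unfolding linearizable_def
  by (auto simp: differentiable_map_id intro!: exI[of _ "1 :: real"])
qed

lemma linearizable_compose:
 assumes G: "linearizable G" and H: "linearizable H"
 shows "linearizable (G \<circ> H)"
proof -
 have dG: "differentiable_map M A G" and dH: "differentiable_map M A H" using G H by (simp_all add: linearizable_def)
 have HM: "H p \<in> M" if "p \<in> M" for p using dH that by (auto simp: differentiable_map_def)
 obtain a where a: "a >= 0" "\<And>p v. p \<in> M ==> norm (L G p v) <= a * norm v" using G unfolding linearizable_def by blast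
 obtain b where b: "b >= 0" "\<And>p v. p \<in> M ==> norm (L H p v) <= b * norm v" using H unfolding linearizable_def by blast
 have bound: "norm (L (G \<circ> H) p v) <= a * b * norm v" if "p \<in> M" for p v
  unfolding L_compose[OF dG dH that]
  using order_trans[OF a(2)[OF HM[OF that]] mult_left_mono[OF b(2)[OF that] a(1)]] by (simp add: mult.assoc)
 have "\<exists>\<delta>>0. \<forall>p\<in>M. \<forall>y\<in>patch (idx p). norm (V p y) < \<delta> -->
   G (H y) \<in> patch (idx (G (H p))) \<and> norm (V (G (H p)) (G (H y)) - L (G \<circ> H) p (V p y)) <= \<eta> * norm (V p y)" if \<eta>: "\<eta> > 0" for \<eta>
 proof -
  \<comment> \<open>The composite error is \<open>\<eta>' * (b + 1)\<close> from G, whose argument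
    grows by at most \<open>b + 1\<close>, plus \<open>a * \<eta>'\<close> from H pushed forward by
    the derivative of G.\<close>
  define \<eta>' where "\<eta>' = min 1 (\<eta> / (a + b + 1))"
  have ab: "a + b + 1 > 0" using a b by linarith
  have \<eta>': "\<eta>' > 0" "\<eta>' <= 1" "\<eta>' * (a + b + 1) <= \<eta>"
  proof -
   have "\<eta>' <= \<eta> / (a + b + 1)" by (simp add: \<eta>'_def)
   then show "\<eta>' * (a + b + 1) <= \<eta>" using ab by (simp add: le_divide_eq)
  qed (use \<eta> ab in \<open>simp_all add: \<eta>'_def\<close>)
  obtain \<delta>G where \<delta>G: "\<delta>G > 0" "\<And>p y. p \<in> M ==> y \<in> patch (idx p) ==> norm (V p y) < \<delta>G ==>
    G y \<in> patch (idx (G p)) \<and> norm (V (G p) (G y) - L G p (V p y)) <= \<eta>' * norm (V p y)"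
   using G \<eta>'(1) unfolding linearizable_def by metis
  obtain \<delta>H where \<delta>H: "\<delta>H > 0" "\<And>p y. p \<in> M ==> y \<in> patch (idx p) ==> norm (V p y) < \<delta>H ==>
    H y \<in> patch (idx (H p)) \<and> norm (V (H p) (H y) - L H p (V p y)) <= \<eta>' * norm (V p y)"
   using H \<eta>'(1) unfolding linearizable_def by metis
  have "G (H y) \<in> patch (idx (G (H p))) \<and> norm (V (G (H p)) (G (H y)) - L (G \<circ> H) p (V p y)) <= \<eta> * norm (V p y)"
   if p: "p \<in> M" "y \<in> patch (idx p)" "norm (V p y) < min \<delta>H (\<delta>G / (b + 1))" for p y
  proof -
   let ?v = "V p y" and ?w = "V (H p) (H y)"
   have h: "H y \<in> patch (idx (H p))" "norm (?w - L H p ?v) <= \<eta>' * norm ?v" using \<delta>H(2)[OF p(1,2)] p(3) by auto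
   have "norm ?w <= norm (?w - L H p ?v) + norm (L H p ?v)" using norm_triangle_ineq[of "?w - L H p ?v" "L H p ?v"] by simp
   also have "... <= 1 * norm ?v + b * norm ?v"
    using h(2) b(2)[OF p(1)] \<eta>'(2) by (intro add_mono order_trans[OF h(2)] mult_right_mono) auto
   finally have w: "norm ?w <= (b + 1) * norm ?v" by (simp add: algebra_simps)
   also have "... < \<delta>G" using p(3) b(1) by (simp add: less_divide_eq mult.commute)
   finally have g': "G (H y) \<in> patch (idx (G (H p)))" "norm (V (G (H p)) (G (H y)) - L G (H p) ?w) <= \<eta>' * norm ?w"
    using \<delta>G(2)[OF HM[OF p(1)] h(1)] by auto
   have "norm (L G (H p) ?w - L (G \<circ> H) p ?v) = norm (L G (H p) (?w - L H p ?v))"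
    by (simp add: L_compose[OF dG dH p(1)] linear_diff[OF linear_L[OF dG HM[OF p(1)]]])
   also have "... <= a * (\<eta>' * norm ?v)" by (rule order_trans[OF a(2)[OF HM[OF p(1)]] mult_left_mono[OF h(2) a(1)]])
   finally have "norm (V (G (H p)) (G (H y)) - L (G \<circ> H) p ?v) <= \<eta>' * norm ?w + a * (\<eta>' * norm ?v)"
    using norm_triangle_ineq[of "V (G (H p)) (G (H y)) - L G (H p) ?w" "L G (H p) ?w - L (G \<circ> H) p ?v"] g'(2) by simp
   also have "... <= \<eta>' * ((b + 1) * norm ?v) + a * (\<eta>' * norm ?v)" using w \<eta>'(1) by (intro add_right_mono mult_left_mono) auto
   also have "... = (\<eta>' * (a + b + 1)) * norm ?v" by (simp add: algebra_simps)
   also have "... <= \<eta> * norm ?v" using \<eta>'(3) by (intro mult_right_mono) auto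
   finally show ?thesis using g'(1) by simp
  qed
  then show ?thesis using \<delta>G(1) \<delta>H(1) b(1) by (intro exI[of _ "min \<delta>H (\<delta>G / (b + 1))"]) auto
 qed
 moreover have "\<exists>\<Lambda>\<ge>0. \<forall>p\<in>M. \<forall>v. norm (L (G \<circ> H) p v) <= \<Lambda> * norm v"
  using a(1) b(1) bound by (intro exI[of _ "a * b"]) simp
 ultimately show ?thesis using differentiable_map_compose[OF dG dH] by (simp add: linearizable_def)
qed

lemma linearizable_funpow: "linearizable G ==> linearizable (G^^n)"
 by (induction n) (simp_all add: linearizable_id linearizable_compose)

text \<open>For each pair of cores, the points of the first that F maps into the second form a
  compact set, on which the local estimates are uniform; there are finitely many pairs.\<close>

lemma linearizable_C1_map:
 assumes F: "C1_map M A F"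
 shows "linearizable F"
proof -
 have FM: "F ` M \<subseteq> M" "continuous_on M F" using F by (auto simp: C1_map_def)
 define H where "H i j = snd (fst j) \<circ> F \<circ> chart_inv (fst i)" for i j :: "('a, 'e) chart \<times> 'e \<times> real"
 define K where "K i j = snd (fst i) ` {p \<in> core i. F p \<in> core j}" for i j :: "('a, 'e) chart \<times> 'e \<times> real"
 define W where "W i j = snd (fst i) ` {p \<in> fst (fst i). F p \<in> patch j}" for i j :: "('a, 'e) chart \<times> 'e \<times> real"
 have KW: "C1_on (H i j) (W i j)" "open (W i j)" "compact (K i j)" "K i j \<subseteq> W i j" if ij: "i \<in> I" "j \<in> I" for i j
 proof -
  note A = patch_in(3)[OF ij(1)] patch_in(3)[OF ij(2)]
  have "C1_on (H i j) (snd (fst i) ` {p \<in> fst (fst i). F p \<in> fst (fst j)})" using F A unfolding C1_map_def H_def by blast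
  then show "C1_on (H i j) (W i j)" by (rule C1_on_subset) (use patch_in(1)[OF ij(2)] in \<open>auto simp: W_def\<close>)
  show "open (W i j)" unfolding W_def
   using patch_in(1) ij by (intro open_chart_image[OF A(1) openin_preimage[OF FM(2,1) A(1) openin_patch[OF ij(2)]]]) auto
  show "K i j \<subseteq> W i j" unfolding K_def W_def using patch_in ij by blast
  have cc: "compact (core k)" "core k \<subseteq> fst (fst k)" "core k \<subseteq> M" if "k \<in> I" for k
  proof -
   obtain c z r where k: "k = (c, z, r)" by (cases k)
   show "compact (core k)" using that I_chart[of c z r] I_subsets(2)[of c z r] unfolding k core.simps by (intro compact_chart_inv_image) auto
   show "core k \<subseteq> fst (fst k)" using that patch_in by blast
   then show "core k \<subseteq> M" using chart_in_M[OF patch_in(3)[OF that]] by blast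
  qed
  have "closed (core i \<inter> F -` core j)"
   by (intro continuous_closed_preimage continuous_on_subset[OF FM(2)] compact_imp_closed cc ij)
  then have "compact (core i \<inter> (core i \<inter> F -` core j))" using cc(1)[OF ij(1)] by (rule compact_Int_closed[rotated])
  moreover have "continuous_on (core i \<inter> (core i \<inter> F -` core j)) (snd (fst i))"
   by (rule continuous_on_subset[OF homeomorphism_cont1[OF chart_homeo[OF A(1)]]]) (use cc(2)[OF ij(1)] in auto)
  ultimately have "compact (snd (fst i) ` (core i \<inter> (core i \<inter> F -` core j)))" by (intro compact_continuous_image)
  also have "core i \<inter> (core i \<inter> F -` core j) = {p \<in> core i. F p \<in> core j}" by auto
  finally show "compact (K i j)" unfolding K_def .
 qed
 have mem: "snd (ch p) p \<in> K (idx p) (idx (F p))" "idx p \<in> I" "idx (F p) \<in> I" "F p \<in> M" if "p \<in> M" for p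
 proof -
  show FpM: "F p \<in> M" using that FM(1) by blast
  show "snd (ch p) p \<in> K (idx p) (idx (F p))" unfolding K_def ch_def using idx[OF that] idx[OF FpM] by blast
 qed (use idx that FM(1) in blast)+
 have L_eq: "L F p = frechet_derivative (H (idx p) (idx (F p))) (at (snd (ch p) p))" for p
  by (simp add: L_def chart_deriv_def H_def ch_def)
 have "\<exists>\<Lambda>\<ge>0. \<forall>p\<in>M. \<forall>v. norm (L F p v) <= \<Lambda> * norm v"
 proof -
  have "\<forall>i\<in>I. \<forall>j\<in>I. \<exists>\<Lambda>. \<forall>z\<in>K i j. \<forall>v. norm (frechet_derivative (H i j) (at z) v) <= \<Lambda> * norm v"
   by (intro ballI C1_on_derivative_bound[OF KW(1,3,4)])
  then obtain \<Lambda> where \<Lambda>: "\<And>i j z v. i \<in> I ==> j \<in> I ==> z \<in> K i j ==> norm (frechet_derivative (H i j) (at z) v) <= \<Lambda> i j * norm v"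
   by metis
  have "norm (L F p v) <= (\<Sum>(i, j)\<in>I \<times> I. abs (\<Lambda> i j)) * norm v" if "p \<in> M" for p v
  proof -
   have "norm (L F p v) <= \<Lambda> (idx p) (idx (F p)) * norm v" unfolding L_eq by (intro \<Lambda> mem that)
   also have "\<Lambda> (idx p) (idx (F p)) <= abs (\<Lambda> (idx p) (idx (F p)))" by simp
   also have "abs (\<Lambda> (idx p) (idx (F p))) <= (\<Sum>(i, j)\<in>I \<times> I. abs (\<Lambda> i j))"
    using member_le_sum[of "(idx p, idx (F p))" "I \<times> I" "\<lambda>(i, j). abs (\<Lambda> i j)"] mem[OF that] finite_I by auto
   finally show ?thesis by (simp add: mult_right_mono)
  qed
  then show ?thesis by (intro exI[of _ "\<Sum>(i, j)\<in>I \<times> I. abs (\<Lambda> i j)"]) (auto intro!: sum_nonneg)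
 qed
 moreover have "\<exists>\<delta>>0. \<forall>p\<in>M. \<forall>y\<in>patch (idx p). norm (V p y) < \<delta> -->
   F y \<in> patch (idx (F p)) \<and> norm (V (F p) (F y) - L F p (V p y)) <= \<eta> * norm (V p y)" if \<eta>: "\<eta> > 0" for \<eta>
 proof -
  define P where "P ij \<delta> \<longleftrightarrow> (case ij of (i, j) => \<forall>z\<in>K i j. \<forall>z'. norm (z' - z) < \<delta> -->
   z' \<in> W i j \<and> norm (H i j z' - H i j z - frechet_derivative (H i j) (at z) (z' - z)) <= \<eta> * norm (z' - z))" for ij \<delta>
  have "\<exists>\<delta>>0. \<forall>ij\<in>I \<times> I. P ij \<delta>"
  proof (rule finite_uniform_pos)
   show "\<exists>\<delta>>0. P ij \<delta>" if ij: "ij \<in> I \<times> I" for ij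
   proof -
    have ij': "fst ij \<in> I" "snd ij \<in> I" using ij by auto
    show ?thesis unfolding P_def case_prod_beta by (rule C1_on_uniform_linearization[OF KW[OF ij'] \<eta>])
   qed
   show "P ij \<delta>'" if "P ij \<delta>" "0 < \<delta>'" "\<delta>' <= \<delta>" for ij \<delta> \<delta>'
    using that unfolding P_def case_prod_beta by (meson less_le_trans)
  qed (use finite_I in simp)
  then obtain \<delta> where \<delta>: "\<delta> > 0" "\<And>i j. i \<in> I ==> j \<in> I ==> P (i, j) \<delta>" by blast
  have "F y \<in> patch (idx (F p)) \<and> norm (V (F p) (F y) - L F p (V p y)) <= \<eta> * norm (V p y)"
   if p: "p \<in> M" "y \<in> patch (idx p)" "norm (V p y) < \<delta>" for p y
  proof -
   note m = mem[OF p(1)]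
   have lin: "snd (ch p) y \<in> W (idx p) (idx (F p))"
    "norm (H (idx p) (idx (F p)) (snd (ch p) y) - H (idx p) (idx (F p)) (snd (ch p) p) - L F p (V p y)) <= \<eta> * norm (V p y)"
    using \<delta>(2)[OF m(2,3)] m(1) p(3) unfolding P_def prod.case L_eq V_def by blast+
   have y: "y \<in> fst (ch p)" "chart_inv (ch p) (snd (ch p) y) = y" "chart_inv (ch p) (snd (ch p) p) = p" using p ch by auto
   from lin(1) have "snd (ch p) y \<in> snd (ch p) ` {q \<in> fst (ch p). F q \<in> patch (idx (F p))}" by (simp only: W_def ch_def)
   then obtain q where q: "q \<in> fst (ch p)" "F q \<in> patch (idx (F p))" "snd (ch p) y = snd (ch p) q"
    by (elim imageE CollectE conjE)
   then have "q = y" using y(2) chart_inv_chart[OF ch(1)[OF p(1)] q(1)] by metis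
   then have "F y \<in> patch (idx (F p))" using q(2) by simp
   moreover have "H (idx p) (idx (F p)) (snd (ch p) y) - H (idx p) (idx (F p)) (snd (ch p) p) = V (F p) (F y)"
    using y by (simp add: H_def V_def ch_def)
   ultimately show ?thesis using lin(2) by simp
  qed
  then show ?thesis using \<delta>(1) by blast
 qed
 ultimately show ?thesis unfolding linearizable_def using C1_map_differentiable[OF F] by blast
qed

end

section \<open>Hyperbolicity in charts\<close>

text \<open>Here a is the stable and b the unstable component. Once b dominates, it keeps dominating
  and at least triples, so it is small compared with its last value; as long as a dominates, a
  shrinks by \<open>3 / 4\<close>. The common rate \<open>3 / 4\<close> is merely
  convenient.\<close>

lemma cone_sequence_bound:
 fixes a b :: "nat => real"
 assumes ab0: "\<And>k. 0 <= a k" "\<And>k. 0 <= b k"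
  and a: "\<And>k. k < n ==> a (Suc k) <= a k / 2 + b k / 4"
  and b: "\<And>k. k < n ==> 4 * b k - (a k + b k) / 4 <= b (Suc k)"
  and R: "\<And>k. k <= n ==> a k <= R" "\<And>k. k <= n ==> b k <= R" and k: "k <= n"
 shows "a k + b k <= 2 * R * ((3 / 4)^k + (3 / 4)^(n - k))"
proof -
 have R0: "R >= 0" using R(1)[of 0] ab0(1)[of 0] by simp
 have fwd: "a (j + i) <= b (j + i) \<and> b j <= (3 / 4)^i * b (j + i)" if "a j <= b j" "j + i <= n" for i j
  using that(2)
 proof (induction i)
  case (Suc i)
  then have IH: "a (j + i) <= b (j + i)" "b j <= (3 / 4)^i * b (j + i)" by auto
  have "3 * b (j + i) <= b (j + Suc i)" 
   using b[of "j + i"] Suc.prems IH(1) ab0(2)[of "j + i"] by (simp only: add_Suc_right Suc_le_eq) argo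
  moreover have "a (j + Suc i) <= b (j + i)" using a[of "j + i"] Suc.prems IH(1) ab0(2)[of "j + i"] by simp
  moreover have "(3 / 4)^i * b (j + i) <= (3 / 4)^i * (3 / 4 * b (j + Suc i))"
   using \<open>3 * b (j + i) <= _\<close> ab0(2)[of "j + i"] by (intro mult_left_mono) auto
  ultimately have "a (j + Suc i) <= b (j + Suc i)" "b j <= (3 / 4)^i * (3 / 4 * b (j + Suc i))"
   using IH(2) ab0(2)[of "j + i"] by linarith+
  then show ?case by (simp add: ac_simps)
 qed (use that in simp)
 show ?thesis
 proof (cases "a k <= b k")
  case True
  have "a k + b k <= 2 * b k" using True by simp
  also have "b k <= (3 / 4)^(n - k) * b n" using fwd[OF True, of "n - k"] k by simp
  also have "... <= (3 / 4)^(n - k) * R" using R(2)[of n] by (intro mult_left_mono) auto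
  finally have "a k + b k <= 2 * R * (3 / 4)^(n - k)" by (simp add: mult.commute)
  moreover have "0 <= 2 * R * (3 / 4)^k" using R0 by simp
  ultimately show ?thesis by (simp add: distrib_left)
 next
  case False
  have lt: "b j < a j" if "j <= k" for j
   using fwd[of j "k - j"] False that k by force
  have "a j <= (3 / 4)^j * R" if "j <= k" for j
   using that
  proof (induction j)
   case (Suc j)
   then show ?case using a[of j] lt[of j] k by simp
  qed (use R(1)[of 0] in simp)
  from this[of k] have "a k + b k <= 2 * R * (3 / 4)^k" using lt[of k] by (simp add: mult.commute)
  moreover have "0 <= 2 * R * (3 / 4)^(n - k)" using R0 by simp
  ultimately show ?thesis by (simp add: distrib_left)
 qed
qed

text \<open>The rates \<open>1 / 4\<close> and 4 leave room for nonlinear errors in the plain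
  coordinate norm, without a norm adapted to the splitting.\<close>

definition hyperbolic_step :: "('e::real_normed_vector => 'e) => 'e set => 'e set => 'e set => 'e set => bool" where
 "hyperbolic_step L S U S' U' \<longleftrightarrow> subspace S \<and> subspace U \<and> (\<forall>x. \<exists>s\<in>S. \<exists>u\<in>U. x = s + u) \<and>
  (\<forall>s\<in>S. L s \<in> S' \<and> norm (L s) <= norm s / 4) \<and> (\<forall>u\<in>U. L u \<in> U' \<and> 4 * norm u <= norm (L u))"

text \<open>A vector close to both subspaces would have to be contracted and expanded at the same time.\<close>

lemma hyperbolic_step_projection_bound:
 assumes h: "hyperbolic_step L S U S' U'" "linear L" "\<And>x. norm (L x) <= \<Lambda> * norm x"
  and su: "s \<in> S" "u \<in> U"
 shows "norm u <= (\<Lambda> + 2) * norm (s + u)" "norm s <= (\<Lambda> + 2) * norm (s + u)"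
proof -
 let ?t = "norm (s + u)"
 have "norm (L u) <= norm (L (s + u)) + norm (L s)"
  using norm_triangle_ineq4[of "L (s + u)" "L s"] by (simp add: linear_add[OF h(2)])
 then have "4 * norm u <= \<Lambda> * ?t + norm s / 4" using h(1) su h(3)[of "s + u"] unfolding hyperbolic_step_def by force
 moreover have s: "norm s <= norm u + ?t" using norm_triangle_ineq4[of "s + u" u] by simp
 moreover have "0 <= \<Lambda> * ?t" using h(3)[of "s + u"] norm_ge_zero order_trans by blast
 ultimately have "norm u <= \<Lambda> * ?t + ?t" using norm_ge_zero[of "s + u"] by argo
 then show "norm u <= (\<Lambda> + 2) * ?t" "norm s <= (\<Lambda> + 2) * ?t" unfolding distrib_right using s norm_ge_zero[of "s + u"] by linarith+
qed

text \<open>The displacement is split along the stable and unstable subspaces. The projections have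
  norm at most \<open>\<Lambda> + 2\<close>, so the hypothesis on \<eta> keeps the projected error
  below a quarter of the sum of the components, as in \<open>cone_sequence_bound\<close>.\<close>

lemma hyperbolic_pseudo_orbit_bound:
 fixes v :: "nat => 'e::real_normed_vector"
 assumes h: "\<And>k. hyperbolic_step (L k) (S k) (U k) (S (Suc k)) (U (Suc k))" "\<And>k. linear (L k)" "\<And>k x. norm (L k x) <= \<Lambda> * norm x"
  and \<Lambda>: "\<Lambda> >= 0" and \<eta>: "\<eta> * (\<Lambda> + 2) <= 1 / 4"
  and step: "\<And>k. k < n ==> norm (v (Suc k) - L k (v k)) <= \<eta> * norm (v k)"
  and R: "\<And>k. k <= n ==> norm (v k) <= R" and k: "k <= n"
 shows "norm (v k) <= 2 * ((\<Lambda> + 2) * R) * ((3 / 4)^k + (3 / 4)^(n - k))"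
proof -
 have "\<forall>k x. \<exists>s u. s \<in> S k \<and> u \<in> U k \<and> x = s + u" using h(1) unfolding hyperbolic_step_def by blast
 then obtain s u where su: "\<And>k x. s k x \<in> S k" "\<And>k x. u k x \<in> U k" "\<And>k x. x = s k x + u k x" by metis
 note bound = hyperbolic_step_projection_bound[OF h]
 have bnd: "norm (u k x) <= (\<Lambda> + 2) * norm x" "norm (s k x) <= (\<Lambda> + 2) * norm x" for k x
  using bound[OF su(1,2)[of k x]] su(3)[of x k, symmetric] by simp_all
 have uniq: "s k x = s'" "u k x = u'" if "s' \<in> S k" "u' \<in> U k" "x = s' + u'" for k x s' u'
 proof -
  have "s k x - s' \<in> S k" "u k x - u' \<in> U k" "(s k x - s') + (u k x - u') = 0"
   using h(1)[of k] su(1,2)[of k x] su(3)[of x k] that by (auto simp: hyperbolic_step_def subspace_diff algebra_simps)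
  from bound[OF this(1,2)] this(3) show "s k x = s'" "u k x = u'" by simp_all
 qed
 have small: "(\<Lambda> + 2) * (\<eta> * norm (v k)) <= (norm (s k (v k)) + norm (u k (v k))) / 4" for k
 proof -
  have "(\<Lambda> + 2) * (\<eta> * norm (v k)) = \<eta> * (\<Lambda> + 2) * norm (v k)" by simp
  also have "... <= 1 / 4 * norm (v k)" by (intro mult_right_mono \<eta>) simp
  also have "norm (v k) <= norm (s k (v k)) + norm (u k (v k))" using norm_triangle_ineq su(3)[of "v k" k] by metis
  finally show ?thesis by simp
 qed
 have rec: "norm (s (Suc k) (v (Suc k))) <= norm (s k (v k)) / 2 + norm (u k (v k)) / 4 \<and>
  4 * norm (u k (v k)) - (norm (s k (v k)) + norm (u k (v k))) / 4 <= norm (u (Suc k) (v (Suc k)))" if k: "k < n" for k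
 proof -
  define e where "e = v (Suc k) - L k (v k)"
  let ?s = "s k (v k)" and ?u = "u k (v k)" and ?S = "s (Suc k) e" and ?U = "u (Suc k) e"
  have Ls: "L k ?s \<in> S (Suc k)" "norm (L k ?s) <= norm ?s / 4" "L k ?u \<in> U (Suc k)" "4 * norm ?u <= norm (L k ?u)"
   using h(1)[of k] su(1,2) unfolding hyperbolic_step_def by blast+
  have "L k (v k) = L k ?s + L k ?u" using linear_add[OF h(2), of k ?s ?u] su(3)[of "v k" k] by simp
  then have "v (Suc k) = (L k ?s + ?S) + (L k ?u + ?U)" using su(3)[of e "Suc k"] by (simp add: e_def algebra_simps)
  then have eq: "s (Suc k) (v (Suc k)) = L k ?s + ?S" "u (Suc k) (v (Suc k)) = L k ?u + ?U"
   using h(1)[of "Suc k"] Ls su(1,2) by (intro uniq; simp add: hyperbolic_step_def subspace_add)+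
  have "norm e <= \<eta> * norm (v k)" unfolding e_def by (rule step[OF k])
  then have "(\<Lambda> + 2) * norm e <= (norm ?s + norm ?u) / 4" using small[of k] \<Lambda> by (meson add_nonneg_nonneg mult_left_mono order_trans zero_le_numeral)
  then have "norm ?S <= (norm ?s + norm ?u) / 4" "norm ?U <= (norm ?s + norm ?u) / 4" using bnd[of "Suc k" e] by linarith+
  moreover have "norm (L k ?s + ?S) <= norm (L k ?s) + norm ?S" by (rule norm_triangle_ineq)
  moreover have "norm (L k ?u) <= norm (L k ?u + ?U) + norm ?U" using norm_triangle_ineq4[of "L k ?u + ?U" ?U] by simp
  ultimately show ?thesis unfolding eq using Ls(2,4) by argo
 qed
 have "norm (v k) <= norm (s k (v k)) + norm (u k (v k))" using norm_triangle_ineq su(3)[of "v k" k] by metis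
 also have "... <= 2 * ((\<Lambda> + 2) * R) * ((3 / 4)^k + (3 / 4)^(n - k))"
 proof (rule cone_sequence_bound[OF _ _ _ _ _ _ k])
  show "norm (s k (v k)) <= (\<Lambda> + 2) * R" "norm (u k (v k)) <= (\<Lambda> + 2) * R" if "k <= n" for k
   using bnd[of k "v k"] mult_left_mono[OF R[OF that], of "\<Lambda> + 2"] \<Lambda> by linarith+
 qed (use rec in auto)
 finally show ?thesis .
qed

context adapted_charts begin

text \<open>The splitting is pulled back to preferred coordinates by \<open>to_tangent\<close>; an
  iterate is taken so that the hyperbolic rates beat the distortion between metric and coordinate
  norms.\<close>

lemma hyperbolic_step_charts:
 assumes F: "diffeo M A F" and hyp: "hyperbolic_set M A g F \<Lambda>"
 shows "\<exists>N S U. N > 0 \<and> (\<forall>p\<in>\<Lambda>. hyperbolic_step (L (F^^N) p) (S p) (U p) (S ((F^^N) p)) (U ((F^^N) p)))"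
proof -
 let ?inv = "the_inv_into M F"
 have dF: "differentiable_map M A (F^^n)" "differentiable_map M A (?inv^^n)" for n
  using F C1_map_differentiable by (auto simp: diffeo_def intro!: differentiable_map_funpow)
 have inv: "(?inv^^n) ((F^^n) p) = p" if "p \<in> M" for n p
  using that
 proof (induction n arbitrary: p)
  case (Suc n)
  have "(F^^n) p \<in> M" using Suc.prems dF(1)[of n] by (auto simp: differentiable_map_def)
  moreover have "inj_on F M" using F by (simp add: diffeo_def bij_betw_def)
  ultimately have "?inv (F ((F^^n) p)) = (F^^n) p" by (simp add: the_inv_into_f_f)
  moreover have "(?inv^^Suc n) ((F^^Suc n) p) = (?inv^^n) (?inv (F ((F^^n) p)))"
   by (simp only: funpow_Suc_right[of n ?inv] funpow.simps(2)[of n F] comp_apply)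
  ultimately show ?case using Suc by simp
 qed simp
 have \<Lambda>: "\<Lambda> \<subseteq> M" "F ` \<Lambda> = \<Lambda>" using hyp closedin_imp_subset by (auto simp: hyperbolic_set_def)
 obtain Es Eu c r where cr: "c > 0" "0 < r" "r < 1" and E': "\<forall>p\<in>\<Lambda>.
   subspace (Es p) \<and> subspace (Eu p) \<and>
   Es p \<inter> Eu p = {0} \<and> {v + w | v w. v \<in> Es p \<and> w \<in> Eu p} = UNIV \<and>
   tangent_map A F p ` Es p = Es (F p) \<and> tangent_map A F p ` Eu p = Eu (F p) \<and>
   (\<forall>n. \<forall>v\<in>Es p. tangent_norm g ((F^^n) p) (tangent_map A (F^^n) p v) <= c * r^n * tangent_norm g p v) \<and>
   (\<forall>n. \<forall>v\<in>Eu p. tangent_norm g ((?inv^^n) p) (tangent_map A (?inv^^n) p v) <= c * r^n * tangent_norm g p v)"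
  using hyp unfolding hyperbolic_set_def by (elim conjE exE) (rule that; assumption)
 note E = bspec[OF E']
 have C2: "4 * C^2 > 0" using C_ge_1 by simp
 \<comment> \<open>Norms are converted at both ends, each time at the cost of C; N makes the total
   factor \<open>C * (c * r^N * C)\<close> at most \<open>1 / 4\<close>.\<close>
 obtain N0 where N0: "r^N0 < 1 / (4 * C^2 * c)" using real_arch_pow_inv[of "1 / (4 * C^2 * c)" r] cr C2 by auto
 define N where "N = Suc N0"
 have N: "N > 0" "C * (c * r^N * C) <= 1 / 4"
 proof -
  have "r^N <= r^N0" using cr by (simp add: N_def mult_left_le_one_le)
  then have "r^N <= 1 / (4 * C^2 * c)" using N0 by simp
  then have "r^N * (4 * C^2 * c) <= 1" using C2 cr by (simp add: le_divide_eq)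
  then show "C * (c * r^N * C) <= 1 / 4" by (simp add: power2_eq_square ac_simps)
 qed (simp add: N_def)
 define G where "G = F^^N"
 have iter: "(F^^n) p \<in> \<Lambda>" if "p \<in> \<Lambda>" for n p using that \<Lambda>(2) by (induction n) auto
 have inv_E: "tangent_map A (F^^n) p v \<in> X ((F^^n) p)"
  if p: "p \<in> \<Lambda>" "v \<in> X p" and X: "\<And>p. p \<in> \<Lambda> ==> tangent_map A F p ` X p = X (F p)" for X :: "'a => 'e set" and n p v
 proof (induction n)
  case 0
  have "tangent_map A (F^^0) p v = v" by (rule tangent_map_ident) (use p(1) \<Lambda>(1) in auto)
  moreover have "(F^^0) p = p" by simp
  ultimately show ?case using p(2) by metis
 next
  case (Suc n)
  have eq: "tangent_map A (F^^Suc n) p v = tangent_map A F ((F^^n) p) (tangent_map A (F^^n) p v)" "(F^^Suc n) p = F ((F^^n) p)"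
   using tangent_map_compose[OF dF(1)[of 1] dF(1)[of n], of p v] p(1) \<Lambda>(1) by auto
  show ?case using imageI[OF Suc, of "tangent_map A F ((F^^n) p)"] X[OF iter[OF p(1), of n]] eq by metis
 qed
 have inv_G: "tangent_map A G p v \<in> Es (G p)" if "p \<in> \<Lambda>" "v \<in> Es p" for p v
  unfolding G_def by (rule inv_E[where X = Es, OF that]) (use E in blast)
 have inv_G': "tangent_map A G p v \<in> Eu (G p)" if "p \<in> \<Lambda>" "v \<in> Eu p" for p v
  unfolding G_def by (rule inv_E[where X = Eu, OF that]) (use E in blast)
 define tt where "tt p = to_tangent A (ch p) p" for p
 have tt: "linear (tt p)" "bij (tt p)" "norm v <= C * tangent_norm g p (tt p v)" "tangent_norm g p (tt p v) <= C * norm v" if "p \<in> M" for p v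
 proof -
  obtain c z r where i: "idx p = (c, z, r)" by (cases "idx p")
  show "linear (tt p)" "bij (tt p)" unfolding tt_def using that by (auto intro: linear_to_tangent bij_to_tangent ch)
  have "(c, z, r) \<in> I" "p \<in> chart_inv c ` cball z (4 * r)"
   using idx[OF that] I_subsets(4)[of c z r] ch(4)[OF that] unfolding i by auto
  from norm_equiv[OF this] show "norm v <= C * tangent_norm g p (tt p v)" "tangent_norm g p (tt p v) <= C * norm v"
   unfolding tt_def ch_def i by simp_all
 qed
 have tt_L: "tt (G p) (L G p v) = tangent_map A G p (tt p v)" and GM: "G p \<in> M" if "p \<in> M" for p v
 proof -
  show "G p \<in> M" using that dF(1)[of N] by (auto simp: G_def differentiable_map_def)
  then show "tt (G p) (L G p v) = tangent_map A G p (tt p v)"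
   unfolding tt_def L_def using that by (intro tangent_map_to_tangent[symmetric]) (auto simp: ch G_def dF(1))
 qed
 have "hyperbolic_step (L G p) (tt p -` Es p) (tt p -` Eu p) (tt (G p) -` Es (G p)) (tt (G p) -` Eu (G p))" if p: "p \<in> \<Lambda>" for p
  unfolding hyperbolic_step_def
 proof (intro conjI allI ballI)
  have pM: "p \<in> M" "G p \<in> M" "G p \<in> \<Lambda>" using p \<Lambda>(1) iter[OF p] by (auto simp: G_def)
  note Ep = E[OF p]
  show "subspace (tt p -` Es p)" "subspace (tt p -` Eu p)" using Ep tt(1)[OF pM(1)] by (auto intro: linear_subspace_vimage)
  have small: "C * (c * r^N * (C * t)) <= t / 4" if "t >= 0" for t
   using mult_right_mono[OF N(2) that] by (simp add: ac_simps)
  have cr0: "0 <= c * r^N" "0 <= C" using cr C_ge_1 by auto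
  show "\<exists>s\<in>tt p -` Es p. \<exists>u\<in>tt p -` Eu p. x = s + u" for x
  proof -
   have "tt p x \<in> {v + w | v w. v \<in> Es p \<and> w \<in> Eu p}" using Ep by simp
   then obtain v w where vw: "tt p x = v + w" "v \<in> Es p" "w \<in> Eu p" by blast
   obtain s u where su: "v = tt p s" "w = tt p u" using bij_is_surj[OF tt(2)[OF pM(1)]] by (metis surjD)
   have "tt p x = tt p (s + u)" using vw(1) by (simp add: su linear_add[OF tt(1)[OF pM(1)]])
   then have "x = s + u" using bij_is_inj[OF tt(2)[OF pM(1)]] by (simp add: inj_eq)
   then show ?thesis using vw su by auto
  qed
  show "L G p s \<in> tt (G p) -` Es (G p)" if "s \<in> tt p -` Es p" for s
   using inv_G[OF p] that by (simp add: tt_L[OF pM(1)])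
  show "L G p u \<in> tt (G p) -` Eu (G p)" if "u \<in> tt p -` Eu p" for u
   using inv_G'[OF p] that by (simp add: tt_L[OF pM(1)])
  show "norm (L G p s) <= norm s / 4" if s: "s \<in> tt p -` Es p" for s
  proof -
   have "tangent_norm g (G p) (tangent_map A G p (tt p s)) <= c * r^N * tangent_norm g p (tt p s)"
    using Ep s unfolding G_def by blast
   also have "... <= c * r^N * (C * norm s)" by (intro mult_left_mono tt pM cr0)
   finally have "C * tangent_norm g (G p) (tt (G p) (L G p s)) <= C * (c * r^N * (C * norm s))"
    unfolding tt_L[OF pM(1)] by (rule mult_left_mono[OF _ cr0(2)])
   then show ?thesis using tt(3)[OF pM(2), of "L G p s"] small[of "norm s"] by simp
  qed
  \<comment> \<open>Expansion is contraction of the inverse iterate, applied at \<open>G p\<close>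
    to the image vector.\<close>
  show "4 * norm u <= norm (L G p u)" if u: "u \<in> tt p -` Eu p" for u
  proof -
   have "tangent_map A ((?inv^^N) \<circ> G) p (tt p u) = tt p u"
    by (rule tangent_map_ident) (use inv pM in \<open>auto simp: G_def\<close>)
   then have bk: "tangent_map A (?inv^^N) (G p) (tt (G p) (L G p u)) = tt p u"
    using tangent_map_compose[OF dF(2)[of N] dF(1)[of N] pM(1), folded G_def] by (simp add: tt_L[OF pM(1)])
   have "tt (G p) (L G p u) \<in> Eu (G p)"
    using inv_G'[OF p] u by (simp add: tt_L[OF pM(1)])
   then have "tangent_norm g ((?inv^^N) (G p)) (tangent_map A (?inv^^N) (G p) (tt (G p) (L G p u)))
     <= c * r^N * tangent_norm g (G p) (tt (G p) (L G p u))" using E[OF pM(3)] by blast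
   moreover have "(?inv^^N) (G p) = p" using inv[OF pM(1)] by (simp add: G_def)
   ultimately have "tangent_norm g p (tt p u) <= c * r^N * tangent_norm g (G p) (tt (G p) (L G p u))"
    using bk by simp
   also have "... <= c * r^N * (C * norm (L G p u))" by (intro mult_left_mono tt pM cr0)
   finally have "C * tangent_norm g p (tt p u) <= C * (c * r^N * (C * norm (L G p u)))" by (rule mult_left_mono[OF _ cr0(2)])
   then show ?thesis using tt(3)[OF pM(1), of u] small[of "norm (L G p u)"] by simp
  qed
 qed
 then show ?thesis using N(1) unfolding G_def
  by (intro exI[of _ N] exI[of _ "\<lambda>p. tt p -` Es p"] exI[of _ "\<lambda>p. tt p -` Eu p"]) blast
qed

text \<open>While the orbits are close, their coordinate displacements nearly follow the derivatives
  of an iterate of F along the orbit of x, so the cone estimate applies. Only the orbit of x lies in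
  the hyperbolic set; y is arbitrary.\<close>

theorem bowen_close_exponential:
 assumes F: "diffeo M A F" and hyp: "hyperbolic_set M A g F \<Lambda>"
 shows "\<exists>eps>0. \<exists>B\<ge>0. \<exists>\<theta>. 0 < \<theta> \<and> \<theta> < 1 \<and> (\<forall>x\<in>\<Lambda>. \<forall>y n. (\<forall>k<n. d ((F^^k) x) ((F^^k) y) < ennreal eps) -->
  (\<forall>k<n. d ((F^^k) x) ((F^^k) y) <= ennreal (B * (\<theta> ^ k + \<theta> ^ (n - k)))))"
proof -
 obtain N S U where N: "N > 0" and SU: "\<And>p. p \<in> \<Lambda> ==> hyperbolic_step (L (F^^N) p) (S p) (U p) (S ((F^^N) p)) (U ((F^^N) p))"
  using hyperbolic_step_charts[OF F hyp] by blast
 have \<Lambda>: "\<Lambda> \<subseteq> M" "F ` \<Lambda> = \<Lambda>" using hyp closedin_imp_subset by (auto simp: hyperbolic_set_def)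
 have iter: "(F^^n) p \<in> \<Lambda>" if "p \<in> \<Lambda>" for n p using that \<Lambda>(2) by (induction n) auto
 define G where "G = F^^N"
 have lG: "linearizable G" unfolding G_def using F by (intro linearizable_funpow linearizable_C1_map) (simp add: diffeo_def)
 then have dG: "differentiable_map M A G" by (simp add: linearizable_def)
 obtain a where a: "a >= 0" "\<And>p v. p \<in> M ==> norm (L G p v) <= a * norm v" using lG unfolding linearizable_def by blast
 define \<eta> where "\<eta> = 1 / (4 * (a + 2))"
 have \<eta>: "\<eta> > 0" "\<eta> * (a + 2) <= 1 / 4" using a(1) by (simp_all add: \<eta>_def)
 obtain \<delta> where \<delta>: "\<delta> > 0" "\<And>p y. p \<in> M ==> y \<in> patch (idx p) ==> norm (V p y) < \<delta> ==>
   G y \<in> patch (idx (G p)) \<and> norm (V (G p) (G y) - L G p (V p y)) <= \<eta> * norm (V p y)"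
  using lG \<eta>(1) unfolding linearizable_def by metis
 define eps where "eps = min e\<^sub>0 (\<delta> / (2 * C))"
 have eps: "eps > 0" "eps <= e\<^sub>0" "C * eps < \<delta>"
 proof -
  have "C * eps <= C * (\<delta> / (2 * C))" using C_ge_1 by (intro mult_left_mono) (auto simp: eps_def)
  also have "... = \<delta> / 2" using C_ge_1 by simp
  finally show "C * eps < \<delta>" using \<delta>(1) by simp
 qed (use \<delta>(1) e0_pos C_ge_1 in \<open>simp_all add: eps_def\<close>)
 \<comment> \<open>The rate \<open>3 / 4\<close> per N steps, spread over single steps; rounding to
   multiples of N costs the factor \<open>4 / 3\<close>.\<close>
 define \<theta> where "\<theta> = root N (3 / 4)"
 have \<theta>: "0 < \<theta>" "\<theta> < 1" "\<theta> ^ N = 3 / 4" using N by (simp_all add: \<theta>_def)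
 define B0 where "B0 = 2 * ((a + 2) * (C * eps))"
 have B0: "B0 >= 0" using a(1) eps(1) C_ge_1 by (simp add: B0_def)
 have "d ((F^^k) x) ((F^^k) y) <= ennreal (C * (B0 * (4 / 3)) * (\<theta> ^ k + \<theta> ^ (n - k)))"
  if x: "x \<in> \<Lambda>" and close: "\<And>k. k < n ==> d ((F^^k) x) ((F^^k) y) < ennreal eps" and k: "k < n" for x y n k
 proof -
  \<comment> \<open>The orbit is sampled every N steps in the residue class of k, so k is itself a
    sample time, of number j; J is the last sample before n.\<close>
  define i j J where "i = k mod N" and "j = k div N" and "J = (n - 1 - i) div N"
  have kij: "k = i + j * N" "i < N" unfolding i_def j_def using N by simp_all
  have iJ: "i + J * N < n"
  proof -
   have "J * N <= n - 1 - i" unfolding J_def by simp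
   moreover have "i < n" using kij k by simp
   ultimately show ?thesis by linarith
  qed
  have jJ: "j <= J"
  proof -
   have "j * N <= n - 1 - i" using kij k by simp
   then have "j * N div N <= J" unfolding J_def by (rule div_le_mono)
   then show ?thesis using N by simp
  qed
  have nJ: "n - k <= (J - j) * N + N"
  proof -
   have "n - 1 - i < J * N + N" unfolding J_def using N by (metis add.commute dividend_less_div_times)
   then have "n - i <= J * N + N" using k kij by linarith
   then show ?thesis using kij jJ by (simp add: diff_mult_distrib)
  qed
  define p q where "p l = (F^^(i + l * N)) x" and "q l = (F^^(i + l * N)) y" for l
  have pq: "p (Suc l) = G (p l)" "q (Suc l) = G (q l)" for l
  proof -
   have "i + Suc l * N = N + (i + l * N)" by simp
   then show "p (Suc l) = G (p l)" "q (Suc l) = G (q l)" unfolding p_def q_def G_def by (simp_all only: funpow_add comp_apply)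
  qed
  have pM: "p l \<in> \<Lambda>" "p l \<in> M" for l using iter[OF x] \<Lambda>(1) by (auto simp: p_def)
  have cl: "d (p l) (q l) < ennreal eps" if "l <= J" for l
  proof -
   have "l * N <= J * N" using that by simp
   then show ?thesis unfolding p_def q_def using iJ by (intro close) linarith
  qed
  have v: "q l \<in> patch (idx (p l))" "norm (V (p l) (q l)) <= C * eps" if "l <= J" for l
   using V_less[OF pM(2) cl[OF that] eps(2)] by simp_all
  have "norm (V (p j) (q j)) <= B0 * ((3 / 4)^j + (3 / 4)^(J - j))"
   unfolding B0_def
  proof (rule hyperbolic_pseudo_orbit_bound[where v = "\<lambda>l. V (p l) (q l)" and L = "\<lambda>l. L G (p l)" and S = "\<lambda>l. S (p l)" and U = "\<lambda>l. U (p l)", OF _ _ _ a(1) \<eta>(2) _ _ jJ])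
   show "hyperbolic_step (L G (p l)) (S (p l)) (U (p l)) (S (p (Suc l))) (U (p (Suc l)))" for l
    unfolding pq using SU[OF pM(1)] by (simp add: G_def)
   show "norm (V (p (Suc l)) (q (Suc l)) - L G (p l) (V (p l) (q l))) <= \<eta> * norm (V (p l) (q l))" if "l < J" for l
    unfolding pq using \<delta>(2)[OF pM(2) v(1)[of l]] v(2)[of l] eps(3) that by simp
  qed (use v linear_L[OF dG pM(2)] a(2)[OF pM(2)] in auto)
  also have "... <= B0 * (4 / 3 * (\<theta> ^ k + \<theta> ^ (n - k)))"
  proof (rule mult_left_mono[OF _ B0])
   have pw: "(3 / 4)^l <= 4 / 3 * \<theta> ^ l'" if "l' <= l * N + N" for l l'
   proof -
    have "\<theta> ^ (l * N + N) <= \<theta> ^ l'" using \<theta> by (intro power_decreasing that) auto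
    moreover have "\<theta> ^ (l * N + N) = (3 / 4)^l * (3 / 4)"
     unfolding power_add mult.commute[of l N] power_mult \<theta>(3) ..
    ultimately show ?thesis by simp
   qed
   show "(3 / 4)^j + (3 / 4)^(J - j) <= 4 / 3 * (\<theta> ^ k + \<theta> ^ (n - k))"
    using pw[of k j] pw[OF nJ] kij by simp
  qed
  finally have "C * norm (V (p j) (q j)) <= C * (B0 * (4 / 3)) * (\<theta> ^ k + \<theta> ^ (n - k))"
   using mult_left_mono[of _ _ C] C_ge_1 by (fastforce simp: mult.assoc)
  then have "d (p j) (q j) <= ennreal (C * (B0 * (4 / 3)) * (\<theta> ^ k + \<theta> ^ (n - k)))"
   using dist_le_V[OF pM(2) v(1)[OF jJ]] by (meson ennreal_leI order_trans)
  then show ?thesis by (simp add: p_def q_def kij(1)[symmetric])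
 qed
 then show ?thesis using eps(1) \<theta>(1,2) B0 C_ge_1
  by (intro exI[of _ eps] conjI exI[of _ "C * (B0 * (4 / 3))"] exI[of _ \<theta>] ballI allI impI) simp_all
qed

end

section \<open>Cells of a Gibbs measure\<close>

lemma birkhoff_sum_add: "birkhoff_sum T \<phi> (l + n) x = birkhoff_sum T \<phi> l x + birkhoff_sum T \<phi> n ((T^^l) x)"
 by (induction n) (simp_all add: birkhoff_sum_def funpow_add[of _ l, simplified add.commute])

text \<open>Cells are named by natural numbers, so a maximal family of disjoint balls has to be
  countable.\<close>

lemma (in finite_measure) countable_disjoint_positive:
 assumes "disjoint_family_on A E" "\<And>i. i \<in> E ==> measure M (A i) > 0"
 shows "countable E"
proof -
 have sets: "A i \<in> sets M" if "i \<in> E" for i using assms(2)[OF that] measure_notin_sets by fastforce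
 have "(\<Sum>i\<in>F. measure M (A i)) <= measure M (space M)" if F: "finite F" "F \<subseteq> E" for F
 proof -
  have "(\<Sum>i\<in>F. measure M (A i)) = measure M (\<Union>i\<in>F. A i)"
   using F sets disjoint_family_on_mono[OF F(2) assms(1)] by (intro finite_measure_finite_Union[symmetric]) auto
  also have "... <= measure M (space M)" by (rule bounded_measure)
  finally show ?thesis .
 qed
 then have "(\<lambda>i. measure M (A i)) summable_on E"
  by (intro nonneg_bounded_partial_sums_imp_summable_on[where C = "measure M (space M)"] eventually_finite_subsets_at_top_weakI) auto
 then have "countable {i \<in> E. measure M (A i) \<noteq> 0}" by (rule summable_countable_real)
 also have "{i \<in> E. measure M (A i) \<noteq> 0} = E" using assms(2) by force
 finally show ?thesis .
qed

locale gibbs_balls =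
 fixes d :: "'a::topological_space => 'a => ennreal" and X T \<phi> m
 assumes gibbs: "gibbs_measure d X T \<phi> m" and dist_refl: "\<And>x. x \<in> X ==> d x x = 0"
  and quasi_triangle: "\<And>e. e > 0 ==> \<exists>e'>0. e' <= e \<and> (\<forall>x\<in>X. \<forall>y\<in>X. \<forall>z\<in>X.
   d x z < ennreal e' --> d y z < ennreal e' --> d y x < ennreal e)"
begin

sublocale prob_space m
 using gibbs by (simp add: gibbs_measure_def)

lemma space_eq: "space m = X"
proof -
 have "sets m = sets (restrict_space borel X)" using gibbs by (simp add: gibbs_measure_def)
 from sets_eq_imp_space_eq[OF this] show ?thesis by (simp add: space_restrict_space)
qed

lemma iter_in: "x \<in> X ==> (T^^n) x \<in> X"
proof (induction n)
 case (Suc n)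
 have "T \<in> measurable m m" using gibbs by (simp add: gibbs_measure_def)
 from measurable_space[OF this, of "(T^^n) x"] Suc show ?case by (simp add: space_eq)
qed simp

abbreviation "bowen n e x \<equiv> bowen_ball d X T n e x"

lemma ball_refl: "x \<in> X ==> e > 0 ==> x \<in> bowen n e x"
 by (simp add: bowen_ball_def dist_refl iter_in)

lemma ball_mono: "e' <= e ==> bowen n e' x \<subseteq> bowen n e x"
 unfolding bowen_ball_def by (auto intro: less_le_trans ennreal_leI)

lemma ball_quasi_triangle:
 assumes "e > 0"
 obtains e' where "e' > 0" "e' <= e" "\<And>n u v z. u \<in> X ==> v \<in> X ==> z \<in> bowen n e' u ==> z \<in> bowen n e' v ==> u \<in> bowen n e v"
proof -
 obtain e' where e': "e' > 0" "e' <= e" "\<forall>x\<in>X. \<forall>y\<in>X. \<forall>z\<in>X. d x z < ennreal e' --> d y z < ennreal e' --> d y x < ennreal e"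
  using quasi_triangle[OF assms] by blast
 show thesis
 proof (rule that[OF e'(1,2)])
  fix n u v z assume "u \<in> X" "v \<in> X" "z \<in> bowen n e' u" "z \<in> bowen n e' v"
  then show "u \<in> bowen n e v" unfolding bowen_ball_def by (auto intro: e'(3)[rule_format] iter_in)
 qed
qed

text \<open>The cells are squeezed between a maximal disjoint family of small Bowen balls and the
 corresponding enlarged balls, whose measures are comparable.\<close>

theorem gibbs_cells:
 assumes eps: "eps > 0"
 shows "\<exists>\<kappa> K. K >= 1 \<and> (\<forall>l. \<kappa> l \<in> measurable m (count_space UNIV)) \<and>
  (\<forall>l. \<forall>x\<in>X. \<forall>y\<in>X. \<kappa> l x = \<kappa> l y --> y \<in> bowen l eps x) \<and>
  (\<forall>w. measure m (cylinder X T \<kappa> w) <= (\<Prod>(l, a)\<leftarrow>w. K * measure m {x \<in> X. \<kappa> l x = a}))"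
proof -
 obtain P e0 where e0: "e0 > 0" "\<And>e. 0 < e ==> e < e0 ==> \<exists>c C. 0 < c \<and> 0 < C \<and> (\<forall>x\<in>X. \<forall>n.
   c * exp (birkhoff_sum T \<phi> n x - real n * P) <= measure m (bowen n e x) \<and>
   measure m (bowen n e x) <= C * exp (birkhoff_sum T \<phi> n x - real n * P))"
  using gibbs unfolding gibbs_measure_def by blast
 define G where "G n x = exp (birkhoff_sum T \<phi> n x - real n * P)" for n x
 have Gpos: "G n x > 0" for n x by (simp add: G_def)
 have G_add: "G (l + n) x = G l x * G n ((T^^l) x)" for l n x
  unfolding G_def exp_add[symmetric] birkhoff_sum_add by (simp add: algebra_simps)
 \<comment> \<open>Four radii: disjoint kernels at e4, covering by maximality at e3, symmetry at e2,
   and e1 for balls that contain whole cells. All lie below e0, where the Gibbs estimate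
   holds.\<close>
 define e1 where "e1 = min eps (e0 / 2)"
 have e1: "e1 > 0" "e1 <= eps" "e1 < e0" using eps e0(1) by (simp_all add: e1_def min_less_iff_disj)
 obtain e2 where e2: "e2 > 0" "e2 <= e1" "\<And>n u v z. u \<in> X ==> v \<in> X ==> z \<in> bowen n e2 u ==> z \<in> bowen n e2 v ==> u \<in> bowen n e1 v"
  using ball_quasi_triangle[OF e1(1)] by metis
 obtain e3 where e3: "e3 > 0" "e3 <= e2" "\<And>n u v z. u \<in> X ==> v \<in> X ==> z \<in> bowen n e3 u ==> z \<in> bowen n e3 v ==> u \<in> bowen n e2 v"
  using ball_quasi_triangle[OF e2(1)] by metis
 obtain e4 where e4: "e4 > 0" "e4 <= e3" "\<And>n u v z. u \<in> X ==> v \<in> X ==> z \<in> bowen n e4 u ==> z \<in> bowen n e4 v ==> u \<in> bowen n e3 v"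
  using ball_quasi_triangle[OF e3(1)] by metis
 have sym: "u \<in> bowen n e2 v" if "u \<in> X" "v \<in> bowen n e3 u" for u v n
  using e3(3)[of u v v n] that ball_refl[of v e3 n] e3(1) by (auto simp: bowen_ball_def)
 obtain c1 C1 where C1: "0 < C1" "\<And>x n. x \<in> X ==> c1 * G n x <= measure m (bowen n e1 x)" "\<And>x n. x \<in> X ==> measure m (bowen n e1 x) <= C1 * G n x" "0 < c1"
  using e0(2)[OF e1(1,3)] unfolding G_def by blast
 obtain c3 where c3: "0 < c3" "\<And>x n. x \<in> X ==> c3 * G n x <= measure m (bowen n e3 x)"
  using e0(2)[of e3] e1 e2 e3 unfolding G_def by auto
 obtain c4 where c4: "0 < c4" "\<And>x n. x \<in> X ==> c4 * G n x <= measure m (bowen n e4 x)"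
  using e0(2)[of e4] e1 e2 e3 e4 unfolding G_def by auto
 \<comment> \<open>The Gibbs estimate makes these measures positive, and \<open>measure\<close>
   vanishes on nonmeasurable sets.\<close>
 have sets: "bowen n e1 x \<in> sets m" "bowen n e3 x \<in> sets m" "bowen n e4 x \<in> sets m" if "x \<in> X" for n x
  using C1(2)[OF that, of n] c3(2)[OF that, of n] c4(2)[OF that, of n] Gpos[of n x] C1(4) c3(1) c4(1) measure_notin_sets
  by (metis mult_pos_pos not_le)+
 \<comment> \<open>Passing from x to the centre of its ball costs \<open>C1 / c3\<close>; the kernel
   around the centre, contained in the cell, has measure at least c4 times G there.\<close>
 define K' where "K' = C1 / (c3 * c4)"
 have "\<exists>\<kappa> :: 'a => nat. \<kappa> \<in> measurable m (count_space UNIV) \<and> (\<forall>x\<in>X. \<forall>y\<in>X. \<kappa> x = \<kappa> y --> y \<in> bowen l e1 x) \<and>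
   (\<forall>x\<in>X. G l x <= K' * measure m {y \<in> X. \<kappa> y = \<kappa> x})" for l
 proof -
  define \<A> where "\<A> = {E. E \<subseteq> X \<and> disjoint_family_on (bowen l e4) E}"
  have "\<exists>E\<in>\<A>. \<forall>E'\<in>\<A>. E \<subseteq> E' --> E' = E"
  proof (rule subset_Zorn_nonempty)
   show "\<Union>\<C> \<in> \<A>" if "\<C> \<noteq> {}" and ch: "subset.chain \<A> \<C>" for \<C>
   proof -
    have "bowen l e4 x \<inter> bowen l e4 y = {}" if xy: "x \<in> \<Union>\<C>" "y \<in> \<Union>\<C>" "x \<noteq> y" for x y
    proof -
     obtain E E' where E: "E \<in> \<C>" "x \<in> E" "E' \<in> \<C>" "y \<in> E'" using xy by blast
     then have "E \<subseteq> E' \<or> E' \<subseteq> E" and "E \<in> \<A>" "E' \<in> \<A>" using ch by (auto simp: subset.chain_def subset_chain_def)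
     then show ?thesis using E xy(3) unfolding \<A>_def disjoint_family_on_def by blast
    qed
    moreover have "\<Union>\<C> \<subseteq> X" using ch by (auto simp: subset_chain_def \<A>_def)
    ultimately show ?thesis by (simp add: \<A>_def disjoint_family_on_def)
   qed
  qed (auto simp: \<A>_def disjoint_family_on_def)
  then obtain E where EA: "E \<in> \<A>" and E3: "\<forall>E'\<in>\<A>. E \<subseteq> E' --> E' = E" by (elim bexE)
  from EA have E: "E \<subseteq> X" "disjoint_family_on (bowen l e4) E" by (simp_all add: \<A>_def)
  have near: "\<exists>y\<in>E. x \<in> bowen l e3 y" if x: "x \<in> X" for x
  proof (cases "x \<in> E")
   case True
   then show ?thesis using ball_refl[OF x e3(1)] by blast
  next
   case False
   then have "insert x E \<notin> \<A>" using E3[rule_format, of "insert x E"] by blast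
   then obtain y where "y \<in> E" "bowen l e4 x \<inter> bowen l e4 y \<noteq> {}"
    using E(1,2) x unfolding \<A>_def disjoint_family_on_def by blast
   then show ?thesis using e4(3)[OF x, of y _ l] E(1) by blast
  qed
  have "0 < measure m (bowen l e4 y)" if "y \<in> E" for y
   using c4 Gpos[of l y] E(1) that by (meson less_le_trans mult_pos_pos subsetD)
  then have cE: "countable E" by (rule countable_disjoint_positive[OF E(2)])
  have "E \<noteq> {}" using near not_empty space_eq by auto
  define e where "e = from_nat_into E"
  have e: "e a \<in> X" "range e = E" for a
   using from_nat_into[OF \<open>E \<noteq> {}\<close>] range_from_nat_into[OF \<open>E \<noteq> {}\<close> cE] E(1) unfolding e_def by blast+
  \<comment> \<open>A point of a kernel must keep that kernel's name, so that cells contain kernels;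
    only the remaining points take the first ball that covers them.\<close>
  define Q where "Q x a \<longleftrightarrow> (if \<exists>b. x \<in> bowen l e4 (e b) then x \<in> bowen l e4 (e a) else x \<in> bowen l e3 (e a))" for x and a :: nat
  define \<kappa> where "\<kappa> x = (LEAST a. Q x a)" for x
  have ex: "\<exists>a. Q x a" if x: "x \<in> X" for x
  proof (cases "\<exists>b. x \<in> bowen l e4 (e b)")
   case True
   then show ?thesis unfolding Q_def if_P[OF True] .
  next
   case False
   obtain y where "y \<in> range e" "x \<in> bowen l e3 y" using near[OF x] unfolding e(2) by blast
   then show ?thesis unfolding Q_def if_not_P[OF False] by blast
  qed
  have Q: "Q x (\<kappa> x)" if "x \<in> X" for x unfolding \<kappa>_def by (rule LeastI_ex[OF ex[OF that]])
  have in_ball: "x \<in> bowen l e3 (e (\<kappa> x))" if "x \<in> X" for x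
  proof -
   have "x \<in> bowen l e4 (e (\<kappa> x)) \<or> x \<in> bowen l e3 (e (\<kappa> x))" using Q[OF that] unfolding Q_def by (simp split: if_splits)
   then show ?thesis using ball_mono[OF e4(2)] by blast
  qed
  have [measurable]: "Measurable.pred m (\<lambda>x. x \<in> bowen l e4 (e a))" "Measurable.pred m (\<lambda>x. x \<in> bowen l e3 (e a))" for a
   using sets[OF e(1)] by measurable
  have "\<kappa> \<in> measurable m (count_space UNIV)" unfolding \<kappa>_def Q_def by measurable
  moreover have "y \<in> bowen l e1 x" if "x \<in> X" "y \<in> X" "\<kappa> x = \<kappa> y" for x y
   using e2(3)[of y x "e (\<kappa> x)" l] sym in_ball that e(1) by metis
  moreover have "G l x <= K' * measure m {y \<in> X. \<kappa> y = \<kappa> x}" if x: "x \<in> X" for x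
  proof -
   let ?y = "e (\<kappa> x)"
   have sub: "bowen l e4 ?y \<subseteq> {z \<in> X. \<kappa> z = \<kappa> x}"
   proof
    fix z assume z: "z \<in> bowen l e4 ?y"
    then have zX: "z \<in> X" by (simp add: bowen_ball_def)
    \<comment> \<open>The enumeration repeats when E is finite, so kernels are compared by their
      centres; the least index then makes the name unique.\<close>
    have Qz: "Q z a \<longleftrightarrow> e a = ?y" for a
     using z E(2) e(2) unfolding Q_def disjoint_family_on_def by (auto; blast)
    have "e (\<kappa> z) = ?y" using Q[OF zX] Qz by blast
    moreover have "\<kappa> z <= \<kappa> x" unfolding \<kappa>_def[of z] by (rule Least_le) (simp add: Qz)
    moreover have "\<kappa> x <= \<kappa> z" unfolding \<kappa>_def[of x]
     by (rule Least_le) (use Q[OF x] calculation(1) in \<open>simp add: Q_def\<close>)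
    ultimately show "z \<in> {z \<in> X. \<kappa> z = \<kappa> x}" using zX by simp
   qed
   have "bowen l e3 x \<subseteq> bowen l e1 ?y"
   proof
    fix z assume z: "z \<in> bowen l e3 x"
    then have "z \<in> X" by (simp add: bowen_ball_def)
    moreover have "x \<in> bowen l e2 ?y" using in_ball[OF x] ball_mono[OF e3(2)] by blast
    ultimately show "z \<in> bowen l e1 ?y" using e2(3) sym[OF x z] e(1) by blast
   qed
   then have "measure m (bowen l e3 x) <= measure m (bowen l e1 ?y)" using sets e(1) by (intro finite_measure_mono) auto
   then have "c3 * G l x <= C1 * G l ?y" using c3(2)[OF x] C1(3)[OF e(1)] by (meson order_trans)
   also have "... <= C1 * (measure m (bowen l e4 ?y) / c4)"
    using c4 e(1) C1(1) by (intro mult_left_mono) (auto simp: le_divide_eq mult.commute)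
   also have "... <= C1 * (measure m {y \<in> X. \<kappa> y = \<kappa> x} / c4)"
   proof (intro mult_left_mono divide_right_mono finite_measure_mono sub)
    have "{y \<in> space m. \<kappa> y = \<kappa> x} \<in> sets m" using \<open>\<kappa> \<in> _\<close> by measurable
    then show "{y \<in> X. \<kappa> y = \<kappa> x} \<in> sets m" by (simp add: space_eq)
   qed (use C1 c4 in auto)
   finally have "G l x * c3 <= C1 * (measure m {y \<in> X. \<kappa> y = \<kappa> x} / c4)" by (simp add: mult.commute)
   then show ?thesis using c3(1) c4(1) by (simp add: K'_def field_simps)
  qed
  ultimately show ?thesis by blast
 qed
 then obtain \<kappa> :: "nat => 'a => nat" where \<kappa>: "\<And>l. \<kappa> l \<in> measurable m (count_space UNIV)"
   "\<And>l x y. x \<in> X ==> y \<in> X ==> \<kappa> l x = \<kappa> l y ==> y \<in> bowen l e1 x"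
   "\<And>l x. x \<in> X ==> G l x <= K' * measure m {y \<in> X. \<kappa> l y = \<kappa> l x}"
  by metis
 \<comment> \<open>Each window costs \<open>K'\<close>, and comparing the whole cylinder with one
   Bowen ball costs C1 once, charged to the first window.\<close>
 define K where "K = max 1 (max K' (C1 * K'))"
 have K: "K >= 1" "K' <= K" "C1 * K' <= K" by (simp_all add: K_def)
 define len where "len w = sum_list (map fst w)" for w :: "(nat \<times> nat) list"
 let ?p = "\<lambda>w. \<Prod>(l, a)\<leftarrow>w. K * measure m {x \<in> X. \<kappa> l x = a}"
 have p0: "?p w >= 0" for w using K(1) by (induction w) auto
 have cyl_ball: "z \<in> bowen (len w) e1 x" if "x \<in> cylinder X T \<kappa> w" "z \<in> cylinder X T \<kappa> w" for w x z
  using that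
 proof (induction w arbitrary: x z)
  case (Cons la w)
  obtain l a where la: "la = (l, a)" by force
  have *: "x \<in> X" "z \<in> X" "\<kappa> l x = \<kappa> l z" "(T^^l) x \<in> cylinder X T \<kappa> w" "(T^^l) z \<in> cylinder X T \<kappa> w"
   using Cons.prems by (auto simp: la)
  have "d ((T^^k) x) ((T^^k) z) < ennreal e1" if "k < len (la # w)" for k
  proof (cases "k < l")
   case True
   then show ?thesis using \<kappa>(2)[OF *(1-3)] by (simp add: bowen_ball_def)
  next
   case False
   then obtain i where i: "k = i + l" by (metis le_Suc_ex add.commute not_less)
   then have "i < len w" using that by (simp add: len_def la)
   then show ?thesis using Cons.IH[OF *(4,5)] by (simp add: i funpow_add bowen_ball_def)
  qed
  then show ?case using * by (simp add: bowen_ball_def)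
 qed (auto simp: bowen_ball_def len_def)
 have G_le: "G (len w) x <= ?p w" if "x \<in> cylinder X T \<kappa> w" for w x
  using that
 proof (induction w arbitrary: x)
  case (Cons la w)
  obtain l a where la: "la = (l, a)" by force
  have *: "x \<in> X" "\<kappa> l x = a" "(T^^l) x \<in> cylinder X T \<kappa> w" using Cons.prems by (auto simp: la)
  have "G l x <= K * measure m {y \<in> X. \<kappa> l y = a}"
   using \<kappa>(3)[OF *(1), of l] mult_right_mono[OF K(2), of "measure m {y \<in> X. \<kappa> l y = a}"] *(2) by simp
  then have "G l x * G (len w) ((T^^l) x) <= K * measure m {y \<in> X. \<kappa> l y = a} * ?p w"
   using Cons.IH[OF *(3)] Gpos K(1) by (intro mult_mono) (auto simp: less_imp_le)
  then show ?case by (simp add: la len_def G_add)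
 qed (simp add: len_def G_def birkhoff_sum_def)
 have "measure m (cylinder X T \<kappa> w) <= ?p w" for w
 proof (cases w)
  case (Cons la w')
  show ?thesis
  proof (cases "cylinder X T \<kappa> w = {}")
   case False
   then obtain x where x: "x \<in> cylinder X T \<kappa> w" by blast
   obtain l a where la: "la = (l, a)" by force
   have *: "x \<in> X" "\<kappa> l x = a" "(T^^l) x \<in> cylinder X T \<kappa> w'" using x by (auto simp: Cons la)
   have "measure m (cylinder X T \<kappa> w) <= measure m (bowen (len w) e1 x)"
    by (intro finite_measure_mono sets) (use cyl_ball[OF x] * in auto)
   also have "... <= C1 * G (len w) x" by (rule C1(3)[OF *(1)])
   also have "... = (C1 * G l x) * G (len w') ((T^^l) x)" by (simp add: Cons la len_def G_add)
   also have "... <= (K * measure m {y \<in> X. \<kappa> l y = a}) * ?p w'"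
   proof (rule mult_mono[OF _ G_le[OF *(3)]])
    have "C1 * G l x <= C1 * (K' * measure m {y \<in> X. \<kappa> l y = a})"
     using \<kappa>(3)[OF *(1), of l] *(2) C1(1) by (intro mult_left_mono) auto
    also have "... <= K * measure m {y \<in> X. \<kappa> l y = a}"
     using mult_right_mono[OF K(3), of "measure m {y \<in> X. \<kappa> l y = a}"] by (simp add: mult.assoc)
    finally show "C1 * G l x <= K * measure m {y \<in> X. \<kappa> l y = a}" .
   qed (use K Gpos in \<open>auto simp: less_imp_le\<close>)
   finally show ?thesis by (simp add: Cons la)
  qed (simp add: p0)
 qed (simp add: prob_space[unfolded space_eq])
 moreover have "y \<in> bowen l eps x" if "x \<in> X" "y \<in> X" "\<kappa> l x = \<kappa> l y" for l x y
  using \<kappa>(2)[OF that] ball_mono[OF e1(2)] by blast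
 ultimately show ?thesis using K(1) \<kappa>(1) by (intro exI[of _ \<kappa>] exI[of _ K] conjI allI ballI impI)
qed

end

text \<open>Links the Riemannian distance to the given topology, so that Hoelder functions are
  continuous, hence measurable, and bounded on the compact set X.\<close>

lemma (in adapted_charts) dist_small_neighbourhood:
 assumes x: "x \<in> M" and e: "e > 0"
 shows "\<exists>U. open U \<and> x \<in> U \<and> (\<forall>y\<in>U \<inter> M. d x y < ennreal e)"
proof -
 obtain c z r where i: "idx x = (c, z, r)" by (cases "idx x")
 have iI: "(c, z, r) \<in> I" using idx[OF x] i by simp
 note ci = I_chart[OF iI]
 define W where "W = chart_inv c ` (ball z (3 * r) \<inter> ball (snd c x) (e / C))"
 have sub: "ball z (3 * r) \<inter> ball (snd c x) (e / C) \<subseteq> snd c ` fst c" using I_subsets(1)[OF iI] by blast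
 have W: "y \<in> W \<longleftrightarrow> y \<in> patch (idx x) \<and> norm (V x y) < e / C" for y
  unfolding W_def i patch_iff[OF iI] using chart_inv_image_iff[OF _ sub] ci
  by (auto simp: V_def ch_def i dist_norm norm_minus_commute)
 have "openin (top_of_set M) W" unfolding W_def using ci sub by (intro openin_chart_inv_image) auto
 then obtain U where U: "open U" "W = M \<inter> U" unfolding openin_open by blast
 have "x \<in> W" unfolding W using ch(4)[OF x] e C_ge_1 by (simp add: V_def)
 moreover have "d x y < ennreal e" if "y \<in> W" for y
 proof -
  have "C * norm (V x y) < e" using that C_ge_1 unfolding W by (simp add: less_divide_eq mult.commute)
  then show ?thesis using dist_le_V[OF x, of y] that e unfolding W by (meson ennreal_lessI order_le_less_trans)
 qed
 ultimately show ?thesis using U by blast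
qed

lemma hoelder_bound_exp:
 fixes \<theta> \<alpha> B :: real
 assumes \<alpha>: "0 < \<alpha>" "\<alpha> <= 1" and \<theta>: "0 < \<theta>" and B: "B >= 0" and s: "0 <= s" "s <= B * (\<theta> ^ i + \<theta> ^ j)"
 shows "s powr \<alpha> <= (2 * B) powr \<alpha> * ((\<theta> powr \<alpha>)^i + (\<theta> powr \<alpha>)^j)"
proof -
 have pw: "(\<theta> ^ n) powr \<alpha> = (\<theta> powr \<alpha>)^n" for n
  using \<theta> by (simp add: powr_powr mult.commute flip: powr_realpow)
 have "\<theta> ^ i + \<theta> ^ j <= 2 * max (\<theta> ^ i) (\<theta> ^ j)" by linarith
 then have "B * (\<theta> ^ i + \<theta> ^ j) <= 2 * B * max (\<theta> ^ i) (\<theta> ^ j)" using mult_left_mono[OF _ B] by fastforce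
 then have "s powr \<alpha> <= (2 * B * max (\<theta> ^ i) (\<theta> ^ j)) powr \<alpha>" using s \<alpha> by (intro powr_mono2) auto
 also have "... = (2 * B) powr \<alpha> * max (\<theta> ^ i) (\<theta> ^ j) powr \<alpha>" by (rule powr_mult)
 also have "max (\<theta> ^ i) (\<theta> ^ j) powr \<alpha> <= (\<theta> powr \<alpha>)^i + (\<theta> powr \<alpha>)^j"
  unfolding max_def using \<theta> by (auto simp: pw)
 finally show ?thesis by (simp add: mult_left_mono)
qed

theorem proposition2p17:
  fixes M X :: "'a::t2_space set"
    and A :: "('a, 'e::euclidean_space) chart set"
    and g :: "'a \<Rightarrow> 'e \<Rightarrow> 'e \<Rightarrow> real"
    and F T :: "'a \<Rightarrow> 'a"
    and \<phi> f :: "'a \<Rightarrow> real"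
    and m :: "'a measure"
    and \<sigma> :: real
  assumes "closed_manifold M A"
    and "riemannian_metric M A g"
    and "axiom_A M A g F"
    and "basic_set M F X"
    and "\<And>x. x \<in> X \<Longrightarrow> T x = F x"
    and "topologically_mixing_on T X"
    and "hoelder_on (riemannian_dist M A g) X \<phi>"
    and "gibbs_measure (riemannian_dist M A g) X T \<phi> m"
    and "hoelder_on (riemannian_dist M A g) X f"
    and "(\<integral>x. f x \<partial>m) = 0"
    and "\<sigma> \<ge> 0"
    and "weak_conv_m (\<lambda>n. distr m borel (\<lambda>x. birkhoff_sum T f n x / sqrt (real n)))
           (normal_law 0 (\<sigma>\<^sup>2))"
  shows "almost_sure_limit_theorem m (\<lambda>n x. birkhoff_sum T f n x / sqrt (real n))
           (normal_law 0 (\<sigma>\<^sup>2))"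
proof -
 interpret riemannian_manifold M A g using assms(1,2) by unfold_locales
 obtain I C e where "adapted_charts M A g I C e" using ex_adapted_charts by blast
 then interpret adapted_charts M A g I C e .
 let ?\<Lambda> = "nonwandering_set M F"
 have F: "diffeo M A F" "hyperbolic_set M A g F ?\<Lambda>" using assms(3) by (auto simp: axiom_A_def)
 have X: "X \<subseteq> ?\<Lambda>" "closedin (top_of_set M) X" "F ` X = X"
  using assms(4) by (auto simp: basic_set_def spectral_decomposition_def)
 have XM: "X \<subseteq> M" using X(2) by (rule closedin_imp_subset)
 have comp: "compact X" using X(2) manifold by (meson closed_manifold_def closedin_compact)
 have iter: "(F^^n) x \<in> X" "(T^^n) x = (F^^n) x" if "x \<in> X" for n x
 proof -
  show inX: "(F^^n) x \<in> X" for n using that X(3) by (induction n) auto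
  show "(T^^n) x = (F^^n) x" by (induction n) (simp_all add: assms(5)[OF inX])
 qed
 interpret gibbs_balls d X T \<phi> m
 proof
  show "gibbs_measure d X T \<phi> m" by (rule assms(8))
  show "d x x = 0" if "x \<in> X" for x
   using dist_le_V[of x x] ch(4)[of x] that XM by (auto simp: V_def)
  show "\<exists>e'>0. e' <= e \<and> (\<forall>x\<in>X. \<forall>y\<in>X. \<forall>z\<in>X. d x z < ennreal e' --> d y z < ennreal e' --> d y x < ennreal e)" if "e > 0" for e
   using quasi_triangle[OF that] XM by blast
 qed
 obtain eps B \<theta> where eps: "eps > 0" "B >= 0" "0 < \<theta>" "\<theta> < 1" and close: "\<forall>x\<in>?\<Lambda>. \<forall>y n. (\<forall>k<n. d ((F^^k) x) ((F^^k) y) < ennreal eps) -->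
   (\<forall>k<n. d ((F^^k) x) ((F^^k) y) <= ennreal (B * (\<theta> ^ k + \<theta> ^ (n - k))))"
  using bowen_close_exponential[OF F] by (elim exE conjE) (rule that)
 obtain \<kappa> K where K: "K >= 1" and \<kappa>: "\<forall>l. \<kappa> l \<in> measurable m (count_space UNIV)"
   "\<forall>l. \<forall>x\<in>X. \<forall>y\<in>X. \<kappa> l x = \<kappa> l y --> y \<in> bowen_ball d X T l eps x"
   "\<forall>w. measure m (cylinder X T \<kappa> w) <= (\<Prod>(l, a)\<leftarrow>w. K * measure m {x \<in> X. \<kappa> l x = a})"
  using gibbs_cells[OF eps(1)] by (elim exE conjE) (rule that)
 obtain H \<alpha> where H: "H >= 0" "0 < \<alpha>" "\<alpha> <= 1" "\<And>x y. x \<in> X ==> y \<in> X ==> d x y < \<infinity> ==> abs (f x - f y) <= H * enn2real (d x y) powr \<alpha>"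
  using assms(9) unfolding hoelder_on_def by (elim exE conjE) (rule that; blast)
 have cont: "continuous_on X f"
  unfolding continuous_on_def
 proof (intro ballI tendstoI)
  fix x b :: real and p assume p: "p \<in> X" and b: "b > 0"
  \<comment> \<open>At this radius the Hoelder bound is \<open>H * b / (H + 1) < b\<close>; the
    summand 1 covers \<open>H = 0\<close>.\<close>
  define a where "a = (b / (H + 1)) powr (1 / \<alpha>)"
  have a: "a > 0" "a powr \<alpha> = b / (H + 1)" using b H(1-3) by (simp_all add: a_def powr_powr)
  obtain U where U: "open U" "p \<in> U" "\<And>y. y \<in> U \<inter> M ==> d p y < ennreal a"
   using dist_small_neighbourhood[OF subsetD[OF XM p] a(1)] by blast
  have "dist (f y) (f p) < b" if y: "y \<in> U" "y \<in> X" for y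
  proof -
   have dy: "d p y < ennreal a" using U(3) y XM by blast
   then have "enn2real (d p y) powr \<alpha> <= a powr \<alpha>"
    using H(2) a(1) enn2real_mono[of "d p y" "ennreal a"] by (intro powr_mono2) auto
   then have "abs (f p - f y) <= H * (b / (H + 1))"
    unfolding a(2)[symmetric] using order_less_trans[OF dy ennreal_less_top] H(1)
    by (intro order_trans[OF H(4)[OF p y(2)]] mult_left_mono) auto
   also have "... < b" using H(1) b by (simp add: field_simps)
   finally show ?thesis by (simp add: dist_real_def abs_minus_commute)
  qed
  then show "\<forall>\<^sub>F y in at p within X. dist (f y) (f p) < b"
   unfolding eventually_at_topological using U(1,2) by blast
 qed
 have "bounded (f ` X)" using compact_continuous_image[OF cont comp] by (rule compact_imp_bounded)
 then obtain b where b: "\<And>x. x \<in> X ==> abs (f x) <= b" unfolding bounded_iff by auto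
 have "sets m = sets (restrict_space borel X)" using assms(8) by (simp add: gibbs_measure_def)
 then have fm: "f \<in> borel_measurable m"
  using borel_measurable_continuous_on_restrict[OF cont] by (simp cong: measurable_cong_sets)
 have \<theta>1: "\<theta> powr \<alpha> < 1" using powr_less_mono2[of \<alpha> \<theta> 1] eps(3,4) H(2) by simp
 have "quasi_bernoulli_clt m T f \<kappa> b (H * (2 * B) powr \<alpha>) (\<theta> powr \<alpha>) K \<sigma>"
 proof (unfold_locales, goal_cases)
  \<comment> \<open>The oscillation of f on a cell: points of one cell are Bowen close for l steps,
    hence exponentially close inside, and the Hoelder exponent turns the rate \<theta> into
    \<open>\<theta> powr \<alpha>\<close>.\<close>
  case (10 l k x y)
  have xy: "x \<in> X" "y \<in> X" using 10(1,2) space_eq by auto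
  have cl: "\<forall>k<l. d ((F^^k) x) ((F^^k) y) < ennreal eps"
   using \<kappa>(2)[rule_format, OF xy 10(3)] iter(2) xy by (simp add: bowen_ball_def)
  have dk: "d ((F^^k) x) ((F^^k) y) <= ennreal (B * (\<theta> ^ k + \<theta> ^ (l - k)))"
   by (rule close[rule_format, OF _ cl[rule_format] 10(4)]) (use X xy in auto)
  have nn: "0 <= B * (\<theta> ^ k + \<theta> ^ (l - k))" using eps by simp
  have "abs (f ((T^^k) x) - f ((T^^k) y)) <= H * enn2real (d ((F^^k) x) ((F^^k) y)) powr \<alpha>"
   unfolding iter(2)[OF xy(1)] iter(2)[OF xy(2)] using dk by (intro H iter xy) (simp add: order_le_less_trans)
  also have "enn2real (d ((F^^k) x) ((F^^k) y)) powr \<alpha> <= (2 * B) powr \<alpha> * ((\<theta> powr \<alpha>)^k + (\<theta> powr \<alpha>)^(l - k))"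
   using enn2real_mono[OF dk] nn by (intro hoelder_bound_exp H eps) auto
  finally show ?case using H(1) by (simp add: mult_left_mono mult.assoc)
 qed (use assms(8,11,12) fm b \<kappa> K eps(2,3) H(1) \<theta>1 space_eq in \<open>auto simp: gibbs_measure_def\<close>)
 then show ?thesis by (rule quasi_bernoulli_clt.almost_sure_limit)
qed

end
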